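(* For all nonnegative integers $p,q$ with $p+q > pq/2$, there is an $O((p+q)^{O(p)})$-approximation algorithm for $(p,q)$-Flex-ST that runs in $n^{O(p+q)}$ time, where $n=|V|$. In particular, there is an $O(1)$-approximation for $(p,2)$-Flex-ST and for $(2,q)$-Flex-ST when $p,q$ are fixed constants.
   Context: Input of $(p,q)$-Flex-ST: an undirected (multi)graph $G=(V,E)$ with nonnegative edge costs $c:E\to\mathbb{R}_{\ge0}$, a partition of $E$ into safe edges $\mathcal{S}$ and unsafe edges $\mathcal{U}$, and two vertices $s,t\in V$. For $F\subseteq E$ and $A\subseteq V$, $\delta_F(A)$ is the set of edges of $F$ with exactly one endpoint in $A$. A set $F\subseteq E$ is feasible if $s$ and $t$ are $(p,q)$-flex-connected in $(V,F)$, i.e., $s$ and $t$ are $p$-edge-connected in $(V,F\setminus B)$ for every $B\subseteq \mathcal{U}$ with $|B|\le q$; equivalently, every $A\subseteq V$ with $s\in A$, $t\notin A$ satisfies $|\delta_{F\cap\mathcal{S}}(A)|\ge p$ or $|\delta_F(A)|\ge p+q$. The goal is a feasible $F$ of minimum cost. An $\alpha$-approximation outputs a feasible solution of cost at most $\alpha$ times the optimum.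
   Formalization: The running time is O((p+q)m) + n^{O(p+q)} with m=|E|, in unit-cost operations on a real RAM: in a multigraph m is not bounded in n and all edges must be read, so n^{O(p+q)} alone fails (p=1, q=0, n=2); when m ≤ n^{O(p+q)} it is n^{O(p+q)}. *)

theory Defs
  imports Complex_Main
begin

section \<open>Flexible s-t connectivity\<close>

text \<open>
  Undirected multigraphs: \<open>ends e\<close> lists the two endpoints of \<open>e\<close> in an arbitrary order that
  no notion below depends on. Parallel edges and loops are allowed.
\<close>

record ('v, 'e) flex_st =
  verts :: "'v set"
  edges :: "'e set"
  ends :: "'e \<Rightarrow> 'v \<times> 'v"
  cost :: "'e \<Rightarrow> real"
  safe :: "'e set"
  source :: 'v
  sink :: 'v

definition unsafe :: "('v, 'e) flex_st \<Rightarrow> 'e set" where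
  "unsafe I = edges I - safe I"

definition flex_st_instance :: "('v, 'e) flex_st \<Rightarrow> bool" where
  "flex_st_instance I \<longleftrightarrow>
     finite (verts I) \<and> finite (edges I) \<and>
     (\<forall>e\<in>edges I. ends I e \<in> verts I \<times> verts I \<and> 0 \<le> cost I e) \<and>
     safe I \<subseteq> edges I \<and> source I \<in> verts I \<and> sink I \<in> verts I"

definition adjacency :: "('v, 'e) flex_st \<Rightarrow> 'e set \<Rightarrow> ('v \<times> 'v) set" where
  "adjacency I F = {(u, v). \<exists>e\<in>F. ends I e = (u, v) \<or> ends I e = (v, u)}"

definition edge_connected :: "nat \<Rightarrow> ('v, 'e) flex_st \<Rightarrow> 'e set \<Rightarrow> 'v \<Rightarrow> 'v \<Rightarrow> bool" where
  "edge_connected k I F u v \<longleftrightarrow>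
     (\<forall>X\<subseteq>F. finite X \<and> card X < k \<longrightarrow> (u, v) \<in> (adjacency I (F - X))\<^sup>*)"

definition flex_connected :: "nat \<Rightarrow> nat \<Rightarrow> ('v, 'e) flex_st \<Rightarrow> 'e set \<Rightarrow> 'v \<Rightarrow> 'v \<Rightarrow> bool" where
  "flex_connected p q I F u v \<longleftrightarrow>
     (\<forall>B\<subseteq>unsafe I. finite B \<and> card B \<le> q \<longrightarrow> edge_connected p I (F - B) u v)"

definition feasible :: "nat \<Rightarrow> nat \<Rightarrow> ('v, 'e) flex_st \<Rightarrow> 'e set \<Rightarrow> bool" where
  "feasible p q I F \<longleftrightarrow> F \<subseteq> edges I \<and> flex_connected p q I F (source I) (sink I)"

definition total_cost :: "('v, 'e) flex_st \<Rightarrow> 'e set \<Rightarrow> real" where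
  "total_cost I F = (\<Sum>e\<in>F. cost I e)"

text \<open>Meaningful only if a feasible set exists.\<close>

definition opt :: "nat \<Rightarrow> nat \<Rightarrow> ('v, 'e) flex_st \<Rightarrow> real" where
  "opt p q I = Min (total_cost I ` {F. feasible p q I F})"

text \<open>Agreement with the formulation of feasibility by cuts.\<close>

definition cut :: "('v, 'e) flex_st \<Rightarrow> 'e set \<Rightarrow> 'v set \<Rightarrow> 'e set" where
  "cut I F A = {e\<in>F. (fst (ends I e) \<in> A) \<noteq> (snd (ends I e) \<in> A)}"

lemma edge_connected_iff_cut:
  assumes I: "flex_st_instance I" and F: "F \<subseteq> edges I"
  shows "edge_connected k I F (source I) (sink I) \<longleftrightarrow>
    (\<forall>A\<subseteq>verts I. source I \<in> A \<and> sink I \<notin> A \<longrightarrow> k \<le> card (cut I F A))"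
    (is "?l \<longleftrightarrow> ?r")
proof
  assume l: ?l
  show ?r
  proof (intro allI impI, rule ccontr)
    fix A assume A: "A \<subseteq> verts I" "source I \<in> A \<and> sink I \<notin> A" and "\<not> k \<le> card (cut I F A)"
    moreover have "cut I F A \<subseteq> F" "finite (cut I F A)"
      using I F by (auto simp: cut_def flex_st_instance_def intro: finite_subset)
    ultimately have "(source I, sink I) \<in> (adjacency I (F - cut I F A))\<^sup>*"
      using l unfolding edge_connected_def by auto
    then have "sink I \<in> A"
      by (induction rule: rtrancl_induct) (use A in \<open>auto simp: adjacency_def cut_def\<close>)
    with A show False by blast
  qed
next
  assume r: ?r
  show ?l
    unfolding edge_connected_def
  proof (intro allI impI, rule ccontr)
    fix X assume X: "X \<subseteq> F" "finite X \<and> card X < k"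
      and n: "(source I, sink I) \<notin> (adjacency I (F - X))\<^sup>*"
    define A where "A = {v \<in> verts I. (source I, v) \<in> (adjacency I (F - X))\<^sup>*}"
    have step: "v \<in> A" if "u \<in> A" "e \<in> F - X" "ends I e = (u, v) \<or> ends I e = (v, u)" for u v e
    proof -
      have "(u, v) \<in> adjacency I (F - X)"
        using that(2,3) unfolding adjacency_def by blast
      moreover have "v \<in> verts I"
        using that(2,3) F I unfolding flex_st_instance_def by fastforce
      ultimately show ?thesis
        using that(1) unfolding A_def by (auto intro: rtrancl_into_rtrancl)
    qed
    have "cut I F A \<subseteq> X"
    proof
      fix e assume "e \<in> cut I F A"
      then show "e \<in> X"
        using step[of "fst (ends I e)" e "snd (ends I e)"] step[of "snd (ends I e)" e "fst (ends I e)"]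
        by (auto simp: cut_def)
    qed
    then have "card (cut I F A) < k"
      using X card_mono[of X "cut I F A"] by linarith
    moreover have "k \<le> card (cut I F A)"
      using r n I by (auto simp: A_def flex_st_instance_def)
    ultimately show False by simp
  qed
qed

lemma feasible_iff_cut:
  assumes I: "flex_st_instance I" and F: "F \<subseteq> edges I"
  shows "feasible p q I F \<longleftrightarrow>
    (\<forall>A\<subseteq>verts I. source I \<in> A \<and> sink I \<notin> A \<longrightarrow>
       p \<le> card (cut I (F \<inter> safe I) A) \<or> p + q \<le> card (cut I F A))"
    (is "_ \<longleftrightarrow> ?r")
proof -
  have fin: "finite (cut I G A)" if "G \<subseteq> F" for G A
  proof (rule finite_subset)
    show "cut I G A \<subseteq> edges I" using F that by (auto simp: cut_def)
    show "finite (edges I)" using I by (simp add: flex_st_instance_def)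
  qed
  have eq: "feasible p q I F \<longleftrightarrow>
    (\<forall>B\<subseteq>unsafe I. finite B \<and> card B \<le> q \<longrightarrow>
      (\<forall>A\<subseteq>verts I. source I \<in> A \<and> sink I \<notin> A \<longrightarrow> p \<le> card (cut I (F - B) A)))"
  proof -
    have "F - B \<subseteq> edges I" for B using F by blast
    from edge_connected_iff_cut[OF I this] F show ?thesis
      by (simp add: feasible_def flex_connected_def)
  qed
  show ?thesis
  proof
    assume f: "feasible p q I F"
    show ?r
    proof (intro allI impI, rule ccontr)
      fix A assume A: "A \<subseteq> verts I" "source I \<in> A \<and> sink I \<notin> A"
        and n: "\<not> (p \<le> card (cut I (F \<inter> safe I) A) \<or> p + q \<le> card (cut I F A))"
      let ?D = "cut I (F \<inter> unsafe I) A"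
      have D: "?D \<subseteq> unsafe I" "?D \<subseteq> cut I F A" by (auto simp: cut_def)
      have "finite ?D" by (rule fin) simp
      note D = D this
      show False
      proof (cases "card ?D \<le> q")
        case True
        then have "p \<le> card (cut I (F - ?D) A)" using f[unfolded eq] A D by blast
        also have "cut I (F - ?D) A = cut I (F \<inter> safe I) A"
          using F I by (auto simp: cut_def unsafe_def flex_st_instance_def)
        finally show False using n by simp
      next
        case False
        then obtain B where B: "B \<subseteq> ?D" "card B = q" "finite B"
          using obtain_subset_with_card_n[of q ?D] by (metis nat_le_linear)
        then have "p \<le> card (cut I (F - B) A)" using f[unfolded eq] A D by blast
        also have "cut I (F - B) A = cut I F A - B" by (auto simp: cut_def)
        also have "card \<dots> = card (cut I F A) - q"
          using B D card_Diff_subset[of B "cut I F A"] by auto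
        finally show False
          using n B D card_mono[OF fin[OF subset_refl] D(2)] False by linarith
      qed
    qed
  next
    assume r: ?r
    show "feasible p q I F"
      unfolding eq
    proof (intro allI impI)
      fix B A assume B: "B \<subseteq> unsafe I" "finite B \<and> card B \<le> q"
        and A: "A \<subseteq> verts I" "source I \<in> A \<and> sink I \<notin> A"
      have "card (cut I (F \<inter> safe I) A) \<le> card (cut I (F - B) A)"
        using B by (intro card_mono fin) (auto simp: cut_def unsafe_def)
      moreover have "card (cut I F A) - card B \<le> card (cut I (F - B) A)"
      proof -
        have "cut I (F - B) A = cut I F A - B" by (auto simp: cut_def)
        then show ?thesis using B diff_card_le_card_Diff by metis
      qed
      moreover have "p \<le> card (cut I (F \<inter> safe I) A) \<or> p + q \<le> card (cut I F A)"
        using r A by blast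
      ultimately show "p \<le> card (cut I (F - B) A)" using B by linarith
    qed
  qed
qed


section \<open>Real RAM\<close>

text \<open>
  Costs are arbitrary reals, so the machine is a real RAM: one memory of natural numbers and one
  of reals, both indexed by natural numbers and addressed indirectly, with unit cost per
  operation. As usual, natural numbers have no unit-cost multiplication, and reals cannot be
  rounded or otherwise converted to naturals. Programs contain no real constants other than those
  computable from natural numbers.
\<close>

type_synonym state = "(nat \<Rightarrow> nat) \<times> (nat \<Rightarrow> real)"

datatype nexp =
    NLit nat
  | NMem nexp
  | NAdd nexp nexp
  | NSub nexp nexp

datatype rexp =
    RNat nexp
  | RMem nexp
  | RAdd rexp rexp
  | RSub rexp rexp
  | RMul rexp rexp
  | RDiv rexp rexp

datatype bexp =
    NLess nexp nexp
  | RLess rexp rexp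
  | BNot bexp
  | BAnd bexp bexp

datatype com =
    Skip
  | NStore nexp nexp
  | RStore nexp rexp
  | Seq com com
  | Cond bexp com com
  | While bexp com

primrec nval :: "nexp \<Rightarrow> state \<Rightarrow> nat" where
  "nval (NLit k) \<sigma> = k"
| "nval (NMem a) \<sigma> = fst \<sigma> (nval a \<sigma>)"
| "nval (NAdd a b) \<sigma> = nval a \<sigma> + nval b \<sigma>"
| "nval (NSub a b) \<sigma> = nval a \<sigma> - nval b \<sigma>"

primrec rval :: "rexp \<Rightarrow> state \<Rightarrow> real" where
  "rval (RNat a) \<sigma> = real (nval a \<sigma>)"
| "rval (RMem a) \<sigma> = snd \<sigma> (nval a \<sigma>)"
| "rval (RAdd x y) \<sigma> = rval x \<sigma> + rval y \<sigma>"
| "rval (RSub x y) \<sigma> = rval x \<sigma> - rval y \<sigma>"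
| "rval (RMul x y) \<sigma> = rval x \<sigma> * rval y \<sigma>"
| "rval (RDiv x y) \<sigma> = rval x \<sigma> / rval y \<sigma>"

primrec bval :: "bexp \<Rightarrow> state \<Rightarrow> bool" where
  "bval (NLess a b) \<sigma> \<longleftrightarrow> nval a \<sigma> < nval b \<sigma>"
| "bval (RLess x y) \<sigma> \<longleftrightarrow> rval x \<sigma> < rval y \<sigma>"
| "bval (BNot b) \<sigma> \<longleftrightarrow> \<not> bval b \<sigma>"
| "bval (BAnd b c) \<sigma> \<longleftrightarrow> bval b \<sigma> \<and> bval c \<sigma>"

primrec ntime :: "nexp \<Rightarrow> nat" where
  "ntime (NLit k) = 1"
| "ntime (NMem a) = ntime a + 1"
| "ntime (NAdd a b) = ntime a + ntime b + 1"
| "ntime (NSub a b) = ntime a + ntime b + 1"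

primrec rtime :: "rexp \<Rightarrow> nat" where
  "rtime (RNat a) = ntime a + 1"
| "rtime (RMem a) = ntime a + 1"
| "rtime (RAdd x y) = rtime x + rtime y + 1"
| "rtime (RSub x y) = rtime x + rtime y + 1"
| "rtime (RMul x y) = rtime x + rtime y + 1"
| "rtime (RDiv x y) = rtime x + rtime y + 1"

primrec btime :: "bexp \<Rightarrow> nat" where
  "btime (NLess a b) = ntime a + ntime b + 1"
| "btime (RLess x y) = rtime x + rtime y + 1"
| "btime (BNot b) = btime b + 1"
| "btime (BAnd b c) = btime b + btime c + 1"

text \<open>\<open>exec c \<sigma> t \<tau>\<close>: started in \<open>\<sigma>\<close>, program \<open>c\<close> halts in \<open>\<tau>\<close> after \<open>t\<close> operations.\<close>

inductive exec :: "com \<Rightarrow> state \<Rightarrow> nat \<Rightarrow> state \<Rightarrow> bool" where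
  Skip: "exec Skip \<sigma> 1 \<sigma>"
| NStore: "exec (NStore a b) \<sigma> (ntime a + ntime b + 1) ((fst \<sigma>)(nval a \<sigma> := nval b \<sigma>), snd \<sigma>)"
| RStore: "exec (RStore a x) \<sigma> (ntime a + rtime x + 1) (fst \<sigma>, (snd \<sigma>)(nval a \<sigma> := rval x \<sigma>))"
| Seq: "exec c \<sigma> t \<tau> \<Longrightarrow> exec d \<tau> u \<rho> \<Longrightarrow> exec (Seq c d) \<sigma> (t + u) \<rho>"
| CondTrue: "bval b \<sigma> \<Longrightarrow> exec c \<sigma> t \<tau> \<Longrightarrow> exec (Cond b c d) \<sigma> (btime b + t) \<tau>"
| CondFalse: "\<not> bval b \<sigma> \<Longrightarrow> exec d \<sigma> t \<tau> \<Longrightarrow> exec (Cond b c d) \<sigma> (btime b + t) \<tau>"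
| WhileFalse: "\<not> bval b \<sigma> \<Longrightarrow> exec (While b c) \<sigma> (btime b) \<sigma>"
| WhileTrue: "bval b \<sigma> \<Longrightarrow> exec c \<sigma> t \<tau> \<Longrightarrow> exec (While b c) \<tau> u \<rho> \<Longrightarrow>
    exec (While b c) \<sigma> (btime b + t + u) \<rho>"

lemma exec_deterministic:
  "exec c \<sigma> t \<tau> \<Longrightarrow> exec c \<sigma> t' \<tau>' \<Longrightarrow> t = t' \<and> \<tau> = \<tau>'"
proof (induction arbitrary: t' \<tau>' rule: exec.induct)
  case (WhileTrue b \<sigma> c t \<tau> u \<rho>)
  from WhileTrue.prems WhileTrue.hyps WhileTrue.IH show ?case
    by (cases rule: exec.cases) blast+
next
  case (Seq c \<sigma> t \<tau> d u \<rho>)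
  from Seq.prems Seq.IH show ?case by (cases rule: exec.cases) blast+
qed (erule exec.cases; blast)+


section \<open>Approximation algorithms\<close>

text \<open>
  A machine receives its input with the vertices and the edges numbered from 0. The natural
  memory starts with the numbers of vertices and edges, the source and the sink, followed by three
  cells per edge (endpoints, and 1 or 0 for safe or unsafe); the real memory starts with the edge
  costs. All other cells are 0. The output is a list of edge numbers in cells 1, 2, \<open>\<dots>\<close> of the
  natural memory, with its length in cell 0.
\<close>

definition numbered :: "(nat, nat) flex_st \<Rightarrow> bool" where
  "numbered I \<longleftrightarrow> verts I = {..<card (verts I)} \<and> edges I = {..<card (edges I)}"

definition memory :: "'a::zero list \<Rightarrow> nat \<Rightarrow> 'a" where
  "memory xs = (\<lambda>a. if a < length xs then xs ! a else 0)"

definition input_state :: "(nat, nat) flex_st \<Rightarrow> state" where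
  "input_state I =
    (memory ([card (verts I), card (edges I), source I, sink I] @
       concat (map (\<lambda>e. [fst (ends I e), snd (ends I e), if e \<in> safe I then 1 else 0])
         [0..<card (edges I)])),
     memory (map (cost I) [0..<card (edges I)]))"

definition output_edges :: "state \<Rightarrow> nat set" where
  "output_edges \<sigma> = fst \<sigma> ` {1..fst \<sigma> 0}"

text \<open>
  \<open>T n m\<close> bounds the running time on \<open>n\<close> vertices and \<open>m\<close> edges. It has to hold on every
  instance, whereas the output matters only if the instance has a feasible solution.
  The dependence on \<open>m\<close> is needed because a multigraph may have arbitrarily many parallel edges,
  all of which have to be read: no bound in \<open>n\<close> alone is possible.
\<close>

definition approx_algorithm ::
  "nat \<Rightarrow> nat \<Rightarrow> real \<Rightarrow> (nat \<Rightarrow> nat \<Rightarrow> nat) \<Rightarrow> com \<Rightarrow> bool" where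
  "approx_algorithm p q \<alpha> T c \<longleftrightarrow>
    (\<forall>I. flex_st_instance I \<and> numbered I \<longrightarrow>
      (\<exists>t \<tau>. exec c (input_state I) t \<tau> \<and>
        t \<le> T (card (verts I)) (card (edges I)) \<and>
        ((\<exists>F. feasible p q I F) \<longrightarrow>
          feasible p q I (output_edges \<tau>) \<and>
          total_cost I (output_edges \<tau>) \<le> \<alpha> * opt p q I)))"

end

theory Submission imports Defs begin

text \<open>
  A feasible set admits an \<open>s\<close>-\<open>t\<close> flow of value \<open>N = p * (p + q)\<close> with capacity \<open>p + q\<close> on safe
  and \<open>p\<close> on unsafe edges. Conversely, a set admitting such a flow, which \<open>N\<close> shortest augmentations
  buy at \<open>N\<close> times the optimum, has \<open>p\<close> safe edges or \<open>p\<close> edges in every cut. It remains to raise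
  the second number from \<open>p\<close> to \<open>p + q\<close> in \<open>q\<close> stages. A cut violated in stage \<open>r\<close> has exactly \<open>r\<close>
  edges, fewer than \<open>p\<close> of them safe, and is found by enumerating the pairs of vertices it separates.

  By \<open>p * q < 2 * (p + q)\<close> its capacity is less than \<open>N + (p + q)\<close>. Decompose the flow into
  \<open>N\<close> unit flows. The slack is so small that a greedily chosen set \<open>Q\<close> of unit flows uses each safe
  edge of the cut exactly once, so \<open>card Q < p\<close>. The cuts saturated by the same \<open>Q\<close> are closed under
  a digraph of free arcs and carry \<open>card Q\<close> safe edges, and \<open>r + 1\<close> shortest augmentations relative to
  these arcs cover all of them. There are at most \<open>(N + 1) ^ p\<close> choices of \<open>Q\<close>.

  The algorithm is written in a language of bounded loops, whose programs are total and have
  syntactic time bounds, and is compiled to the machine.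
\<close>

section \<open>Bounded loop programs and their compilation\<close>

text \<open>The obstacle is that the cuts violated in one stage cannot be covered together. Having
  fewer than \<open>p\<close> safe edges need not survive intersections and unions, so these cuts do
  not behave like minimum cuts. Fixing \<open>Q\<close> repairs this: every cut that no free arc
  leaves has the same number of safe edges, and covering such cuts means raising a minimum from
  \<open>r\<close> to \<open>r + 1\<close>. The condition \<open>p * q < 2 * (p + q)\<close> is what
  counting requires. A violated cut has at most \<open>p + q - 1\<close> edges and
  \<open>p - 1\<close> safe ones, so its capacity is at most
  \<open>p * (p + q - 1) + q * (p - 1) = N - (p + q) + p * q\<close>. No augmentation costs more
  than the optimum, because an optimal solution offers an edge across every cut that blocks the
  flow. Parallel edges are bought in order of cost, so \<open>p + q\<close> edges per pair of
  vertices suffice. Once these are selected, the edges are read again only for the output, and the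
  remaining time depends on \<open>n\<close>, \<open>p\<close> and \<open>q\<close> alone.\<close>

record store =
  narr :: "nat \<Rightarrow> nat \<Rightarrow> nat"
  rarr :: "nat \<Rightarrow> nat \<Rightarrow> real"
  nin :: "nat \<Rightarrow> nat"
  rin :: "nat \<Rightarrow> real"

datatype nx = Lit nat | Inp nat | Arr nat nx | Pls nx nx | Mns nx nx
datatype rx = RLit nat | RArr nat nx | RPls rx rx
datatype bx = Lss nx nx | RLss rx rx | Neg bx | Cnj bx bx
text \<open>Bounds are fixed by the program and the sizes of the input, so every loop terminates and
  its time is a product. \<open>Once\<close> is the test \<open>2 <= n\<close> in the guise of a
  bound: a conditional is charged for both branches, whereas a loop with bound 0 is charged a
  constant.\<close>

datatype bound = Times nat | Verts | Edges | Once
datatype prog =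
    Nop
  | Put nat nx nx
  | RPut nat nx rx
  | Sq prog prog (infixr ";;" 55)
  | Ifte bx prog prog
  | Loop nat nat bound prog
  | Load nat nat nx
  | RLoad nat nx

primrec neval :: "nx \<Rightarrow> store \<Rightarrow> nat" where
  "neval (Lit k) h = k"
| "neval (Inp k) h = nin h k"
| "neval (Arr k a) h = narr h k (neval a h)"
| "neval (Pls a b) h = neval a h + neval b h"
| "neval (Mns a b) h = neval a h - neval b h"

primrec reval :: "rx \<Rightarrow> store \<Rightarrow> real" where
  "reval (RLit k) h = real k"
| "reval (RArr k a) h = rarr h k (neval a h)"
| "reval (RPls x y) h = reval x h + reval y h"

primrec beval :: "bx \<Rightarrow> store \<Rightarrow> bool" where
  "beval (Lss a b) h \<longleftrightarrow> neval a h < neval b h"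
| "beval (RLss x y) h \<longleftrightarrow> reval x h < reval y h"
| "beval (Neg b) h \<longleftrightarrow> \<not> beval b h"
| "beval (Cnj b c) h \<longleftrightarrow> beval b h \<and> beval c h"

definition setn :: "nat \<Rightarrow> nat \<Rightarrow> nat \<Rightarrow> store \<Rightarrow> store" where
  "setn k i x h = h\<lparr>narr := (narr h)(k := (narr h k)(i := x))\<rparr>"

definition setr :: "nat \<Rightarrow> nat \<Rightarrow> real \<Rightarrow> store \<Rightarrow> store" where
  "setr k i x h = h\<lparr>rarr := (rarr h)(k := (rarr h k)(i := x))\<rparr>"

lemma setn_sel [simp]:
  "narr (setn k i x h) = (narr h)(k := (narr h k)(i := x))"
  "rarr (setn k i x h) = rarr h" "nin (setn k i x h) = nin h" "rin (setn k i x h) = rin h"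
  by (simp_all add: setn_def)

lemma setr_sel [simp]:
  "rarr (setr k i x h) = (rarr h)(k := (rarr h k)(i := x))"
  "narr (setr k i x h) = narr h" "nin (setr k i x h) = nin h" "rin (setr k i x h) = rin h"
  by (simp_all add: setr_def)

primrec bval_of :: "bound \<Rightarrow> store \<Rightarrow> nat" where
  "bval_of (Times k) h = k"
| "bval_of Verts h = nin h 0"
| "bval_of Edges h = nin h (Suc 0)"
| "bval_of Once h = 1 - (2 - nin h 0)"

text \<open>The counter is set from the index of the fold before each iteration and ends with the
  value of the bound, as the compiled while loop leaves it. \<open>Load\<close> and
  \<open>RLoad\<close> do nothing beyond the last edge, because the machine keeps array cells
  there.\<close>

primrec sem :: "prog \<Rightarrow> store \<Rightarrow> store" where
  "sem Nop h = h"
| "sem (Put k a b) h = setn k (neval a h) (neval b h) h"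
| "sem (RPut k a x) h = setr k (neval a h) (reval x h) h"
| "sem (c ;; d) h = sem d (sem c h)"
| "sem (Ifte b c d) h = (if beval b h then sem c h else sem d h)"
| "sem (Loop k l b c) h =
     setn k l (bval_of b h) (fold (\<lambda>i g. sem c (setn k l i g)) [0..<bval_of b h] h)"
| "sem (Load k j a) h =
     (if neval a h < nin h (Suc 0) then setn k (neval a h) (nin h (4 + 3 * neval a h + j)) h else h)"
| "sem (RLoad k a) h = (if neval a h < nin h (Suc 0) then setr k (neval a h) (rin h (neval a h)) h else h)"

text \<open>An over-approximation: indices are not known statically, so a store counts as writing a
  whole array. Only a loop counter is a known single cell, which lets nested loops keep their
  counters in one array.\<close>

primrec writes :: "prog \<Rightarrow> nat \<Rightarrow> nat \<Rightarrow> bool" where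
  "writes Nop k i \<longleftrightarrow> False"
| "writes (Put k' a b) k i \<longleftrightarrow> k = k'"
| "writes (RPut k' a x) k i \<longleftrightarrow> False"
| "writes (c ;; d) k i \<longleftrightarrow> writes c k i \<or> writes d k i"
| "writes (Ifte b c d) k i \<longleftrightarrow> writes c k i \<or> writes d k i"
| "writes (Loop k' l b c) k i \<longleftrightarrow> k = k' \<and> i = l \<or> writes c k i"
| "writes (Load k' j a) k i \<longleftrightarrow> k = k'"
| "writes (RLoad k' a) k i \<longleftrightarrow> False"

primrec rwrites :: "prog \<Rightarrow> nat \<Rightarrow> bool" where
  "rwrites Nop k \<longleftrightarrow> False"
| "rwrites (Put k' a b) k \<longleftrightarrow> False"
| "rwrites (RPut k' a x) k \<longleftrightarrow> k = k'"
| "rwrites (c ;; d) k \<longleftrightarrow> rwrites c k \<or> rwrites d k"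
| "rwrites (Ifte b c d) k \<longleftrightarrow> rwrites c k \<or> rwrites d k"
| "rwrites (Loop k' l b c) k \<longleftrightarrow> rwrites c k"
| "rwrites (Load k' j a) k \<longleftrightarrow> False"
| "rwrites (RLoad k' a) k \<longleftrightarrow> k = k'"

lemma fold_inv: "(\<And>i g. P g \<Longrightarrow> P (f i g)) \<Longrightarrow> P h \<Longrightarrow> P (fold f xs h)"
  by (induction xs arbitrary: h) auto

lemma sem_nin [simp]: "nin (sem c h) = nin h"
proof (induction c arbitrary: h)
  case (Loop k l b c)
  have "nin (fold (\<lambda>i g. sem c (setn k l i g)) xs h) = nin h" for xs
    by (rule fold_inv[where P = "\<lambda>g. nin g = nin h"]) (simp_all add: Loop)
  then show ?case by simp
qed auto

lemma sem_rin [simp]: "rin (sem c h) = rin h"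
proof (induction c arbitrary: h)
  case (Loop k l b c)
  have "rin (fold (\<lambda>i g. sem c (setn k l i g)) xs h) = rin h" for xs
    by (rule fold_inv[where P = "\<lambda>g. rin g = rin h"]) (simp_all add: Loop)
  then show ?case by simp
qed auto

lemma sem_frame: "\<not> writes c k i \<Longrightarrow> narr (sem c h) k i = narr h k i"
proof (induction c arbitrary: h)
  case (Loop k' l b c)
  have "narr (fold (\<lambda>j g. sem c (setn k' l j g)) xs h) k i = narr h k i" for xs
    by (rule fold_inv[where P = "\<lambda>g. narr g k i = narr h k i"]) (use Loop in auto)
  then show ?case using Loop.prems by auto
qed auto

lemma sem_frame_arr: "(\<And>i. \<not> writes c k i) \<Longrightarrow> narr (sem c h) k = narr h k"
  using sem_frame by blast

lemma sem_rframe: "\<not> rwrites c k \<Longrightarrow> rarr (sem c h) k = rarr h k"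
proof (induction c arbitrary: h)
  case (Loop k' l b c)
  have "rarr (fold (\<lambda>j g. sem c (setn k' l j g)) xs h) k = rarr h k" for xs
    by (rule fold_inv[where P = "\<lambda>g. rarr g k = rarr h k"]) (use Loop in auto)
  then show ?case using Loop.prems by auto
qed auto

lemma sem_Loop_rule:
  assumes "I 0 h"
    and "\<And>i g. i < bval_of b h \<Longrightarrow> I i g \<Longrightarrow> I (Suc i) (sem c (setn k l i g))"
    and "\<And>g. I (bval_of b h) g \<Longrightarrow> Q (setn k l (bval_of b h) g)"
  shows "Q (sem (Loop k l b c) h)"
proof -
  have "I j (fold (\<lambda>i g. sem c (setn k l i g)) [0..<j] h)" if "j \<le> bval_of b h" for j
    using that by (induction j) (use assms(1,2) in auto)
  then show ?thesis using assms(3) by simp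
qed

text \<open>
  Array cells are interleaved behind the input: with at most 64 (resp. 4) arrays, cell \<open>i\<close> of
  array \<open>k\<close> is stored \<open>64 * i + k\<close> (resp. \<open>4 * i + k\<close>) places after the last input cell.
\<close>

definition twice :: "nexp \<Rightarrow> nexp" where "twice a = NAdd a a"

definition addr :: "nat \<Rightarrow> nexp \<Rightarrow> nexp" where
  "addr k a = NAdd (NAdd (NLit 4) (NAdd (NMem (NLit 1)) (twice (NMem (NLit 1)))))
     (NAdd (twice (twice (twice (twice (twice (twice a)))))) (NLit k))"

definition raddr :: "nat \<Rightarrow> nexp \<Rightarrow> nexp" where
  "raddr k a = NAdd (NMem (NLit 1)) (NAdd (twice (twice a)) (NLit k))"

section \<open>Compilation to the machine and its time bounds\<close>

primrec ncomp :: "nx \<Rightarrow> nexp" where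
  "ncomp (Lit k) = NLit k"
| "ncomp (Inp k) = NMem (NLit k)"
| "ncomp (Arr k a) = NMem (addr k (ncomp a))"
| "ncomp (Pls a b) = NAdd (ncomp a) (ncomp b)"
| "ncomp (Mns a b) = NSub (ncomp a) (ncomp b)"

primrec rcomp :: "rx \<Rightarrow> rexp" where
  "rcomp (RLit k) = RNat (NLit k)"
| "rcomp (RArr k a) = RMem (raddr k (ncomp a))"
| "rcomp (RPls x y) = RAdd (rcomp x) (rcomp y)"

primrec bcomp :: "bx \<Rightarrow> bexp" where
  "bcomp (Lss a b) = NLess (ncomp a) (ncomp b)"
| "bcomp (RLss x y) = RLess (rcomp x) (rcomp y)"
| "bcomp (Neg b) = BNot (bcomp b)"
| "bcomp (Cnj b c) = BAnd (bcomp b) (bcomp c)"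

primrec bound_exp :: "bound \<Rightarrow> nexp" where
  "bound_exp (Times k) = NLit k"
| "bound_exp Verts = NMem (NLit 0)"
| "bound_exp Edges = NMem (NLit 1)"
| "bound_exp Once = NSub (NLit 1) (NSub (NLit 2) (NMem (NLit 0)))"

primrec compile :: "prog \<Rightarrow> com" where
  "compile Nop = Skip"
| "compile (Put k a b) = NStore (addr k (ncomp a)) (ncomp b)"
| "compile (RPut k a x) = RStore (raddr k (ncomp a)) (rcomp x)"
| "compile (c ;; d) = Seq (compile c) (compile d)"
| "compile (Ifte b c d) = Cond (bcomp b) (compile c) (compile d)"
| "compile (Loop k l b c) = Seq (NStore (addr k (NLit l)) (NLit 0))
     (While (NLess (NMem (addr k (NLit l))) (bound_exp b))
       (Seq (compile c) (NStore (addr k (NLit l)) (NAdd (NMem (addr k (NLit l))) (NLit 1)))))"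
| "compile (Load k j a) = Cond (NLess (ncomp a) (NMem (NLit 1)))
     (NStore (addr k (ncomp a))
       (NMem (NAdd (NAdd (NLit 4) (NAdd (ncomp a) (twice (ncomp a)))) (NLit j)))) Skip"
| "compile (RLoad k a) = Cond (NLess (ncomp a) (NMem (NLit 1)))
     (RStore (raddr k (ncomp a)) (RMem (ncomp a))) Skip"

primrec nlegal :: "nx \<Rightarrow> bool" where
  "nlegal (Lit k) \<longleftrightarrow> True"
| "nlegal (Inp k) \<longleftrightarrow> k < 4"
| "nlegal (Arr k a) \<longleftrightarrow> k < 64 \<and> nlegal a"
| "nlegal (Pls a b) \<longleftrightarrow> nlegal a \<and> nlegal b"
| "nlegal (Mns a b) \<longleftrightarrow> nlegal a \<and> nlegal b"

primrec rlegal :: "rx \<Rightarrow> bool" where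
  "rlegal (RLit k) \<longleftrightarrow> True"
| "rlegal (RArr k a) \<longleftrightarrow> k < 4 \<and> nlegal a"
| "rlegal (RPls x y) \<longleftrightarrow> rlegal x \<and> rlegal y"

primrec blegal :: "bx \<Rightarrow> bool" where
  "blegal (Lss a b) \<longleftrightarrow> nlegal a \<and> nlegal b"
| "blegal (RLss x y) \<longleftrightarrow> rlegal x \<and> rlegal y"
| "blegal (Neg b) \<longleftrightarrow> blegal b"
| "blegal (Cnj b c) \<longleftrightarrow> blegal b \<and> blegal c"

text \<open>The numeric limits are those of the memory layout. A loop body must not write its own
  counter, because the compiled loop keeps the counter in memory between iterations.\<close>

primrec legal :: "prog \<Rightarrow> bool" where
  "legal Nop \<longleftrightarrow> True"
| "legal (Put k a b) \<longleftrightarrow> k < 64 \<and> nlegal a \<and> nlegal b"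
| "legal (RPut k a x) \<longleftrightarrow> k < 4 \<and> nlegal a \<and> rlegal x"
| "legal (c ;; d) \<longleftrightarrow> legal c \<and> legal d"
| "legal (Ifte b c d) \<longleftrightarrow> blegal b \<and> legal c \<and> legal d"
| "legal (Loop k l b c) \<longleftrightarrow> k < 64 \<and> \<not> writes c k l \<and> legal c"
| "legal (Load k j a) \<longleftrightarrow> k < 64 \<and> j < 3 \<and> nlegal a"
| "legal (RLoad k a) \<longleftrightarrow> k < 4 \<and> nlegal a"

text \<open>An address is formed by six doublings, each of which evaluates its argument twice; hence
  the factor 64 per indirection. The summand 100 exceeds the remaining overhead.\<close>

primrec nbd :: "nx \<Rightarrow> nat" where
  "nbd (Lit k) = 1"
| "nbd (Inp k) = 2"
| "nbd (Arr k a) = 64 * nbd a + 100"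
| "nbd (Pls a b) = nbd a + nbd b + 1"
| "nbd (Mns a b) = nbd a + nbd b + 1"

primrec rbd :: "rx \<Rightarrow> nat" where
  "rbd (RLit k) = 2"
| "rbd (RArr k a) = 4 * nbd a + 10"
| "rbd (RPls x y) = rbd x + rbd y + 1"

primrec bbd :: "bx \<Rightarrow> nat" where
  "bbd (Lss a b) = nbd a + nbd b + 1"
| "bbd (RLss x y) = rbd x + rbd y + 1"
| "bbd (Neg b) = bbd b + 1"
| "bbd (Cnj b c) = bbd b + bbd c + 1"

primrec times :: "bound \<Rightarrow> nat \<Rightarrow> nat \<Rightarrow> nat" where
  "times (Times k) n m = k"
| "times Verts n m = n"
| "times Edges n m = m"
| "times Once n m = 1 - (2 - n)"

primrec tbd :: "prog \<Rightarrow> nat \<Rightarrow> nat \<Rightarrow> nat" where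
  "tbd Nop n m = 1"
| "tbd (Put k a b) n m = 64 * nbd a + nbd b + 100"
| "tbd (RPut k a x) n m = 4 * nbd a + rbd x + 10"
| "tbd (c ;; d) n m = tbd c n m + tbd d n m"
| "tbd (Ifte b c d) n m = bbd b + tbd c n m + tbd d n m"
| "tbd (Loop k l b c) n m = times b n m * (tbd c n m + 1000) + 1000"
| "tbd (Load k j a) n m = 80 * nbd a + 120"
| "tbd (RLoad k a) n m = 8 * nbd a + 20"

definition repr :: "store \<Rightarrow> state \<Rightarrow> bool" where
  "repr h \<sigma> \<longleftrightarrow>
     (\<forall>a<4 + 3 * nin h (Suc 0). fst \<sigma> a = nin h a) \<and> (\<forall>a<nin h (Suc 0). snd \<sigma> a = rin h a) \<and>
     (\<forall>k<64. \<forall>i. fst \<sigma> (4 + 3 * nin h (Suc 0) + 64 * i + k) = narr h k i) \<and>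
     (\<forall>k<4. \<forall>i. snd \<sigma> (nin h (Suc 0) + 4 * i + k) = rarr h k i)"

lemma repr_in: "repr h \<sigma> \<Longrightarrow> k < 4 \<Longrightarrow> fst \<sigma> k = nin h k"
  by (simp add: repr_def)

lemma repr_1: "repr h \<sigma> \<Longrightarrow> fst \<sigma> 1 = nin h (Suc 0)" "repr h \<sigma> \<Longrightarrow> fst \<sigma> (Suc 0) = nin h (Suc 0)"
  by (simp_all add: repr_def)

lemma nval_addr: "repr h \<sigma> \<Longrightarrow> nval (addr k a) \<sigma> = 4 + 3 * nin h (Suc 0) + 64 * nval a \<sigma> + k"
  by (simp add: addr_def twice_def repr_1)

lemma nval_raddr: "repr h \<sigma> \<Longrightarrow> nval (raddr k a) \<sigma> = nin h (Suc 0) + 4 * nval a \<sigma> + k"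
  by (simp add: raddr_def twice_def repr_1)

lemma ntime_addr [simp]: "ntime (addr k a) = 64 * ntime a + 76"
  by (simp add: addr_def twice_def)

lemma ntime_raddr [simp]: "ntime (raddr k a) = 4 * ntime a + 8"
  by (simp add: raddr_def twice_def)

lemma repr_narr: "repr h \<sigma> \<Longrightarrow> k < 64 \<Longrightarrow> fst \<sigma> (4 + 3 * nin h (Suc 0) + 64 * i + k) = narr h k i"
  by (simp add: repr_def)

lemma repr_rarr: "repr h \<sigma> \<Longrightarrow> k < 4 \<Longrightarrow> snd \<sigma> (nin h (Suc 0) + 4 * i + k) = rarr h k i"
  by (simp add: repr_def)

lemma ncomp_correct: "nlegal a \<Longrightarrow> repr h \<sigma> \<Longrightarrow> nval (ncomp a) \<sigma> = neval a h"
  by (induction a) (auto simp: nval_addr repr_narr repr_in)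

lemma rcomp_correct: "rlegal x \<Longrightarrow> repr h \<sigma> \<Longrightarrow> rval (rcomp x) \<sigma> = reval x h"
  by (induction x) (auto simp: nval_raddr repr_rarr ncomp_correct)

lemma bcomp_correct: "blegal b \<Longrightarrow> repr h \<sigma> \<Longrightarrow> bval (bcomp b) \<sigma> = beval b h"
  by (induction b) (auto simp: ncomp_correct rcomp_correct)

lemma ntime_ncomp: "ntime (ncomp a) \<le> nbd a"
  by (induction a) auto

lemma rtime_rcomp: "rtime (rcomp x) \<le> rbd x"
proof (induction x)
  case (RArr k a)
  then show ?case using ntime_ncomp[of a] by simp
qed auto

lemma btime_bcomp: "btime (bcomp b) \<le> bbd b"
proof (induction b)
  case (Lss a b)
  then show ?case using ntime_ncomp[of a] ntime_ncomp[of b] by simp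
next
  case (RLss a b)
  then show ?case using rtime_rcomp[of a] rtime_rcomp[of b] by simp
qed auto

text \<open>Uniqueness of quotient and remainder. It separates the cells of different arrays and,
  later, the entries of different rows and planes.\<close>

lemma interleave_eq: "k < c \<Longrightarrow> k' < c \<Longrightarrow> c * i + k = c * i' + k' \<longleftrightarrow> i = i' \<and> k = (k' :: nat)"
  by (metis add.commute add_diff_cancel_left' bot_nat_0.not_eq_extremum div_less div_mult_self2
      less_nat_zero_code)

lemma repr_setn:
  assumes "repr h \<sigma>" "k < 64"
  shows "repr (setn k i x h) ((fst \<sigma>)(4 + 3 * nin h (Suc 0) + 64 * i + k := x), snd \<sigma>)"
  using assms interleave_eq[of k 64 _ i] unfolding repr_def
  by (auto simp: add.assoc) metis+

lemma repr_setr: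
  assumes "repr h \<sigma>" "k < 4"
  shows "repr (setr k i x h) (fst \<sigma>, (snd \<sigma>)(nin h (Suc 0) + 4 * i + k := x))"
  using assms interleave_eq[of k 4 _ i] unfolding repr_def
  by (auto simp: add.assoc) metis+

lemma bound_exp_val: "repr h \<sigma> \<Longrightarrow> nval (bound_exp b) \<sigma> = bval_of b h"
  by (cases b) (auto simp: repr_in)

lemma times_eq: "times b (nin h 0) (nin h (Suc 0)) = bval_of b h"
  by (cases b) auto

lemma ntime_bound: "ntime (bound_exp b) \<le> 6"
  by (cases b) auto

lemma compile_correct:
  "legal c \<Longrightarrow> repr h \<sigma> \<Longrightarrow>
    \<exists>t \<tau>. exec (compile c) \<sigma> t \<tau> \<and> t \<le> tbd c (nin h 0) (nin h (Suc 0)) \<and> repr (sem c h) \<tau>"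
proof (induction c arbitrary: h \<sigma>)
  case Nop
  then show ?case using exec.Skip by fastforce
next
  case (Put k a b)
  have "exec (compile (Put k a b)) \<sigma> (ntime (addr k (ncomp a)) + ntime (ncomp b) + 1)
     ((fst \<sigma>)(nval (addr k (ncomp a)) \<sigma> := nval (ncomp b) \<sigma>), snd \<sigma>)"
    by (simp only: compile.simps exec.NStore)
  moreover have "repr (sem (Put k a b) h)
     ((fst \<sigma>)(nval (addr k (ncomp a)) \<sigma> := nval (ncomp b) \<sigma>), snd \<sigma>)"
    using Put by (simp add: nval_addr ncomp_correct repr_setn)
  ultimately show ?case
    using ntime_ncomp[of a] ntime_ncomp[of b] by (intro exI conjI) (assumption, auto)
next
  case (RPut k a x)
  have "exec (compile (RPut k a x)) \<sigma> (ntime (raddr k (ncomp a)) + rtime (rcomp x) + 1)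
     (fst \<sigma>, (snd \<sigma>)(nval (raddr k (ncomp a)) \<sigma> := rval (rcomp x) \<sigma>))"
    by (simp only: compile.simps exec.RStore)
  moreover have "repr (sem (RPut k a x) h)
     (fst \<sigma>, (snd \<sigma>)(nval (raddr k (ncomp a)) \<sigma> := rval (rcomp x) \<sigma>))"
    using RPut by (simp add: nval_raddr ncomp_correct rcomp_correct repr_setr)
  ultimately show ?case
    using ntime_ncomp[of a] rtime_rcomp[of x] by (intro exI conjI) (assumption, auto)
next
  case (Sq c d)
  then have w: "legal c" "legal d" by auto
  obtain t \<tau> where 1: "exec (compile c) \<sigma> t \<tau>" "t \<le> tbd c (nin h 0) (nin h (Suc 0))" "repr (sem c h) \<tau>"
    using Sq.IH(1)[OF w(1) Sq.prems(2)] by blast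
  obtain u \<rho> where "exec (compile d) \<tau> u \<rho>" "u \<le> tbd d (nin h 0) (nin h (Suc 0))"
      "repr (sem d (sem c h)) \<rho>"
    using Sq.IH(2)[OF w(2) 1(3)] by auto
  with 1 show ?case by (intro exI[of _ "t + u"] exI[of _ \<rho>]) (auto intro: exec.Seq)
next
  case (Ifte b c d)
  then have b: "bval (bcomp b) \<sigma> = beval b h" by (simp add: bcomp_correct)
  show ?case
  proof (cases "beval b h")
    case True
    obtain t \<tau> where 1: "exec (compile c) \<sigma> t \<tau>" "t \<le> tbd c (nin h 0) (nin h (Suc 0))" "repr (sem c h) \<tau>"
      using Ifte.IH(1)[OF _ Ifte.prems(2)] Ifte.prems(1) by auto
    with b True btime_bcomp[of b] show ?thesis
      by (intro exI[of _ "btime (bcomp b) + t"] exI[of _ \<tau>]) (auto intro: exec.CondTrue)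
  next
    case False
    obtain t \<tau> where 1: "exec (compile d) \<sigma> t \<tau>" "t \<le> tbd d (nin h 0) (nin h (Suc 0))" "repr (sem d h) \<tau>"
      using Ifte.IH(2)[OF _ Ifte.prems(2)] Ifte.prems(1) by auto
    with b False btime_bcomp[of b] show ?thesis
      by (intro exI[of _ "btime (bcomp b) + t"] exI[of _ \<tau>]) (auto intro: exec.CondFalse)
  qed
next
  case (Loop k l b c)
  define B where "B = bval_of b h"
  define n m where "n = nin h 0" and "m = nin h (Suc 0)"
  define T where "T = tbd c n m + 1000"
  let ?cell = "addr k (NLit l)"
  let ?test = "NLess (NMem ?cell) (bound_exp b)"
  let ?body = "Seq (compile c) (NStore ?cell (NAdd (NMem ?cell) (NLit 1)))"
  have k: "k < 64" and nw: "\<not> writes c k l" and w: "legal c" using Loop.prems by auto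
  have test: "btime ?test \<le> 200" using ntime_bound[of b] by simp
  \<comment> \<open>Induction on the iterations left. At the loop head the machine represents
    \<open>setn k l i g\<close>, which is also the store from which the fold starts iteration
    \<open>i\<close>; so the two advance in step.\<close>
  have loop: "\<exists>t \<tau>. exec (While ?test ?body) \<sigma> t \<tau> \<and> t \<le> (B - i) * T + 200 \<and>
      repr (setn k l B (fold (\<lambda>i g. sem c (setn k l i g)) [i..<B] g)) \<tau>"
    if "i \<le> B" "repr (setn k l i g) \<sigma>" "nin g = nin h" for i g \<sigma>
    using that
  proof (induction "B - i" arbitrary: i g \<sigma>)
    case 0
    then have i: "i = B" by simp
    have "\<not> bval ?test \<sigma>"
      using repr_narr[OF 0(3) k, of l] bound_exp_val[OF 0(3), of b] 0(4) nval_addr[OF 0(3), of k "NLit l"] times_eq[of b h] times_eq[of b "setn k l i g"]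
      by (simp add: i B_def)
    then have "exec (While ?test ?body) \<sigma> (btime ?test) \<sigma>" by (rule exec.WhileFalse)
    then show ?case using 0 i test by (intro exI conjI) (assumption, auto)
  next
    case (Suc x)
    then have i: "i < B" and x: "x = B - Suc i" by simp_all
    note r = Suc(4)
    have "bval ?test \<sigma>"
      using repr_narr[OF r k, of l] bound_exp_val[OF r, of b] Suc(5) nval_addr[OF r, of k "NLit l"] times_eq[of b h] times_eq[of b "setn k l i g"] i
      by (simp add: B_def)
    moreover obtain t \<tau> where 1: "exec (compile c) \<sigma> t \<tau>" "t \<le> tbd c n m"
        "repr (sem c (setn k l i g)) \<tau>"
      using Loop.IH[OF w r] Suc(5) by (auto simp: n_def m_def)
    define g' where "g' = sem c (setn k l i g)"
    have cell: "narr g' k l = i" using sem_frame[OF nw] by (simp add: g'_def)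
    have nin: "nin g' = nin h" by (simp add: g'_def Suc(5))
    note r' = 1(3)[folded g'_def]
    let ?\<tau> = "((fst \<tau>)(nval ?cell \<tau> := nval (NAdd (NMem ?cell) (NLit 1)) \<tau>), snd \<tau>)"
    have "exec (NStore ?cell (NAdd (NMem ?cell) (NLit 1))) \<tau>
       (ntime ?cell + ntime (NAdd (NMem ?cell) (NLit 1)) + 1) ?\<tau>"
      by (rule exec.NStore)
    then have "exec ?body \<sigma> (t + (ntime ?cell + ntime (NAdd (NMem ?cell) (NLit 1)) + 1)) ?\<tau>"
      by (rule exec.Seq[OF 1(1)])
    moreover have "repr (setn k l (Suc i) g') ?\<tau>"
      using repr_setn[OF r' k, of l "Suc i"] repr_narr[OF r' k, of l] nval_addr[OF r', of k "NLit l"]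
      by (simp add: cell)
    moreover obtain u \<rho> where "exec (While ?test ?body) ?\<tau> u \<rho>" "u \<le> (B - Suc i) * T + 200"
      "repr (setn k l B (fold (\<lambda>i g. sem c (setn k l i g)) [Suc i..<B] g')) \<rho>"
      using Suc(1)[OF x _ calculation(3) nin] i by (metis Suc_leI)
    ultimately have "exec (While ?test ?body) \<sigma>
       (btime ?test + (t + (ntime ?cell + ntime (NAdd (NMem ?cell) (NLit 1)) + 1)) + u) \<rho>"
      by (intro exec.WhileTrue)
    moreover have "btime ?test + (t + (ntime ?cell + ntime (NAdd (NMem ?cell) (NLit 1)) + 1)) + u
       \<le> (B - i) * T + 200"
    proof -
      have "(B - i) * T = (B - Suc i) * T + T" using i by (metis Suc_diff_Suc mult_Suc add.commute)
      then show ?thesis using test 1(2) \<open>u \<le> _\<close> by (simp add: T_def)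
    qed
    moreover have "fold (\<lambda>i g. sem c (setn k l i g)) [i..<B] g =
        fold (\<lambda>i g. sem c (setn k l i g)) [Suc i..<B] g'"
      using i by (simp add: upt_rec[of i] g'_def)
    ultimately show ?case
      using \<open>repr (setn k l B _) \<rho>\<close> by (intro exI conjI) (assumption, auto)
  qed
  let ?\<sigma> = "((fst \<sigma>)(nval ?cell \<sigma> := nval (NLit 0) \<sigma>), snd \<sigma>)"
  have "exec (NStore ?cell (NLit 0)) \<sigma> (ntime ?cell + ntime (NLit 0) + 1) ?\<sigma>"
    by (rule exec.NStore)
  moreover have "repr (setn k l 0 h) ?\<sigma>"
    using repr_setn[OF Loop.prems(2) k, of l 0] nval_addr[OF Loop.prems(2), of k "NLit l"] by simp
  moreover obtain t \<tau> where "exec (While ?test ?body) ?\<sigma> t \<tau>" "t \<le> (B - 0) * T + 200"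
      "repr (setn k l B (fold (\<lambda>i g. sem c (setn k l i g)) [0..<B] h)) \<tau>"
    using loop[OF _ calculation(2)] by auto
  ultimately show ?case
    unfolding compile.simps sem.simps tbd.simps B_def[symmetric] n_def[symmetric] m_def[symmetric]
      times_eq[of b h, folded n_def m_def]
    by (intro exI[of _ "ntime ?cell + ntime (NLit 0) + 1 + t"] exI[of _ \<tau>] conjI exec.Seq)
      (auto simp: T_def)
next
  case (Load k j a)
  then have a: "nval (ncomp a) \<sigma> = neval a h" by (simp add: ncomp_correct)
  let ?t = "NLess (ncomp a) (NMem (NLit 1))"
  have bt: "btime ?t \<le> nbd a + 3" using ntime_ncomp[of a] by simp
  show ?case
  proof (cases "neval a h < nin h (Suc 0)")
    case True
    let ?e = "NMem (NAdd (NAdd (NLit 4) (NAdd (ncomp a) (twice (ncomp a)))) (NLit j))"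
    have "exec (NStore (addr k (ncomp a)) ?e) \<sigma> (ntime (addr k (ncomp a)) + ntime ?e + 1)
      ((fst \<sigma>)(nval (addr k (ncomp a)) \<sigma> := nval ?e \<sigma>), snd \<sigma>)"
      by (rule exec.NStore)
    moreover have "bval ?t \<sigma>" using True Load.prems a by (simp add: repr_1)
    ultimately have "exec (compile (Load k j a)) \<sigma>
       (btime ?t + (ntime (addr k (ncomp a)) + ntime ?e + 1))
       ((fst \<sigma>)(nval (addr k (ncomp a)) \<sigma> := nval ?e \<sigma>), snd \<sigma>)"
      by (simp only: compile.simps exec.CondTrue)
    moreover have "nval ?e \<sigma> = nin h (4 + 3 * neval a h + j)"
    proof -
      have "nval ?e \<sigma> = fst \<sigma> (4 + 3 * neval a h + j)" by (simp add: twice_def a ac_simps)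
      also have "\<dots> = nin h (4 + 3 * neval a h + j)"
      proof -
        have "4 + 3 * neval a h + j < 4 + 3 * nin h (Suc 0)" using Load.prems(1) True by auto
        then show ?thesis using Load.prems(2) unfolding repr_def by blast
      qed
      finally show ?thesis .
    qed
    then have "repr (sem (Load k j a) h)
        ((fst \<sigma>)(nval (addr k (ncomp a)) \<sigma> := nval ?e \<sigma>), snd \<sigma>)"
      using True Load.prems repr_setn[of h \<sigma> k "neval a h"] by (simp add: nval_addr a)
    ultimately show ?thesis
      using ntime_ncomp[of a] by (intro exI conjI) (assumption, auto simp: twice_def)
  next
    case False
    then have "exec (compile (Load k j a)) \<sigma> (btime ?t + 1) \<sigma>"
      using Load.prems a unfolding compile.simps
      by (intro exec.CondFalse exec.Skip) (simp add: repr_1)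
    then show ?thesis using False Load.prems bt by (intro exI conjI) (assumption, auto)
  qed
next
  case (RLoad k a)
  then have a: "nval (ncomp a) \<sigma> = neval a h" by (simp add: ncomp_correct)
  let ?t = "NLess (ncomp a) (NMem (NLit 1))"
  have bt: "btime ?t \<le> nbd a + 3" using ntime_ncomp[of a] by simp
  show ?case
  proof (cases "neval a h < nin h (Suc 0)")
    case True
    let ?e = "RMem (ncomp a)"
    have "exec (RStore (raddr k (ncomp a)) ?e) \<sigma> (ntime (raddr k (ncomp a)) + rtime ?e + 1)
      (fst \<sigma>, (snd \<sigma>)(nval (raddr k (ncomp a)) \<sigma> := rval ?e \<sigma>))"
      by (rule exec.RStore)
    moreover have "bval ?t \<sigma>" using True RLoad.prems a by (simp add: repr_1)
    ultimately have "exec (compile (RLoad k a)) \<sigma>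
       (btime ?t + (ntime (raddr k (ncomp a)) + rtime ?e + 1))
       (fst \<sigma>, (snd \<sigma>)(nval (raddr k (ncomp a)) \<sigma> := rval ?e \<sigma>))"
      by (simp only: compile.simps exec.CondTrue)
    moreover have "repr (sem (RLoad k a) h)
        (fst \<sigma>, (snd \<sigma>)(nval (raddr k (ncomp a)) \<sigma> := rval ?e \<sigma>))"
      using True RLoad.prems repr_setr[of h \<sigma> k "neval a h" "rin h (neval a h)"]
      by (simp add: nval_raddr a) (simp add: repr_def)
    ultimately show ?thesis
      using ntime_ncomp[of a] by (intro exI conjI) (assumption, auto)
  next
    case False
    then have "exec (compile (RLoad k a)) \<sigma> (btime ?t + 1) \<sigma>"
      using RLoad.prems a unfolding compile.simps
      by (intro exec.CondFalse exec.Skip) (simp add: repr_1)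
    then show ?thesis using False RLoad.prems bt by (intro exI conjI) (assumption, auto)
  qed
qed

text \<open>The output overwrites the input, and cell 1 holds the number of edges, on which all
  array addresses depend. Hence cells \<open>m\<close> down to 2 are filled with a decreasing
  counter, and cell 1 comes last. Copying \<open>m\<close> entries whatever the length of the list
  is harmless, as cell 0 tells how many of them count.\<close>

definition emit :: "nat \<Rightarrow> nat \<Rightarrow> nat \<Rightarrow> com" where
  "emit k c j =
     Seq (While (NLess (NLit 1) (NMem (addr j (NLit 0))))
       (Seq (NStore (NMem (addr j (NLit 0))) (NMem (addr k (NSub (NMem (addr j (NLit 0))) (NLit 1)))))
            (NStore (addr j (NLit 0)) (NSub (NMem (addr j (NLit 0))) (NLit 1)))))
     (Seq (NStore (NLit 0) (NMem (addr c (NLit 0))))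
          (NStore (NLit 1) (NMem (addr k (NLit 0)))))"

lemma nval_addr_raw: "fst \<sigma> 1 = m \<Longrightarrow> nval (addr k a) \<sigma> = 4 + 3 * m + 64 * nval a \<sigma> + k"
  by (simp add: addr_def twice_def)

text \<open>Cells 2 to \<open>m\<close> lie below \<open>4 + 3 * m\<close>, so the copying destroys
  input cells only and never the array that is being read.\<close>

lemma emit_loop:
  fixes m x :: nat
  defines "B \<equiv> 4 + 3 * m"
  assumes "k \<noteq> j" "c \<noteq> j" "k < 64" "j < 64" "c < 64"
    and "fst \<sigma> 1 = m" "fst \<sigma> (B + j) = x" "x \<le> m" "fst \<sigma> (B + c) = y"
    and "\<And>i. fst \<sigma> (B + 64 * i + k) = f i"
    and "\<And>i. x < i \<Longrightarrow> 2 \<le> i \<Longrightarrow> i \<le> m \<Longrightarrow> fst \<sigma> i = f (i - 1)"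
  shows "\<exists>t \<tau>. exec (While (NLess (NLit 1) (NMem (addr j (NLit 0))))
       (Seq (NStore (NMem (addr j (NLit 0))) (NMem (addr k (NSub (NMem (addr j (NLit 0))) (NLit 1)))))
            (NStore (addr j (NLit 0)) (NSub (NMem (addr j (NLit 0))) (NLit 1))))) \<sigma> t \<tau> \<and>
     t \<le> 20000 * x + 1000 \<and> fst \<tau> 1 = m \<and> fst \<tau> (B + c) = y \<and>
     (\<forall>i. fst \<tau> (B + 64 * i + k) = f i) \<and> (\<forall>i. 2 \<le> i \<longrightarrow> i \<le> m \<longrightarrow> fst \<tau> i = f (i - 1))"
  using assms(7-)
proof (induction x arbitrary: \<sigma>)
  case 0
  let ?b = "NLess (NLit 1) (NMem (addr j (NLit 0)))"
  have "\<not> bval ?b \<sigma>" using 0 nval_addr_raw[OF 0(1)] by (simp add: B_def)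
  then show ?case
    by (intro exI[of _ "btime ?b"] exI[of _ \<sigma>] conjI exec.WhileFalse) (use 0 in auto)
next
  case (Suc x)
  let ?b = "NLess (NLit 1) (NMem (addr j (NLit 0)))"
  let ?c1 = "NStore (NMem (addr j (NLit 0))) (NMem (addr k (NSub (NMem (addr j (NLit 0))) (NLit 1))))"
  let ?c2 = "NStore (addr j (NLit 0)) (NSub (NMem (addr j (NLit 0))) (NLit 1))"
  have aj: "nval (addr j (NLit 0)) \<sigma> = B + j" using nval_addr_raw[OF Suc.prems(1)] by (simp add: B_def)
  have Bm: "m < B" by (simp add: B_def)
  show ?case
  proof (cases x)
    case 0
    then have "\<not> bval ?b \<sigma>" using Suc.prems by (simp add: aj)
    then show ?thesis
      by (intro exI[of _ "btime ?b"] exI[of _ \<sigma>] conjI exec.WhileFalse) (use Suc.prems 0 in auto)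
  next
    case (Suc x')
    define \<sigma>1 where "\<sigma>1 = ((fst \<sigma>)(Suc x := f x), snd \<sigma>)"
    define \<sigma>2 where "\<sigma>2 = ((fst \<sigma>1)(B + j := x), snd \<sigma>1)"
    have b: "bval ?b \<sigma>" using Suc.prems Suc by (simp add: aj)
    have ak: "nval (addr k (NSub (NMem (addr j (NLit 0))) (NLit 1))) \<sigma> = B + 64 * x + k"
      using Suc.prems(2) aj nval_addr_raw[OF Suc.prems(1)] by (simp add: B_def)
    have 1: "exec ?c1 \<sigma> (ntime (NMem (addr j (NLit 0))) +
        ntime (NMem (addr k (NSub (NMem (addr j (NLit 0))) (NLit 1)))) + 1) \<sigma>1"
    proof -
      have "\<sigma>1 = ((fst \<sigma>)(nval (NMem (addr j (NLit 0))) \<sigma> :=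
          nval (NMem (addr k (NSub (NMem (addr j (NLit 0))) (NLit 1)))) \<sigma>), snd \<sigma>)"
        using Suc.prems by (simp only: nval.simps ak aj) (simp add: \<sigma>1_def)
      then show ?thesis by (simp only: exec.NStore)
    qed
    have s1: "fst \<sigma>1 1 = m" "fst \<sigma>1 (B + j) = Suc x"
      using Suc.prems Suc Bm by (auto simp: \<sigma>1_def)
    then have aj1: "nval (addr j (NLit 0)) \<sigma>1 = B + j"
      using nval_addr_raw[OF s1(1)] by (simp add: B_def)
    have 2: "exec ?c2 \<sigma>1 (ntime (addr j (NLit 0)) + ntime (NSub (NMem (addr j (NLit 0))) (NLit 1)) + 1) \<sigma>2"
    proof -
      have "\<sigma>2 = ((fst \<sigma>1)(nval (addr j (NLit 0)) \<sigma>1 :=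
          nval (NSub (NMem (addr j (NLit 0))) (NLit 1)) \<sigma>1), snd \<sigma>1)"
        using s1 by (simp only: nval.simps aj1) (simp add: \<sigma>2_def)
      then show ?thesis by (simp only: exec.NStore)
    qed
    have *: "B + 64 * i + k \<noteq> B + j" for i
      using interleave_eq[of k 64 j i 0] assms by auto
    have "fst \<sigma>2 1 = m" "fst \<sigma>2 (B + j) = x" "x \<le> m" "fst \<sigma>2 (B + c) = y"
      "\<And>i. fst \<sigma>2 (B + 64 * i + k) = f i"
      "\<And>i. x < i \<Longrightarrow> 2 \<le> i \<Longrightarrow> i \<le> m \<Longrightarrow> fst \<sigma>2 i = f (i - 1)"
      using Suc.prems Bm s1 * assms(2,3) unfolding \<sigma>2_def \<sigma>1_def by auto
    from Suc.IH[OF this] obtain t \<tau> where t: "exec (While ?b (Seq ?c1 ?c2)) \<sigma>2 t \<tau>"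
      "t \<le> 20000 * x + 1000" "fst \<tau> 1 = m" "fst \<tau> (B + c) = y"
      "\<forall>i. fst \<tau> (B + 64 * i + k) = f i" "\<forall>i. 2 \<le> i \<longrightarrow> i \<le> m \<longrightarrow> fst \<tau> i = f (i - 1)"
      by blast
    show ?thesis
      by (rule exI, rule exI, intro conjI, rule exec.WhileTrue[OF b exec.Seq[OF 1 2] t(1)])
        (use t in auto)
  qed
qed

lemma emit_correct:
  assumes r: "repr h \<sigma>" and d: "k \<noteq> j" "c \<noteq> j" "k < 64" "j < 64" "c < 64"
    and j: "narr h j 0 = nin h 1"
  shows "\<exists>t \<tau>. exec (emit k c j) \<sigma> t \<tau> \<and> t \<le> 20000 * nin h 1 + 2000 \<and>
     (narr h c 0 \<le> nin h 1 \<longrightarrow> output_edges \<tau> = narr h k ` {..<narr h c 0})"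
proof -
  define m where "m = nin h 1"
  have m: "nin h (Suc 0) = m" by (simp add: m_def)
  have m1: "fst \<sigma> 1 = m" using repr_1[OF r] by (simp add: m_def)
  have jj: "fst \<sigma> (4 + 3 * m + j) = m"
    using repr_narr[OF r d(4), of 0] j by (simp add: m_def)
  have cc: "fst \<sigma> (4 + 3 * m + c) = narr h c 0"
    using repr_narr[OF r d(5), of 0] by (simp add: m_def)
  have kk: "fst \<sigma> (4 + 3 * m + 64 * i + k) = narr h k i" for i
    using repr_narr[OF r d(3), of i] by (simp add: m_def)
  have last: "fst \<sigma> i = narr h k (i - 1)" if "m < i" "2 \<le> i" "i \<le> m" for i
    using that by simp
  obtain t \<tau> where t: "exec (While (NLess (NLit 1) (NMem (addr j (NLit 0))))
       (Seq (NStore (NMem (addr j (NLit 0))) (NMem (addr k (NSub (NMem (addr j (NLit 0))) (NLit 1)))))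
            (NStore (addr j (NLit 0)) (NSub (NMem (addr j (NLit 0))) (NLit 1))))) \<sigma> t \<tau>"
     "t \<le> 20000 * m + 1000" "fst \<tau> 1 = m" "fst \<tau> (4 + 3 * m + c) = narr h c 0"
     "\<forall>i. fst \<tau> (4 + 3 * m + 64 * i + k) = narr h k i"
     "\<forall>i. 2 \<le> i \<longrightarrow> i \<le> m \<longrightarrow> fst \<tau> i = narr h k (i - 1)"
    using emit_loop[OF d m1 jj order_refl cc kk last] by blast
  define \<tau>1 where "\<tau>1 = ((fst \<tau>)(0 := narr h c 0), snd \<tau>)"
  define \<tau>2 where "\<tau>2 = ((fst \<tau>1)(1 := narr h k 0), snd \<tau>1)"
  have 1: "exec (NStore (NLit 0) (NMem (addr c (NLit 0)))) \<tau>
      (ntime (NLit 0) + ntime (NMem (addr c (NLit 0))) + 1) \<tau>1"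
  proof -
    have "\<tau>1 = ((fst \<tau>)(nval (NLit 0) \<tau> := nval (NMem (addr c (NLit 0))) \<tau>), snd \<tau>)"
      using t(4) nval_addr_raw[OF t(3)] by (simp add: \<tau>1_def)
    then show ?thesis by (simp only: exec.NStore)
  qed
  have 2: "exec (NStore (NLit 1) (NMem (addr k (NLit 0)))) \<tau>1
      (ntime (NLit 1) + ntime (NMem (addr k (NLit 0))) + 1) \<tau>2"
  proof -
    have "fst \<tau> (4 + 3 * m + k) = narr h k 0" using t(5)[rule_format, of 0] by simp
    moreover have "fst \<tau>1 1 = m" using t(3) by (simp add: \<tau>1_def)
    ultimately have "\<tau>2 = ((fst \<tau>1)(nval (NLit 1) \<tau>1 := nval (NMem (addr k (NLit 0))) \<tau>1), snd \<tau>1)"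
      using nval_addr_raw[of \<tau>1 m k "NLit 0"] by (simp add: \<tau>2_def \<tau>1_def)
    then show ?thesis by (simp only: exec.NStore)
  qed
  have "exec (emit k c j) \<sigma> (t + ((ntime (NLit 0) + ntime (NMem (addr c (NLit 0))) + 1) +
      (ntime (NLit 1) + ntime (NMem (addr k (NLit 0))) + 1))) \<tau>2"
    unfolding emit_def by (rule exec.Seq[OF t(1) exec.Seq[OF 1 2]])
  moreover have "output_edges \<tau>2 = narr h k ` {..<narr h c 0}" if "narr h c 0 \<le> m"
  proof -
    have "fst \<tau>2 i = narr h k (i - 1)" if "i \<in> {1..narr h c 0}" for i
      using t(6) that \<open>narr h c 0 \<le> m\<close> by (cases "i = 1") (auto simp: \<tau>2_def \<tau>1_def)
    then have "fst \<tau>2 ` {1..narr h c 0} = (\<lambda>i. narr h k (i - 1)) ` {1..narr h c 0}"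
      by (rule image_cong[OF refl])
    moreover have "fst \<tau>2 0 = narr h c 0" by (simp add: \<tau>2_def \<tau>1_def)
    ultimately have "output_edges \<tau>2 = (\<lambda>i. narr h k (i - 1)) ` {1..narr h c 0}"
      by (simp only: output_edges_def)
    also have "\<dots> = narr h k ` {..<narr h c 0}"
    proof -
      have "{..<narr h c 0} = (\<lambda>i. i - 1) ` {1..narr h c 0}"
      proof (intro equalityI subsetI)
        fix x assume "x \<in> {..<narr h c 0}"
        then show "x \<in> (\<lambda>i. i - 1) ` {1..narr h c 0}" by (intro image_eqI[of _ _ "Suc x"]) auto
      qed auto
      then show ?thesis by (simp add: image_image)
    qed
    finally show ?thesis .
  qed
  ultimately show ?thesis
    using t(2) by (intro exI conjI) (assumption, auto simp: m)
qed

section \<open>Initial stores and complete runs\<close>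

definition initial :: "(nat, nat) flex_st \<Rightarrow> store" where
  "initial I = \<lparr>narr = \<lambda>_ _. 0, rarr = \<lambda>_ _. 0, nin = fst (input_state I), rin = snd (input_state I)\<rparr>"

lemma length_concat3: "length (concat (map (\<lambda>e. [f e, g e, k e]) xs)) = 3 * length xs"
  by (induction xs) auto

lemma nth_concat3:
  "e < length xs \<Longrightarrow> j < 3 \<Longrightarrow>
    concat (map (\<lambda>e. [f e, g e, k e]) xs) ! (3 * e + j) = [f (xs ! e), g (xs ! e), k (xs ! e)] ! j"
proof (induction xs arbitrary: e)
  case (Cons x xs)
  then show ?case by (cases e) (auto simp: nth_Cons numeral_3_eq_3 split: nat.split)
qed simp

lemma initial_in:
  "nin (initial I) 0 = card (verts I)" "nin (initial I) (Suc 0) = card (edges I)"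
  "nin (initial I) 2 = source I" "nin (initial I) 3 = sink I"
  by (simp_all add: initial_def input_state_def memory_def length_concat3)

lemma initial_edge:
  assumes "e < card (edges I)"
  shows "nin (initial I) (4 + 3 * e) = fst (ends I e)"
    and "nin (initial I) (5 + 3 * e) = snd (ends I e)"
    and "nin (initial I) (6 + 3 * e) = (if e \<in> safe I then 1 else 0)"
    and "rin (initial I) e = cost I e"
proof -
  have *: "nin (initial I) (4 + (3 * e + j)) =
      [fst (ends I e), snd (ends I e), if e \<in> safe I then 1 else 0] ! j" if "j < 3" for j
    using assms that nth_concat3[of e "[0..<card (edges I)]" j "\<lambda>e. fst (ends I e)"
        "\<lambda>e. snd (ends I e)" "\<lambda>e. if e \<in> safe I then 1 else 0"]
    by (simp add: initial_def input_state_def memory_def length_concat3 nth_append)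
  show "nin (initial I) (4 + 3 * e) = fst (ends I e)"
    "nin (initial I) (5 + 3 * e) = snd (ends I e)"
    "nin (initial I) (6 + 3 * e) = (if e \<in> safe I then 1 else 0)"
    using *[of 0] *[of 1] *[of 2] by (simp_all add: add.commute[of _ "3 * e"])
  show "rin (initial I) e = cost I e"
    using assms by (simp add: initial_def input_state_def memory_def)
qed

lemma repr_initial: "repr (initial I) (input_state I)"
  by (auto simp: repr_def initial_def input_state_def memory_def length_concat3)

lemma run_program:
  assumes "legal P" "k \<noteq> j" "c \<noteq> j" "k < 64" "j < 64" "c < 64"
    and "narr (sem P (initial I)) j 0 = card (edges I)"
  shows "\<exists>t \<tau>. exec (Seq (compile P) (emit k c j)) (input_state I) t \<tau> \<and>
     t \<le> tbd P (card (verts I)) (card (edges I)) + 20000 * card (edges I) + 2000 \<and>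
     (narr (sem P (initial I)) c 0 \<le> card (edges I) \<longrightarrow>
       output_edges \<tau> = narr (sem P (initial I)) k ` {..<narr (sem P (initial I)) c 0})"
proof -
  obtain t \<tau> where 1: "exec (compile P) (input_state I) t \<tau>"
    "t \<le> tbd P (card (verts I)) (card (edges I))" "repr (sem P (initial I)) \<tau>"
    using compile_correct[OF assms(1) repr_initial[of I]] unfolding initial_in by blast
  obtain u \<rho> where 2: "exec (emit k c j) \<tau> u \<rho>" "u \<le> 20000 * card (edges I) + 2000"
    "narr (sem P (initial I)) c 0 \<le> card (edges I) \<longrightarrow>
       output_edges \<rho> = narr (sem P (initial I)) k ` {..<narr (sem P (initial I)) c 0}"
    using emit_correct[OF 1(3) assms(2-6)] assms(7) by (auto simp: initial_in)
  show ?thesis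
    by (intro exI[of _ "t + u"] exI[of _ \<rho>] conjI exec.Seq[OF 1(1) 2(1)]) (use 1 2 in auto)
qed

section \<open>Flows and cuts\<close>

text \<open>The sum runs over ordered pairs and takes values in any commutative monoid, so that one
  set of rules serves symmetric multiplicities, capacities and signed net flow.\<close>

definition flux :: "nat \<Rightarrow> (nat \<Rightarrow> nat \<Rightarrow> 'a::comm_monoid_add) \<Rightarrow> nat set \<Rightarrow> 'a" where
  "flux n f A = (\<Sum>(u, v)\<in>A \<times> ({..<n} - A). f u v)"

lemma finite_cut_pairs [simp]: "A \<subseteq> {..<n} \<Longrightarrow> finite (A \<times> ({..<n} - A))" for n :: nat
  using finite_subset by auto

lemma flux_add: "flux n (\<lambda>u v. f u v + g u v) A = flux n f A + flux n g A"
  by (simp add: flux_def split_def sum.distrib)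

lemma flux_sum: "flux n (\<lambda>u v. \<Sum>i\<in>S. f i u v) A = (\<Sum>i\<in>S. flux n (f i) A)"
  unfolding flux_def split_def by (rule sum.swap)

lemma flux_mult: "flux n (\<lambda>u v. c * f u v) A = c * flux n f A" for c :: "'a::semiring_0"
  by (simp add: flux_def split_def sum_distrib_left)

lemma flux_of_nat: "flux n (\<lambda>u v. int (f u v)) A = int (flux n f A)"
  by (simp add: flux_def split_def)

lemma flux_diff: "flux n (\<lambda>u v. f u v - g u v) A = flux n f A - flux n g A"
  for f :: "nat \<Rightarrow> nat \<Rightarrow> 'a::ab_group_add"
  by (simp add: flux_def split_def sum_subtractf)

lemma flux_mono:
  fixes f :: "nat \<Rightarrow> nat \<Rightarrow> 'a::ordered_comm_monoid_add"
  assumes "\<And>u v. u \<in> A \<Longrightarrow> v < n \<Longrightarrow> v \<notin> A \<Longrightarrow> f u v \<le> g u v"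
  shows "flux n f A \<le> flux n g A"
  unfolding flux_def using assms by (auto intro!: sum_mono)

lemma flux_cong:
  assumes "\<And>u v. u \<in> A \<Longrightarrow> v < n \<Longrightarrow> v \<notin> A \<Longrightarrow> f u v = g u v"
  shows "flux n f A = flux n g A"
  unfolding flux_def using assms by (auto intro!: sum.cong)

lemma flux_member_le:
  fixes f :: "nat \<Rightarrow> nat \<Rightarrow> nat"
  assumes "A \<subseteq> {..<n}" "u \<in> A" "v < n" "v \<notin> A"
  shows "f u v \<le> flux n f A"
  unfolding flux_def using assms
  by (intro member_le_sum[of "(u, v)" _ "\<lambda>(u, v). f u v", simplified]) auto

lemma flux_zero:
  fixes f :: "nat \<Rightarrow> nat \<Rightarrow> nat"
  assumes "A \<subseteq> {..<n}"
  shows "flux n f A = 0 \<longleftrightarrow> (\<forall>u\<in>A. \<forall>v\<in>{..<n} - A. f u v = 0)"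
  unfolding flux_def using assms by (subst sum_eq_0_iff) auto

text \<open>
  A flow is stored as gross amounts \<open>f u v\<close> in both directions; only the difference matters.
\<close>

definition net :: "nat \<Rightarrow> (nat \<Rightarrow> nat \<Rightarrow> nat) \<Rightarrow> nat set \<Rightarrow> int" where
  "net n f A = flux n (\<lambda>u v. int (f u v) - int (f v u)) A"

lemma net_eq: "net n f A = int (flux n f A) - int (flux n (\<lambda>u v. f v u) A)"
  by (simp add: net_def flux_diff flux_of_nat)

definition inc :: "nat \<Rightarrow> nat \<Rightarrow> (nat \<Rightarrow> nat \<Rightarrow> nat) \<Rightarrow> nat \<Rightarrow> nat \<Rightarrow> nat" where
  "inc a b f u v = (if u = a \<and> v = b then Suc (f u v) else f u v)"

text \<open>The two indicators telescope along a walk: a unit pushed from \<open>s\<close> to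
  \<open>t\<close> raises the net flow out of every cut between them by one, whichever vertices the
  walk visits.\<close>

lemma net_inc:
  assumes "A \<subseteq> {..<n}" "a < n" "b < n"
  shows "net n (inc a b f) A = net n f A + of_bool (a \<in> A) - of_bool (b \<in> A)"
proof -
  have 1: "flux n (\<lambda>u v. of_bool (u = a \<and> v = b) :: int) A = of_bool (a \<in> A \<and> b \<notin> A)"
    if "b < n" for a b
  proof -
    have "flux n (\<lambda>u v. of_bool (u = a \<and> v = b) :: int) A =
        (\<Sum>x\<in>A \<times> ({..<n} - A). if x = (a, b) then 1 else 0)"
      unfolding flux_def by (intro sum.cong) auto
    also have "\<dots> = of_bool (a \<in> A \<and> b \<notin> A)"
      using assms(1) that by (subst sum.delta) auto
    finally show ?thesis .
  qed
  have "int (inc a b f u v) - int (inc a b f v u) =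
      int (f u v) - int (f v u) + of_bool (u = a \<and> v = b) - of_bool (u = b \<and> v = a)" for u v
    by (cases "u = a"; cases "v = b"; cases "u = b"; cases "v = a"; simp add: inc_def)
  then have "net n (inc a b f) A = net n f A + flux n (\<lambda>u v. of_bool (u = a \<and> v = b)) A
      - flux n (\<lambda>u v. of_bool (u = b \<and> v = a)) A"
    by (simp only: net_def flux_add flux_diff)
  then have "net n (inc a b f) A = net n f A + of_bool (a \<in> A \<and> b \<notin> A) - of_bool (b \<in> A \<and> a \<notin> A)"
    by (simp only: 1[OF assms(3)] 1[OF assms(2)])
  then show ?thesis by (cases "a \<in> A"; cases "b \<in> A"; simp)
qed

lemma net_sum: "net n (\<lambda>u v. \<Sum>i\<in>S. f i u v) A = (\<Sum>i\<in>S. net n (f i) A)"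
  by (simp add: net_eq flux_sum sum_subtractf)

text \<open>
  One Bellman-Ford layer per number of arcs. A predecessor other than \<open>v\<close> itself is chosen only
  for a strict improvement, so a traced walk never returns to a vertex it has left, even if
  there are arcs of weight 0.
\<close>

definition relaxed ::
  "nat \<Rightarrow> (nat \<Rightarrow> nat \<Rightarrow> real) \<Rightarrow> (nat \<Rightarrow> real) \<Rightarrow> (nat \<Rightarrow> real) \<Rightarrow> (nat \<Rightarrow> nat) \<Rightarrow> nat \<Rightarrow> bool" where
  "relaxed n W d d' P v \<longleftrightarrow>
     P v < n \<and> d' v = d (P v) + (if P v = v then 0 else W (P v) v) \<and>
     d' v \<le> d v \<and> (\<forall>u<n. d' v \<le> d u + W u v) \<and> (P v \<noteq> v \<longrightarrow> d' v < d v)"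

lemma relaxed_cong:
  "(\<And>u. u < n \<Longrightarrow> d u = e u) \<Longrightarrow> d' v = e' v \<Longrightarrow> P v = Q v \<Longrightarrow> v < n \<Longrightarrow>
    relaxed n W d d' P v = relaxed n W e e' Q v"
  unfolding relaxed_def by (cases "P v < n") auto

text \<open>\<open>B\<close> stands for infinity; in all uses it exceeds the cost of the whole edge
  set.\<close>

definition layered ::
  "nat \<Rightarrow> nat \<Rightarrow> real \<Rightarrow> (nat \<Rightarrow> nat \<Rightarrow> real) \<Rightarrow> (nat \<Rightarrow> nat \<Rightarrow> real) \<Rightarrow> (nat \<Rightarrow> nat \<Rightarrow> nat) \<Rightarrow> bool" where
  "layered n s B W d P \<longleftrightarrow> (\<forall>v<n. d 0 v = (if v = s then 0 else B)) \<and>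
     (\<forall>k<n. \<forall>v<n. relaxed n W (d k) (d (Suc k)) (P k) v)"

definition traced :: "nat \<Rightarrow> (nat \<Rightarrow> nat \<Rightarrow> nat) \<Rightarrow> nat \<Rightarrow> (nat \<Rightarrow> nat) \<Rightarrow> bool" where
  "traced n P t w \<longleftrightarrow> w n = t \<and> (\<forall>k<n. w k = P k (w (Suc k)))"

definition step :: "(nat \<Rightarrow> nat \<Rightarrow> real) \<Rightarrow> (nat \<Rightarrow> nat) \<Rightarrow> nat \<Rightarrow> real" where
  "step W w k = (if w k = w (Suc k) then 0 else W (w k) (w (Suc k)))"

section \<open>Layered distances and the walks traced in them\<close>

lemma rtrancl_distinct_path:
  assumes "(s, t) \<in> R\<^sup>*"
  shows "\<exists>xs. xs \<noteq> [] \<and> xs ! 0 = s \<and> last xs = t \<and> distinct xs \<and>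
    (\<forall>i. Suc i < length xs \<longrightarrow> (xs ! i, xs ! Suc i) \<in> R)"
  using assms
proof (induction rule: rtrancl_induct)
  case base
  show ?case by (intro exI[of _ "[s]"]) auto
next
  case (step y z)
  then obtain xs where xs: "xs \<noteq> []" "xs ! 0 = s" "last xs = y" "distinct xs"
    "\<And>i. Suc i < length xs \<Longrightarrow> (xs ! i, xs ! Suc i) \<in> R" by blast
  show ?case
  proof (cases "z \<in> set xs")
    case True
    then obtain k where k: "k < length xs" "xs ! k = z" by (auto simp: in_set_conv_nth)
    have "last (take (Suc k) xs) = z"
      using k by (simp add: take_Suc_conv_app_nth)
    then show ?thesis
      by (intro exI[of _ "take (Suc k) xs"]) (use xs k in auto)
  next
    case False
    have "((xs @ [z]) ! i, (xs @ [z]) ! Suc i) \<in> R" if "i < length xs" for i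
    proof (cases "Suc i = length xs")
      case True
      then have "xs ! i = y" using xs(1,3) by (metis diff_Suc_1 last_conv_nth)
      then show ?thesis using step.hyps(2) True that by (simp add: nth_append)
    next
      case False
      then show ?thesis using xs(5)[of i] that by (simp add: nth_append)
    qed
    then show ?thesis using xs False by (intro exI[of _ "xs @ [z]"]) (auto simp: nth_append)
  qed
qed

context
  fixes n s t :: nat and B :: real and W d :: "nat \<Rightarrow> nat \<Rightarrow> real" and P :: "nat \<Rightarrow> nat \<Rightarrow> nat"
  assumes L: "layered n s B W d P" and W: "\<And>u v. u < n \<Longrightarrow> v < n \<Longrightarrow> 0 \<le> W u v"
begin

lemma layered_base: "v < n \<Longrightarrow> d 0 v = (if v = s then 0 else B)"
  using L by (simp add: layered_def)

lemma layered_step: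
  assumes "k < n" "v < n"
  shows "P k v < n" "d (Suc k) v = d k (P k v) + (if P k v = v then 0 else W (P k v) v)"
    "d (Suc k) v \<le> d k v" "\<And>u. u < n \<Longrightarrow> d (Suc k) v \<le> d k u + W u v"
    "P k v \<noteq> v \<Longrightarrow> d (Suc k) v < d k v"
  using L assms unfolding layered_def relaxed_def by blast+

lemma layered_antimono: "v < n \<Longrightarrow> i \<le> j \<Longrightarrow> j \<le> n \<Longrightarrow> d j v \<le> d i v"
proof (induction j)
  case (Suc j)
  show ?case
  proof (cases "i = Suc j")
    case False
    then have "d j v \<le> d i v" using Suc by auto
    moreover have "d (Suc j) v \<le> d j v" using layered_step(3)[of j v] Suc.prems by simp
    ultimately show ?thesis by linarith
  qed simp
qed simp

lemma layered_nonneg: "0 \<le> B \<Longrightarrow> k \<le> n \<Longrightarrow> v < n \<Longrightarrow> 0 \<le> d k v"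
proof (induction k arbitrary: v)
  case 0
  then show ?case by (simp add: layered_base)
next
  case (Suc k)
  then show ?case
    using layered_step(1,2)[of k v] W[of "P k v" v] Suc.IH[of "P k v"] by auto
qed

text \<open>A path without repeated vertices has fewer than \<open>n\<close> arcs, so layer
  \<open>n\<close> is late enough for it.\<close>

lemma layered_le_path:
  assumes "xs \<noteq> []" "xs ! 0 = s" "distinct xs" "set xs \<subseteq> {..<n}"
  shows "d n (last xs) \<le> (\<Sum>i<length xs - 1. W (xs ! i) (xs ! Suc i))"
proof -
  have len: "length xs \<le> n"
    using card_mono[OF _ assms(4)] distinct_card[OF assms(3)] by simp
  have nth: "xs ! i < n" if "i < length xs" for i using assms(4) that nth_mem by blast
  have "d k (xs ! k) \<le> (\<Sum>i<k. W (xs ! i) (xs ! Suc i))" if "k < length xs" for k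
    using that
  proof (induction k)
    case 0
    then show ?case using layered_base assms(2) nth[of 0] by simp
  next
    case (Suc k)
    have "d (Suc k) (xs ! Suc k) \<le> d k (xs ! k) + W (xs ! k) (xs ! Suc k)"
      using layered_step(4) Suc.prems len nth[of k] nth[of "Suc k"] by simp
    then show ?case using Suc by simp
  qed
  from this[of "length xs - 1"]
  have "d (length xs - 1) (last xs) \<le> (\<Sum>i<length xs - 1. W (xs ! i) (xs ! Suc i))"
    using assms(1) by (simp add: last_conv_nth)
  moreover have "d n (last xs) \<le> d (length xs - 1) (last xs)"
    using layered_antimono[of "last xs" "length xs - 1" n] len assms(1,4) by force
  ultimately show ?thesis by linarith
qed

text \<open>A path without repeated vertices uses no edge twice, in either direction. Its arcs of
  nonzero weight are therefore charged to different edges of \<open>J\<close>, and the distance to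
  the cost of \<open>J\<close>. With empty \<open>J\<close> this says that vertices reachable by
  arcs of weight 0 have distance 0.\<close>

lemma layered_le_edges:
  fixes c :: "'e \<Rightarrow> real" and en :: "'e \<Rightarrow> nat \<times> nat"
  assumes "s < n" "finite J" "\<And>e. e \<in> J \<Longrightarrow> 0 \<le> c e" and path: "(s, v) \<in> R\<^sup>*"
    and R: "\<And>u v. (u, v) \<in> R \<Longrightarrow> v < n \<and>
      (W u v = 0 \<or> (\<exists>e\<in>J. (en e = (u, v) \<or> en e = (v, u)) \<and> W u v \<le> c e))"
  shows "d n v \<le> (\<Sum>e\<in>J. c e)"
proof -
  obtain xs where xs: "xs \<noteq> []" "xs ! 0 = s" "last xs = v" "distinct xs"
    "\<And>i. Suc i < length xs \<Longrightarrow> (xs ! i, xs ! Suc i) \<in> R"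
    using rtrancl_distinct_path[OF path] by blast
  have nth: "xs ! i < n" if "i < length xs" for i
    using that xs(2) assms(1) R[OF xs(5)] by (cases i) auto
  then have "set xs \<subseteq> {..<n}" by (auto simp: in_set_conv_nth)
  then have "d n v \<le> (\<Sum>i<length xs - 1. W (xs ! i) (xs ! Suc i))"
    using layered_le_path[OF xs(1,2,4)] xs(3) by simp
  also have "\<dots> = (\<Sum>i | i < length xs - 1 \<and> W (xs ! i) (xs ! Suc i) \<noteq> 0. W (xs ! i) (xs ! Suc i))"
    by (rule sum.mono_neutral_right) auto
  also have "\<dots> \<le> (\<Sum>e\<in>J. c e)"
  proof -
    let ?I = "{i. i < length xs - 1 \<and> W (xs ! i) (xs ! Suc i) \<noteq> 0}"
    have "\<exists>e. e \<in> J \<and> (en e = (xs ! i, xs ! Suc i) \<or> en e = (xs ! Suc i, xs ! i)) \<and>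
        W (xs ! i) (xs ! Suc i) \<le> c e" if "i \<in> ?I" for i
    proof -
      have "Suc i < length xs" using that by auto
      with R[OF xs(5)[OF this]] that show ?thesis by blast
    qed
    then have "\<exists>h. \<forall>i\<in>?I. h i \<in> J \<and> (en (h i) = (xs ! i, xs ! Suc i) \<or> en (h i) = (xs ! Suc i, xs ! i)) \<and>
        W (xs ! i) (xs ! Suc i) \<le> c (h i)"
      by (intro bchoice) blast
    then obtain h where h: "\<And>i. i \<in> ?I \<Longrightarrow> h i \<in> J"
      "\<And>i. i \<in> ?I \<Longrightarrow> en (h i) = (xs ! i, xs ! Suc i) \<or> en (h i) = (xs ! Suc i, xs ! i)"
      "\<And>i. i \<in> ?I \<Longrightarrow> W (xs ! i) (xs ! Suc i) \<le> c (h i)"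
      by blast
    \<comment> \<open>Arcs along the same edge coincide or are opposite; on distinct vertices the
      second case needs both \<open>i = Suc j\<close> and \<open>Suc i = j\<close>.\<close>
    have inj: "inj_on h ?I"
    proof (rule inj_onI)
      fix i j assume ij: "i \<in> ?I" "j \<in> ?I" "h i = h j"
      then have "(xs ! i, xs ! Suc i) = (xs ! j, xs ! Suc j) \<or>
          (xs ! i, xs ! Suc i) = (xs ! Suc j, xs ! j)"
        using h(2)[OF ij(1)] h(2)[OF ij(2)] by auto
      then have "i = j \<or> i = Suc j \<and> Suc i = j"
        using ij xs(4) by (auto simp: nth_eq_iff_index_eq)
      then show "i = j" by linarith
    qed
    have "(\<Sum>i\<in>?I. W (xs ! i) (xs ! Suc i)) \<le> (\<Sum>i\<in>?I. c (h i))"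
      by (rule sum_mono) (rule h(3))
    also have "\<dots> = (\<Sum>e\<in>h ` ?I. c e)" using inj by (simp add: sum.reindex)
    also have "\<dots> \<le> (\<Sum>e\<in>J. c e)"
      using h(1) assms(2,3) by (intro sum_mono2) auto
    finally show ?thesis .
  qed
  finally show ?thesis .
qed

context
  fixes w :: "nat \<Rightarrow> nat"
  assumes T: "traced n P t w" and t: "t < n"
begin

lemma traced_less: "k \<le> n \<Longrightarrow> w k < n"
proof (induction "n - k" arbitrary: k)
  case 0
  then show ?case using T t by (simp add: traced_def)
next
  case (Suc x)
  then have "w (Suc k) < n" by simp
  then show ?case using layered_step(1)[of k "w (Suc k)"] T Suc by (simp add: traced_def)
qed

lemma traced_step:
  assumes "k < n"
  shows "d (Suc k) (w (Suc k)) = d k (w k) + step W w k"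
    and "w k \<noteq> w (Suc k) \<Longrightarrow> d (Suc k) (w (Suc k)) < d k (w (Suc k))"
  using layered_step(2,5)[of k "w (Suc k)"] T assms traced_less[of "Suc k"]
  by (auto simp: traced_def step_def)

lemma step_nonneg: "k < n \<Longrightarrow> 0 \<le> step W w k"
  using W traced_less[of k] traced_less[of "Suc k"] by (auto simp: step_def)

lemma traced_sum: "k \<le> n \<Longrightarrow> d k (w k) = d 0 (w 0) + (\<Sum>i<k. step W w i)"
  by (induction k) (use traced_step(1) in auto)

text \<open>Steps have nonnegative weight, so a walk that began outside \<open>s\<close>, with value
  \<open>B\<close> in layer 0, would end with a value of at least \<open>B\<close>.\<close>

lemma traced_source:
  assumes "0 \<le> B" "d n t < B" 
  shows "w 0 = s" "(\<Sum>i<n. step W w i) = d n t" 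
proof -
  have "d n t = d 0 (w 0) + (\<Sum>i<n. step W w i)"
    using traced_sum[of n] T by (simp add: traced_def)
  moreover have "0 \<le> (\<Sum>i<n. step W w i)" by (rule sum_nonneg) (use step_nonneg in auto)
  moreover have "d 0 (w 0) = (if w 0 = s then 0 else B)"
    using layered_base traced_less[of 0] by simp
  ultimately show "w 0 = s" "(\<Sum>i<n. step W w i) = d n t"
    using assms by (cases "w 0 = s"; simp)+
qed

text \<open>Values never decrease along the traced walk and never increase from layer to layer at a
  fixed vertex. A return to a vertex by a real arc would be a strict improvement on the value at the
  earlier visit, while monotonicity along the walk makes the value at the return at least as
  large.\<close>

lemma traced_simple:
  assumes "i \<le> k" "k \<le> j" "j \<le> n" "w i = w j"
  shows "w k = w i"
proof -
  have mono: "d i (w i) \<le> d k (w k)" if "i \<le> k" "k \<le> n" for i k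
    using that
  proof (induction k)
    case (Suc k)
    show ?case
    proof (cases "i = Suc k")
      case False
      then have "d i (w i) \<le> d k (w k)" using Suc by auto
      then show ?thesis using traced_step(1)[of k] step_nonneg[of k] Suc.prems by simp
    qed simp
  qed simp
  have const: "w k = w j" if "i \<le> k" "k \<le> j" for k
    using that
  proof (induction "j - k" arbitrary: k)
    case (Suc x)
    then have IH: "w (Suc k) = w j" and k: "k < j" "k < n" using assms(3) by simp_all
    show ?case
    proof (rule ccontr)
      assume "w k \<noteq> w j"
      then have "d (Suc k) (w j) < d k (w j)" using traced_step(2)[OF k(2)] IH by simp
      also have "\<dots> \<le> d i (w j)"
        using layered_antimono[of "w j" i k] traced_less[OF assms(3)] Suc.prems k by simp
      also have "\<dots> \<le> d (Suc k) (w j)"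
        using mono[of i "Suc k"] IH assms Suc.prems k by simp
      finally show False by simp
    qed
  qed simp
  show ?thesis using const[OF assms(1,2)] assms(4) by metis
qed

text \<open>Weights are computed before a walk is used. They remain correct while flow is pushed
  because no unordered pair occurs twice on the walk, not even in opposite directions.\<close>

lemma traced_arcs_distinct:
  assumes "i < k" "k < n" "w k \<noteq> w (Suc k)" "w i \<noteq> w (Suc i)"
  shows "{w i, w (Suc i)} \<noteq> {w k, w (Suc k)}"
proof
  assume "{w i, w (Suc i)} = {w k, w (Suc k)}"
  then consider "w i = w k" | "w i = w (Suc k)" by auto
  then show False
  proof cases
    case 1
    from traced_simple[of i "Suc i" k] show False using assms 1 by simp
  next
    case 2
    from traced_simple[of i "Suc i" "Suc k"] show False using assms 2 by simp
  qed
qed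

end

end

text \<open>
  A unit flow without arcs into \<open>A\<close> leaves \<open>A\<close> exactly once. The capacity of the cut exceeds
  the number \<open>N\<close> of unit flows by less than \<open>p + q\<close>, so each pair carrying \<open>x\<close> safe edges is used
  by at least \<open>x\<close> unit flows of this kind, and a greedy choice never gets stuck.
\<close>

lemma greedy_saturates:
  fixes U :: "nat \<Rightarrow> nat \<Rightarrow> nat \<Rightarrow> nat" and x d g :: "nat \<Rightarrow> nat \<Rightarrow> nat" and p q n N :: nat
  assumes A: "A \<subseteq> {..<n}" and Q: "Q \<subseteq> {..<N}" and pq: "0 < p + q"
    and unit: "\<And>i. i < N \<Longrightarrow> net n (U i) A = 1"
    and U: "\<And>i u v. i < N \<Longrightarrow> U i u v \<le> 1"
    and load: "\<And>u v. u \<in> A \<Longrightarrow> v < n \<Longrightarrow> v \<notin> A \<Longrightarrow>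
      (\<Sum>i<N. U i u v + U i v u) \<le> p * d u v + q * x u v"
    and cap: "flux n (\<lambda>u v. p * d u v + q * x u v) A < N + (p + q)"
    and xd: "\<And>u v. x u v \<le> d u v"
    and g: "\<And>u v. g u v = (\<Sum>i\<in>Q. U i u v)"
    and gx: "\<And>u v. u \<in> A \<Longrightarrow> v < n \<Longrightarrow> v \<notin> A \<Longrightarrow> g u v \<le> x u v"
    and reject: "\<And>i. i < N \<Longrightarrow> i \<notin> Q \<Longrightarrow>
      \<exists>u\<in>A. \<exists>v<n. v \<notin> A \<and> (U i v u \<noteq> 0 \<or> x u v < g u v + U i u v)"
    and uv: "u \<in> A" "v < n" "v \<notin> A"
  shows "g u v = x u v"
proof (rule ccontr)
  assume "g u v \<noteq> x u v"
  then have less: "g u v < x u v" using gx[OF uv] by simp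
  \<comment> \<open>The number of entries of unit \<open>i\<close> into \<open>A\<close>; the unit
    leaves \<open>A\<close> exactly \<open>1 + In i\<close> times. The units in \<open>G\<close>
    below are those that never enter.\<close>
  define In where "In i = flux n (\<lambda>u v. U i v u) A" for i
  define G where "G = {i. i < N \<and> In i = 0}"
  have out: "flux n (U i) A = 1 + In i" if "i < N" for i
    using unit[OF that] by (simp add: net_eq In_def)
  have fin: "finite G" by (simp add: G_def)
  \<comment> \<open>A unit of \<open>G\<close> through \<open>(u, v)\<close> crosses the cut nowhere
    else. So only \<open>(u, v)\<close> could have rejected it, and there
    \<open>g u v < x u v\<close> leaves room for one more.\<close>
  have sub: "i \<in> Q" if "i \<in> G" "U i u v \<noteq> 0" for i
  proof (rule ccontr)
    assume "i \<notin> Q"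
    with that obtain a b where ab: "a \<in> A" "b < n" "b \<notin> A" "U i b a \<noteq> 0 \<or> x a b < g a b + U i a b"
      using reject[of i] by (auto simp: G_def)
    have "U i b a = 0" using that ab flux_zero[OF A, of "\<lambda>u v. U i v u"] by (auto simp: G_def In_def)
    with ab have x: "x a b < g a b + U i a b" by simp
    have "U i a b \<noteq> 0" using x gx[OF ab(1-3)] by linarith
    have "(a, b) = (u, v)"
    proof (rule ccontr)
      assume ne: "(a, b) \<noteq> (u, v)"
      have "U i a b + U i u v = (\<Sum>(u, v)\<in>{(a, b), (u, v)}. U i u v)" using ne by simp
      also have "\<dots> \<le> flux n (U i) A"
        unfolding flux_def using A ab uv by (intro sum_mono2) auto
      also have "\<dots> = 1" using out[of i] that by (simp add: G_def)
      finally show False using that \<open>U i a b \<noteq> 0\<close> by simp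
    qed
    with x less U[of i u v] that show False by (auto simp: G_def)
  qed
  have "(\<Sum>i\<in>G. U i u v) = (\<Sum>i\<in>G \<inter> Q. U i u v)"
    using sub fin by (intro sum.mono_neutral_right) auto
  also have "\<dots> \<le> g u v"
    unfolding g using Q finite_subset[OF Q] by (intro sum_mono2) auto
  finally have good: "(\<Sum>i\<in>G. U i u v + U i v u) \<le> g u v"
    using flux_zero[OF A, of "\<lambda>u v. U i v u" for i] uv by (auto simp: G_def In_def sum.distrib)
  \<comment> \<open>A unit outside \<open>G\<close> enters \<open>A\<close> at least once and loads
    a single pair at most twice.\<close>
  have "(\<Sum>i\<in>{..<N} - G. U i u v + U i v u) \<le> (\<Sum>i\<in>{..<N} - G. 2 * In i)"
  proof (rule sum_mono)
    fix i assume "i \<in> {..<N} - G"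
    then have "U i u v \<le> 1" "U i v u \<le> 1" "1 \<le> In i" using U by (auto simp: G_def)
    then show "U i u v + U i v u \<le> 2 * In i" by linarith
  qed
  also have "\<dots> \<le> (\<Sum>i<N. 2 * In i)" by (intro sum_mono2) auto
  finally have bad: "(\<Sum>i\<in>{..<N} - G. U i u v + U i v u) \<le> (\<Sum>i<N. 2 * In i)" .
  have "(\<Sum>i<N. U i u v + U i v u) =
      (\<Sum>i\<in>{..<N} - G. U i u v + U i v u) + (\<Sum>i\<in>G. U i u v + U i v u)"
    by (rule sum.subset_diff) (auto simp: G_def)
  with good bad less have this_pair: "(\<Sum>i<N. U i u v + U i v u) + 1 \<le> x u v + (\<Sum>i<N. 2 * In i)"
    by linarith
  define load where "load a b = (\<Sum>i<N. U i a b + U i b a)" for a b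
  define c where "c a b = p * d a b + q * x a b" for a b
  have total: "flux n load A = N + (\<Sum>i<N. 2 * In i)"
  proof -
    have "flux n load A = (\<Sum>i<N. flux n (\<lambda>a b. U i a b + U i b a) A)"
      unfolding load_def by (rule flux_sum)
    also have "\<dots> = (\<Sum>i<N. 1 + 2 * In i)"
      by (rule sum.cong) (auto simp: flux_add out In_def[symmetric])
    finally show ?thesis unfolding sum.distrib by simp
  qed
  let ?P = "A \<times> ({..<n} - A)"
  have uvP: "(u, v) \<in> ?P" "finite ?P" using uv A by auto
  \<comment> \<open>All other pairs are bounded by their capacity. The terms \<open>2 * In i\<close>
    cancel between the total load and the bound on the load of \<open>(u, v)\<close>, which leaves
    \<open>c u v + 1 < x u v + (p + q)\<close>. This contradicts
    \<open>(p + q) * x u v <= c u v\<close>, since \<open>1 <= x u v\<close>.\<close>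
  have "flux n load A = load u v + (\<Sum>(u, v)\<in>?P - {(u, v)}. load u v)"
    unfolding flux_def using uvP by (subst sum.remove[of _ "(u, v)"]) auto
  also have "(\<Sum>(u, v)\<in>?P - {(u, v)}. load u v) \<le> (\<Sum>(u, v)\<in>?P - {(u, v)}. c u v)"
    by (rule sum_mono) (auto simp: load_def c_def intro!: assms(6))
  also have "load u v + \<dots> + c u v = load u v + flux n c A"
    unfolding flux_def using uvP by (subst (2) sum.remove[of _ "(u, v)"]) auto
  finally have "N + (\<Sum>i<N. 2 * In i) + c u v \<le> load u v + flux n c A" using total by simp
  moreover have "flux n c A < N + (p + q)" using cap unfolding c_def[abs_def] .
  moreover have "load u v + 1 \<le> x u v + (\<Sum>i<N. 2 * In i)" using this_pair by (simp add: load_def)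
  ultimately have "c u v + 1 < x u v + (p + q)" by linarith
  moreover have "(p + q) * x u v \<le> c u v"
    using xd[of u v] by (simp add: c_def algebra_simps)
  moreover obtain y where "x u v = Suc y" using less by (cases "x u v") auto
  moreover have "y \<le> (p + q) * y" using pq mult_le_mono1[of 1 "p + q" y] by linarith
  ultimately show False by simp
qed

section \<open>Edge multiplicities and cuts\<close>

definition parallel :: "(nat, nat) flex_st \<Rightarrow> nat \<Rightarrow> nat \<Rightarrow> nat set" where
  "parallel I u v = {e \<in> edges I. ends I e = (u, v) \<or> ends I e = (v, u)}"

definition mult :: "(nat, nat) flex_st \<Rightarrow> nat set \<Rightarrow> nat \<Rightarrow> nat \<Rightarrow> nat" where
  "mult I F u v = card (F \<inter> parallel I u v)"

lemma parallel_sym: "parallel I u v = parallel I v u"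
  by (auto simp: parallel_def)

lemma mult_sym: "mult I F u v = mult I F v u"
  by (simp add: mult_def parallel_sym)

lemma parallel_disjoint: "e \<in> parallel I u v \<Longrightarrow> e \<in> parallel I a b \<Longrightarrow> {u, v} = {a, b}"
  by (auto simp: parallel_def)

lemma card_cut_flux:
  assumes I: "flex_st_instance I" "numbered I" and F: "F \<subseteq> edges I" and A: "A \<subseteq> verts I"
  shows "card (cut I F A) = flux (card (verts I)) (mult I F) A"
proof -
  define n where "n = card (verts I)"
  have V: "verts I = {..<n}" using I by (simp add: numbered_def n_def)
  have fin: "finite F" using I F by (auto simp: flex_st_instance_def intro: finite_subset)
  have "cut I F A = (\<Union>(u, v)\<in>A \<times> ({..<n} - A). F \<inter> parallel I u v)"
  proof (intro equalityI subsetI)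
    fix e assume e: "e \<in> cut I F A"
    obtain a b where ab: "ends I e = (a, b)" by fastforce
    have "a < n" "b < n" using e F I ab by (force simp: cut_def flex_st_instance_def V)+
    then show "e \<in> (\<Union>(u, v)\<in>A \<times> ({..<n} - A). F \<inter> parallel I u v)"
      using e F ab by (cases "a \<in> A") (force simp: cut_def parallel_def)+
  next
    fix e assume "e \<in> (\<Union>(u, v)\<in>A \<times> ({..<n} - A). F \<inter> parallel I u v)"
    then show "e \<in> cut I F A" by (auto simp: cut_def parallel_def)
  qed
  also have "card \<dots> = (\<Sum>(u, v)\<in>A \<times> ({..<n} - A). card (F \<inter> parallel I u v))"
    unfolding split_def
  proof (rule card_UN_disjoint)
    show "finite (A \<times> ({..<n} - A))" using A V by simp
    show "\<forall>i\<in>A \<times> ({..<n} - A). finite (F \<inter> parallel I (fst i) (snd i))" using fin by simp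
    show "\<forall>i\<in>A \<times> ({..<n} - A). \<forall>j\<in>A \<times> ({..<n} - A). i \<noteq> j \<longrightarrow>
      F \<inter> parallel I (fst i) (snd i) \<inter> (F \<inter> parallel I (fst j) (snd j)) = {}"
      by (auto simp: parallel_def)
  qed
  finally show ?thesis by (simp add: flux_def mult_def n_def split_def)
qed

lemma feasible_iff_flux:
  assumes I: "flex_st_instance I" "numbered I" and F: "F \<subseteq> edges I"
  defines "n \<equiv> card (verts I)"
  shows "feasible p q I F \<longleftrightarrow> (\<forall>A\<subseteq>{..<n}. source I \<in> A \<longrightarrow> sink I \<notin> A \<longrightarrow>
      p \<le> flux n (mult I (F \<inter> safe I)) A \<or> p + q \<le> flux n (mult I F) A)"
proof -
  have V: "verts I = {..<n}" using I by (simp add: numbered_def n_def)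
  have "F \<inter> safe I \<subseteq> edges I" using F by blast
  then have "card (cut I F A) = flux n (mult I F) A"
    "card (cut I (F \<inter> safe I) A) = flux n (mult I (F \<inter> safe I)) A" if "A \<subseteq> {..<n}" for A
    using card_cut_flux[OF I F, of A] card_cut_flux[OF I, of "F \<inter> safe I" A] that
    by (simp_all add: V)
  moreover have "A \<subseteq> verts I \<longleftrightarrow> A \<subseteq> {..<n}" for A by (simp only: V)
  ultimately show ?thesis
    unfolding feasible_iff_cut[OF I(1) F] by (metis (no_types, lifting))
qed

section \<open>Shortest walks\<close>

text \<open>The frame part of every loop invariant. It relates the store before a loop to the store
  after any number of iterations, so that the invariants themselves mention only what
  changes.\<close>

definition same :: "prog \<Rightarrow> store \<Rightarrow> store \<Rightarrow> bool" where
  "same c h g \<longleftrightarrow> nin g = nin h \<and> rin g = rin h \<and>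
     (\<forall>k i. \<not> writes c k i \<longrightarrow> narr g k i = narr h k i) \<and> (\<forall>k. \<not> rwrites c k \<longrightarrow> rarr g k = rarr h k)"

lemma same_sem: "same c h (sem c h)"
  by (simp add: same_def sem_frame sem_rframe)

lemma sameD:
  assumes "same c h g"
  shows "nin g = nin h" "rin g = rin h" "\<not> writes c k i \<Longrightarrow> narr g k i = narr h k i"
    "(\<And>i. \<not> writes c k i) \<Longrightarrow> narr g k = narr h k" "\<not> rwrites c k \<Longrightarrow> rarr g k = rarr h k"
  using assms by (auto simp: same_def)

lemma Loop_rule:
  assumes "I 0 h"
    and step: "\<And>i g. i < bval_of b h \<Longrightarrow> I i g \<Longrightarrow> same (Loop k l b c) h g \<Longrightarrow>
      I (Suc i) (sem c (setn k l i g))"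
    and "\<And>g. I (bval_of b h) g \<Longrightarrow> same (Loop k l b c) h g \<Longrightarrow> Q (setn k l (bval_of b h) g)"
  shows "Q (sem (Loop k l b c) h)"
proof (rule sem_Loop_rule[where I = "\<lambda>i g. I i g \<and> same (Loop k l b c) h g"])
  show "I 0 h \<and> same (Loop k l b c) h h" using assms(1) by (simp add: same_def)
next
  fix i g assume i: "i < bval_of b h" and g: "I i g \<and> same (Loop k l b c) h g"
  have "same (Loop k l b c) h (sem c (setn k l i g))"
    using g same_sem[of c "setn k l i g"] by (auto simp: same_def)
  then show "I (Suc i) (sem c (setn k l i g)) \<and> same (Loop k l b c) h (sem c (setn k l i g))"
    using step i g by blast
qed (use assms(3) in blast)

text \<open>The arrays \<open>COST\<close>, \<open>WEIGHT\<close>, \<open>DIST\<close> and \<open>BIG\<close> hold reals and are numbered separately.\<close>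

abbreviation (input) "ROW \<equiv> 0::nat"  abbreviation (input) "PLANE \<equiv> Suc 0"
abbreviation (input) "TAIL \<equiv> 2::nat"  abbreviation (input) "HEAD \<equiv> 3::nat"  abbreviation (input) "SAFE \<equiv> 4::nat"
abbreviation (input) "SLOT \<equiv> 5::nat"  abbreviation (input) "USED \<equiv> 6::nat"
abbreviation (input) "SOL \<equiv> 7::nat"  abbreviation (input) "DEG \<equiv> 8::nat"  abbreviation (input) "SDEG \<equiv> 9::nat"
abbreviation (input) "FLOW \<equiv> 10::nat"  abbreviation (input) "FREE \<equiv> 11::nat"
abbreviation (input) "PRED \<equiv> 12::nat"  abbreviation (input) "WALK \<equiv> 13::nat"
abbreviation (input) "UNIT \<equiv> 14::nat"  abbreviation (input) "SIDE \<equiv> 15::nat"  abbreviation (input) "SUB \<equiv> 16::nat"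
abbreviation (input) "TUPLE \<equiv> 17::nat"  abbreviation (input) "OUT \<equiv> 18::nat"  abbreviation (input) "LEN \<equiv> 19::nat"
abbreviation (input) "VU \<equiv> 20::nat"  abbreviation (input) "VV \<equiv> 21::nat"  abbreviation (input) "LAY \<equiv> 22::nat"
abbreviation (input) "RND \<equiv> 23::nat"  abbreviation (input) "OKAY \<equiv> 24::nat"  abbreviation (input) "SUMD \<equiv> 25::nat"
abbreviation (input) "SUMX \<equiv> 26::nat"  abbreviation (input) "EDGE \<equiv> 27::nat"  abbreviation (input) "PATH \<equiv> 28::nat"
abbreviation (input) "TA \<equiv> 29::nat"  abbreviation (input) "TB \<equiv> 30::nat"  abbreviation (input) "CNTR \<equiv> 31::nat"
abbreviation (input) "COST \<equiv> 0::nat"  abbreviation (input) "WEIGHT \<equiv> 3::nat"  abbreviation (input) "DIST \<equiv> 2::nat"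
abbreviation (input) "BIG \<equiv> Suc 0"

abbreviation cell :: "nat \<Rightarrow> nx" where "cell k \<equiv> Arr k (Lit 0)"
abbreviation rcell :: "nat \<Rightarrow> rx" where "rcell k \<equiv> RArr k (Lit 0)"

section \<open>Matrices in linear memory\<close>

definition idx :: "nat \<Rightarrow> nat \<Rightarrow> nat \<Rightarrow> nat" where "idx n u v = u * n + v"

definition idx3 :: "nat \<Rightarrow> nat \<Rightarrow> nat \<Rightarrow> nat \<Rightarrow> nat" where "idx3 n i u v = i * (n * n) + idx n u v"

lemma idx_eq [simp]: "v < n \<Longrightarrow> v' < n \<Longrightarrow> idx n u v = idx n u' v' \<longleftrightarrow> u = u' \<and> v = v'"
  using interleave_eq[of v n v' u u'] by (simp add: idx_def mult.commute)

lemma idx_less: "u < n \<Longrightarrow> v < n \<Longrightarrow> idx n u v < n * n"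
proof -
  assume "u < n" "v < n"
  then have "idx n u v < Suc u * n" by (simp add: idx_def)
  also have "\<dots> \<le> n * n" using \<open>u < n\<close> by (intro mult_le_mono1) simp
  finally show ?thesis .
qed

lemma idx3_eq [simp]:
  "u < n \<Longrightarrow> v < n \<Longrightarrow> u' < n \<Longrightarrow> v' < n \<Longrightarrow>
    idx3 n i u v = idx3 n i' u' v' \<longleftrightarrow> i = i' \<and> u = u' \<and> v = v'"
  using interleave_eq[of "idx n u v" "n * n" "idx n u' v'" i i']
  by (simp add: idx3_def mult.commute idx_less)

definition at2 :: "nx \<Rightarrow> nx \<Rightarrow> nx" where "at2 u v = Pls (Arr ROW u) v"
definition at3 :: "nx \<Rightarrow> nx \<Rightarrow> nx \<Rightarrow> nx" where "at3 i u v = Pls (Arr PLANE i) (at2 u v)"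

text \<open>Row \<open>n\<close> is included because the layers of \<open>DIST\<close> are numbered
  from 0 to \<open>n\<close>, and because its start \<open>n * n\<close> is the size of a
  plane.\<close>

definition tabs :: "nat \<Rightarrow> store \<Rightarrow> bool" where
  "tabs N h \<longleftrightarrow> (\<forall>i\<le>nin h 0. narr h ROW i = i * nin h 0) \<and>
     (\<forall>i\<le>N. narr h PLANE i = i * (nin h 0 * nin h 0))"

lemma tabs_setn [simp]: "Suc 0 < k \<Longrightarrow> tabs N (setn k i x h) = tabs N h"
  by (simp add: tabs_def)

lemma tabs_setr [simp]: "tabs N (setr k i x h) = tabs N h"
  by (simp add: tabs_def)

lemma tabs_same:
  "same c h g \<Longrightarrow> (\<And>i. \<not> writes c ROW i) \<Longrightarrow> (\<And>i. \<not> writes c PLANE i) \<Longrightarrow> tabs N g = tabs N h"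
  using sameD(1)[of c h g] sameD(4)[of c h g ROW] sameD(4)[of c h g PLANE] by (simp add: tabs_def)

lemma neval_at2 [simp]:
  "tabs N h \<Longrightarrow> neval u h \<le> nin h 0 \<Longrightarrow> neval (at2 u v) h = idx (nin h 0) (neval u h) (neval v h)"
  by (simp add: at2_def tabs_def idx_def)

lemma neval_at3 [simp]:
  "tabs N h \<Longrightarrow> neval i h \<le> N \<Longrightarrow> neval u h \<le> nin h 0 \<Longrightarrow>
    neval (at3 i u v) h = idx3 (nin h 0) (neval i h) (neval u h) (neval v h)"
  by (simp add: at3_def tabs_def idx3_def at2_def idx_def)

lemma nlegal_at2 [simp]: "nlegal (at2 u v) \<longleftrightarrow> nlegal u \<and> nlegal v"
  "nlegal (at3 i u v) \<longleftrightarrow> nlegal i \<and> nlegal u \<and> nlegal v"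
  by (auto simp: at2_def at3_def)

definition mat :: "store \<Rightarrow> nat \<Rightarrow> nat \<Rightarrow> nat \<Rightarrow> nat" where
  "mat h k u v = narr h k (idx (nin h 0) u v)"

definition rmat :: "store \<Rightarrow> nat \<Rightarrow> nat \<Rightarrow> nat \<Rightarrow> real" where
  "rmat h k u v = rarr h k (idx (nin h 0) u v)"

definition cube :: "store \<Rightarrow> nat \<Rightarrow> nat \<Rightarrow> nat \<Rightarrow> nat \<Rightarrow> nat" where
  "cube h k i u v = narr h k (idx3 (nin h 0) i u v)"

definition pairs :: "prog \<Rightarrow> prog" where
  "pairs c = Loop VU 0 Verts (Loop VV 0 Verts c)"

lemma pairs_simps [simp]:
  "writes (pairs c) k i \<longleftrightarrow> k = VU \<and> i = 0 \<or> k = VV \<and> i = 0 \<or> writes c k i"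
  "rwrites (pairs c) k \<longleftrightarrow> rwrites c k"
  "legal (pairs c) \<longleftrightarrow> legal c \<and> \<not> writes c VU 0 \<and> \<not> writes c VV 0"
  by (auto simp: pairs_def)

text \<open>The invariant speaks of the set of pairs visited instead of two counters. That the next
  pair is new allows sums to be extended by one term and entries to be assumed unchanged so
  far.\<close>

lemma pairs_rule:
  assumes "I {} h" and nw: "\<not> writes c VU 0" "\<not> writes c VV 0"
    and U: "\<And>S g x. I S g \<Longrightarrow> I S (setn VU 0 x g)"
    and V: "\<And>S g x. I S g \<Longrightarrow> I S (setn VV 0 x g)"
    and step: "\<And>S g u v. u < nin h 0 \<Longrightarrow> v < nin h 0 \<Longrightarrow> (u, v) \<notin> S \<Longrightarrow> I S g \<Longrightarrow>
      same (pairs c) h g \<Longrightarrow> narr g VU 0 = u \<Longrightarrow> narr g VV 0 = v \<Longrightarrow> I (insert (u, v) S) (sem c g)"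
  shows "I ({..<nin h 0} \<times> {..<nin h 0}) (sem (pairs c) h)"
  unfolding pairs_def
proof (rule Loop_rule[where I = "\<lambda>u g. I ({..<u} \<times> {..<nin h 0}) g"])
  show "I ({..<0} \<times> {..<nin h 0}) h" using assms(1) by simp
next
  fix u g
  assume u: "u < bval_of Verts h" and g: "I ({..<u} \<times> {..<nin h 0}) g"
    and s: "same (Loop VU 0 Verts (Loop VV 0 Verts c)) h g"
  have n: "nin g = nin h" by (rule sameD(1)[OF s])
  have "I ({..<u} \<times> {..<nin h 0} \<union> {u} \<times> {..<nin h 0}) (sem (Loop VV 0 Verts c) (setn VU 0 u g))"
  proof (rule Loop_rule[where I = "\<lambda>v f. I ({..<u} \<times> {..<nin h 0} \<union> {u} \<times> {..<v}) f"])
    show "I ({..<u} \<times> {..<nin h 0} \<union> {u} \<times> {..<0}) (setn VU 0 u g)" using g U by simp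
  next
    fix v f
    assume v: "v < bval_of Verts (setn VU 0 u g)"
      and f: "I ({..<u} \<times> {..<nin h 0} \<union> {u} \<times> {..<v}) f"
      and s': "same (Loop VV 0 Verts c) (setn VU 0 u g) f"
    have "narr f VU 0 = u" using sameD(3)[OF s', of VU 0] nw by simp
    moreover have "same (pairs c) h (setn VV 0 v f)"
      using s s' nw unfolding same_def pairs_def by auto
    ultimately have "I (insert (u, v) ({..<u} \<times> {..<nin h 0} \<union> {u} \<times> {..<v})) (sem c (setn VV 0 v f))"
      using u v f n by (intro step V) auto
    moreover have "insert (u, v) ({..<u} \<times> {..<nin h 0} \<union> {u} \<times> {..<v}) =
        {..<u} \<times> {..<nin h 0} \<union> {u} \<times> {..<Suc v}"
      by auto
    ultimately show "I ({..<u} \<times> {..<nin h 0} \<union> {u} \<times> {..<Suc v}) (sem c (setn VV 0 v f))" by simp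
  qed (use V n in simp)
  moreover have "{..<u} \<times> {..<nin h 0} \<union> {u} \<times> {..<nin h 0} = {..<Suc u} \<times> {..<nin h 0}" by auto
  ultimately show "I ({..<Suc u} \<times> {..<nin h 0}) (sem (Loop VV 0 Verts c) (setn VU 0 u g))" by simp
qed (use U in simp)

section \<open>The Bellman-Ford program\<close>

definition relax :: prog where
  "relax =
     RPut DIST (at2 (Pls (cell LAY) (Lit 1)) (cell VV)) (RArr DIST (at2 (cell LAY) (cell VV))) ;;
     Put PRED (at2 (cell LAY) (cell VV)) (cell VV) ;;
     Loop VU 0 Verts
       (Ifte (RLss (RPls (RArr DIST (at2 (cell LAY) (cell VU))) (RArr WEIGHT (at2 (cell VU) (cell VV))))
                   (RArr DIST (at2 (Pls (cell LAY) (Lit 1)) (cell VV))))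
         (RPut DIST (at2 (Pls (cell LAY) (Lit 1)) (cell VV))
             (RPls (RArr DIST (at2 (cell LAY) (cell VU))) (RArr WEIGHT (at2 (cell VU) (cell VV)))) ;;
          Put PRED (at2 (cell LAY) (cell VV)) (cell VU))
         Nop)"

definition walk :: prog where
  "walk =
     Loop VV 0 Verts (RPut DIST (at2 (Lit 0) (cell VV)) (rcell BIG)) ;;
     RPut DIST (at2 (Lit 0) (Inp 2)) (RLit 0) ;;
     Loop LAY 0 Verts (Loop VV 0 Verts relax) ;;
     Put WALK (Inp 0) (Inp 3) ;;
     Loop LAY 0 Verts
       (Put WALK (Mns (Inp 0) (Pls (cell LAY) (Lit 1)))
         (Arr PRED (at2 (Mns (Inp 0) (Pls (cell LAY) (Lit 1))) (Arr WALK (Mns (Inp 0) (cell LAY))))))"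

lemma relax_simps [simp]:
  "writes relax k i \<longleftrightarrow> k = PRED \<or> k = VU \<and> i = 0"
  "rwrites relax k \<longleftrightarrow> k = DIST"
  "legal relax"
  by (auto simp: relax_def)

lemma walk_simps [simp]:
  "writes walk k i \<longleftrightarrow> k \<in> {PRED, WALK} \<or> k \<in> {VU, VV, LAY} \<and> i = 0"
  "rwrites walk k \<longleftrightarrow> k = DIST"
  "legal walk"
  by (auto simp: walk_def)

lemma relax_correct:
  assumes "tabs N h" and k: "narr h LAY 0 = k" "k < n" and v: "narr h VV 0 = v" "v < n"
    and n: "nin h 0 = n" and W: "0 \<le> rmat h WEIGHT v v"
  defines "g \<equiv> sem relax h" and "d \<equiv> rmat h DIST k" and "W \<equiv> rmat h WEIGHT"
  shows "relaxed n W d (rmat g DIST (Suc k)) (mat g PRED k) v"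
    "\<And>k' v'. v' < n \<Longrightarrow> (k', v') \<noteq> (Suc k, v) \<Longrightarrow> rmat g DIST k' v' = rmat h DIST k' v'"
    "\<And>k' v'. v' < n \<Longrightarrow> (k', v') \<noteq> (k, v) \<Longrightarrow> mat g PRED k' v' = mat h PRED k' v'"
proof -
  define body where "body =
       (Ifte (RLss (RPls (RArr DIST (at2 (cell LAY) (cell VU))) (RArr WEIGHT (at2 (cell VU) (cell VV))))
                   (RArr DIST (at2 (Pls (cell LAY) (Lit 1)) (cell VV))))
         (RPut DIST (at2 (Pls (cell LAY) (Lit 1)) (cell VV))
             (RPls (RArr DIST (at2 (cell LAY) (cell VU))) (RArr WEIGHT (at2 (cell VU) (cell VV)))) ;;
          Put PRED (at2 (cell LAY) (cell VV)) (cell VU))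
         Nop)"
  define h1 where "h1 = setn PRED (idx n k v) v (setr DIST (idx n (Suc k) v) (d v) h)"
  have g: "g = sem (Loop VU 0 Verts body) h1"
    using assms by (simp add: g_def relax_def body_def h1_def d_def rmat_def)
  define J where "J u f \<longleftrightarrow> mat f PRED k v < n \<and>
     rmat f DIST (Suc k) v = d (mat f PRED k v) + (if mat f PRED k v = v then 0 else W (mat f PRED k v) v) \<and>
     rmat f DIST (Suc k) v \<le> d v \<and> (\<forall>u'<u. rmat f DIST (Suc k) v \<le> d u' + W u' v) \<and>
     (mat f PRED k v \<noteq> v \<longrightarrow> rmat f DIST (Suc k) v < d v) \<and>
     (\<forall>k' v'. v' < n \<longrightarrow> (k', v') \<noteq> (Suc k, v) \<longrightarrow> rmat f DIST k' v' = rmat h DIST k' v') \<and>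
     (\<forall>k' v'. v' < n \<longrightarrow> (k', v') \<noteq> (k, v) \<longrightarrow> mat f PRED k' v' = mat h PRED k' v')" for u f
  have "J n g"
    unfolding g
  proof (rule Loop_rule[where I = J])
    show "J 0 h1" using v n by (auto simp: J_def h1_def mat_def rmat_def d_def)
  next
    fix u f assume u: "u < bval_of Verts h1" and f: "J u f" and s: "same (Loop VU 0 Verts body) h1 f"
    have u': "u < n" using u n by (simp add: h1_def)
    have nf: "nin f 0 = n" using sameD(1)[OF s] n by (simp add: h1_def)
    have tf: "tabs N f" using tabs_same[OF s, of N] assms(1) by (simp add: body_def h1_def)
    have kf: "narr f LAY 0 = k" "narr f VV 0 = v"
      using sameD(3)[OF s, of LAY 0] sameD(3)[OF s, of VV 0] k v by (simp_all add: body_def h1_def)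
    have Wf: "rarr f WEIGHT (idx n a b) = W a b" for a b
      using sameD(5)[OF s, of WEIGHT] n by (simp add: body_def h1_def W_def rmat_def)
    have df: "rarr f DIST (idx n k a) = d a" if "a < n" for a
      using f that nf n unfolding J_def rmat_def d_def by auto
    have dv: "rarr f DIST (idx n (Suc k) v) \<le> d v" using f nf by (auto simp: J_def rmat_def)
    \<comment> \<open>The weight from \<open>v\<close> to itself is nonnegative, so \<open>v\<close>
      never improves its own value strictly, and predecessor \<open>v\<close> keeps the meaning of
      standing still.\<close>
    have uv: "u \<noteq> v" if "d u + W u v < rarr f DIST (idx n (Suc k) v)"
      using that dv W by (auto simp: W_def)
    show "J (Suc u) (sem body (setn VU 0 u f))"
    proof (cases "d u + W u v < rarr f DIST (idx n (Suc k) v)")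
      case True
      have e: "sem body (setn VU 0 u f) =
          setn PRED (idx n k v) u (setr DIST (idx n (Suc k) v) (d u + W u v) (setn VU 0 u f))"
        using True tf kf k v u' nf by (simp add: body_def Wf df)
      show ?thesis
        unfolding J_def e using f True uv[OF True] dv u' v nf
        unfolding J_def by (auto simp: mat_def rmat_def less_Suc_eq)
    next
      case False
      have e: "sem body (setn VU 0 u f) = setn VU 0 u f"
        using False tf kf k v u' nf by (simp add: body_def Wf df)
      show ?thesis
        unfolding J_def e using f False nf unfolding J_def by (auto simp: mat_def rmat_def less_Suc_eq)
    qed
  next
    fix f assume "J (bval_of Verts h1) f"
    then show "J n (setn VU 0 (bval_of Verts h1) f)"
    proof -
      have "J n (setn VU 0 n f) = J n f" by (simp add: J_def mat_def rmat_def)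
      then show ?thesis using \<open>J (bval_of Verts h1) f\<close> n by (simp add: h1_def)
    qed
  qed
  then show "relaxed n W d (rmat g DIST (Suc k)) (mat g PRED k) v"
    "\<And>k' v'. v' < n \<Longrightarrow> (k', v') \<noteq> (Suc k, v) \<Longrightarrow> rmat g DIST k' v' = rmat h DIST k' v'"
    "\<And>k' v'. v' < n \<Longrightarrow> (k', v') \<noteq> (k, v) \<Longrightarrow> mat g PRED k' v' = mat h PRED k' v'"
    unfolding J_def relaxed_def by blast+
qed

lemma walk_correct:
  assumes tabs: "tabs N h" and n: "nin h 0 = n" and s: "nin h 2 = s" "s < n" and t: "nin h 3 = t" "t < n"
    and W: "\<And>u v. u < n \<Longrightarrow> v < n \<Longrightarrow> 0 \<le> rmat h WEIGHT u v"
  defines "g \<equiv> sem walk h"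
  shows "layered n s (rarr h BIG 0) (rmat h WEIGHT) (rmat g DIST) (mat g PRED)"
    and "traced n (mat g PRED) t (narr g WALK)"
proof -
  define B where "B = rarr h BIG 0"
  define W where "W = rmat h WEIGHT"
  define c1 where "c1 = Loop VV 0 Verts (RPut DIST (at2 (Lit 0) (cell VV)) (rcell BIG))"
  define c3 where "c3 = Loop LAY 0 Verts (Loop VV 0 Verts relax)"
  define c5 where "c5 = Loop LAY 0 Verts
       (Put WALK (Mns (Inp 0) (Pls (cell LAY) (Lit 1)))
         (Arr PRED (at2 (Mns (Inp 0) (Pls (cell LAY) (Lit 1))) (Arr WALK (Mns (Inp 0) (cell LAY))))))"
  define h1 where "h1 = sem c1 h"
  define h2 where "h2 = setr DIST (idx n 0 s) 0 h1"
  define h3 where "h3 = sem c3 h2"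
  define h4 where "h4 = setn WALK n t h3"
  have same1: "same c1 h h1" by (simp add: h1_def same_sem)
  note nin1 = sameD(1)[OF same1]
  have tabs1: "tabs N h1" using tabs_same[OF same1, of N] tabs by (simp add: c1_def)
  have W1: "rarr h1 WEIGHT = rarr h WEIGHT" using sameD(5)[OF same1, of WEIGHT] by (simp add: c1_def)
  have "nin h2 = nin h" by (simp add: h2_def nin1)
  have "\<forall>v<n. rarr h1 DIST (idx n 0 v) = B"
    unfolding h1_def c1_def
  proof (rule Loop_rule[where I = "\<lambda>i g. i \<le> n \<and> (\<forall>v<i. rarr g DIST (idx n 0 v) = B)"])
    fix i f assume i: "i < bval_of Verts h" and f: "i \<le> n \<and> (\<forall>v<i. rarr f DIST (idx n 0 v) = B)"
      and sm: "same (Loop VV 0 Verts (RPut DIST (at2 (Lit 0) (cell VV)) (rcell BIG))) h f"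
    have "tabs N f" using tabs_same[OF sm, of N] tabs by simp
    moreover have "rarr f BIG 0 = B" using sameD(5)[OF sm, of BIG] by (simp add: B_def)
    ultimately show "Suc i \<le> n \<and> (\<forall>v<Suc i. rarr (sem (RPut DIST (at2 (Lit 0) (cell VV)) (rcell BIG))
        (setn VV 0 i f)) DIST (idx n 0 v) = B)"
      using i f sameD(1)[OF sm] n by (simp add: less_Suc_eq)
  qed (use n in simp_all)
  then have base: "\<forall>v<n. rmat h2 DIST 0 v = (if v = s then 0 else B)"
    using s n nin1 by (simp add: h2_def rmat_def)
  define K where "K k f \<longleftrightarrow> (\<forall>v<n. rmat f DIST 0 v = (if v = s then 0 else B)) \<and>
     (\<forall>j<k. \<forall>v<n. relaxed n W (rmat f DIST j) (rmat f DIST (Suc j)) (mat f PRED j) v)" for k f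
  have K_setn: "K k (setn VV 0 x f) = K k f" "K k (setn LAY 0 x f) = K k f" for k x f
    by (simp_all add: K_def mat_def[abs_def] rmat_def[abs_def])
  have "K n h3"
    unfolding h3_def c3_def
  proof (rule Loop_rule[where I = K])
    show "K 0 h2" using base by (simp add: K_def)
  next
    fix k f assume k: "k < bval_of Verts h2" and Kf: "K k f"
      and sm: "same (Loop LAY 0 Verts (Loop VV 0 Verts relax)) h2 f"
    have k': "k < n" using k n nin1 by (simp add: h2_def)
    have nf: "nin f = nin h" using sameD(1)[OF sm] nin1 by (simp add: h2_def)
    have tf: "tabs N f" using tabs_same[OF sm, of N] tabs1 by (simp add: h2_def)
    have Wf: "rmat f WEIGHT = W"
      using sameD(5)[OF sm, of WEIGHT] W1 nf nin1 by (simp add: h2_def W_def rmat_def fun_eq_iff)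
    define M where "M i e \<longleftrightarrow> K k e \<and> rmat e WEIGHT = W \<and>
       (\<forall>v<i. relaxed n W (rmat e DIST k) (rmat e DIST (Suc k)) (mat e PRED k) v)" for i e
    have M_setn: "M k (setn VV 0 x e) = M k e" for k x e
      by (simp add: M_def K_setn) (simp add: mat_def[abs_def] rmat_def[abs_def])
    have "M n (sem (Loop VV 0 Verts relax) (setn LAY 0 k f))"
    proof (rule Loop_rule[where I = M])
      show "M 0 (setn LAY 0 k f)" using Kf Wf by (simp add: M_def K_setn) (simp add: rmat_def fun_eq_iff)
    next
      fix v e assume v: "v < bval_of Verts (setn LAY 0 k f)" and Me: "M v e"
        and sm': "same (Loop VV 0 Verts relax) (setn LAY 0 k f) e"
      have v': "v < n" using v nf n by simp
      let ?e = "setn VV 0 v e"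
      let ?g = "sem relax ?e"
      have ne: "nin ?e = nin h" using sameD(1)[OF sm'] nf by simp
      have te: "tabs N ?e" using tabs_same[OF sm', of N] tf by simp
      have lay: "narr ?e LAY 0 = k" using sameD(3)[OF sm', of LAY 0] by simp
      have We: "rmat ?e WEIGHT = W" using Me M_setn by (simp add: M_def rmat_def fun_eq_iff)
      have "0 \<le> rmat ?e WEIGHT v v" using We W[OF v' v'] by (simp add: W_def)
      have vv: "narr ?e VV 0 = v" "nin ?e 0 = n" using ne n by simp_all
      note R = relax_correct[OF te lay k' vv(1) v' vv(2) \<open>0 \<le> rmat ?e WEIGHT v v\<close>, unfolded We]
      have Me': "M v ?e" using Me M_setn by simp
      have D: "rmat ?g DIST j u = rmat ?e DIST j u" if "j \<le> k" "u < n" for j u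
        using R(2)[of u j] that by auto
      have D': "rmat ?g DIST (Suc k) u = rmat ?e DIST (Suc k) u" if "u < v" for u
        using R(2)[of u "Suc k"] that v' by auto
      have P: "mat ?g PRED j u = mat ?e PRED j u" if "j < k \<or> u < v" "u < n" for j u
        using R(3)[of u j] that by auto
      have "K k ?g"
        unfolding K_def
      proof (intro conjI allI impI)
        fix u assume "u < n"
        then show "rmat ?g DIST 0 u = (if u = s then 0 else B)" using Me' D by (simp add: M_def K_def)
      next
        fix j u assume ju: "j < k" "u < n"
        have "relaxed n W (rmat ?g DIST j) (rmat ?g DIST (Suc j)) (mat ?g PRED j) u =
            relaxed n W (rmat ?e DIST j) (rmat ?e DIST (Suc j)) (mat ?e PRED j) u"
          by (rule relaxed_cong) (use ju D P in auto)
        then show "relaxed n W (rmat ?g DIST j) (rmat ?g DIST (Suc j)) (mat ?g PRED j) u"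
          using Me' ju unfolding M_def K_def by blast
      qed
      moreover have "rmat ?g WEIGHT = W"
        using We sem_rframe[of relax WEIGHT ?e] by (simp add: rmat_def fun_eq_iff)
      moreover have "relaxed n W (rmat ?g DIST k) (rmat ?g DIST (Suc k)) (mat ?g PRED k) u"
        if "u < Suc v" for u
      proof (cases "u = v")
        case True
        have "relaxed n W (rmat ?g DIST k) (rmat ?g DIST (Suc k)) (mat ?g PRED k) u =
            relaxed n W (rmat ?e DIST k) (rmat ?g DIST (Suc k)) (mat ?g PRED k) u"
          by (rule relaxed_cong) (use D True v' in auto)
        then show ?thesis using R(1) True by simp
      next
        case False
        then have u: "u < v" "u < n" using that v' by simp_all
        have "relaxed n W (rmat ?g DIST k) (rmat ?g DIST (Suc k)) (mat ?g PRED k) u =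
            relaxed n W (rmat ?e DIST k) (rmat ?e DIST (Suc k)) (mat ?e PRED k) u"
          by (rule relaxed_cong) (use D D' P u in auto)
        then show ?thesis using Me' u unfolding M_def by blast
      qed
      ultimately show "M (Suc v) ?g" unfolding M_def by blast
    next
      fix e assume "M (bval_of Verts (setn LAY 0 k f)) e"
      then show "M n (setn VV 0 (bval_of Verts (setn LAY 0 k f)) e)"
        using nf n M_setn by simp
    qed
    then show "K (Suc k) (sem (Loop VV 0 Verts relax) (setn LAY 0 k f))"
      unfolding M_def K_def by (auto simp: less_Suc_eq)
  next
    fix f assume "K (bval_of Verts h2) f"
    then show "K n (setn LAY 0 (bval_of Verts h2) f)"
      using n nin1 K_setn by (simp add: h2_def)
  qed
  have same3: "same c3 h2 h3" by (simp add: h3_def same_sem)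
  have n3: "nin h3 = nin h" using sameD(1)[OF same3] nin1 by (simp add: h2_def)
  have tabs3: "tabs N h3" using tabs_same[OF same3, of N] tabs1 by (simp add: c3_def h2_def)
  have walk: "walk = (c1 ;; RPut DIST (at2 (Lit 0) (Inp 2)) (RLit 0) ;; c3 ;; Put WALK (Inp 0) (Inp 3) ;; c5)"
    by (simp only: walk_def c1_def c3_def c5_def)
  have "sem (RPut DIST (at2 (Lit 0) (Inp 2)) (RLit 0)) h1 = h2"
    using n s nin1 tabs1 by (simp add: h2_def)
  moreover have "sem (Put WALK (Inp 0) (Inp 3)) h3 = h4" using n n3 t by (simp add: h4_def)
  ultimately have g: "g = sem c5 h4"
    by (simp only: g_def walk sem.simps(4) h1_def[symmetric] h3_def[symmetric])
  have same5: "same c5 h4 g" by (simp add: g same_sem)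
  have gd: "rarr g DIST = rarr h3 DIST" "narr g PRED = narr h3 PRED" "nin g = nin h"
    using sameD(5)[OF same5, of DIST] sameD(4)[OF same5, of PRED] sameD(1)[OF same5] n3
    by (simp_all add: c5_def h4_def)
  have "K n g" using \<open>K n h3\<close> by (simp add: K_def mat_def[abs_def] rmat_def[abs_def] gd n3)
  then show "layered n s (rarr h BIG 0) (rmat h WEIGHT) (rmat g DIST) (mat g PRED)"
    by (simp add: layered_def K_def B_def W_def)
  define P where "P = mat g PRED"
  have pred: "P k v < n" if "k < n" "v < n" for k v
    using \<open>K n g\<close> that by (simp add: K_def relaxed_def P_def)
  \<comment> \<open>The walk is filled from position \<open>n\<close> downwards. The invariant also
    keeps its entries below \<open>n\<close>, since \<open>PRED\<close> is under control only at
    vertices.\<close>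
  have "narr g WALK n = t \<and> (\<forall>k<n. narr g WALK k = P k (narr g WALK (Suc k)))"
    unfolding g c5_def
  proof (rule Loop_rule[where I = "\<lambda>i f. (\<forall>k\<le>n. n - i \<le> k \<longrightarrow> narr f WALK k < n) \<and> narr f WALK n = t \<and>
      (\<forall>k<n. n - i \<le> k \<longrightarrow> narr f WALK k = P k (narr f WALK (Suc k)))"], goal_cases)
    case 1
    then show ?case using t by (simp add: h4_def)
  next
    case (2 i f)
    have i: "i < n" using 2(1) n n3 by (simp add: h4_def)
    have tf: "tabs N f" using tabs_same[OF 2(3), of N] tabs3 by (simp add: h4_def)
    have nf: "nin f = nin h" using sameD(1)[OF 2(3)] n3 by (simp add: h4_def)
    have pf: "narr f PRED = narr g PRED" using sameD(4)[OF 2(3), of PRED] gd by (simp add: h4_def)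
    have e: "sem (Put WALK (Mns (Inp 0) (Pls (cell LAY) (Lit 1)))
         (Arr PRED (at2 (Mns (Inp 0) (Pls (cell LAY) (Lit 1))) (Arr WALK (Mns (Inp 0) (cell LAY))))))
         (setn LAY 0 i f) =
       setn WALK (n - Suc i) (P (n - Suc i) (narr f WALK (n - i))) (setn LAY 0 i f)"
      using tf nf n gd by (simp add: pf P_def mat_def)
    have Suc: "Suc (n - Suc i) = n - i" using i by simp
    have lt: "narr f WALK (n - i) < n" using 2(2) i by simp
    have split: "n - Suc i \<le> k \<longleftrightarrow> k = n - Suc i \<or> n - i \<le> k" for k using i by auto
    have "n - Suc i < n" "\<And>k. n - i \<le> k \<Longrightarrow> k \<noteq> n - Suc i" using i by auto
    then show ?case
      unfolding e split using 2(2) pred[OF _ lt, of "n - Suc i"] by (auto simp: Suc)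
  next
    case (3 f)
    then show ?case using n n3 by (simp add: h4_def)
  qed
  then show "traced n (mat g PRED) t (narr g WALK)" by (simp add: traced_def P_def)
qed

section \<open>Augmentation\<close>

text \<open>Multiplication by \<open>p\<close> or \<open>q\<close>, unrolled into additions; both
  are constants of the program.\<close>

primrec rep :: "nat \<Rightarrow> nx \<Rightarrow> nx" where
  "rep 0 a = Lit 0"
| "rep (Suc k) a = Pls a (rep k a)"

lemma neval_rep [simp]: "neval (rep k a) h = k * neval a h"
  by (induction k) auto

lemma nlegal_rep [simp]: "nlegal a \<Longrightarrow> nlegal (rep k a)"
  by (induction k) auto

text \<open>The opposite flow is added to the capacity instead of being subtracted from the flow,
  since subtraction is truncated. The nested negations express a disjunction.\<close>

definition residual :: "nat \<Rightarrow> nat \<Rightarrow> nx \<Rightarrow> nx \<Rightarrow> bx" where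
  "residual a b u v = Neg (Cnj (Neg (Lss (Lit 0) (Arr FREE (at2 u v))))
     (Neg (Lss (Arr FLOW (at2 u v)) (Pls (Pls (rep a (Arr DEG (at2 u v))) (rep b (Arr SDEG (at2 u v))))
       (Arr FLOW (at2 v u))))))"

text \<open>The edges of a pair are bought in the order of their slots, so the number bought so far
  is the position of the next one. The entry is the edge number plus 1, and 0 stands for
  none.\<close>

definition next_edge :: "nx \<Rightarrow> nx \<Rightarrow> nx" where
  "next_edge u v = Arr SLOT (at3 (Arr DEG (at2 u v)) u v)"

definition incr :: "nat \<Rightarrow> nx \<Rightarrow> prog" where
  "incr k a = Put k a (Pls (Arr k a) (Lit 1))"

definition weights :: "nat \<Rightarrow> nat \<Rightarrow> prog" where
  "weights a b = pairs
     (Ifte (residual a b (cell VU) (cell VV)) (RPut WEIGHT (at2 (cell VU) (cell VV)) (RLit 0))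
       (Ifte (Lss (Lit 0) (next_edge (cell VU) (cell VV)))
         (RPut WEIGHT (at2 (cell VU) (cell VV))
           (RArr COST (Mns (next_edge (cell VU) (cell VV)) (Lit 1))))
         (RPut WEIGHT (at2 (cell VU) (cell VV)) (rcell BIG))))"

definition buy :: prog where
  "buy = Put EDGE (Lit 0) (Mns (next_edge (cell TA) (cell TB)) (Lit 1)) ;;
     Put SOL (cell EDGE) (Lit 1) ;;
     Ifte (Lss (Lit 0) (Arr SAFE (cell EDGE)))
       (incr SDEG (at2 (cell TA) (cell TB)) ;; incr SDEG (at2 (cell TB) (cell TA))) Nop ;;
     incr DEG (at2 (cell TA) (cell TB)) ;; incr DEG (at2 (cell TB) (cell TA))"

definition push :: "nat \<Rightarrow> nat \<Rightarrow> prog" where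
  "push a b = Loop LAY 0 Verts
     (Put TA (Lit 0) (Arr WALK (cell LAY)) ;;
      Put TB (Lit 0) (Arr WALK (Pls (cell LAY) (Lit 1))) ;;
      Ifte (Cnj (Neg (Lss (cell TA) (cell TB))) (Neg (Lss (cell TB) (cell TA)))) Nop
        (Ifte (residual a b (cell TA) (cell TB)) Nop
           (Ifte (Lss (Lit 0) (next_edge (cell TA) (cell TB))) buy Nop) ;;
         incr FLOW (at2 (cell TA) (cell TB))))"

definition augment :: "nat \<Rightarrow> nat \<Rightarrow> prog" where
  "augment a b = weights a b ;; walk ;; push a b"

lemma incr_simps [simp]:
  "writes (incr k a) k' i \<longleftrightarrow> k' = k" "\<not> rwrites (incr k a) k'"
  "legal (incr k a) \<longleftrightarrow> k < 64 \<and> nlegal a"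
  "sem (incr k a) h = setn k (neval a h) (Suc (narr h k (neval a h))) h"
  by (auto simp: incr_def)

lemma residual_legal [simp]: "nlegal u \<Longrightarrow> nlegal v \<Longrightarrow> blegal (residual a b u v)"
  by (simp add: residual_def)

lemma next_edge_legal [simp]: "nlegal u \<Longrightarrow> nlegal v \<Longrightarrow> nlegal (next_edge u v)"
  by (simp add: next_edge_def)

lemma weights_simps [simp]:
  "writes (weights a b) k i \<longleftrightarrow> k \<in> {VU, VV} \<and> i = 0"
  "rwrites (weights a b) k \<longleftrightarrow> k = WEIGHT" "legal (weights a b)"
  by (auto simp: weights_def)

lemma buy_simps [simp]:
  "writes buy k i \<longleftrightarrow> k \<in> {EDGE, SOL, SDEG, DEG}" "\<not> rwrites buy k" "legal buy"
  by (auto simp: buy_def)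

lemma push_simps [simp]:
  "writes (push a b) k i \<longleftrightarrow> k = LAY \<and> i = 0 \<or> k \<in> {TA, TB, EDGE, SOL, SDEG, DEG, FLOW}"
  "\<not> rwrites (push a b) k" "legal (push a b)"
  by (auto simp: push_def)

lemma augment_simps [simp]:
  "writes (augment a b) k i \<longleftrightarrow> k \<in> {VU, VV, LAY} \<and> i = 0 \<or>
     k \<in> {PRED, WALK, TA, TB, EDGE, SOL, SDEG, DEG, FLOW}"
  "rwrites (augment a b) k \<longleftrightarrow> k \<in> {WEIGHT, DIST}" "legal (augment a b)"
  by (auto simp: augment_def)

definition saturate :: "nat \<Rightarrow> nat \<Rightarrow> nat \<Rightarrow> prog" where
  "saturate k a b = Loop RND 0 (Times k) (augment a b)"

lemma saturate_simps [simp]: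
  "writes (saturate k a b) j i \<longleftrightarrow> j \<in> {VU, VV, LAY, RND} \<and> i = 0 \<or>
     j \<in> {PRED, WALK, TA, TB, EDGE, SOL, SDEG, DEG, FLOW}"
  "rwrites (saturate k a b) j \<longleftrightarrow> j \<in> {WEIGHT, DIST}" "legal (saturate k a b)"
  by (auto simp: saturate_def)

lemma mult_insert:
  assumes "finite F" "e \<notin> F" "e \<in> parallel I a b"
  shows "mult I (insert e F) u v = (if {u, v} = {a, b} then Suc (mult I F u v) else mult I F u v)"
proof (cases "{u, v} = {a, b}")
  case True
  then have "e \<in> parallel I u v" using assms(3) by (auto simp: doubleton_eq_iff parallel_sym)
  then show ?thesis using True assms by (simp add: mult_def Int_insert_left)
next
  case False
  then have "e \<notin> parallel I u v" using assms(3) parallel_disjoint by blast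
  then show ?thesis using False by (simp add: mult_def Int_insert_left)
qed

lemma mult_mono: "finite G \<Longrightarrow> F \<subseteq> G \<Longrightarrow> mult I F u v \<le> mult I G u v"
  unfolding mult_def by (intro card_mono) auto

section \<open>Stores that represent an instance and a partial solution\<close>

locale flex_problem =
  fixes I :: "(nat, nat) flex_st" and p q :: nat
  assumes inst: "flex_st_instance I" and num: "numbered I"
begin

definition n where "n = card (verts I)"
definition m where "m = card (edges I)"
abbreviation s where "s \<equiv> source I"
abbreviation t where "t \<equiv> sink I"
text \<open>Strictly above the cost of every set of edges, hence usable as infinity.\<close>

definition big where "big = 1 + total_cost I (edges I)"

lemma verts: "verts I = {..<n}" and edges: "edges I = {..<m}"
  using num by (simp_all add: numbered_def n_def m_def)

lemma s: "s < n" and t: "t < n"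
  using inst verts by (auto simp: flex_st_instance_def)

lemma fin: "F \<subseteq> edges I \<Longrightarrow> finite F"
  by (auto simp: edges intro: finite_subset)

lemma cost_nonneg: "e \<in> edges I \<Longrightarrow> 0 \<le> cost I e"
  using inst by (auto simp: flex_st_instance_def)

lemma total_cost_mono: "F \<subseteq> G \<Longrightarrow> G \<subseteq> edges I \<Longrightarrow> total_cost I F \<le> total_cost I G"
  unfolding total_cost_def using fin cost_nonneg by (intro sum_mono2) auto

lemma big_pos: "0 < big"
  using total_cost_mono[of "{}" "edges I"] by (simp add: big_def total_cost_def)

lemma total_cost_less_big: "X \<subseteq> edges I \<Longrightarrow> total_cost I X < big"
  using total_cost_mono[of X "edges I"] by (simp add: big_def)

lemma in_parallel: "e \<in> parallel I u v \<Longrightarrow> e \<in> edges I \<and> u < n \<and> v < n"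
  using inst verts by (auto simp: parallel_def flex_st_instance_def)

text \<open>Only the \<open>p + q\<close> cheapest parallel edges of a pair are recorded. Position
  \<open>p + q\<close> holds 0 as a sentinel, so a pair with \<open>p + q\<close> bought edges
  offers nothing more.\<close>

definition sorted_slots :: "(nat \<Rightarrow> nat \<Rightarrow> nat \<Rightarrow> nat) \<Rightarrow> bool" where
  "sorted_slots sl \<longleftrightarrow> (\<forall>u<n. \<forall>v<n. (\<forall>l\<le>p + q. sl l u v = sl l v u) \<and> sl (p + q) u v = 0 \<and>
     (\<forall>l<p + q. (\<forall>e. sl l u v = Suc e \<longrightarrow> e \<in> parallel I u v \<and> (\<forall>l'<l. sl l' u v \<noteq> Suc e) \<and>
           (\<forall>e'\<in>parallel I u v. (\<forall>l'<l. sl l' u v \<noteq> Suc e') \<longrightarrow> cost I e \<le> cost I e')) \<and>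
        (sl l u v = 0 \<longrightarrow> (\<forall>e\<in>parallel I u v. \<exists>l'<l. sl l' u v = Suc e))))"

definition tables :: "store \<Rightarrow> bool" where
  "tables h \<longleftrightarrow> nin h = nin (initial I) \<and> tabs (p * (p + q) + (p + q)) h \<and>
     (\<forall>e<m. narr h SAFE e = (if e \<in> safe I then 1 else 0) \<and> rarr h COST e = cost I e) \<and>
     rarr h BIG 0 = big \<and> sorted_slots (cube h SLOT)"

text \<open>Because \<open>F\<close> takes an initial segment of the recorded edges of each pair,
  the degree matrix alone determines the next edge to buy.\<close>

definition solution :: "store \<Rightarrow> nat set \<Rightarrow> bool" where
  "solution h F \<longleftrightarrow> tables h \<and> F \<subseteq> edges I \<and> (\<forall>e<m. narr h SOL e \<noteq> 0 \<longleftrightarrow> e \<in> F) \<and>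
     (\<forall>u<n. \<forall>v<n. mat h DEG u v = mult I F u v \<and> mat h SDEG u v = mult I (F \<inter> safe I) u v \<and>
        mult I F u v \<le> p + q \<and> F \<inter> parallel I u v = {e. \<exists>l<mult I F u v. cube h SLOT l u v = Suc e})"

lemma tables_nin:
  assumes "tables h"
  shows "nin h 0 = n" "nin h (Suc 0) = m" "nin h 2 = s" "nin h 3 = t"
  using assms initial_in[of I] by (simp_all add: tables_def n_def m_def)

lemma tables_cong:
  assumes "nin g = nin h" "narr g ROW = narr h ROW" "narr g PLANE = narr h PLANE"
    "narr g SAFE = narr h SAFE" "narr g SLOT = narr h SLOT" "rarr g COST = rarr h COST"
    "rarr g BIG = rarr h BIG"
  shows "tables g = tables h"
  using assms by (simp add: tables_def tabs_def cube_def[abs_def])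

lemma solution_cong:
  assumes "nin g = nin h" "narr g ROW = narr h ROW" "narr g PLANE = narr h PLANE"
    "narr g SAFE = narr h SAFE" "narr g SLOT = narr h SLOT" "rarr g COST = rarr h COST"
    "rarr g BIG = rarr h BIG" "narr g SOL = narr h SOL" "narr g DEG = narr h DEG" "narr g SDEG = narr h SDEG"
  shows "solution g F = solution h F"
  using assms tables_cong[OF assms(1-7)] by (simp add: solution_def mat_def cube_def[abs_def])

lemma solution_same:
  assumes "same c h g" "\<And>k i. writes c k i \<Longrightarrow> k \<notin> {ROW, PLANE, SAFE, SLOT, SOL, DEG, SDEG}"
    "\<And>k. rwrites c k \<Longrightarrow> k \<notin> {COST, BIG}"
  shows "solution g F = solution h F"
  using assms by (intro solution_cong sameD(1)[OF assms(1)] sameD(4)[OF assms(1)] sameD(5)[OF assms(1)]) blast+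

lemma tables_same:
  assumes "same c h g" "\<And>k i. writes c k i \<Longrightarrow> k \<notin> {ROW, PLANE, SAFE, SLOT}"
    "\<And>k. rwrites c k \<Longrightarrow> k \<notin> {COST, BIG}"
  shows "tables g = tables h"
  using assms by (intro tables_cong sameD(1)[OF assms(1)] sameD(4)[OF assms(1)] sameD(5)[OF assms(1)]) blast+

lemma solution_deg:
  assumes "solution h F" "u < n" "v < n"
  shows "mat h DEG u v = mult I F u v" "mat h SDEG u v = mult I (F \<inter> safe I) u v"
    "narr h DEG (idx n u v) = mult I F u v" "narr h SDEG (idx n u v) = mult I (F \<inter> safe I) u v"
    "mult I F u v \<le> p + q"
  using assms tables_nin[of h] by (auto simp: solution_def mat_def)

lemma solution_next:
  assumes "solution h F" "u < n" "v < n" "cube h SLOT (mult I F u v) u v = Suc e"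
  shows "e \<in> parallel I u v" "e \<notin> F" "\<And>e'. e' \<in> parallel I u v - F \<Longrightarrow> cost I e \<le> cost I e'"
    "mult I F u v < p + q" "cube h SLOT (mult I F u v) v u = Suc e"
proof -
  have sl: "sorted_slots (cube h SLOT)" and F: "F \<inter> parallel I u v = {e. \<exists>l<mult I F u v. cube h SLOT l u v = Suc e}"
    and le: "mult I F u v \<le> p + q"
    using assms by (auto simp: solution_def tables_def)
  show less: "mult I F u v < p + q"
  proof (rule ccontr)
    assume "\<not> mult I F u v < p + q"
    then show False using le sl assms(2-4) by (auto simp: sorted_slots_def)
  qed
  show e: "e \<in> parallel I u v" using sl assms(2-4) less unfolding sorted_slots_def by blast
  have "\<forall>l'<mult I F u v. cube h SLOT l' u v \<noteq> Suc e"
    using sl assms(2-4) less unfolding sorted_slots_def by blast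
  then show "e \<notin> F" using e F by blast
  show "cost I e \<le> cost I e'" if "e' \<in> parallel I u v - F" for e'
  proof -
    have "\<forall>l'<mult I F u v. cube h SLOT l' u v \<noteq> Suc e'" using that F by blast
    then show ?thesis using sl assms(2-4) less that unfolding sorted_slots_def by blast
  qed
  show "cube h SLOT (mult I F u v) v u = Suc e"
    using sl assms(2-4) le unfolding sorted_slots_def by metis
qed

lemma solution_next_0:
  assumes "solution h F" "u < n" "v < n" "cube h SLOT (mult I F u v) u v = 0" "mult I F u v < p + q"
  shows "parallel I u v \<subseteq> F"
proof
  fix e assume e: "e \<in> parallel I u v"
  have sl: "sorted_slots (cube h SLOT)" and F: "F \<inter> parallel I u v = {e. \<exists>l<mult I F u v. cube h SLOT l u v = Suc e}"
    using assms by (auto simp: solution_def tables_def)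
  have "\<exists>l'<mult I F u v. cube h SLOT l' u v = Suc e"
    using sl assms(2-5) e unfolding sorted_slots_def by blast
  then show "e \<in> F" using F by blast
qed

text \<open>Applied with \<open>a = p\<close> and \<open>b = q\<close>, which gives capacity
  \<open>p\<close> to an unsafe and \<open>p + q\<close> to a safe edge, and with
  \<open>a = 1\<close> and \<open>b = 0\<close>, which counts edges.\<close>

definition capa :: "nat \<Rightarrow> nat \<Rightarrow> nat set \<Rightarrow> nat \<Rightarrow> nat \<Rightarrow> nat" where
  "capa a b F u v = a * mult I F u v + b * mult I (F \<inter> safe I) u v"

definition resid :: "nat \<Rightarrow> nat \<Rightarrow> store \<Rightarrow> nat set \<Rightarrow> nat \<Rightarrow> nat \<Rightarrow> bool" where
  "resid a b h F u v \<longleftrightarrow> mat h FREE u v \<noteq> 0 \<or> mat h FLOW u v < capa a b F u v + mat h FLOW v u"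

text \<open>The price of one edge is enough: for positive \<open>a\<close> a purchase raises the
  capacity by at least 1, and one unit is pushed.\<close>

definition weight :: "nat \<Rightarrow> nat \<Rightarrow> store \<Rightarrow> nat set \<Rightarrow> nat \<Rightarrow> nat \<Rightarrow> real" where
  "weight a b h F u v = (if resid a b h F u v then 0
     else case cube h SLOT (mult I F u v) u v of 0 \<Rightarrow> big | Suc e \<Rightarrow> cost I e)"

lemma beval_residual:
  assumes "solution h F" "neval u h < n" "neval v h < n"
  shows "beval (residual a b u v) h \<longleftrightarrow> resid a b h F (neval u h) (neval v h)"
proof -
  have "tabs (p * (p + q) + (p + q)) h" "nin h 0 = n"
    using assms(1) tables_nin by (auto simp: solution_def tables_def)
  then show ?thesis using assms solution_deg[OF assms]
    by (simp add: residual_def resid_def capa_def mat_def)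
qed

lemma neval_next_edge:
  assumes "solution h F" "neval u h < n" "neval v h < n"
  shows "neval (next_edge u v) h = cube h SLOT (mult I F (neval u h) (neval v h)) (neval u h) (neval v h)"
proof -
  have "tabs (p * (p + q) + (p + q)) h" "nin h 0 = n"
    using assms(1) tables_nin by (auto simp: solution_def tables_def)
  then show ?thesis using assms solution_deg[OF assms]
    by (simp add: next_edge_def cube_def)
qed

lemma weights_correct:
  assumes "solution h F" "u < n" "v < n"
  shows "rmat (sem (weights a b) h) WEIGHT u v = weight a b h F u v"
proof -
  have n: "nin h 0 = n" using assms tables_nin by (auto simp: solution_def)
  have "\<forall>(u, v)\<in>{..<nin h 0} \<times> {..<nin h 0}. rarr (sem (weights a b) h) WEIGHT (idx n u v) = weight a b h F u v"
    unfolding weights_def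
  proof (rule pairs_rule[where I = "\<lambda>S g. S \<subseteq> {..<n} \<times> {..<n} \<longrightarrow>
        (\<forall>(u, v)\<in>S. rarr g WEIGHT (idx n u v) = weight a b h F u v)", THEN mp], goal_cases)
    case (6 S g u v)
    note sm = 6(5)
    have sol: "solution g F"
      by (subst solution_same[OF sm]) (use assms(1) in auto)
    have ng: "nin g = nin h" by (rule sameD(1)[OF sm])
    have uv: "neval (cell VU) g = u" "neval (cell VV) g = v" "u < n" "v < n"
      using 6 n by simp_all
    have tb: "tabs (p * (p + q) + (p + q)) g" using sol by (simp add: solution_def tables_def)
    have "resid a b g F u v = resid a b h F u v" "cube g SLOT = cube h SLOT"
      using sameD(4)[OF sm, of FREE] sameD(4)[OF sm, of FLOW] sameD(4)[OF sm, of SLOT] ng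
      by (simp_all add: resid_def mat_def cube_def fun_eq_iff)
    note * = this beval_residual[OF sol, of "cell VU" "cell VV", unfolded uv, OF uv(3,4)]
      neval_next_edge[OF sol, of "cell VU" "cell VV", unfolded uv, OF uv(3,4)]
    have c: "rarr g COST e = cost I e" if "cube h SLOT (mult I F u v) u v = Suc e" for e
    proof -
      have "e \<in> parallel I u v" using solution_next[OF assms(1) uv(3,4) that] by simp
      then have "e < m" using in_parallel edges by auto
      then show ?thesis using sol by (simp add: solution_def tables_def)
    qed
    have B: "rarr g BIG 0 = big" using sol by (simp add: solution_def tables_def)
    let ?g = "sem (Ifte (residual a b (cell VU) (cell VV)) (RPut WEIGHT (at2 (cell VU) (cell VV)) (RLit 0))
       (Ifte (Lss (Lit 0) (next_edge (cell VU) (cell VV)))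
         (RPut WEIGHT (at2 (cell VU) (cell VV))
           (RArr COST (Mns (next_edge (cell VU) (cell VV)) (Lit 1))))
         (RPut WEIGHT (at2 (cell VU) (cell VV)) (rcell BIG)))) g"
    have "?g = setr WEIGHT (idx n u v) (weight a b h F u v) g"
      using tb uv ng n by (simp add: * weight_def B c split: nat.split)
    then show ?case using 6 n by auto
  qed (use n in auto)
  then show ?thesis using assms n sem_nin[of "weights a b" h] by (simp add: rmat_def)
qed

section \<open>One augmentation and its cost\<close>

lemma net_cong:
  assumes "\<And>u v. u < n \<Longrightarrow> v < n \<Longrightarrow> f u v = g u v" "A \<subseteq> {..<n}"
  shows "net n f A = net n g A"
  unfolding net_def using assms by (intro flux_cong) auto

lemma buy_correct:
  assumes sol: "solution h F" and uv: "narr h TA 0 = u" "narr h TB 0 = v" "u < n" "v < n" "u \<noteq> v"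
    and e: "cube h SLOT (mult I F u v) u v = Suc e"
  shows "solution (sem buy h) (insert e F)" "e \<in> parallel I u v" "e \<notin> F"
proof -
  note N = solution_next[OF sol uv(3,4) e]
  show "e \<in> parallel I u v" "e \<notin> F" by (rule N)+
  have tb: "tables h" and F: "F \<subseteq> edges I" using sol by (auto simp: solution_def)
  note nin = tables_nin[OF tb]
  have tabs: "tabs (p * (p + q) + (p + q)) h" using tb by (simp add: tables_def)
  have em: "e \<in> edges I" "e < m" using N(1) in_parallel edges by auto
  have sm: "same buy h (sem buy h)" by (rule same_sem)
  have tb': "tables (sem buy h)" by (subst tables_same[OF sm]) (use tb in auto)
  note nin' = tables_nin[OF tb']
  have sym: "mult I F v u = mult I F u v" "mult I (F \<inter> safe I) v u = mult I (F \<inter> safe I) u v"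
    by (rule mult_sym)+
  have safe: "narr h SAFE e = (if e \<in> safe I then 1 else 0)" using tb em by (simp add: tables_def)
  define h1 where "h1 = setn SOL e 1 (setn EDGE 0 e h)"
  define h2 where "h2 = (if e \<in> safe I then
      setn SDEG (idx n v u) (Suc (mult I (F \<inter> safe I) u v))
        (setn SDEG (idx n u v) (Suc (mult I (F \<inter> safe I) u v)) h1) else h1)"
  have "neval (next_edge (cell TA) (cell TB)) h = Suc e"
    using neval_next_edge[OF sol, of "cell TA" "cell TB"] uv e by simp
  then have b1: "sem (Put EDGE (Lit 0) (Mns (next_edge (cell TA) (cell TB)) (Lit 1)) ;;
      Put SOL (cell EDGE) (Lit 1)) h = h1"
    by (simp add: h1_def)
  have t1: "tabs (p * (p + q) + (p + q)) h1" "nin h1 0 = n" "narr h1 TA 0 = u" "narr h1 TB 0 = v"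
    using tabs nin uv by (simp_all add: h1_def)
  have b2: "sem (Ifte (Lss (Lit 0) (Arr SAFE (cell EDGE)))
       (incr SDEG (at2 (cell TA) (cell TB)) ;; incr SDEG (at2 (cell TB) (cell TA))) Nop) h1 = h2"
    using t1 uv solution_deg(4)[OF sol uv(3,4)] solution_deg(4)[OF sol uv(4,3)] sym safe
    by (simp add: h2_def) (simp add: h1_def)
  have t2: "tabs (p * (p + q) + (p + q)) h2" "nin h2 0 = n" "narr h2 TA 0 = u" "narr h2 TB 0 = v"
    "narr h2 DEG = narr h DEG"
    using t1 by (simp_all add: h2_def) (simp add: h1_def)
  have b: "sem buy h = setn DEG (idx n v u) (Suc (mult I F u v)) (setn DEG (idx n u v) (Suc (mult I F u v)) h2)"
    unfolding buy_def sem.simps(4) b1[unfolded sem.simps(4)] b2[unfolded sem.simps(4)]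
    using t2 uv solution_deg(3)[OF sol uv(3,4)] solution_deg(3)[OF sol uv(4,3)] sym by simp
  have nd: "narr (sem buy h) DEG = (narr h DEG)(idx n u v := Suc (mult I F u v), idx n v u := Suc (mult I F u v))"
    by (simp add: b t2)
  have nsd: "narr (sem buy h) SDEG = (if e \<in> safe I then (narr h SDEG)
      (idx n u v := Suc (mult I (F \<inter> safe I) u v), idx n v u := Suc (mult I (F \<inter> safe I) u v)) else narr h SDEG)"
    by (simp add: b h2_def h1_def)
  have fin: "finite F" "finite (F \<inter> safe I)" using F fin by auto
  have ins: "mult I (insert e F) a b = (if {a, b} = {u, v} then Suc (mult I F a b) else mult I F a b)" for a b
    by (rule mult_insert[OF fin(1) N(2,1)])
  have ins': "mult I (insert e F \<inter> safe I) a b = (if {a, b} = {u, v} \<and> e \<in> safe I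
      then Suc (mult I (F \<inter> safe I) a b) else mult I (F \<inter> safe I) a b)" for a b
    using mult_insert[OF fin(2) _ N(1), of a b] N(2) by (cases "e \<in> safe I") simp_all
  have "mat (sem buy h) DEG a b = mult I (insert e F) a b \<and>
      mat (sem buy h) SDEG a b = mult I (insert e F \<inter> safe I) a b \<and>
      mult I (insert e F) a b \<le> p + q \<and>
      insert e F \<inter> parallel I a b = {f. \<exists>l<mult I (insert e F) a b. cube (sem buy h) SLOT l a b = Suc f}"
    if ab: "a < n" "b < n" for a b
  proof -
    note dg = solution_deg[OF sol ab]
    have cube: "cube (sem buy h) SLOT = cube h SLOT"
      using sameD(4)[OF sm, of SLOT] sameD(1)[OF sm] by (simp add: cube_def fun_eq_iff)
    have old: "F \<inter> parallel I a b = {f. \<exists>l<mult I F a b. cube h SLOT l a b = Suc f}"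
      using sol ab by (simp add: solution_def)
    have ix: "idx n a b = idx n u v \<longleftrightarrow> a = u \<and> b = v" "idx n a b = idx n v u \<longleftrightarrow> a = v \<and> b = u"
      using uv ab by auto
    have pair: "{a, b} = {u, v} \<longleftrightarrow> a = u \<and> b = v \<or> a = v \<and> b = u" by (rule doubleton_eq_iff)
    have mult_eq: "mult I F a b = mult I F u v" "mult I (F \<inter> safe I) a b = mult I (F \<inter> safe I) u v"
      "parallel I a b = parallel I u v" if "{a, b} = {u, v}"
      using that by (auto simp: doubleton_eq_iff mult_sym parallel_sym)
    have "mat (sem buy h) DEG a b = (if {a, b} = {u, v} then Suc (mult I F u v) else mult I F a b)"
      unfolding mat_def nin'(1) nd pair fun_upd_apply ix dg(3) by presburger
    then have deg: "mat (sem buy h) DEG a b = mult I (insert e F) a b"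
      unfolding ins using mult_eq by simp
    have "mat (sem buy h) SDEG a b = (if {a, b} = {u, v} \<and> e \<in> safe I
        then Suc (mult I (F \<inter> safe I) u v) else mult I (F \<inter> safe I) a b)"
      unfolding mat_def nin'(1) nsd pair if_distribR fun_upd_apply ix dg(4) by presburger
    then have sdeg: "mat (sem buy h) SDEG a b = mult I (insert e F \<inter> safe I) a b"
      unfolding ins' using mult_eq by simp
    have le: "mult I (insert e F) a b \<le> p + q"
      unfolding ins using dg(5) N(4) mult_eq(1) by simp
    have "insert e F \<inter> parallel I a b = {f. \<exists>l<mult I (insert e F) a b. cube h SLOT l a b = Suc f}"
    proof (cases "{a, b} = {u, v}")
      case True
      have sl: "cube h SLOT (mult I F u v) a b = Suc e"
        using True e N(5) by (auto simp: doubleton_eq_iff)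
      have "insert e F \<inter> parallel I a b = insert e (F \<inter> parallel I a b)"
        using N(1) mult_eq(3)[OF True] by auto
      then show ?thesis
        unfolding ins old using sl True mult_eq(1)[OF True] by (auto simp: less_Suc_eq)
    next
      case False
      then have "e \<notin> parallel I a b" using N(1) parallel_disjoint by blast
      then show ?thesis unfolding ins using old False by simp
    qed
    with deg sdeg le show ?thesis unfolding cube by blast
  qed
  moreover have "narr (sem buy h) SOL f \<noteq> 0 \<longleftrightarrow> f \<in> insert e F" if "f < m" for f
    using sol that by (simp add: b h2_def h1_def solution_def)
  ultimately show "solution (sem buy h) (insert e F)"
    using tb' F em by (auto simp: solution_def)
qed

text \<open>A free arc has unbounded capacity in its own direction. The reverse direction stays
  limited unless it is free as well.\<close>

definition valid :: "nat \<Rightarrow> nat \<Rightarrow> store \<Rightarrow> nat set \<Rightarrow> bool" where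
  "valid a b h F \<longleftrightarrow> (\<forall>u<n. \<forall>v<n. u \<noteq> v \<longrightarrow> mat h FREE u v \<noteq> 0 \<or>
     mat h FLOW u v \<le> capa a b F u v + mat h FLOW v u)"

definition amount :: "store \<Rightarrow> nat \<Rightarrow> bool" where
  "amount h k \<longleftrightarrow> (\<forall>A\<subseteq>{..<n}. s \<in> A \<longrightarrow> t \<notin> A \<longrightarrow> net n (mat h FLOW) A = int k)"

text \<open>Each arc of the walk is a pair not met before, so at its turn the pair still has the
  flow and the edges from which its weight was computed, and the purchase costs what the weight
  announced. Steps below \<open>big\<close> guarantee that there is an edge to buy.\<close>

lemma push_correct:
  assumes sol: "solution h F" and val: "valid a b h F" and a: "0 < a"
    and w: "\<And>i. i \<le> n \<Longrightarrow> narr h WALK i < n"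
    and arcs: "\<And>i k. i < k \<Longrightarrow> k < n \<Longrightarrow> narr h WALK k \<noteq> narr h WALK (Suc k) \<Longrightarrow>
      narr h WALK i \<noteq> narr h WALK (Suc i) \<Longrightarrow>
      {narr h WALK i, narr h WALK (Suc i)} \<noteq> {narr h WALK k, narr h WALK (Suc k)}"
    and less: "\<And>i. i < n \<Longrightarrow> step (weight a b h F) (narr h WALK) i < big"
  shows "\<exists>G. solution (sem (push a b) h) G \<and> F \<subseteq> G \<and> valid a b (sem (push a b) h) G \<and>
     total_cost I G \<le> total_cost I F + (\<Sum>i<n. step (weight a b h F) (narr h WALK) i) \<and>
     (\<forall>A\<subseteq>{..<n}. net n (mat (sem (push a b) h) FLOW) A =
        net n (mat h FLOW) A + of_bool (narr h WALK 0 \<in> A) - of_bool (narr h WALK n \<in> A))"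
proof -
  define W where "W = weight a b h F"
  define w where "w = narr h WALK"
  note w = w[folded w_def] and arcs = arcs[folded w_def] and less = less[folded w_def W_def]
  have n: "nin h 0 = n" using sol tables_nin by (simp add: solution_def)
  define K where "K k g G \<longleftrightarrow> solution g G \<and> F \<subseteq> G \<and> valid a b g G \<and>
     total_cost I G \<le> total_cost I F + (\<Sum>i<k. step W w i) \<and>
     (\<forall>A\<subseteq>{..<n}. net n (mat g FLOW) A = net n (mat h FLOW) A + of_bool (w 0 \<in> A) - of_bool (w k \<in> A)) \<and>
     (\<forall>u<n. \<forall>v<n. (\<forall>i<k. w i \<noteq> w (Suc i) \<longrightarrow> {w i, w (Suc i)} \<noteq> {u, v}) \<longrightarrow>
        mat g FLOW u v = mat h FLOW u v \<and> mult I G u v = mult I F u v \<and>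
        mult I (G \<inter> safe I) u v = mult I (F \<inter> safe I) u v)" for k g G
  define J where "J k g \<longleftrightarrow> (\<exists>G. K k g G)" for k g
  have "J n (sem (push a b) h)"
    unfolding push_def
  proof (rule Loop_rule[where I = J], goal_cases)
    case 1
    show ?case using sol val unfolding J_def K_def by (intro exI[of _ F]) simp
  next
    case (2 k g)
    note sm = 2(3)
    have k: "k < n" using 2(1) n by simp
    obtain G where K: "K k g G" using 2(2) by (auto simp: J_def)
    have G: "solution g G" "F \<subseteq> G" "valid a b g G"
      and cost: "total_cost I G \<le> total_cost I F + (\<Sum>i<k. step W w i)"
      and net: "\<And>A. A \<subseteq> {..<n} \<Longrightarrow> net n (mat g FLOW) A =
         net n (mat h FLOW) A + of_bool (w 0 \<in> A) - of_bool (w k \<in> A)"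
      and old: "\<forall>u<n. \<forall>v<n. (\<forall>i<k. w i \<noteq> w (Suc i) \<longrightarrow> {w i, w (Suc i)} \<noteq> {u, v}) \<longrightarrow>
        mat g FLOW u v = mat h FLOW u v \<and> mult I G u v = mult I F u v \<and>
        mult I (G \<inter> safe I) u v = mult I (F \<inter> safe I) u v"
      using K unfolding K_def by simp_all
    note old = old[rule_format]
    have ng: "nin g = nin h" by (rule sameD(1)[OF sm])
    have wg: "narr g WALK = w" using sameD(4)[OF sm, of WALK] by (simp add: w_def)
    define u v where "u = w k" and "v = w (Suc k)"
    have uv: "u < n" "v < n" using w k by (simp_all add: u_def v_def)
    define g1 where "g1 = setn TB 0 v (setn TA 0 u (setn LAY 0 k g))"
    have sol1: "solution g1 G" using solution_cong[of g1 g G] G(1) by (simp add: g1_def)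
    have flow1: "mat g1 FLOW = mat g FLOW" "mat g1 FREE = mat g FREE" "nin g1 0 = n"
      by (simp_all add: g1_def mat_def fun_eq_iff ng n)
    have cube1: "cube g1 SLOT = cube h SLOT"
      using sameD(4)[OF sm, of SLOT] by (simp add: g1_def cube_def fun_eq_iff ng)
    have free1: "mat g1 FREE = mat h FREE"
      using sameD(4)[OF sm, of FREE] by (simp add: g1_def mat_def fun_eq_iff ng)
    let ?c = "Ifte (Cnj (Neg (Lss (cell TA) (cell TB))) (Neg (Lss (cell TB) (cell TA)))) Nop
        (Ifte (residual a b (cell TA) (cell TB)) Nop
           (Ifte (Lss (Lit 0) (next_edge (cell TA) (cell TB))) buy Nop) ;;
         incr FLOW (at2 (cell TA) (cell TB)))"
    have body: "sem (Put TA (Lit 0) (Arr WALK (cell LAY)) ;;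
      Put TB (Lit 0) (Arr WALK (Pls (cell LAY) (Lit 1))) ;; ?c) (setn LAY 0 k g) = sem ?c g1"
      using wg by (simp add: g1_def u_def v_def)
    show ?case
      unfolding body
    proof (cases "u = v")
      case True
      then have e: "sem ?c g1 = g1" by (simp add: g1_def)
      have st: "step W w k = 0" using True by (simp add: step_def u_def v_def)
      show "J (Suc k) (sem ?c g1)"
        unfolding e J_def K_def
      proof (intro exI[of _ G] conjI allI impI)
        show "valid a b g1 G" using G(3) by (simp add: valid_def flow1)
        fix A assume "A \<subseteq> {..<n}"
        then show "net n (mat g1 FLOW) A = net n (mat h FLOW) A + of_bool (w 0 \<in> A) - of_bool (w (Suc k) \<in> A)"
          using net True by (simp add: flow1 u_def v_def)
      qed (use sol1 G cost st old in \<open>auto simp: flow1 less_Suc_eq\<close>)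
    next
      case False
      have new: "mat g FLOW u v = mat h FLOW u v \<and> mult I G u v = mult I F u v \<and>
        mult I (G \<inter> safe I) u v = mult I (F \<inter> safe I) u v"
        using arcs[of _ k] False k by (intro old uv) (auto simp: u_def v_def)
      have new': "mat g FLOW v u = mat h FLOW v u"
        using arcs[of _ k] False k old[OF uv(2,1)] by (auto simp: u_def v_def insert_commute)
      have res: "resid a b g1 G u v = resid a b h F u v"
        using new new' by (simp add: resid_def capa_def flow1(1) free1)
      have st: "step W w k = weight a b h F u v" using False by (simp add: step_def u_def v_def W_def)
      define g2 where "g2 = sem (Ifte (residual a b (cell TA) (cell TB)) Nop
           (Ifte (Lss (Lit 0) (next_edge (cell TA) (cell TB))) buy Nop)) g1"
      have sm2: "same (Ifte (residual a b (cell TA) (cell TB)) Nop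
           (Ifte (Lss (Lit 0) (next_edge (cell TA) (cell TB))) buy Nop)) g1 g2"
        unfolding g2_def by (rule same_sem)
      have flow2: "mat g2 FLOW = mat g FLOW" "mat g2 FREE = mat g FREE" "narr g2 TA 0 = u" "narr g2 TB 0 = v"
        using sameD(1)[OF sm2] sameD(4)[OF sm2, of FLOW] sameD(4)[OF sm2, of FREE]
          sameD(4)[OF sm2, of TA] sameD(4)[OF sm2, of TB] flow1
        by (simp_all add: mat_def[abs_def]) (simp_all add: g1_def)
      have tt: "neval (cell TA) g1 = u" "neval (cell TB) g1 = v" by (simp_all add: g1_def)
      note bev = beval_residual[OF sol1, of "cell TA" "cell TB" a b, unfolded tt, OF uv]
        neval_next_edge[OF sol1, of "cell TA" "cell TB", unfolded tt, OF uv]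
      \<comment> \<open>After the possible purchase the arc is free or has strictly positive
        residual capacity, and the following increment of \<open>FLOW\<close> consumes one unit of
        it.\<close>
      have "\<exists>G'. solution g2 G' \<and> G \<subseteq> G' \<and> total_cost I G' \<le> total_cost I G + weight a b h F u v \<and>
          (mat g FREE u v \<noteq> 0 \<or> mat g FLOW u v < capa a b G' u v + mat g FLOW v u) \<and>
          (\<forall>x y. {x, y} \<noteq> {u, v} \<longrightarrow> mult I G' x y = mult I G x y \<and>
              mult I (G' \<inter> safe I) x y = mult I (G \<inter> safe I) x y)"
      proof (cases "resid a b g1 G u v")
        case True
        then have "g2 = g1" using bev by (simp add: g2_def)
        then show ?thesis
          using sol1 True res by (intro exI[of _ G]) (auto simp: weight_def resid_def flow1)
      next
        case no: False
        then have "weight a b h F u v = (case cube h SLOT (mult I F u v) u v of 0 \<Rightarrow> big | Suc e \<Rightarrow> cost I e)"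
          using res by (simp add: weight_def)
        moreover have "weight a b h F u v < big" using less[OF k] st by simp
        ultimately obtain e where e: "cube h SLOT (mult I F u v) u v = Suc e" "weight a b h F u v = cost I e"
          by (auto split: nat.splits)
        then have e': "cube g1 SLOT (mult I G u v) u v = Suc e" using new cube1 by simp
        then have g2: "g2 = sem buy g1" using bev no by (simp add: g2_def)
        have ta: "narr g1 TA 0 = u" "narr g1 TB 0 = v" by (simp_all add: g1_def)
        note B = buy_correct[OF sol1 ta uv False e']
        have fG: "finite G" "finite (G \<inter> safe I)" using G(1) fin by (auto simp: solution_def)
        have "total_cost I (insert e G) = total_cost I G + cost I e"
          using B(3) fG by (simp add: total_cost_def)
        moreover have "mult I G u v < mult I (insert e G) u v"
          using mult_insert[OF fG(1) B(3,2), of u v] by simp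
        then have "capa a b G u v < capa a b (insert e G) u v"
          using a mult_mono[of "insert e G \<inter> safe I" "G \<inter> safe I" I u v] fG
          unfolding capa_def by (intro add_less_le_mono mult_strict_left_mono mult_le_mono2) auto
        moreover have "mat g FREE u v \<noteq> 0 \<or> mat g FLOW u v \<le> capa a b G u v + mat g FLOW v u"
          using G(3) uv False by (simp add: valid_def)
        moreover have "mult I (insert e G) x y = mult I G x y \<and>
              mult I (insert e G \<inter> safe I) x y = mult I (G \<inter> safe I) x y" if "{x, y} \<noteq> {u, v}" for x y
          using mult_insert[OF fG(1) B(3,2), of x y] mult_insert[OF fG(2) _ B(2), of x y] B(3) that
          by (cases "e \<in> safe I") auto
        ultimately show ?thesis
          using B(1) e(2) g2 by (intro exI[of _ "insert e G"]) auto
      qed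
      then obtain G' where G': "solution g2 G'" "G \<subseteq> G'"
        "total_cost I G' \<le> total_cost I G + weight a b h F u v"
        "mat g FREE u v \<noteq> 0 \<or> mat g FLOW u v < capa a b G' u v + mat g FLOW v u"
        "\<And>x y. {x, y} \<noteq> {u, v} \<Longrightarrow> mult I G' x y = mult I G x y \<and>
              mult I (G' \<inter> safe I) x y = mult I (G \<inter> safe I) x y"
        by blast
      define g3 where "g3 = setn FLOW (idx n u v) (Suc (mat g FLOW u v)) g2"
      have tb2: "tables g2" using G'(1) by (simp add: solution_def)
      have n2: "nin g2 0 = n" by (rule tables_nin[OF tb2])
      have "tabs (p * (p + q) + (p + q)) g2" using tb2 by (simp add: tables_def)
      then have "sem (incr FLOW (at2 (cell TA) (cell TB))) g2 = g3"
        using flow2 n2 uv by (simp add: g3_def mat_def flow2(1)[symmetric])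
      moreover have "\<not> beval (Cnj (Neg (Lss (cell TA) (cell TB))) (Neg (Lss (cell TB) (cell TA)))) g1"
        unfolding beval.simps tt using False by linarith
      ultimately have e: "sem ?c g1 = g3"
        unfolding g2_def by (simp only: sem.simps(4,5) if_False)
      have sol3: "solution g3 G'" using solution_cong[of g3 g2 G'] G'(1) by (simp add: g3_def)
      have fl3: "mat g3 FLOW x y = inc u v (mat g FLOW) x y" if "x < n" "y < n" for x y
        using that uv n2 flow2(1) unfolding g3_def inc_def mat_def by (auto simp: fun_eq_iff)
      have fr3: "mat g3 FREE = mat g FREE" using flow2(2) by (simp add: g3_def mat_def[abs_def])
      have capmono: "capa a b G x y \<le> capa a b G' x y" for x y
      proof -
        have "finite G'" using G'(1) fin by (auto simp: solution_def)
        then show ?thesis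
          unfolding capa_def using G'(2) by (intro add_mono mult_le_mono2 mult_mono) auto
      qed
      show "J (Suc k) (sem ?c g1)"
        unfolding e J_def K_def
      proof (intro exI[of _ G'] conjI allI impI)
        show "total_cost I G' \<le> total_cost I F + (\<Sum>i<Suc k. step W w i)"
          using cost G'(3) st by simp
        show "valid a b g3 G'"
          unfolding valid_def
        proof (intro allI impI)
          fix x y assume xy: "x < n" "y < n" "x \<noteq> y"
          have v: "mat g FREE x y \<noteq> 0 \<or> mat g FLOW x y \<le> capa a b G x y + mat g FLOW y x"
            using G(3) xy by (simp add: valid_def)
          show "mat g3 FREE x y \<noteq> 0 \<or> mat g3 FLOW x y \<le> capa a b G' x y + mat g3 FLOW y x"
          proof (cases "x = u \<and> y = v")
            case True
            then show ?thesis
              using G'(4) False unfolding fl3[OF xy(1,2)] fl3[OF xy(2,1)] fr3 inc_def by auto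
          next
            case no: False
            then have "inc u v (mat g FLOW) x y = mat g FLOW x y" by (auto simp: inc_def)
            moreover have "mat g FLOW y x \<le> inc u v (mat g FLOW) y x" by (simp add: inc_def)
            ultimately show ?thesis
              unfolding fl3[OF xy(1,2)] fl3[OF xy(2,1)] fr3 using v capmono[of x y] by linarith
          qed
        qed
        fix A assume A: "A \<subseteq> {..<n}"
        have "net n (mat g3 FLOW) A = net n (inc u v (mat g FLOW)) A"
          by (rule net_cong) (use fl3 A in auto)
        then show "net n (mat g3 FLOW) A = net n (mat h FLOW) A + of_bool (w 0 \<in> A) - of_bool (w (Suc k) \<in> A)"
          using net_inc[OF A uv] net[OF A] by (simp add: u_def v_def)
      next
        fix x y assume xy: "x < n" "y < n"
          and no: "\<forall>i<Suc k. w i \<noteq> w (Suc i) \<longrightarrow> {w i, w (Suc i)} \<noteq> {x, y}"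
        then have ne: "{x, y} \<noteq> {u, v}" using False by (auto simp: u_def v_def)
        then have "\<not> (x = u \<and> y = v)" by auto
        then have "mat g3 FLOW x y = mat g FLOW x y" using fl3[OF xy] by (simp add: inc_def)
        with old[OF xy] no G'(5)[OF ne]
        show "mat g3 FLOW x y = mat h FLOW x y" "mult I G' x y = mult I F x y"
          "mult I (G' \<inter> safe I) x y = mult I (F \<inter> safe I) x y"
          by auto
      qed (use sol3 G G' in auto)
    qed
  next
    case (3 g)
    have 1: "solution (setn LAY 0 (bval_of Verts h) g) = solution g"
      by (intro ext solution_cong) auto
    have 2: "mat (setn LAY 0 (bval_of Verts h) g) FLOW = mat g FLOW"
      "mat (setn LAY 0 (bval_of Verts h) g) FREE = mat g FREE"
      by (simp_all add: mat_def[abs_def])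
    have "J k (setn LAY 0 (bval_of Verts h) g) = J k g" for k
      by (simp only: J_def K_def valid_def 1 2)
    then show ?case using 3(1) n by simp
  qed
  then obtain G where "K n (sem (push a b) h) G" by (auto simp only: J_def)
  then show ?thesis
    unfolding K_def W_def w_def by (elim conjE) (intro exI[of _ G] conjI; assumption)
qed

text \<open>
  If \<open>t\<close> is not reachable by residual arcs and arcs along edges of \<open>X\<close>, the reachable set is a
  cut of capacity at most \<open>k\<close> that no available edge of \<open>X\<close> crosses.
\<close>

lemma augment_correct:
  assumes sol: "solution h F" and val: "valid a b h F" and a: "0 < a" and am: "amount h k"
    and X: "X \<subseteq> edges I"
    and hyp: "\<And>A. A \<subseteq> {..<n} \<Longrightarrow> s \<in> A \<Longrightarrow> t \<notin> A \<Longrightarrow>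
      (\<And>u v. u \<in> A \<Longrightarrow> v < n \<Longrightarrow> v \<notin> A \<Longrightarrow> mat h FREE u v = 0) \<Longrightarrow> flux n (capa a b F) A \<le> k \<Longrightarrow>
      \<exists>u\<in>A. \<exists>v<n. v \<notin> A \<and> (\<exists>e\<in>X - F. e \<in> parallel I u v) \<and> mult I F u v < p + q"
  shows "\<exists>G. solution (sem (augment a b) h) G \<and> F \<subseteq> G \<and> valid a b (sem (augment a b) h) G \<and>
     total_cost I G \<le> total_cost I F + total_cost I X \<and> amount (sem (augment a b) h) (Suc k)"
proof -
  define W where "W = weight a b h F"
  define h1 where "h1 = sem (weights a b) h"
  define h2 where "h2 = sem walk h1"
  have aug: "sem (augment a b) h = sem (push a b) h2" by (simp add: augment_def h1_def h2_def)
  have sm1: "same (weights a b) h h1" and sm2: "same walk h1 h2"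
    by (simp_all add: h1_def h2_def same_sem)
  have sol1: "solution h1 F" by (subst solution_same[OF sm1]) (use sol in auto)
  have sol2: "solution h2 F" by (subst solution_same[OF sm2]) (use sol1 in auto)
  have tb1: "tables h1" using sol1 by (simp add: solution_def)
  have nn: "nin h1 = nin h" "nin h2 = nin h" using sameD(1)[OF sm1] sameD(1)[OF sm2] by simp_all
  have eq: "mat h2 FREE = mat h FREE" "mat h2 FLOW = mat h FLOW" "cube h2 SLOT = cube h SLOT"
    using sameD(4)[OF sm1, of FREE] sameD(4)[OF sm2, of FREE] sameD(4)[OF sm1, of FLOW]
      sameD(4)[OF sm2, of FLOW] sameD(4)[OF sm1, of SLOT] sameD(4)[OF sm2, of SLOT] nn
    by (simp_all add: mat_def[abs_def] cube_def[abs_def])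
  have W2: "weight a b h2 F = W"
    by (intro ext) (simp add: weight_def resid_def eq W_def)
  have W1: "rmat h1 WEIGHT u v = W u v" if "u < n" "v < n" for u v
    using weights_correct[OF sol that] by (simp add: h1_def W_def)
  have W0: "0 \<le> W u v" if "u < n" "v < n" for u v
  proof (cases "cube h SLOT (mult I F u v) u v")
    case (Suc e)
    then have "e \<in> edges I" using solution_next(1)[OF sol that Suc] in_parallel by blast
    then show ?thesis using Suc cost_nonneg by (simp add: W_def weight_def)
  qed (use big_pos in \<open>simp add: W_def weight_def\<close>)
  have "layered n s (rarr h1 BIG 0) (rmat h1 WEIGHT) (rmat h2 DIST) (mat h2 PRED)"
    and T: "traced n (mat h2 PRED) t (narr h2 WALK)"
    using walk_correct[of "p * (p + q) + (p + q)" h1 n s t] tables_nin[OF tb1] tb1 s t W0 W1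
    by (simp_all add: h2_def tables_def)
  moreover have "relaxed n (rmat h1 WEIGHT) d d' P v = relaxed n W d d' P v" if "v < n" for d d' P v
    unfolding relaxed_def using W1 that by (cases "P v < n") auto
  moreover have "rarr h1 BIG 0 = big" using tb1 by (simp add: tables_def)
  ultimately have L: "layered n s big W (rmat h2 DIST) (mat h2 PRED)" by (simp add: layered_def)
  define J where "J = X - F"
  \<comment> \<open>An edge of \<open>X\<close> counts only while its pair has fewer than
    \<open>p + q\<close> bought edges; otherwise the sentinel hides it.\<close>
  define R where "R = {(u, v). u < n \<and> v < n \<and>
     (W u v = 0 \<or> (\<exists>e\<in>J. e \<in> parallel I u v) \<and> mult I F u v < p + q)}"
  have reach: "(s, t) \<in> R\<^sup>*"
  proof (rule ccontr)
    assume no: "(s, t) \<notin> R\<^sup>*"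
    define A where "A = {v. v < n \<and> (s, v) \<in> R\<^sup>*}"
    have A: "A \<subseteq> {..<n}" "s \<in> A" "t \<notin> A" using s no by (auto simp: A_def)
    have out: "(u, v) \<notin> R" if "u \<in> A" "v < n" "v \<notin> A" for u v
      using that by (auto simp: A_def intro: rtrancl_into_rtrancl)
    have nres: "\<not> resid a b h F u v" if "u \<in> A" "v < n" "v \<notin> A" for u v
    proof
      assume "resid a b h F u v"
      moreover have "u < n" using that A by auto
      ultimately have "(u, v) \<in> R" using that by (simp add: R_def W_def weight_def)
      then show False using out[OF that] by simp
    qed
    \<comment> \<open>No arc that leaves the reached set is residual, so the net flow
      \<open>k\<close> fills at least the whole capacity of this cut.\<close>
    have "int (flux n (capa a b F) A) \<le> net n (mat h FLOW) A"
      unfolding net_def flux_of_nat[symmetric]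
      by (rule flux_mono) (use nres in \<open>fastforce simp: resid_def\<close>)
    also have "\<dots> = int k" using am A by (auto simp: amount_def)
    finally have "flux n (capa a b F) A \<le> k" by simp
    then obtain u v where "u \<in> A" "v < n" "v \<notin> A" "\<exists>e\<in>J. e \<in> parallel I u v" "mult I F u v < p + q"
      using hyp[OF A] nres by (auto simp: resid_def J_def)
    then show False using out[of u v] A by (auto simp: R_def)
  qed
  have J: "finite J" "\<And>e. e \<in> J \<Longrightarrow> 0 \<le> cost I e" using X fin cost_nonneg by (auto simp: J_def)
  have "rmat h2 DIST n t \<le> (\<Sum>e\<in>J. cost I e)"
  proof (rule layered_le_edges[where en = "ends I", OF L W0 s J reach])
    fix u v assume uv: "(u, v) \<in> R"
    then have lt: "u < n" "v < n" by (auto simp: R_def)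
    \<comment> \<open>The recorded next edge of a pair is at most as expensive as any edge of
      \<open>X - F\<close> there. So the cost of \<open>X\<close> bounds the walk even if other
      edges are bought.\<close>
    have "\<exists>e\<in>J. (ends I e = (u, v) \<or> ends I e = (v, u)) \<and> W u v \<le> cost I e" if nz: "W u v \<noteq> 0"
    proof -
      obtain e where e: "e \<in> J" "e \<in> parallel I u v" "mult I F u v < p + q"
        using uv nz by (auto simp: R_def)
      then have "cube h SLOT (mult I F u v) u v \<noteq> 0"
        using solution_next_0[OF sol lt] by (auto simp: J_def)
      then obtain f where f: "cube h SLOT (mult I F u v) u v = Suc f" by (cases "cube h SLOT (mult I F u v) u v") auto
      then have "W u v = cost I f" using nz by (simp add: W_def weight_def split: if_splits)
      moreover have "cost I f \<le> cost I e" using solution_next(3)[OF sol lt f] e by (auto simp: J_def)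
      ultimately show ?thesis using e by (auto simp: parallel_def)
    qed
    then show "v < n \<and> (W u v = 0 \<or> (\<exists>e\<in>J. (ends I e = (u, v) \<or> ends I e = (v, u)) \<and> W u v \<le> cost I e))"
      using lt by auto
  qed
  also have "\<dots> = total_cost I J" by (simp add: total_cost_def)
  also have "\<dots> \<le> total_cost I X" using X by (intro total_cost_mono) (auto simp: J_def)
  finally have dist: "rmat h2 DIST n t \<le> total_cost I X" .
  then have "rmat h2 DIST n t < big" using total_cost_less_big[OF X] by linarith
  note src = traced_source[OF L W0 T t _ this]
  have w0: "narr h2 WALK 0 = s" and sum: "(\<Sum>i<n. step W (narr h2 WALK) i) = rmat h2 DIST n t"
    using src big_pos by simp_all
  have less: "step (weight a b h2 F) (narr h2 WALK) i < big" if "i < n" for i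
  proof -
    have "step W (narr h2 WALK) i \<le> (\<Sum>i<n. step W (narr h2 WALK) i)"
      using that step_nonneg[OF L W0 T t] by (intro member_le_sum) auto
    then show ?thesis using sum \<open>rmat h2 DIST n t < big\<close> by (simp add: W2)
  qed
  have val2: "valid a b h2 F" using val by (simp add: valid_def eq)
  have less_n: "narr h2 WALK i < n" if "i \<le> n" for i
    using traced_less[OF L W0 T t that] .
  have arcs: "{narr h2 WALK i, narr h2 WALK (Suc i)} \<noteq> {narr h2 WALK k, narr h2 WALK (Suc k)}"
    if "i < k" "k < n" "narr h2 WALK k \<noteq> narr h2 WALK (Suc k)" "narr h2 WALK i \<noteq> narr h2 WALK (Suc i)" for i k
    using traced_arcs_distinct[OF L W0 T t that] .
  obtain G where G: "solution (sem (push a b) h2) G" "F \<subseteq> G"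
    "valid a b (sem (push a b) h2) G"
    "total_cost I G \<le> total_cost I F + (\<Sum>i<n. step W (narr h2 WALK) i)"
    "\<And>A. A \<subseteq> {..<n} \<Longrightarrow> net n (mat (sem (push a b) h2) FLOW) A =
        net n (mat h2 FLOW) A + of_bool (narr h2 WALK 0 \<in> A) - of_bool (narr h2 WALK n \<in> A)"
    using push_correct[OF sol2 val2 a less_n arcs less, unfolded W2] by blast
  have "narr h2 WALK n = t" using T by (simp add: traced_def)
  then have "amount (sem (push a b) h2) (Suc k)"
    using G(5) am by (simp add: amount_def w0 eq)
  then show ?thesis unfolding aug using G sum dist by (intro exI[of _ G]) auto
qed

text \<open>Each of the \<open>k\<close> augmentations is charged a full copy of \<open>X\<close>.
  The condition on cuts ranges over all \<open>G\<close> containing \<open>F\<close>, because the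
  solution grows between augmentations.\<close>

lemma saturate_correct:
  assumes sol: "solution h F" and a: "0 < a" and X: "X \<subseteq> edges I"
    and zero: "\<And>u v. u < n \<Longrightarrow> v < n \<Longrightarrow> mat h FLOW u v = 0"
    and hyp: "\<And>G A. F \<subseteq> G \<Longrightarrow> G \<subseteq> edges I \<Longrightarrow> A \<subseteq> {..<n} \<Longrightarrow> s \<in> A \<Longrightarrow> t \<notin> A \<Longrightarrow>
      (\<And>u v. u \<in> A \<Longrightarrow> v < n \<Longrightarrow> v \<notin> A \<Longrightarrow> mat h FREE u v = 0) \<Longrightarrow> flux n (capa a b G) A < k \<Longrightarrow>
      \<exists>u\<in>A. \<exists>v<n. v \<notin> A \<and> (\<exists>e\<in>X - G. e \<in> parallel I u v) \<and> mult I G u v < p + q"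
  shows "\<exists>G. solution (sem (saturate k a b) h) G \<and> F \<subseteq> G \<and> valid a b (sem (saturate k a b) h) G \<and>
     total_cost I G \<le> total_cost I F + k * total_cost I X \<and> amount (sem (saturate k a b) h) k"
proof -
  define J where "J i g G \<longleftrightarrow> solution g G \<and> F \<subseteq> G \<and> valid a b g G \<and>
     total_cost I G \<le> total_cost I F + real i * total_cost I X \<and> amount g i" for i g G
  have J_setn: "J i (setn RND 0 x g) G = J i g G" for i x g G
  proof -
    have "solution (setn RND 0 x g) G = solution g G" by (intro solution_cong) auto
    moreover have "mat (setn RND 0 x g) FLOW = mat g FLOW" "mat (setn RND 0 x g) FREE = mat g FREE"
      by (simp_all add: mat_def[abs_def])
    ultimately show ?thesis by (simp only: J_def valid_def amount_def)
  qed
  have "\<exists>G. J k (sem (saturate k a b) h) G"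
    unfolding saturate_def
  proof (rule Loop_rule[where I = "\<lambda>i g. \<exists>G. J i g G"], goal_cases)
    case 1
    have "net n (mat h FLOW) A = 0" if "A \<subseteq> {..<n}" for A
      using that zero net_cong[of "mat h FLOW" "\<lambda>_ _. 0" A] by (simp add: net_def flux_def)
    then show ?case
      using sol zero by (intro exI[of _ F]) (simp add: J_def valid_def amount_def)
  next
    case (2 i g)
    then obtain G where G: "J i g G" by blast
    let ?g = "setn RND 0 i g"
    have G': "J i ?g G" using G by (simp only: J_setn)
    have GE: "F \<subseteq> G" "G \<subseteq> edges I" using G by (auto simp: J_def solution_def)
    have free: "mat ?g FREE = mat h FREE"
      using sameD(4)[OF 2(3), of FREE] sameD(1)[OF 2(3)] by (simp add: mat_def[abs_def])
    have "\<exists>H. solution (sem (augment a b) ?g) H \<and> G \<subseteq> H \<and> valid a b (sem (augment a b) ?g) H \<and>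
     total_cost I H \<le> total_cost I G + total_cost I X \<and> amount (sem (augment a b) ?g) (Suc i)"
    proof (rule augment_correct[OF _ _ a _ X])
      fix A assume "A \<subseteq> {..<n}" "s \<in> A" "t \<notin> A" "flux n (capa a b G) A \<le> i"
        "\<And>u v. u \<in> A \<Longrightarrow> v < n \<Longrightarrow> v \<notin> A \<Longrightarrow> mat ?g FREE u v = 0"
      then show "\<exists>u\<in>A. \<exists>v<n. v \<notin> A \<and> (\<exists>e\<in>X - G. e \<in> parallel I u v) \<and> mult I G u v < p + q"
        using 2(1) by (intro hyp[OF GE]) (simp_all add: free)
    qed (use G' in \<open>simp_all add: J_def\<close>)
    then obtain H where "solution (sem (augment a b) ?g) H" "G \<subseteq> H" "valid a b (sem (augment a b) ?g) H"
     "total_cost I H \<le> total_cost I G + total_cost I X" "amount (sem (augment a b) ?g) (Suc i)"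
      by blast
    then show ?case using G by (intro exI[of _ H]) (auto simp: J_def algebra_simps)
  next
    case (3 g)
    then show ?case by (simp only: J_setn bval_of.simps)
  qed
  then show ?thesis by (simp only: J_def)
qed

end

section \<open>Unit flows\<close>

lemma pairs_assign:
  assumes nw: "\<not> writes c VU 0" "\<not> writes c VV 0" and n: "nin h 0 = n" and k: "k \<noteq> VU" "k \<noteq> VV"
    and step: "\<And>g u v. u < n \<Longrightarrow> v < n \<Longrightarrow> same (pairs c) h g \<Longrightarrow> narr g VU 0 = u \<Longrightarrow> narr g VV 0 = v \<Longrightarrow>
      narr g k (idx n u v) = narr h k (idx n u v) \<Longrightarrow>
      narr (sem c g) k = (narr g k)(idx n u v := f u v)"
  shows "u < n \<Longrightarrow> v < n \<Longrightarrow> mat (sem (pairs c) h) k u v = f u v"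
proof -
  let ?I = "\<lambda>S g. S \<subseteq> {..<n} \<times> {..<n} \<longrightarrow> (\<forall>u<n. \<forall>v<n.
    narr g k (idx n u v) = (if (u, v) \<in> S then f u v else narr h k (idx n u v)))"
  have "?I ({..<nin h 0} \<times> {..<nin h 0}) (sem (pairs c) h)"
  proof (rule pairs_rule[where I = ?I], goal_cases)
    case (6 S g u v)
    have S: "insert (u, v) S \<subseteq> {..<n} \<times> {..<n} \<Longrightarrow> S \<subseteq> {..<n} \<times> {..<n}" by blast
    show ?case
    proof (intro impI allI)
      fix a b assume ab: "a < n" "b < n" and sub: "insert (u, v) S \<subseteq> {..<n} \<times> {..<n}"
      have old: "narr g k (idx n a b) = (if (a, b) \<in> S then f a b else narr h k (idx n a b))"
        "narr g k (idx n u v) = narr h k (idx n u v)"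
        using 6(1-4) S[OF sub] ab n by auto
      have "narr (sem c g) k = (narr g k)(idx n u v := f u v)"
        using 6 n old(2) by (intro step) auto
      then show "narr (sem c g) k (idx n a b) =
          (if (a, b) \<in> insert (u, v) S then f a b else narr h k (idx n a b))"
        using ab old(1) 6(1,2) n by (cases "(a, b) = (u, v)") auto
    qed
  qed (use nw k in auto)
  then show "u < n \<Longrightarrow> v < n \<Longrightarrow> mat (sem (pairs c) h) k u v = f u v"
    using n by (simp add: mat_def)
qed

lemma pairs_rassign:
  assumes nw: "\<not> writes c VU 0" "\<not> writes c VV 0" and n: "nin h 0 = n"
    and step: "\<And>g u v. u < n \<Longrightarrow> v < n \<Longrightarrow> same (pairs c) h g \<Longrightarrow> narr g VU 0 = u \<Longrightarrow> narr g VV 0 = v \<Longrightarrow>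
      rarr (sem c g) k = (rarr g k)(idx n u v := f u v)"
  shows "u < n \<Longrightarrow> v < n \<Longrightarrow> rmat (sem (pairs c) h) k u v = f u v"
proof -
  let ?I = "\<lambda>S g. S \<subseteq> {..<n} \<times> {..<n} \<longrightarrow> (\<forall>(u, v)\<in>S. rarr g k (idx n u v) = f u v)"
  have "?I ({..<nin h 0} \<times> {..<nin h 0}) (sem (pairs c) h)"
  proof (rule pairs_rule[where I = ?I], goal_cases)
    case (6 S g u v)
    have "rarr (sem c g) k = (rarr g k)(idx n u v := f u v)"
      using 6 n by (intro step) auto
    then show ?case using 6(1-4) n by auto
  qed (use nw in auto)
  then show "u < n \<Longrightarrow> v < n \<Longrightarrow> rmat (sem (pairs c) h) k u v = f u v"
    using n by (auto simp: rmat_def)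
qed

text \<open>Arcs with positive net flow have weight 0 and all others weight \<open>big\<close>, so a
  shortest walk from \<open>s\<close> to \<open>t\<close> follows flow throughout. Its unit is
  removed by adding to the opposite direction, as only differences of gross amounts matter.\<close>

definition peel :: prog where
  "peel =
     pairs (Ifte (Lss (Arr FLOW (at2 (cell VV) (cell VU))) (Arr FLOW (at2 (cell VU) (cell VV))))
       (RPut WEIGHT (at2 (cell VU) (cell VV)) (RLit 0))
       (RPut WEIGHT (at2 (cell VU) (cell VV)) (rcell BIG))) ;;
     walk ;;
     Loop LAY 0 Verts
     (Put TA (Lit 0) (Arr WALK (cell LAY)) ;;
      Put TB (Lit 0) (Arr WALK (Pls (cell LAY) (Lit 1))) ;;
      Ifte (Cnj (Neg (Lss (cell TA) (cell TB))) (Neg (Lss (cell TB) (cell TA)))) Nop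
        (Put UNIT (at3 (cell RND) (cell TA) (cell TB)) (Lit 1) ;;
         incr FLOW (at2 (cell TB) (cell TA))))"

definition decompose :: "nat \<Rightarrow> prog" where
  "decompose N = Loop RND 0 (Times N) peel"

lemma peel_simps [simp]:
  "writes peel k i \<longleftrightarrow> k \<in> {VU, VV, LAY} \<and> i = 0 \<or> k \<in> {PRED, WALK, TA, TB, UNIT, FLOW}"
  "rwrites peel k \<longleftrightarrow> k \<in> {WEIGHT, DIST}" "legal peel"
  by (auto simp: peel_def)

lemma decompose_simps [simp]:
  "writes (decompose N) k i \<longleftrightarrow> k \<in> {VU, VV, LAY, RND} \<and> i = 0 \<or> k \<in> {PRED, WALK, TA, TB, UNIT, FLOW}"
  "rwrites (decompose N) k \<longleftrightarrow> k \<in> {WEIGHT, DIST}" "legal (decompose N)"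
  by (auto simp: decompose_def)

context flex_problem
begin

abbreviation bound where "bound \<equiv> p * (p + q) + (p + q)"

lemma tables_tabs: "tables h \<Longrightarrow> tabs bound h"
  by (simp add: tables_def)

text \<open>The truncated differences in the fourth conclusion are positive parts of net flow. They
  drop by exactly the unit on its arcs and remain 0 on the reversed arcs, because the walk follows
  positive net flow only.\<close>

lemma peel_correct:
  assumes tb: "tables h" and am: "amount h (Suc k)" and i: "narr h RND 0 = i" "i \<le> bound"
    and zero: "\<And>u v. u < n \<Longrightarrow> v < n \<Longrightarrow> cube h UNIT i u v = 0"
  defines "g \<equiv> sem peel h"
  shows "amount g k"
    "\<And>A. A \<subseteq> {..<n} \<Longrightarrow> s \<in> A \<Longrightarrow> t \<notin> A \<Longrightarrow> net n (cube g UNIT i) A = 1"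
    "\<And>u v. u < n \<Longrightarrow> v < n \<Longrightarrow> cube g UNIT i u v \<le> 1"
    "\<And>u v. u < n \<Longrightarrow> v < n \<Longrightarrow>
      cube g UNIT i u v + (mat g FLOW u v - mat g FLOW v u) = mat h FLOW u v - mat h FLOW v u"
    "\<And>u v j. u < n \<Longrightarrow> v < n \<Longrightarrow> j \<noteq> i \<Longrightarrow> cube g UNIT j u v = cube h UNIT j u v"
proof -
  let ?c1 = "pairs (Ifte (Lss (Arr FLOW (at2 (cell VV) (cell VU))) (Arr FLOW (at2 (cell VU) (cell VV))))
       (RPut WEIGHT (at2 (cell VU) (cell VV)) (RLit 0))
       (RPut WEIGHT (at2 (cell VU) (cell VV)) (rcell BIG)))"
  define W where "W u v = (if mat h FLOW v u < mat h FLOW u v then 0 else big)" for u v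
  define h1 where "h1 = sem ?c1 h"
  define h2 where "h2 = sem walk h1"
  have nh: "nin h 0 = n" by (rule tables_nin[OF tb])
  have sm1: "same ?c1 h h1" and sm2: "same walk h1 h2" unfolding h1_def h2_def by (rule same_sem)+
  have tb1: "tables h1" by (subst tables_same[OF sm1]) (use tb in auto)
  have tb2: "tables h2" by (subst tables_same[OF sm2]) (use tb1 in auto)
  have nn: "nin h1 = nin h" "nin h2 = nin h" using sameD(1)[OF sm1] sameD(1)[OF sm2] by simp_all
  have W1: "rmat h1 WEIGHT u v = W u v" if "u < n" "v < n" for u v
    unfolding h1_def
  proof (rule pairs_rassign[OF _ _ nh _ that])
    fix g u v assume uv: "u < n" "v < n" and sm: "same ?c1 h g" and c: "narr g VU 0 = u" "narr g VV 0 = v"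
    have tg: "tables g" by (subst tables_same[OF sm]) (use tb in auto)
    have "narr g FLOW = narr h FLOW" using sameD(4)[OF sm, of FLOW] by simp
    then show "rarr (sem (Ifte (Lss (Arr FLOW (at2 (cell VV) (cell VU))) (Arr FLOW (at2 (cell VU) (cell VV))))
       (RPut WEIGHT (at2 (cell VU) (cell VV)) (RLit 0))
       (RPut WEIGHT (at2 (cell VU) (cell VV)) (rcell BIG))) g) WEIGHT = (rarr g WEIGHT)(idx n u v := W u v)"
      using tg tables_tabs[OF tg] tables_nin[OF tg] uv c nh by (simp add: W_def mat_def) (simp add: tables_def)
  qed auto
  have W0: "0 \<le> W u v" for u v using big_pos by (simp add: W_def)
  have "layered n s (rarr h1 BIG 0) (rmat h1 WEIGHT) (rmat h2 DIST) (mat h2 PRED)"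
    and T: "traced n (mat h2 PRED) t (narr h2 WALK)"
    using walk_correct[OF tables_tabs[OF tb1], of n s t] tables_nin[OF tb1] s t W0 W1
    by (simp_all add: h2_def)
  moreover have "relaxed n (rmat h1 WEIGHT) d d' P v = relaxed n W d d' P v" if "v < n" for d d' P v
    unfolding relaxed_def using W1 that by (cases "P v < n") auto
  moreover have "rarr h1 BIG 0 = big" using tb1 by (simp add: tables_def)
  ultimately have L: "layered n s big W (rmat h2 DIST) (mat h2 PRED)" by (simp add: layered_def)
  define R where "R = {(u, v). u < n \<and> v < n \<and> mat h FLOW v u < mat h FLOW u v}"
  have reach: "(s, t) \<in> R\<^sup>*"
  proof (rule ccontr)
    assume no: "(s, t) \<notin> R\<^sup>*"
    define A where "A = {v. v < n \<and> (s, v) \<in> R\<^sup>*}"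
    have A: "A \<subseteq> {..<n}" "s \<in> A" "t \<notin> A" using s no by (auto simp: A_def)
    have "mat h FLOW u v \<le> mat h FLOW v u" if "u \<in> A" "v < n" "v \<notin> A" for u v
    proof (rule ccontr)
      assume "\<not> mat h FLOW u v \<le> mat h FLOW v u"
      then have "(u, v) \<in> R" using that A by (auto simp: R_def)
      then show False using that by (auto simp: A_def intro: rtrancl_into_rtrancl)
    qed
    \<comment> \<open>With no arc of positive net flow leaving \<open>A\<close>, the net flow would
      be at most 0 instead of \<open>Suc k\<close>.\<close>
    then have "net n (mat h FLOW) A \<le> flux n (\<lambda>_ _. 0) A"
      unfolding net_def by (intro flux_mono) auto
    then show False using am A by (auto simp: amount_def flux_def)
  qed
  have "rmat h2 DIST n t \<le> (\<Sum>e\<in>({} :: nat set). cost I e)"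
    by (rule layered_le_edges[where en = "ends I", OF L W0 s _ _ reach]) (auto simp: R_def W_def)
  then have dist: "rmat h2 DIST n t \<le> 0" by simp
  then have "rmat h2 DIST n t < big" using big_pos by linarith
  note src = traced_source[OF L W0 T t _ this]
  have w0: "narr h2 WALK 0 = s" and sum: "(\<Sum>i<n. step W (narr h2 WALK) i) = rmat h2 DIST n t"
    using src big_pos by simp_all
  define w where "w = narr h2 WALK"
  have w: "w k < n" if "k \<le> n" for k using traced_less[OF L W0 T t that] by (simp add: w_def)
  have pos: "mat h FLOW (w (Suc k)) (w k) < mat h FLOW (w k) (w (Suc k))"
    if "k < n" "w k \<noteq> w (Suc k)" for k
  proof -
    have "step W w k \<le> (\<Sum>i<n. step W w i)"
      using that step_nonneg[OF L W0 T t] by (intro member_le_sum) (auto simp: w_def)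
    then have "W (w k) (w (Suc k)) \<le> 0" using sum dist that by (simp add: w_def step_def)
    then show ?thesis using big_pos by (auto simp: W_def split: if_splits)
  qed
  have arcs: "{w i, w (Suc i)} \<noteq> {w k, w (Suc k)}"
    if "i < k" "k < n" "w k \<noteq> w (Suc k)" "w i \<noteq> w (Suc i)" for i k
    using traced_arcs_distinct[OF L W0 T t] that by (simp add: w_def)
  have eq: "mat h2 FLOW = mat h FLOW" "cube h2 UNIT = cube h UNIT" "narr h2 RND 0 = i"
    using sameD(4)[OF sm1, of FLOW] sameD(4)[OF sm2, of FLOW] sameD(4)[OF sm1, of UNIT]
      sameD(4)[OF sm2, of UNIT] sameD(4)[OF sm1, of RND] sameD(4)[OF sm2, of RND] nn i
    by (simp_all add: mat_def[abs_def] cube_def[abs_def])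
  define J where "J k f \<longleftrightarrow>
     (\<forall>A\<subseteq>{..<n}. net n (mat f FLOW) A = net n (mat h FLOW) A - of_bool (w 0 \<in> A) + of_bool (w k \<in> A)) \<and>
     (\<forall>A\<subseteq>{..<n}. net n (cube f UNIT i) A = of_bool (w 0 \<in> A) - of_bool (w k \<in> A)) \<and>
     (\<forall>u<n. \<forall>v<n. cube f UNIT i u v \<le> 1 \<and>
        cube f UNIT i u v + (mat f FLOW u v - mat f FLOW v u) = mat h FLOW u v - mat h FLOW v u) \<and>
     (\<forall>u<n. \<forall>v<n. \<forall>j. j \<noteq> i \<longrightarrow> cube f UNIT j u v = cube h UNIT j u v) \<and>
     (\<forall>u<n. \<forall>v<n. (\<forall>j<k. w j \<noteq> w (Suc j) \<longrightarrow> {w j, w (Suc j)} \<noteq> {u, v}) \<longrightarrow>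
        mat f FLOW u v = mat h FLOW u v \<and> cube f UNIT i u v = 0)" for k f
  have J_cong: "J k f = J k f'" if "narr f FLOW = narr f' FLOW" "narr f UNIT = narr f' UNIT" "nin f = nin f'"
    for k f f'
    by (simp only: J_def mat_def[abs_def] cube_def[abs_def] that)
  let ?c = "Ifte (Cnj (Neg (Lss (cell TA) (cell TB))) (Neg (Lss (cell TB) (cell TA)))) Nop
        (Put UNIT (at3 (cell RND) (cell TA) (cell TB)) (Lit 1) ;;
         incr FLOW (at2 (cell TB) (cell TA)))"
  let ?loop = "Loop LAY 0 Verts (Put TA (Lit 0) (Arr WALK (cell LAY)) ;;
      Put TB (Lit 0) (Arr WALK (Pls (cell LAY) (Lit 1))) ;; ?c)"
  have "J n (sem ?loop h2)"
  proof (rule Loop_rule[where I = J], goal_cases)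
    case 1
    have "net n (cube h2 UNIT i) A = 0" if "A \<subseteq> {..<n}" for A
      using net_cong[of "cube h2 UNIT i" "\<lambda>_ _. 0" A] zero that by (simp add: eq net_def flux_def)
    then show ?case using zero by (simp add: J_def eq)
  next
    case (2 k f)
    note sm = 2(3)
    have k: "k < n" using 2(1) nh nn by simp
    have tf: "tables f" by (subst tables_same[OF sm]) (use tb2 in auto)
    have wf: "narr f WALK = w" "narr f RND 0 = i"
      using sameD(4)[OF sm, of WALK] sameD(4)[OF sm, of RND] eq by (simp_all add: w_def)
    note Jf = 2(2)[unfolded J_def]
    note net0 = Jf[THEN conjunct1] Jf[THEN conjunct2, THEN conjunct1]
      and le0 = Jf[THEN conjunct2, THEN conjunct2, THEN conjunct1]
        Jf[THEN conjunct2, THEN conjunct2, THEN conjunct2, THEN conjunct1]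
      and old0 = Jf[THEN conjunct2, THEN conjunct2, THEN conjunct2, THEN conjunct2]
    note net = net0[rule_format] and old = old0[rule_format]
    have le1: "cube f UNIT i u v \<le> 1"
      "cube f UNIT i u v + (mat f FLOW u v - mat f FLOW v u) = mat h FLOW u v - mat h FLOW v u"
      "j \<noteq> i \<Longrightarrow> cube f UNIT j u v = cube h UNIT j u v" if "u < n" "v < n" for u v j
      using le0 that by simp_all
    define u v where "u = w k" and "v = w (Suc k)"
    have uv: "u < n" "v < n" using w k by (simp_all add: u_def v_def)
    define g1 where "g1 = setn TB 0 v (setn TA 0 u (setn LAY 0 k f))"
    have body: "sem (Put TA (Lit 0) (Arr WALK (cell LAY)) ;;
      Put TB (Lit 0) (Arr WALK (Pls (cell LAY) (Lit 1))) ;; ?c) (setn LAY 0 k f) = sem ?c g1"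
      using wf by (simp add: g1_def u_def v_def)
    have n1: "nin g1 0 = n" "narr g1 RND 0 = i" "narr g1 FLOW = narr f FLOW" "narr g1 UNIT = narr f UNIT"
      "nin g1 = nin f" "narr g1 TA 0 = u" "narr g1 TB 0 = v"
      using tables_nin[OF tf] wf by (simp_all add: g1_def)
    show ?case
      unfolding body
    proof (cases "u = v")
      case True
      then have e: "sem ?c g1 = g1" by (simp add: g1_def)
      have "J (Suc k) f"
        unfolding J_def
      proof (intro conjI allI impI)
        fix x y assume "x < n" "y < n" "\<forall>j<Suc k. w j \<noteq> w (Suc j) \<longrightarrow> {w j, w (Suc j)} \<noteq> {x, y}"
        then show "mat f FLOW x y = mat h FLOW x y" "cube f UNIT i x y = 0" using old[of x y] by simp_all
      qed (use net le1 True in \<open>simp_all add: u_def v_def\<close>)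
      then show "J (Suc k) (sem ?c g1)" unfolding e using J_cong[OF n1(3-5)] by simp
    next
      case False
      define g3 where "g3 = setn FLOW (idx n v u) (Suc (mat f FLOW v u)) (setn UNIT (idx3 n i u v) 1 g1)"
      have tg: "tabs bound g1" using tables_tabs[OF tf] by (simp add: g1_def)
      have "\<not> beval (Cnj (Neg (Lss (cell TA) (cell TB))) (Neg (Lss (cell TB) (cell TA)))) g1"
        using False n1(6,7) by auto
      moreover have "sem (Put UNIT (at3 (cell RND) (cell TA) (cell TB)) (Lit 1) ;;
         incr FLOW (at2 (cell TB) (cell TA))) g1 = g3"
        using tg n1 uv i by (simp add: g3_def mat_def) 
      ultimately have e: "sem ?c g1 = g3"
        by (simp only: sem.simps(5) if_False)
      have n3: "nin g3 0 = n" using n1 by (simp add: g3_def)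
      have nf: "nin f 0 = n" by (rule tables_nin[OF tf])
      have fl: "mat g3 FLOW x y = inc v u (mat f FLOW) x y" if "x < n" "y < n" for x y
        using that uv n1 nf n3 unfolding g3_def inc_def mat_def by (auto simp: g3_def)
      have un': "cube g3 UNIT j x y = (if j = i \<and> x = u \<and> y = v then 1 else cube f UNIT j x y)"
        if "x < n" "y < n" for j x y
        using that uv n1 nf n3 unfolding g3_def cube_def by (auto simp: g3_def)
      have free: "\<forall>j<k. w j \<noteq> w (Suc j) \<longrightarrow> {w j, w (Suc j)} \<noteq> {u, v}"
        using arcs[of _ k] k False by (auto simp: u_def v_def)
      have new: "mat f FLOW u v = mat h FLOW u v" "cube f UNIT i u v = 0"
        "mat f FLOW v u = mat h FLOW v u" "cube f UNIT i v u = 0"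
        using old[OF uv] old[OF uv(2,1)] free by (auto simp: insert_commute)
      have un: "cube g3 UNIT i x y = inc u v (cube f UNIT i) x y" if "x < n" "y < n" for x y
        using un'[OF that] new(2) by (auto simp: inc_def)
      have ps: "mat h FLOW v u < mat h FLOW u v" using pos[OF k] False by (simp add: u_def v_def)
      show "J (Suc k) (sem ?c g1)"
        unfolding e J_def
      proof (intro conjI allI impI)
        fix A assume A: "A \<subseteq> {..<n}"
        have "net n (mat g3 FLOW) A = net n (inc v u (mat f FLOW)) A"
          by (rule net_cong) (use fl A in auto)
        then show "net n (mat g3 FLOW) A = net n (mat h FLOW) A - of_bool (w 0 \<in> A) + of_bool (w (Suc k) \<in> A)"
          using net_inc[OF A uv(2,1)] net[OF A] by (simp add: u_def v_def)
        have "net n (cube g3 UNIT i) A = net n (inc u v (cube f UNIT i)) A"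
          by (rule net_cong) (use un A in auto)
        then show "net n (cube g3 UNIT i) A = of_bool (w 0 \<in> A) - of_bool (w (Suc k) \<in> A)"
          using net_inc[OF A uv] net[OF A] by (simp add: u_def v_def)
      next
        fix x y assume xy: "x < n" "y < n"
        show "cube g3 UNIT i x y \<le> 1"
          using le1(1)[OF xy] new(2) unfolding un[OF xy] inc_def by auto
        show "cube g3 UNIT i x y + (mat g3 FLOW x y - mat g3 FLOW y x) = mat h FLOW x y - mat h FLOW y x"
        proof (cases "x = u \<and> y = v")
          case True
          then show ?thesis
            using new ps False unfolding un[OF xy] fl[OF xy] fl[OF xy(2,1)] inc_def by auto
        next
          case no: False
          show ?thesis
          proof (cases "x = v \<and> y = u")
            case True
            then have "x = v" "y = u" by simp_all
            then show ?thesis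
              using new ps False unfolding un[OF xy] fl[OF xy] fl[OF xy(2,1)] inc_def by auto
          next
            case no': False
            have "inc u v (cube f UNIT i) x y = cube f UNIT i x y" "inc v u (mat f FLOW) x y = mat f FLOW x y"
              "inc v u (mat f FLOW) y x = mat f FLOW y x"
              unfolding inc_def using no no' by presburger+
            then show ?thesis unfolding un[OF xy] fl[OF xy] fl[OF xy(2,1)] using le1(2)[OF xy] by simp
          qed
        qed
        show "cube g3 UNIT j x y = cube h UNIT j x y" if "j \<noteq> i" for j
          using un'[OF xy, of j] le1(3)[OF xy that] that by simp
      next
        fix x y assume xy: "x < n" "y < n"
          and no: "\<forall>j<Suc k. w j \<noteq> w (Suc j) \<longrightarrow> {w j, w (Suc j)} \<noteq> {x, y}"
        then have ne: "{u, v} \<noteq> {x, y}" using False by (auto simp: u_def v_def)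
        then have "\<not> (x = u \<and> y = v)" "\<not> (x = v \<and> y = u)" by auto
        then have "inc u v (cube f UNIT i) x y = cube f UNIT i x y" "inc v u (mat f FLOW) x y = mat f FLOW x y"
          unfolding inc_def by presburger+
        moreover have "\<forall>j<k. w j \<noteq> w (Suc j) \<longrightarrow> {w j, w (Suc j)} \<noteq> {x, y}" using no by simp
        ultimately show "mat g3 FLOW x y = mat h FLOW x y" "cube g3 UNIT i x y = 0"
          using old[OF xy] fl[OF xy] un[OF xy] by simp_all
      qed
    qed
  next
    case (3 f)
    have "bval_of Verts h2 = n" using nh nn by simp
    moreover have "J n (setn LAY 0 n f) = J n f" by (rule J_cong) simp_all
    ultimately show ?case using 3(1) by simp
  qed
  moreover have "sem ?loop h2 = g" by (simp only: g_def peel_def sem.simps(4) h1_def h2_def)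
  ultimately have Jn: "J n g" by simp
  have wn: "w n = t" "w 0 = s" using T w0 by (simp_all add: traced_def w_def)
  note Jn = Jn[unfolded J_def]
  note J1 = Jn[THEN conjunct1] and J2 = Jn[THEN conjunct2, THEN conjunct1]
    and J3 = Jn[THEN conjunct2, THEN conjunct2, THEN conjunct1]
      Jn[THEN conjunct2, THEN conjunct2, THEN conjunct2, THEN conjunct1]
  show "amount g k" using J1 am by (simp add: amount_def wn)
  show "net n (cube g UNIT i) A = 1" if "A \<subseteq> {..<n}" "s \<in> A" "t \<notin> A" for A
    using J2 that by (simp add: wn)
  show "cube g UNIT i u v \<le> 1"
    "cube g UNIT i u v + (mat g FLOW u v - mat g FLOW v u) = mat h FLOW u v - mat h FLOW v u"
    "j \<noteq> i \<Longrightarrow> cube g UNIT j u v = cube h UNIT j u v" if "u < n" "v < n" for u v j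
    using J3 that by simp_all
qed

text \<open>The load counts both directions together and is compared with the capacities of
  \<open>F\<close>. It stays admissible when \<open>F\<close> grows, so one decomposition serves all
  stages.\<close>

definition units :: "(nat \<Rightarrow> nat \<Rightarrow> nat \<Rightarrow> nat) \<Rightarrow> nat set \<Rightarrow> bool" where
  "units U F \<longleftrightarrow>
     (\<forall>i<p * (p + q). (\<forall>u<n. \<forall>v<n. U i u v \<le> 1) \<and>
        (\<forall>A\<subseteq>{..<n}. s \<in> A \<longrightarrow> t \<notin> A \<longrightarrow> net n (U i) A = 1)) \<and>
     (\<forall>u<n. \<forall>v<n. u \<noteq> v \<longrightarrow> (\<Sum>i<p * (p + q). U i u v + U i v u) \<le> capa p q F u v)"

lemma capa_sym: "capa a b F u v = capa a b F v u"
  unfolding capa_def mult_sym[of I _ u v] ..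

text \<open>Of the two opposite positive parts of the net flow at a pair, one is 0. Hence the unit
  flows in both directions together stay within a single capacity.\<close>

lemma decompose_correct:
  assumes tb: "tables h" and am: "amount h (p * (p + q))" and val: "valid p q h F"
    and free: "\<And>u v. u < n \<Longrightarrow> v < n \<Longrightarrow> mat h FREE u v = 0"
    and zero: "\<And>i u v. u < n \<Longrightarrow> v < n \<Longrightarrow> cube h UNIT i u v = 0"
  defines "g \<equiv> sem (decompose (p * (p + q))) h"
  shows "units (cube g UNIT) F"
proof -
  define N where "N = p * (p + q)"
  define J where "J i f \<longleftrightarrow> i \<le> N \<and> amount f (N - i) \<and>
     (\<forall>j<i. (\<forall>u<n. \<forall>v<n. cube f UNIT j u v \<le> 1) \<and>
        (\<forall>A\<subseteq>{..<n}. s \<in> A \<longrightarrow> t \<notin> A \<longrightarrow> net n (cube f UNIT j) A = 1)) \<and>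
     (\<forall>u<n. \<forall>v<n. (\<Sum>j<i. cube f UNIT j u v) + (mat f FLOW u v - mat f FLOW v u) =
        mat h FLOW u v - mat h FLOW v u) \<and>
     (\<forall>j\<ge>i. \<forall>u<n. \<forall>v<n. cube f UNIT j u v = 0)" for i f
  have J_setn: "J k (setn RND 0 x f) = J k f" for k x f
    by (simp only: J_def amount_def) (simp add: mat_def[abs_def] cube_def[abs_def])
  have "J N g"
    unfolding g_def decompose_def N_def[symmetric]
  proof (rule Loop_rule[where I = J], goal_cases)
    case 1
    show ?case using am zero by (simp add: J_def N_def)
  next
    case (2 i f)
    have i: "i < N" using 2(1) by simp
    let ?f = "setn RND 0 i f" and ?g = "sem peel (setn RND 0 i f)"
    have "tables f" by (subst tables_same[OF 2(3)]) (use tb in auto)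
    then have tf: "tables ?f" using tables_cong[of ?f f] by simp
    have Jf: "J i ?f" using 2(2) J_setn by simp
    have "amount ?f (Suc (N - Suc i))" using Jf i by (simp add: J_def Suc_diff_Suc)
    note E = peel_correct[OF tf this, of i]
    have E: "amount ?g (N - Suc i)"
      "\<And>A. A \<subseteq> {..<n} \<Longrightarrow> s \<in> A \<Longrightarrow> t \<notin> A \<Longrightarrow> net n (cube ?g UNIT i) A = 1"
      "\<And>u v. u < n \<Longrightarrow> v < n \<Longrightarrow> cube ?g UNIT i u v \<le> 1"
      "\<And>u v. u < n \<Longrightarrow> v < n \<Longrightarrow>
        cube ?g UNIT i u v + (mat ?g FLOW u v - mat ?g FLOW v u) = mat ?f FLOW u v - mat ?f FLOW v u"
      "\<And>u v j. u < n \<Longrightarrow> v < n \<Longrightarrow> j \<noteq> i \<Longrightarrow> cube ?g UNIT j u v = cube ?f UNIT j u v"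
      using E Jf i by (simp_all add: J_def N_def)
    show ?case
      unfolding J_def
    proof (intro conjI allI impI)
      fix j A assume "j < Suc i" "A \<subseteq> {..<n}" "s \<in> A" "t \<notin> A"
      moreover have "net n (cube ?g UNIT j) A = net n (cube ?f UNIT j) A" if "j < i"
        using that \<open>A \<subseteq> {..<n}\<close> E(5) by (intro net_cong) auto
      ultimately show "net n (cube ?g UNIT j) A = 1"
        using Jf E(2) by (cases "j = i") (simp_all add: J_def less_Suc_eq)
    next
      fix u v assume uv: "u < n" "v < n"
      have "(\<Sum>j<i. cube ?g UNIT j u v) = (\<Sum>j<i. cube ?f UNIT j u v)"
        using uv E(5) by (intro sum.cong) auto
      moreover have "(\<Sum>j<i. cube ?f UNIT j u v) + (mat ?f FLOW u v - mat ?f FLOW v u) =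
        mat h FLOW u v - mat h FLOW v u"
        using Jf uv unfolding J_def by (elim conjE) simp
      ultimately show "(\<Sum>j<Suc i. cube ?g UNIT j u v) + (mat ?g FLOW u v - mat ?g FLOW v u) =
        mat h FLOW u v - mat h FLOW v u"
        using E(4)[OF uv] by simp
      show "cube ?g UNIT j u v \<le> 1" if "j < Suc i" for j
        using Jf E(3,5) uv that by (cases "j = i") (simp_all add: J_def less_Suc_eq)
      show "cube ?g UNIT j u v = 0" if "Suc i \<le> j" for j
        using Jf E(5)[OF uv, of j] uv that by (simp add: J_def)
    qed (use i E(1) in simp_all)
  next
    case (3 f)
    then show ?case using J_setn by simp
  qed
  have load: "(\<Sum>j<N. cube g UNIT j u v) \<le> mat h FLOW u v - mat h FLOW v u" if "u < n" "v < n" for u v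
  proof -
    have "(\<Sum>j<N. cube g UNIT j u v) + (mat g FLOW u v - mat g FLOW v u) = mat h FLOW u v - mat h FLOW v u"
      using \<open>J N g\<close> that unfolding J_def by (elim conjE) simp
    then show ?thesis by linarith
  qed
  have "(\<Sum>j<N. cube g UNIT j u v + cube g UNIT j v u) \<le> capa p q F u v" if "u < n" "v < n" "u \<noteq> v" for u v
  proof -
    have "mat h FLOW u v - mat h FLOW v u \<le> capa p q F u v" "mat h FLOW v u - mat h FLOW u v \<le> capa p q F u v"
      using val[unfolded valid_def, rule_format, of u v] val[unfolded valid_def, rule_format, of v u]
        that free capa_sym[of p q F v u] by auto
    then show ?thesis using load[OF that(1,2)] load[OF that(2,1)] by (simp add: sum.distrib)
  qed
  moreover have "\<forall>j<N. (\<forall>u<n. \<forall>v<n. cube g UNIT j u v \<le> 1) \<and>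
      (\<forall>A\<subseteq>{..<n}. s \<in> A \<longrightarrow> t \<notin> A \<longrightarrow> net n (cube g UNIT j) A = 1)"
    using \<open>J N g\<close> unfolding J_def by (elim conjE) assumption
  ultimately show ?thesis unfolding units_def N_def[symmetric] by simp
qed

end

section \<open>Covering violated cuts\<close>

primrec nest :: "nat \<Rightarrow> prog \<Rightarrow> prog" where
  "nest 0 c = c"
| "nest (Suc d) c = Loop TUPLE d Verts (nest d c)"

lemma nest_writes: "writes (nest d c) k i \<longleftrightarrow> k = TUPLE \<and> i < d \<or> writes c k i"
  by (induction d) auto

lemma nest_rwrites [simp]: "rwrites (nest d c) k \<longleftrightarrow> rwrites c k"
  by (induction d) auto

lemma nest_legal: "legal c \<Longrightarrow> (\<And>i. \<not> writes c TUPLE i) \<Longrightarrow> legal (nest d c)"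
  by (induction d) (auto simp: nest_writes)

text \<open>\<open>P w\<close> expresses that the tuple \<open>w\<close> has been dealt with. Every
  later step has to preserve it, for the conclusion collects it for all tuples after the last
  iteration.\<close>

lemma nest_rule:
  assumes nw: "\<And>i. \<not> writes c TUPLE i"
    and I: "\<And>i x g. I g \<Longrightarrow> I (setn TUPLE i x g)"
    and P: "\<And>w i x g. P w g \<Longrightarrow> P w (setn TUPLE i x g)"
    and step: "\<And>g. I g \<Longrightarrow> nin g 0 = n \<Longrightarrow> (\<And>i. i < e \<Longrightarrow> narr g TUPLE i < n) \<Longrightarrow>
      I (sem c g) \<and> P (narr g TUPLE) (sem c g) \<and> (\<forall>w. P w g \<longrightarrow> P w (sem c g))"
    and h: "I h" "nin h 0 = n" "\<And>i. d \<le> i \<Longrightarrow> i < e \<Longrightarrow> narr h TUPLE i < n"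
  shows "I (sem (nest d c) h) \<and>
    (\<forall>w. (\<forall>i<d. w i < n) \<and> (\<forall>i\<ge>d. w i = narr h TUPLE i) \<longrightarrow> P w (sem (nest d c) h)) \<and>
    (\<forall>w. P w h \<longrightarrow> P w (sem (nest d c) h))"
  using h
proof (induction d arbitrary: h)
  case 0
  have "P w (sem c h)" if "\<forall>i. w i = narr h TUPLE i" for w
  proof -
    have "w = narr h TUPLE" using that by blast
    then show ?thesis using step 0 by simp
  qed
  then show ?case using step 0 by simp
next
  case (Suc d)
  let ?J = "\<lambda>j g. I g \<and>
    (\<forall>w. (\<forall>i<d. w i < n) \<and> w d < j \<and> (\<forall>i>d. w i = narr h TUPLE i) \<longrightarrow> P w g) \<and> (\<forall>w. P w h \<longrightarrow> P w g)"
  have "?J n (sem (nest (Suc d) c) h)"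
    unfolding nest.simps
  proof (rule Loop_rule[where I = ?J], goal_cases)
    case 1
    then show ?case using Suc.prems by simp
  next
    case (2 j g)
    have j: "j < n" using 2(1) Suc.prems by simp
    let ?g = "setn TUPLE d j g"
    have ng: "nin ?g 0 = n" using sameD(1)[OF 2(3)] Suc.prems by simp
    have fr: "narr g TUPLE i = narr h TUPLE i" if "d < i" for i
      using sameD(3)[OF 2(3), of TUPLE i] that nw by (simp add: nest_writes)
    have IH: "I (sem (nest d c) ?g) \<and>
      (\<forall>w. (\<forall>i<d. w i < n) \<and> (\<forall>i\<ge>d. w i = narr ?g TUPLE i) \<longrightarrow> P w (sem (nest d c) ?g)) \<and>
      (\<forall>w. P w ?g \<longrightarrow> P w (sem (nest d c) ?g))"
    proof (rule Suc.IH)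
      show "narr ?g TUPLE i < n" if "d \<le> i" "i < e" for i
        using Suc.prems(3)[of i] fr[of i] that j by (cases "i = d") auto
    qed (use 2(2) I ng in auto)
    show ?case
    proof (intro conjI allI impI)
      fix w assume w: "(\<forall>i<d. w i < n) \<and> w d < Suc j \<and> (\<forall>i>d. w i = narr h TUPLE i)"
      show "P w (sem (nest d c) ?g)"
      proof (cases "w d = j")
        case True
        then have "\<forall>i\<ge>d. w i = narr ?g TUPLE i" using w fr by (auto simp: le_less)
        then show ?thesis using IH w by blast
      next
        case False
        then have "P w g" using 2(2) w by (auto simp: less_Suc_eq)
        then show ?thesis using IH P by blast
      qed
    qed (use IH 2(2) P in blast)+
  next
    case (3 g)
    then show ?case using I P Suc.prems(2) by (auto simp: less_Suc_eq)
  qed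
  then show ?case by (auto simp: less_Suc_eq Suc_le_eq)
qed

text \<open>A tuple lists the tails of \<open>d\<close> pairs, followed by their heads. These pairs
  act as walls in the graph of the solution, and arcs of weight 0 from \<open>s\<close> to all tails
  give entry to every part of the source side that touches the cut. The entries are written after
  the walls, so that no wall blocks one.\<close>

definition side :: "nat \<Rightarrow> prog" where
  "side d =
     pairs (Ifte (Lss (Lit 0) (Arr DEG (at2 (cell VU) (cell VV))))
       (RPut WEIGHT (at2 (cell VU) (cell VV)) (RLit 0))
       (RPut WEIGHT (at2 (cell VU) (cell VV)) (rcell BIG))) ;;
     Loop PATH 0 (Times d)
       (RPut WEIGHT (at2 (Arr TUPLE (cell PATH)) (Arr TUPLE (Pls (Lit d) (cell PATH)))) (rcell BIG) ;;
        RPut WEIGHT (at2 (Arr TUPLE (Pls (Lit d) (cell PATH))) (Arr TUPLE (cell PATH))) (rcell BIG)) ;;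
     Loop PATH 0 (Times d) (RPut WEIGHT (at2 (Inp 2) (Arr TUPLE (cell PATH))) (RLit 0)) ;;
     walk ;;
     Loop VV 0 Verts
       (Ifte (RLss (RArr DIST (at2 (Inp 0) (cell VV))) (rcell BIG))
         (Put SIDE (cell VV) (Lit 1)) (Put SIDE (cell VV) (Lit 0)))"

definition leaves :: "nx \<Rightarrow> nx \<Rightarrow> bx" where
  "leaves u v = Cnj (Lss (Lit 0) (Arr SIDE u)) (Neg (Lss (Lit 0) (Arr SIDE v)))"

definition measure_cut :: prog where
  "measure_cut = Put SUMD (Lit 0) (Lit 0) ;; Put SUMX (Lit 0) (Lit 0) ;;
     pairs (Ifte (leaves (cell VU) (cell VV))
       (Put SUMD (Lit 0) (Pls (cell SUMD) (Arr DEG (at2 (cell VU) (cell VV)))) ;;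
        Put SUMX (Lit 0) (Pls (cell SUMX) (Arr SDEG (at2 (cell VU) (cell VV))))) Nop)"

definition greedy :: "nat \<Rightarrow> prog" where
  "greedy N = pairs (Put SUB (at2 (cell VU) (cell VV)) (Lit 0)) ;;
     Loop PATH 0 (Times N)
       (Put OKAY (Lit 0) (Lit 1) ;;
        pairs (Ifte (Cnj (leaves (cell VU) (cell VV))
            (Neg (Cnj (Neg (Lss (Lit 0) (Arr UNIT (at3 (cell PATH) (cell VV) (cell VU)))))
              (Neg (Lss (Arr SDEG (at2 (cell VU) (cell VV)))
                (Pls (Arr SUB (at2 (cell VU) (cell VV))) (Arr UNIT (at3 (cell PATH) (cell VU) (cell VV)))))))))
          (Put OKAY (Lit 0) (Lit 0)) Nop) ;;
        Ifte (Lss (Lit 0) (cell OKAY))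
          (pairs (Put SUB (at2 (cell VU) (cell VV))
            (Pls (Arr SUB (at2 (cell VU) (cell VV))) (Arr UNIT (at3 (cell PATH) (cell VU) (cell VV)))))) Nop)"

text \<open>An arc is not free exactly if the chosen units fill its safe edges and avoid its
  reverse. So a set that no free arc leaves is one that the chosen units saturate, just as they
  saturate the cut that was found.\<close>

definition set_free :: prog where
  "set_free =
     pairs (Ifte (Cnj (Neg (Lss (Lit 0) (Arr SUB (at2 (cell VV) (cell VU)))))
         (Cnj (Neg (Lss (Arr SUB (at2 (cell VU) (cell VV))) (Arr SDEG (at2 (cell VU) (cell VV)))))
            (Neg (Lss (Arr SDEG (at2 (cell VU) (cell VV))) (Arr SUB (at2 (cell VU) (cell VV)))))))
       (Put FREE (at2 (cell VU) (cell VV)) (Lit 0)) (Put FREE (at2 (cell VU) (cell VV)) (Lit 1))) ;;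
     pairs (Put FLOW (at2 (cell VU) (cell VV)) (Lit 0))"

definition cover :: "nat \<Rightarrow> nat \<Rightarrow> nat \<Rightarrow> prog" where
  "cover p q r = side (p + q) ;; measure_cut ;;
     Ifte (Cnj (Neg (Lss (Lit 0) (Arr SIDE (Inp 3))))
         (Cnj (Cnj (Neg (Lss (cell SUMD) (Lit r))) (Neg (Lss (Lit r) (cell SUMD)))) (Lss (cell SUMX) (Lit p))))
       (greedy (p * (p + q)) ;; set_free ;; saturate (Suc r) 1 0) Nop"

lemma leaves_legal [simp]: "nlegal u \<Longrightarrow> nlegal v \<Longrightarrow> blegal (leaves u v)"
  by (simp add: leaves_def)

lemma side_simps [simp]:
  "writes (side d) k i \<longleftrightarrow> k \<in> {VU, VV, LAY, PATH} \<and> i = 0 \<or> k \<in> {PRED, WALK, SIDE}"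
  "rwrites (side d) k \<longleftrightarrow> k \<in> {WEIGHT, DIST}" "legal (side d)"
  by (auto simp: side_def)

lemma measure_cut_simps [simp]:
  "writes measure_cut k i \<longleftrightarrow> k \<in> {VU, VV} \<and> i = 0 \<or> k \<in> {SUMD, SUMX}"
  "\<not> rwrites measure_cut k" "legal measure_cut"
  by (auto simp: measure_cut_def)

lemma greedy_simps [simp]:
  "writes (greedy N) k i \<longleftrightarrow> k \<in> {VU, VV, PATH} \<and> i = 0 \<or> k \<in> {SUB, OKAY}"
  "\<not> rwrites (greedy N) k" "legal (greedy N)"
  by (auto simp: greedy_def)

lemma set_free_simps [simp]:
  "writes set_free k i \<longleftrightarrow> k \<in> {VU, VV} \<and> i = 0 \<or> k \<in> {FREE, FLOW}"
  "\<not> rwrites set_free k" "legal set_free"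
  by (auto simp: set_free_def)

lemma cover_simps [simp]:
  "writes (cover p q r) k i \<longleftrightarrow> k \<in> {VU, VV, LAY, PATH, RND} \<and> i = 0 \<or>
     k \<in> {PRED, WALK, SIDE, SUMD, SUMX, SUB, OKAY, FREE, TA, TB, EDGE, SOL, SDEG, DEG, FLOW}"
  "rwrites (cover p q r) k \<longleftrightarrow> k \<in> {WEIGHT, DIST}" "legal (cover p q r)"
  by (auto simp: cover_def)

context flex_problem
begin

text \<open>Weights are 0 or \<open>big\<close>, so a single arc of weight \<open>big\<close>
  already spoils a walk, and distances below \<open>big\<close> express reachability by arcs of
  weight 0.\<close>

lemma walk_reach:
  assumes tb: "tables h" and W: "\<And>u v. u < n \<Longrightarrow> v < n \<Longrightarrow> rmat h WEIGHT u v \<in> {0, big}"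
    and v: "v < n"
  shows "rmat (sem walk h) DIST n v < big \<longleftrightarrow>
    (s, v) \<in> {(u, v). u < n \<and> v < n \<and> rmat h WEIGHT u v = 0}\<^sup>*"
proof -
  define Wm where "Wm = rmat h WEIGHT"
  define d where "d = rmat (sem walk h) DIST"
  define R where "R = {(u, v). u < n \<and> v < n \<and> Wm u v = 0}"
  have W0: "0 \<le> Wm u v" if "u < n" "v < n" for u v
    using W[OF that] big_pos by (auto simp: Wm_def)
  have B: "rarr h BIG 0 = big" using tb by (simp add: tables_def)
  have L: "layered n s big Wm d (mat (sem walk h) PRED)"
    using walk_correct(1)[OF tables_tabs[OF tb], of n s t] tables_nin[OF tb] s t W0 B
    by (simp add: Wm_def d_def)
  have "(s, v) \<in> R\<^sup>*" if "k \<le> n" "v < n" "d k v < big" for k v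
    using that
  proof (induction k arbitrary: v)
    case 0
    then show ?case using layered_base[OF L W0, of v] by (auto split: if_splits)
  next
    case (Suc k)
    define u where "u = mat (sem walk h) PRED k v"
    have k: "k < n" using Suc.prems by simp
    have u: "u < n" "d (Suc k) v = d k u + (if u = v then 0 else Wm u v)"
      using layered_step(1,2)[OF L W0 k Suc.prems(2)] by (simp_all add: u_def)
    have "0 \<le> d k u" using layered_nonneg[OF L W0 _ _ u(1)] big_pos k by simp
    have "Wm u v = 0" if "u \<noteq> v"
      using W[OF u(1) Suc.prems(2)] u(2) that Suc.prems(3) \<open>0 \<le> d k u\<close> by (auto simp: Wm_def)
    moreover have "d k u < big" using u Suc.prems(3) W0[OF u(1) Suc.prems(2)] by (auto split: if_splits)
    then have "(s, u) \<in> R\<^sup>*" using Suc.IH[of u] u(1) k by simp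
    ultimately show ?case
      using u(1) Suc.prems(2) by (cases "u = v") (auto simp: R_def intro: rtrancl_into_rtrancl)
  qed
  moreover have "d n v \<le> 0" if "(s, v) \<in> R\<^sup>*"
  proof -
    have "d n v \<le> (\<Sum>e\<in>({} :: nat set). cost I e)"
      by (rule layered_le_edges[where en = "ends I", OF L W0 s _ _ that]) (auto simp: R_def)
    then show ?thesis by simp
  qed
  ultimately show ?thesis using v big_pos by (fastforce simp: d_def R_def Wm_def)
qed

text \<open>Positions left over are padded with the pair \<open>(s, s)\<close>, which blocks no arc
  between different vertices and gives entry to nothing new.\<close>

definition enumerates :: "(nat \<Rightarrow> nat) \<Rightarrow> nat set \<Rightarrow> nat set \<Rightarrow> bool" where
  "enumerates w F A \<longleftrightarrow>
     (\<forall>i<p + q. w i \<in> A \<and> w (p + q + i) < n \<and> w (p + q + i) \<notin> A \<or> w i = s \<and> w (p + q + i) = s) \<and>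
     (\<forall>u\<in>A. \<forall>v<n. v \<notin> A \<longrightarrow> 0 < mult I F u v \<longrightarrow> (\<exists>i<p + q. u = w i \<and> v = w (p + q + i)))"

definition on_side :: "store \<Rightarrow> nat set" where
  "on_side h = {v. v < n \<and> narr h SIDE v \<noteq> 0}"

text \<open>\<open>S\<close> may be smaller than \<open>A\<close>, since parts of \<open>A\<close>
  that touch neither \<open>s\<close> nor the cut are missed. But all tails of crossing pairs are
  entries, and the walls keep \<open>S\<close> inside \<open>A\<close>. So both sets are left by the
  same edges, which is all that counting can see.\<close>

lemma side_correct:
  assumes sol: "solution h F" and tup: "\<And>i. i < 2 * (p + q) \<Longrightarrow> narr h TUPLE i < n"
  defines "S \<equiv> on_side (sem (side (p + q)) h)"
  shows "s \<in> S"
    "A \<subseteq> {..<n} \<Longrightarrow> s \<in> A \<Longrightarrow> enumerates (narr h TUPLE) F A \<Longrightarrow>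
      S \<subseteq> A \<and> (\<forall>u<n. \<forall>v<n. 0 < mult I F u v \<longrightarrow> (u \<in> S \<and> v \<notin> S \<longleftrightarrow> u \<in> A \<and> v \<notin> A))"
proof -
  define w where "w = narr h TUPLE"
  define d where "d = p + q"
  have w: "w i < n" "w (d + i) < n" if "i < d" for i using tup that by (auto simp: w_def d_def)
  have tb: "tables h" using sol by (simp add: solution_def)
  have nh: "nin h 0 = n" by (rule tables_nin[OF tb])
  define c1 where "c1 = pairs (Ifte (Lss (Lit 0) (Arr DEG (at2 (cell VU) (cell VV))))
       (RPut WEIGHT (at2 (cell VU) (cell VV)) (RLit 0))
       (RPut WEIGHT (at2 (cell VU) (cell VV)) (rcell BIG)))"
  define b2 where "b2 = (RPut WEIGHT (at2 (Arr TUPLE (cell PATH)) (Arr TUPLE (Pls (Lit d) (cell PATH)))) (rcell BIG) ;;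
        RPut WEIGHT (at2 (Arr TUPLE (Pls (Lit d) (cell PATH))) (Arr TUPLE (cell PATH))) (rcell BIG))"
  define c2 where "c2 = Loop PATH 0 (Times d) b2"
  define b3 where "b3 = RPut WEIGHT (at2 (Inp 2) (Arr TUPLE (cell PATH))) (RLit 0)"
  define c3 where "c3 = Loop PATH 0 (Times d) b3"
  define b5 where "b5 = (Ifte (RLss (RArr DIST (at2 (Inp 0) (cell VV))) (rcell BIG))
         (Put SIDE (cell VV) (Lit 1)) (Put SIDE (cell VV) (Lit 0)))"
  define c5 where "c5 = Loop VV 0 Verts b5"
  have prog: "side d = (c1 ;; c2 ;; c3 ;; walk ;; c5)"
    by (simp only: side_def c1_def c2_def c3_def c5_def b2_def b3_def b5_def)
  define h1 where "h1 = sem c1 h"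
  define h2 where "h2 = sem c2 h1"
  define h3 where "h3 = sem c3 h2"
  define h4 where "h4 = sem walk h3"
  define h5 where "h5 = sem c5 h4"
  have sm: "same c1 h h1" "same c2 h1 h2" "same c3 h2 h3" "same walk h3 h4" "same c5 h4 h5"
    unfolding h1_def h2_def h3_def h4_def h5_def by (rule same_sem)+
  have wr [simp]: "writes c1 k i \<longleftrightarrow> k \<in> {VU, VV} \<and> i = 0" "rwrites c1 k \<longleftrightarrow> k = WEIGHT"
    "writes c2 k i \<longleftrightarrow> k = PATH \<and> i = 0" "rwrites c2 k \<longleftrightarrow> k = WEIGHT"
    "writes c3 k i \<longleftrightarrow> k = PATH \<and> i = 0" "rwrites c3 k \<longleftrightarrow> k = WEIGHT"
    "writes c5 k i \<longleftrightarrow> k = VV \<and> i = 0 \<or> k = SIDE" "\<not> rwrites c5 k" for k i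
    by (auto simp: c1_def c2_def c3_def c5_def b2_def b3_def b5_def)
  have tb1: "tables h1" by (subst tables_same[OF sm(1)]) (use tb in auto)
  have tb2: "tables h2" by (subst tables_same[OF sm(2)]) (use tb1 in auto)
  have tb3: "tables h3" by (subst tables_same[OF sm(3)]) (use tb2 in auto)
  have tb4: "tables h4" by (subst tables_same[OF sm(4)]) (use tb3 in auto)
  have tu: "narr h1 TUPLE = w" "narr h2 TUPLE = w" "narr h3 TUPLE = w"
    using sameD(4)[OF sm(1), of TUPLE] sameD(4)[OF sm(2), of TUPLE] sameD(4)[OF sm(3), of TUPLE]
    by (simp_all add: w_def)
  define W1 where "W1 u v = (if 0 < mult I F u v then 0 else big)" for u v
  have W1: "rmat h1 WEIGHT u v = W1 u v" if "u < n" "v < n" for u v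
    unfolding h1_def c1_def
  proof (rule pairs_rassign[OF _ _ nh _ that])
    fix g u v assume uv: "u < n" "v < n" and sg: "same (pairs (Ifte (Lss (Lit 0) (Arr DEG (at2 (cell VU) (cell VV))))
       (RPut WEIGHT (at2 (cell VU) (cell VV)) (RLit 0))
       (RPut WEIGHT (at2 (cell VU) (cell VV)) (rcell BIG)))) h g" and c: "narr g VU 0 = u" "narr g VV 0 = v"
    have tg: "tables g" by (subst tables_same[OF sg]) (use tb in auto)
    have "narr g DEG = narr h DEG" using sameD(4)[OF sg, of DEG] by simp
    moreover have "rarr g BIG 0 = big" using tg by (simp add: tables_def)
    ultimately show "rarr (sem (Ifte (Lss (Lit 0) (Arr DEG (at2 (cell VU) (cell VV))))
       (RPut WEIGHT (at2 (cell VU) (cell VV)) (RLit 0))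
       (RPut WEIGHT (at2 (cell VU) (cell VV)) (rcell BIG))) g) WEIGHT = (rarr g WEIGHT)(idx n u v := W1 u v)"
      using tables_tabs[OF tg] tables_nin[OF tg] uv c solution_deg(3)[OF sol uv] by (simp add: W1_def)
  qed auto
  define rem where "rem i u v \<longleftrightarrow> (\<exists>j<i. u = w j \<and> v = w (d + j) \<or> u = w (d + j) \<and> v = w j)" for i u v
  have W2: "\<forall>u<n. \<forall>v<n. rarr h2 WEIGHT (idx n u v) = (if rem d u v then big else W1 u v)"
    unfolding h2_def c2_def
  proof (rule Loop_rule[where I = "\<lambda>i g. \<forall>u<n. \<forall>v<n. rarr g WEIGHT (idx n u v) = (if rem i u v then big else W1 u v)"], goal_cases)
    case 1
    show ?case using W1 tables_nin[OF tb1] by (simp add: rem_def rmat_def)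
  next
    case (2 i g)
    have i: "i < d" using 2(1) by simp
    have tg: "tables g" by (subst tables_same[OF 2(3)[folded c2_def]]) (use tb1 in auto)
    have B: "rarr g BIG 0 = big" using tg by (simp add: tables_def)
    have tug: "narr g TUPLE = w" using sameD(4)[OF 2(3)[folded c2_def], of TUPLE] tu by simp
    have e: "rarr (sem b2 (setn PATH 0 i g)) WEIGHT =
        (rarr g WEIGHT)(idx n (w i) (w (d + i)) := big, idx n (w (d + i)) (w i) := big)"
      using tables_tabs[OF tg] tables_nin[OF tg] w[OF i] B by (simp add: b2_def tug)
    show ?case
    proof (intro allI impI)
      fix u v assume uv: "u < n" "v < n"
      have "idx n u v = idx n (w i) (w (d + i)) \<longleftrightarrow> u = w i \<and> v = w (d + i)"
        "idx n u v = idx n (w (d + i)) (w i) \<longleftrightarrow> u = w (d + i) \<and> v = w i"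
        using uv w[OF i] by auto
      moreover have "rem (Suc i) u v \<longleftrightarrow> rem i u v \<or> u = w i \<and> v = w (d + i) \<or> u = w (d + i) \<and> v = w i"
        unfolding rem_def less_Suc_eq by blast
      moreover have "rarr g WEIGHT (idx n u v) = (if rem i u v then big else W1 u v)"
        using 2(2) uv by blast
      ultimately show "rarr (sem b2 (setn PATH 0 i g)) WEIGHT (idx n u v) = (if rem (Suc i) u v then big else W1 u v)"
        unfolding e fun_upd_apply by presburger
    qed
  qed simp
  define W3 where "W3 u v = (if u = s \<and> (\<exists>j<d. v = w j) then 0 else if rem d u v then big else W1 u v)" for u v
  have W3: "\<forall>u<n. \<forall>v<n. rarr h3 WEIGHT (idx n u v) = W3 u v"
  proof -
    have "\<forall>u<n. \<forall>v<n. rarr h3 WEIGHT (idx n u v) =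
        (if u = s \<and> (\<exists>j<d. v = w j) then 0 else if rem d u v then big else W1 u v)"
      unfolding h3_def c3_def
    proof (rule Loop_rule[where I = "\<lambda>i g. \<forall>u<n. \<forall>v<n. rarr g WEIGHT (idx n u v) =
        (if u = s \<and> (\<exists>j<i. v = w j) then 0 else if rem d u v then big else W1 u v)"], goal_cases)
      case 1
      show ?case using W2 by simp
    next
      case (2 i g)
      have i: "i < d" using 2(1) by simp
      have tg: "tables g" by (subst tables_same[OF 2(3)[folded c3_def]]) (use tb2 in auto)
      have tug: "narr g TUPLE = w" using sameD(4)[OF 2(3)[folded c3_def], of TUPLE] tu by simp
      have e: "rarr (sem b3 (setn PATH 0 i g)) WEIGHT = (rarr g WEIGHT)(idx n s (w i) := 0)"
        using tables_tabs[OF tg] tables_nin[OF tg] w[OF i] s by (simp add: b3_def tug)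
      show ?case
      proof (intro allI impI)
        fix u v assume uv: "u < n" "v < n"
        have "idx n u v = idx n s (w i) \<longleftrightarrow> u = s \<and> v = w i"
          using uv w[OF i] by auto
        moreover have "(\<exists>j<Suc i. v = w j) \<longleftrightarrow> (\<exists>j<i. v = w j) \<or> v = w i" by (auto simp: less_Suc_eq)
        moreover have "rarr g WEIGHT (idx n u v) =
            (if u = s \<and> (\<exists>j<i. v = w j) then 0 else if rem d u v then big else W1 u v)"
          using 2(2) uv by blast
        ultimately show "rarr (sem b3 (setn PATH 0 i g)) WEIGHT (idx n u v) =
            (if u = s \<and> (\<exists>j<Suc i. v = w j) then 0 else if rem d u v then big else W1 u v)"
          unfolding e fun_upd_apply by (cases "u = s \<and> v = w i") (simp_all only: if_True if_False simp_thms conj_disj_distribL)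
      qed
    qed simp
    then show ?thesis by (simp only: W3_def)
  qed
  then have W3m: "rmat h3 WEIGHT u v = W3 u v" if "u < n" "v < n" for u v
    using that tables_nin[OF tb3] by (simp add: rmat_def)
  define R where "R = {(u, v). u < n \<and> v < n \<and> W3 u v = 0}"
  have reach: "rmat h4 DIST n v < big \<longleftrightarrow> (s, v) \<in> R\<^sup>*" if "v < n" for v
  proof -
    have "{(u, v). u < n \<and> v < n \<and> rmat h3 WEIGHT u v = 0} = R" using W3m by (auto simp: R_def)
    moreover have "rmat h3 WEIGHT u v \<in> {0, big}" if "u < n" "v < n" for u v
      unfolding W3m[OF that] by (auto simp: W3_def W1_def)
    ultimately show ?thesis using walk_reach[OF tb3 _ that] by (simp add: h4_def)
  qed
  have "\<forall>v<n. narr h5 SIDE v \<noteq> 0 \<longleftrightarrow> (s, v) \<in> R\<^sup>*"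
    unfolding h5_def c5_def
  proof (rule Loop_rule[where I = "\<lambda>i g. i \<le> n \<and> (\<forall>v<i. narr g SIDE v \<noteq> 0 \<longleftrightarrow> (s, v) \<in> R\<^sup>*)"], goal_cases)
    case (2 i g)
    have i: "i < n" using 2(1) tables_nin[OF tb4] by simp
    have tg: "tables g" by (subst tables_same[OF 2(3)[folded c5_def]]) (use tb4 in auto)
    have B: "rarr g BIG 0 = big" using tg by (simp add: tables_def)
    have D: "rarr g DIST (idx n n i) < big \<longleftrightarrow> (s, i) \<in> R\<^sup>*"
      using sameD(5)[OF 2(3)[folded c5_def], of DIST] reach[OF i] tables_nin[OF tb4] by (simp add: rmat_def)
    have "narr (sem b5 (setn VV 0 i g)) SIDE = (narr g SIDE)(i := of_bool ((s, i) \<in> R\<^sup>*))"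
      using tables_tabs[OF tg] tables_nin[OF tg] B D i by (simp add: b5_def)
    then show ?case using 2(2) i by (auto simp: less_Suc_eq)
  qed (use tables_nin[OF tb4] in auto)
  moreover have "sem (side (p + q)) h = h5"
    unfolding d_def[symmetric] prog by (simp add: h1_def h2_def h3_def h4_def h5_def)
  ultimately have S: "S = {v. v < n \<and> (s, v) \<in> R\<^sup>*}" by (auto simp: S_def on_side_def)
  show "s \<in> S" using s by (simp add: S)
  show "S \<subseteq> A \<and> (\<forall>u<n. \<forall>v<n. 0 < mult I F u v \<longrightarrow> (u \<in> S \<and> v \<notin> S \<longleftrightarrow> u \<in> A \<and> v \<notin> A))"
    if A: "A \<subseteq> {..<n}" "s \<in> A" and en: "enumerates (narr h TUPLE) F A"
  proof -
    have e1: "w i \<in> A \<and> w (d + i) \<notin> A \<or> w i = s \<and> w (d + i) = s" if "i < d" for i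
      using en that by (auto simp: enumerates_def d_def w_def)
    have e2: "\<exists>i<d. u = w i \<and> v = w (d + i)" if "u \<in> A" "v < n" "v \<notin> A" "0 < mult I F u v" for u v
      using en that unfolding enumerates_def d_def w_def by blast
    have sub: "v \<in> A" if "(s, v) \<in> R\<^sup>*" for v
      using that
    proof (induction rule: rtrancl_induct)
      case (step u v)
      show ?case
      proof (rule ccontr)
        assume v: "v \<notin> A"
        have uv: "u < n" "v < n" "W3 u v = 0" using step.hyps by (auto simp: R_def)
        have "\<not> (\<exists>j<d. v = w j)" using e1 v A by metis
        then have "\<not> rem d u v" "0 < mult I F u v" using uv(3) big_pos by (auto simp: W3_def W1_def split: if_splits)
        then show False using e2[OF step.IH uv(2) v] by (auto simp: rem_def)
      qed
    qed (use A in simp)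
    have seed: "w i \<in> S" if "i < d" for i
      using that w s by (auto simp: S R_def W3_def intro!: r_into_rtrancl)
    have "u \<in> S \<and> v \<notin> S \<longleftrightarrow> u \<in> A \<and> v \<notin> A" if uv: "u < n" "v < n" "0 < mult I F u v" for u v
    proof
      assume "u \<in> A \<and> v \<notin> A"
      then show "u \<in> S \<and> v \<notin> S" using e2[of u v] uv seed sub by (auto simp: S)
    next
      assume a: "u \<in> S \<and> v \<notin> S"
      have "v \<notin> A"
      proof
        assume v: "v \<in> A"
        have "u \<in> A" using a sub by (auto simp: S)
        \<comment> \<open>A wall separates \<open>A\<close> from its complement or is the padding
          \<open>(s, s)\<close>; neither is possible for a pair inside \<open>A\<close> that leaves
          \<open>S\<close>.\<close>
        have "\<not> rem d u v"
        proof
          assume "rem d u v"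
          then obtain j where j: "j < d" "u = w j \<and> v = w (d + j) \<or> u = w (d + j) \<and> v = w j"
            by (auto simp: rem_def)
          then have "u = s \<and> v = s" using e1[OF j(1)] v \<open>u \<in> A\<close> by auto
          then show False using a s by (simp add: S)
        qed
        then have "(u, v) \<in> R" using uv by (simp add: R_def W3_def W1_def)
        then show False using a uv by (auto simp: S intro: rtrancl_into_rtrancl)
      qed
      then show "u \<in> A \<and> v \<notin> A" using a sub by (auto simp: S)
    qed
    then show ?thesis using sub by (auto simp: S)
  qed
qed

end

primrec stages :: "nat \<Rightarrow> nat \<Rightarrow> nat \<Rightarrow> prog" where
  "stages p q 0 = Nop"
| "stages p q (Suc k) = stages p q k ;; nest (2 * (p + q)) (cover p q (p + k))"

context flex_problem
begin

section \<open>The cut that was found and the unit flows chosen for it\<close>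

lemma beval_leaves [simp]:
  "neval v h < n \<Longrightarrow> neval u h < n \<Longrightarrow>
    beval (leaves u v) h \<longleftrightarrow> neval u h \<in> on_side h \<and> neval v h \<notin> on_side h"
  by (simp add: leaves_def on_side_def)

lemma on_side_cong: "narr g SIDE = narr h SIDE \<Longrightarrow> on_side g = on_side h"
  by (simp add: on_side_def)

lemma on_side_sub: "on_side h \<subseteq> {..<n}"
  by (auto simp: on_side_def)

lemma measure_cut_correct:
  assumes sol: "solution h F"
  shows "narr (sem measure_cut h) SUMD 0 = flux n (mult I F) (on_side h)"
    "narr (sem measure_cut h) SUMX 0 = flux n (mult I (F \<inter> safe I)) (on_side h)"
proof -
  define S where "S = on_side h"
  let ?c = "Ifte (leaves (cell VU) (cell VV))
       (Put SUMD (Lit 0) (Pls (cell SUMD) (Arr DEG (at2 (cell VU) (cell VV)))) ;;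
        Put SUMX (Lit 0) (Pls (cell SUMX) (Arr SDEG (at2 (cell VU) (cell VV))))) Nop"
  define h1 where "h1 = setn SUMX 0 0 (setn SUMD 0 0 h)"
  have sol1: "solution h1 F" using sol solution_cong[of h1 h F] by (simp add: h1_def)
  have S1: "on_side h1 = S" by (simp add: S_def on_side_def h1_def)
  have n1: "nin h1 0 = n" using sol1 tables_nin by (simp add: solution_def)
  let ?J = "\<lambda>T g. T \<subseteq> {..<n} \<times> {..<n} \<longrightarrow>
      narr g SUMD 0 = (\<Sum>(u, v)\<in>T. if u \<in> S \<and> v \<notin> S then mult I F u v else 0) \<and>
      narr g SUMX 0 = (\<Sum>(u, v)\<in>T. if u \<in> S \<and> v \<notin> S then mult I (F \<inter> safe I) u v else 0)"
  have "?J ({..<nin h1 0} \<times> {..<nin h1 0}) (sem (pairs ?c) h1)"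
  proof (rule pairs_rule[where I = ?J], goal_cases)
    case (6 T g u v)
    have solg: "solution g F" by (subst solution_same[OF 6(5)]) (use sol1 in auto)
    then have tg: "tables g" by (simp add: solution_def)
    have Sg: "on_side g = S" using on_side_cong[OF sameD(4)[OF 6(5), of SIDE]] S1 by simp
    have uv: "u < n" "v < n" using 6 n1 by simp_all
    show ?case
    proof
      assume T: "insert (u, v) T \<subseteq> {..<n} \<times> {..<n}"
      then have "finite T" using finite_subset[of T "{..<n} \<times> {..<n}"] by auto
      then show "narr (sem ?c g) SUMD 0 = (\<Sum>(u, v)\<in>insert (u, v) T. if u \<in> S \<and> v \<notin> S then mult I F u v else 0) \<and>
        narr (sem ?c g) SUMX 0 = (\<Sum>(u, v)\<in>insert (u, v) T. if u \<in> S \<and> v \<notin> S then mult I (F \<inter> safe I) u v else 0)"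
        using 6(3,4,6,7) T uv tables_tabs[OF tg] tables_nin[OF tg] solution_deg(3,4)[OF solg uv] Sg
        by (simp add: sum.insert)
    qed
  qed (auto simp: h1_def)
  moreover have "(\<Sum>(u, v)\<in>{..<n} \<times> {..<n}. if u \<in> S \<and> v \<notin> S then f u v else 0) = flux n f S" for f :: "nat \<Rightarrow> nat \<Rightarrow> nat"
  proof -
    have "flux n f S = (\<Sum>(u, v)\<in>S \<times> ({..<n} - S). if u \<in> S \<and> v \<notin> S then f u v else 0)"
      unfolding flux_def by (rule sum.cong) auto
    also have "\<dots> = (\<Sum>(u, v)\<in>{..<n} \<times> {..<n}. if u \<in> S \<and> v \<notin> S then f u v else 0)"
      using on_side_sub[of h] by (intro sum.mono_neutral_left) (auto simp: S_def split: if_splits)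
    finally show ?thesis by simp
  qed
  moreover have "sem measure_cut h = sem (pairs ?c) h1" by (simp only: measure_cut_def sem.simps h1_def neval.simps)
  ultimately show "narr (sem measure_cut h) SUMD 0 = flux n (mult I F) (on_side h)"
    "narr (sem measure_cut h) SUMX 0 = flux n (mult I (F \<inter> safe I)) (on_side h)"
    using n1 by (simp_all add: S_def)
qed

lemma greedy_correct:
  assumes sol: "solution h F" and N: "N \<le> bound"
  defines "S \<equiv> on_side h" and "U \<equiv> cube h UNIT" and "x \<equiv> mult I (F \<inter> safe I)"
  shows "\<exists>Q\<subseteq>{..<N}. (\<forall>u<n. \<forall>v<n. mat (sem (greedy N) h) SUB u v = (\<Sum>i\<in>Q. U i u v)) \<and>
     (\<forall>i\<in>Q. \<forall>u\<in>S. \<forall>v<n. v \<notin> S \<longrightarrow> U i v u = 0) \<and>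
     (\<forall>u\<in>S. \<forall>v<n. v \<notin> S \<longrightarrow> (\<Sum>i\<in>Q. U i u v) \<le> x u v) \<and>
     (\<forall>i<N. i \<notin> Q \<longrightarrow> (\<exists>u\<in>S. \<exists>v<n. v \<notin> S \<and> (U i v u \<noteq> 0 \<or> x u v < (\<Sum>i\<in>Q. U i u v) + U i u v)))"
proof -
  define c1 where "c1 = pairs (Put SUB (at2 (cell VU) (cell VV)) (Lit 0))"
  define b2 where "b2 = Ifte (Cnj (leaves (cell VU) (cell VV))
            (Neg (Cnj (Neg (Lss (Lit 0) (Arr UNIT (at3 (cell PATH) (cell VV) (cell VU)))))
              (Neg (Lss (Arr SDEG (at2 (cell VU) (cell VV)))
                (Pls (Arr SUB (at2 (cell VU) (cell VV))) (Arr UNIT (at3 (cell PATH) (cell VU) (cell VV)))))))))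
          (Put OKAY (Lit 0) (Lit 0)) Nop"
  define b3 where "b3 = Put SUB (at2 (cell VU) (cell VV))
            (Pls (Arr SUB (at2 (cell VU) (cell VV))) (Arr UNIT (at3 (cell PATH) (cell VU) (cell VV))))"
  define body where "body = (Put OKAY (Lit 0) (Lit 1) ;; pairs b2 ;; Ifte (Lss (Lit 0) (cell OKAY)) (pairs b3) Nop)"
  have prog: "greedy N = (c1 ;; Loop PATH 0 (Times N) body)"
    by (simp only: greedy_def c1_def b2_def b3_def body_def)
  have wr: "writes b2 k i \<longleftrightarrow> k = OKAY" "writes b3 k i \<longleftrightarrow> k = SUB" "\<not> rwrites b2 k" "\<not> rwrites b3 k" for k i
    by (auto simp: b2_def b3_def)
  have wb: "writes body k i \<longleftrightarrow> k \<in> {OKAY, SUB} \<or> k \<in> {VU, VV} \<and> i = 0" "\<not> rwrites body k" for k i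
    by (auto simp: body_def wr)
  define good where "good i Q u v \<longleftrightarrow> U i v u = 0 \<and> (\<Sum>j\<in>Q. U j u v) + U i u v \<le> x u v" for i Q u v
  define J where "J k Q f \<longleftrightarrow> Q \<subseteq> {..<k} \<and> (\<forall>u<n. \<forall>v<n. mat f SUB u v = (\<Sum>i\<in>Q. U i u v)) \<and>
     (\<forall>i\<in>Q. \<forall>u\<in>S. \<forall>v<n. v \<notin> S \<longrightarrow> U i v u = 0) \<and>
     (\<forall>u\<in>S. \<forall>v<n. v \<notin> S \<longrightarrow> (\<Sum>i\<in>Q. U i u v) \<le> x u v) \<and>
     (\<forall>i<k. i \<notin> Q \<longrightarrow> (\<exists>u\<in>S. \<exists>v<n. v \<notin> S \<and> \<not> good i Q u v))" for k Q f
  define h1 where "h1 = sem c1 h"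
  have sm1: "same c1 h h1" by (simp add: h1_def same_sem)
  have sol1: "solution h1 F" by (subst solution_same[OF sm1]) (use sol in \<open>auto simp: c1_def\<close>)
  have n1: "nin h 0 = n" "nin h1 0 = n" using sol sol1 tables_nin by (simp_all add: solution_def)
  have SU1: "on_side h1 = S" "cube h1 UNIT = U"
    using on_side_cong[OF sameD(4)[OF sm1, of SIDE]] sameD(4)[OF sm1, of UNIT] sameD(1)[OF sm1]
    by (simp_all add: S_def U_def cube_def[abs_def] c1_def)
  have "\<exists>Q. J N Q (sem (Loop PATH 0 (Times N) body) h1)"
  proof (rule Loop_rule[where I = "\<lambda>k f. \<exists>Q. J k Q f"], goal_cases)
    case 1
    have "mat h1 SUB u v = 0" if "u < n" "v < n" for u v
      unfolding h1_def c1_def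
    proof (rule pairs_assign[OF _ _ n1(1) _ _ _ that])
      fix g u v assume uv: "u < n" "v < n" and sg: "same (pairs (Put SUB (at2 (cell VU) (cell VV)) (Lit 0))) h g"
        and c: "narr g VU 0 = u" "narr g VV 0 = v"
      have "tables g" by (subst tables_same[OF sg]) (use sol in \<open>auto simp: solution_def\<close>)
      from tables_tabs[OF this] tables_nin(1)[OF this]
      show "narr (sem (Put SUB (at2 (cell VU) (cell VV)) (Lit 0)) g) SUB = (narr g SUB)(idx n u v := 0)"
        using uv c by simp
    qed auto
    then show ?case by (intro exI[of _ "{}"]) (simp add: J_def)
  next
    case (2 k f)
    then obtain Q where Q: "J k Q f" by blast
    have k: "k < N" using 2(1) by simp
    have solf: "solution f F" by (subst solution_same[OF 2(3)]) (use sol1 in \<open>auto simp: wb\<close>)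
    have SUf: "on_side f = S" "cube f UNIT = U" "nin f = nin h1"
      using on_side_cong[OF sameD(4)[OF 2(3), of SIDE]] sameD(4)[OF 2(3), of UNIT] sameD(1)[OF 2(3)] SU1
      by (simp_all add: cube_def[abs_def] wb)
    have QB: "Q \<subseteq> {..<k}" and Qs: "\<forall>u<n. \<forall>v<n. mat f SUB u v = (\<Sum>i\<in>Q. U i u v)"
      and Qa: "\<forall>i\<in>Q. \<forall>u\<in>S. \<forall>v<n. v \<notin> S \<longrightarrow> U i v u = 0"
      and Qx: "\<forall>u\<in>S. \<forall>v<n. v \<notin> S \<longrightarrow> (\<Sum>i\<in>Q. U i u v) \<le> x u v"
      and Qr: "\<forall>i<k. i \<notin> Q \<longrightarrow> (\<exists>u\<in>S. \<exists>v<n. v \<notin> S \<and> \<not> good i Q u v)"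
      using Q by (simp_all add: J_def)
    define f1 where "f1 = setn OKAY 0 1 (setn PATH 0 k f)"
    define f2 where "f2 = sem (pairs b2) f1"
    have sol_f1: "solution f1 F" using solf solution_cong[of f1 f F] by (simp add: f1_def)
    have f1: "nin f1 0 = n" "on_side f1 = S" "cube f1 UNIT = U" "narr f1 SUB = narr f SUB" "narr f1 PATH 0 = k"
      "nin f1 = nin f"
      using SUf n1 by (simp_all add: f1_def on_side_def cube_def[abs_def])
    let ?I = "\<lambda>T g. T \<subseteq> {..<n} \<times> {..<n} \<longrightarrow>
       narr g OKAY 0 = (if \<exists>(u, v)\<in>T. u \<in> S \<and> v \<notin> S \<and> \<not> good k Q u v then 0 else 1)"
    have "?I ({..<nin f1 0} \<times> {..<nin f1 0}) f2"
      unfolding f2_def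
    proof (rule pairs_rule[where I = ?I], goal_cases)
      case (6 T g u v)
      have uv: "u < n" "v < n" using 6 f1 by simp_all
      have solg: "solution g F" by (subst solution_same[OF 6(5)]) (use sol_f1 in \<open>auto simp: wr\<close>)
      then have tg: "tables g" by (simp add: solution_def)
      have Sg: "on_side g = S" using on_side_cong[OF sameD(4)[OF 6(5), of SIDE]] f1 by (simp add: wr)
      have Ug: "narr g UNIT (idx3 n k a b) = U k a b" for a b
        using sameD(4)[OF 6(5), of UNIT] f1 by (auto simp: wr cube_def fun_eq_iff)
      have sub: "narr g SUB (idx n u v) = (\<Sum>j\<in>Q. U j u v)"
        using sameD(4)[OF 6(5), of SUB] f1 Qs uv n1 SUf by (simp add: wr mat_def)
      have path: "narr g PATH 0 = k" using sameD(4)[OF 6(5), of PATH] f1 by (simp add: wr)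
      have e: "sem b2 g = (if u \<in> S \<and> v \<notin> S \<and> \<not> good k Q u v then setn OKAY 0 0 g else g)"
        using tables_tabs[OF tg] tables_nin[OF tg] uv 6(6,7) Sg sub Ug path k N solution_deg(4)[OF solg uv]
        by (auto simp: b2_def good_def x_def not_less)
      show ?case
      proof
        assume "insert (u, v) T \<subseteq> {..<n} \<times> {..<n}"
        then show "narr (sem b2 g) OKAY 0 = (if \<exists>(u, v)\<in>insert (u, v) T. u \<in> S \<and> v \<notin> S \<and> \<not> good k Q u v then 0 else 1)"
          using 6(4) unfolding e by auto
      qed
    qed (auto simp: wr f1_def)
    then have ok: "narr f2 OKAY 0 = (if \<exists>u<n. \<exists>v<n. u \<in> S \<and> v \<notin> S \<and> \<not> good k Q u v then 0 else 1)"
      using f1(1) by auto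
    have sm2: "same (pairs b2) f1 f2" unfolding f2_def by (rule same_sem)
    have sol_f2: "solution f2 F" by (subst solution_same[OF sm2]) (use sol_f1 in \<open>auto simp: wr\<close>)
    have f2: "nin f2 0 = n" "cube f2 UNIT = U" "narr f2 SUB = narr f SUB" "narr f2 PATH 0 = k"
      "nin f2 = nin f"
      using f1 sameD(1)[OF sm2] sameD(4)[OF sm2, of UNIT] sameD(4)[OF sm2, of SUB] sameD(4)[OF sm2, of PATH]
      by (simp_all add: wr cube_def[abs_def])
    have e: "sem body (setn PATH 0 k f) = (if narr f2 OKAY 0 = 0 then f2 else sem (pairs b3) f2)"
      by (simp add: body_def f2_def f1_def)
    have Ssub: "u < n" if "u \<in> S" for u using that on_side_sub[of h] by (auto simp: S_def)
    show ?case
    proof (cases "narr f2 OKAY 0 = 0")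
      case True
      then have bad: "\<exists>u\<in>S. \<exists>v<n. v \<notin> S \<and> \<not> good k Q u v"
        using ok by (auto split: if_splits)
      have "J (Suc k) Q f2"
        unfolding J_def
      proof (intro conjI)
        show "\<forall>i<Suc k. i \<notin> Q \<longrightarrow> (\<exists>u\<in>S. \<exists>v<n. v \<notin> S \<and> \<not> good i Q u v)"
          using Qr bad by (auto simp: less_Suc_eq)
        show "\<forall>u<n. \<forall>v<n. mat f2 SUB u v = (\<Sum>i\<in>Q. U i u v)"
          using Qs f2 by (simp add: mat_def)
      qed (use QB Qa Qx in auto)
      then show ?thesis unfolding e using True by auto
    next
      case False
      then have all: "good k Q u v" if "u \<in> S" "v < n" "v \<notin> S" for u v
        using ok that Ssub by (auto split: if_splits)
      have kQ: "k \<notin> Q" "finite Q" using QB finite_subset by auto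
      have "mat (sem (pairs b3) f2) SUB u v = (\<Sum>i\<in>insert k Q. U i u v)" if "u < n" "v < n" for u v
      proof (rule pairs_assign[OF _ _ f2(1) _ _ _ that])
        fix g u v assume uv: "u < n" "v < n" and sg: "same (pairs b3) f2 g"
          and c: "narr g VU 0 = u" "narr g VV 0 = v" and old: "narr g SUB (idx n u v) = narr f2 SUB (idx n u v)"
        have solg: "solution g F" by (subst solution_same[OF sg]) (use sol_f2 in \<open>auto simp: wr\<close>)
        then have tg: "tables g" by (simp add: solution_def)
        have "narr g UNIT (idx3 n k u v) = U k u v"
          using sameD(4)[OF sg, of UNIT] f2 by (auto simp: wr cube_def fun_eq_iff)
        moreover have "narr g PATH 0 = k" using sameD(4)[OF sg, of PATH] f2 by (simp add: wr)
        moreover have "narr f2 SUB (idx n u v) = (\<Sum>j\<in>Q. U j u v)"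
          using f2 Qs uv n1 SUf by (simp add: mat_def)
        ultimately show "narr (sem b3 g) SUB = (narr g SUB)(idx n u v := \<Sum>i\<in>insert k Q. U i u v)"
          using tables_tabs[OF tg] tables_nin[OF tg] uv c old k N kQ by (simp add: b3_def add.commute)
      qed (auto simp: wr)
      then have "J (Suc k) (insert k Q) (sem (pairs b3) f2)"
        unfolding J_def
      proof (intro conjI)
        show "\<forall>u\<in>S. \<forall>v<n. v \<notin> S \<longrightarrow> (\<Sum>i\<in>insert k Q. U i u v) \<le> x u v"
          using all kQ by (auto simp: good_def add.commute)
        show "\<forall>i\<in>insert k Q. \<forall>u\<in>S. \<forall>v<n. v \<notin> S \<longrightarrow> U i v u = 0"
          using all Qa by (auto simp: good_def)
        show "\<forall>i<Suc k. i \<notin> insert k Q \<longrightarrow> (\<exists>u\<in>S. \<exists>v<n. v \<notin> S \<and> \<not> good i (insert k Q) u v)"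
        proof (intro allI impI)
          fix i assume "i < Suc k" "i \<notin> insert k Q"
          then obtain u v where uv: "u \<in> S" "v < n" "v \<notin> S" "\<not> good i Q u v"
            using Qr by (auto simp: less_Suc_eq)
          \<comment> \<open>Sums over \<open>Q\<close> only grow, so a rejected unit stays rejected.
            Hence all rejections hold for the final \<open>Q\<close>.\<close>
          then have "\<not> good i (insert k Q) u v" using kQ by (auto simp: good_def)
          then show "\<exists>u\<in>S. \<exists>v<n. v \<notin> S \<and> \<not> good i (insert k Q) u v" using uv by blast
        qed
      qed (use QB in auto)
      then show ?thesis unfolding e using False by auto
    qed
  next
    case (3 f)
    have "J N Q (setn PATH 0 (bval_of (Times N) h1) f) = J N Q f" for Q
      by (simp add: J_def mat_def)
    then show ?case using 3(1) by simp
  qed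
  then obtain Q where "J N Q (sem (greedy N) h)" by (auto simp: prog h1_def)
  then show ?thesis
    unfolding J_def good_def by (intro exI[of _ Q]) (auto simp: not_le)
qed

lemma set_free_correct:
  assumes sol: "solution h F" and uv: "u < n" "v < n"
  shows "mat (sem set_free h) FREE u v = 0 \<longleftrightarrow>
      mat h SUB v u = 0 \<and> mat h SUB u v = mult I (F \<inter> safe I) u v"
    "mat (sem set_free h) FLOW u v = 0"
proof -
  let ?c = "Ifte (Cnj (Neg (Lss (Lit 0) (Arr SUB (at2 (cell VV) (cell VU)))))
         (Cnj (Neg (Lss (Arr SUB (at2 (cell VU) (cell VV))) (Arr SDEG (at2 (cell VU) (cell VV)))))
            (Neg (Lss (Arr SDEG (at2 (cell VU) (cell VV))) (Arr SUB (at2 (cell VU) (cell VV)))))))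
       (Put FREE (at2 (cell VU) (cell VV)) (Lit 0)) (Put FREE (at2 (cell VU) (cell VV)) (Lit 1))"
  let ?d = "Put FLOW (at2 (cell VU) (cell VV)) (Lit 0)"
  define h1 where "h1 = sem (pairs ?c) h"
  have nh: "nin h 0 = n" using sol tables_nin by (simp add: solution_def)
  have sm1: "same (pairs ?c) h h1" unfolding h1_def by (rule same_sem)
  have sol1: "solution h1 F" by (subst solution_same[OF sm1]) (use sol in auto)
  have n1: "nin h1 0 = n" using sameD(1)[OF sm1] nh by simp
  have free: "mat h1 FREE u v = (if mat h SUB v u = 0 \<and> mat h SUB u v = mult I (F \<inter> safe I) u v then 0 else 1)"
    unfolding h1_def
  proof (rule pairs_assign[OF _ _ nh _ _ _ uv])
    fix g u v assume uv: "u < n" "v < n" and sg: "same (pairs ?c) h g" and c: "narr g VU 0 = u" "narr g VV 0 = v"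
    have solg: "solution g F" by (subst solution_same[OF sg]) (use sol in auto)
    then have tg: "tables g" by (simp add: solution_def)
    have "narr g SUB = narr h SUB" using sameD(4)[OF sg, of SUB] by simp
    then show "narr (sem ?c g) FREE = (narr g FREE)(idx n u v :=
        if mat h SUB v u = 0 \<and> mat h SUB u v = mult I (F \<inter> safe I) u v then 0 else 1)"
      using tables_tabs[OF tg] tables_nin[OF tg] uv c solution_deg(4)[OF solg uv] nh
      by (auto simp: mat_def)
  qed auto
  have flow: "mat (sem (pairs ?d) h1) FLOW u v = 0"
  proof (rule pairs_assign[OF _ _ n1 _ _ _ uv])
    fix g u v assume uv: "u < n" "v < n" and sg: "same (pairs ?d) h1 g" and c: "narr g VU 0 = u" "narr g VV 0 = v"
    have "tables g" by (subst tables_same[OF sg]) (use sol1 in \<open>auto simp: solution_def\<close>)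
    from tables_tabs[OF this] tables_nin(1)[OF this] show "narr (sem ?d g) FLOW = (narr g FLOW)(idx n u v := 0)"
      using uv c by simp
  qed auto
  have e: "sem set_free h = sem (pairs ?d) h1" by (simp only: set_free_def h1_def sem.simps(4))
  have "mat (sem (pairs ?d) h1) FREE u v = mat h1 FREE u v"
    using sem_frame_arr[of "pairs ?d" FREE h1] by (simp add: mat_def)
  then show "mat (sem set_free h) FREE u v = 0 \<longleftrightarrow>
      mat h SUB v u = 0 \<and> mat h SUB u v = mult I (F \<inter> safe I) u v"
    unfolding e free by simp
  show "mat (sem set_free h) FLOW u v = 0" unfolding e by (rule flow)
qed

section \<open>Violated cuts and their monotonicity\<close>

definition violated :: "nat \<Rightarrow> nat set \<Rightarrow> nat set \<Rightarrow> bool" where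
  "violated r F A \<longleftrightarrow> A \<subseteq> {..<n} \<and> s \<in> A \<and> t \<notin> A \<and> flux n (mult I F) A = r \<and>
     flux n (mult I (F \<inter> safe I)) A < p"

definition reached :: "nat \<Rightarrow> nat set \<Rightarrow> bool" where
  "reached r F \<longleftrightarrow> (\<forall>A\<subseteq>{..<n}. s \<in> A \<longrightarrow> t \<notin> A \<longrightarrow>
     p \<le> flux n (mult I (F \<inter> safe I)) A \<or> r \<le> flux n (mult I F) A)"

text \<open>The equations concern each outgoing pair separately. This is why the sets that fit
  \<open>Q\<close> are exactly the closed sets of a digraph.\<close>

definition fits :: "(nat \<Rightarrow> nat \<Rightarrow> nat \<Rightarrow> nat) \<Rightarrow> nat set \<Rightarrow> nat set \<Rightarrow> nat set \<Rightarrow> bool" where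
  "fits U Q F A \<longleftrightarrow> (\<forall>u\<in>A. \<forall>v<n. v \<notin> A \<longrightarrow>
     (\<Sum>i\<in>Q. U i v u) = 0 \<and> (\<Sum>i\<in>Q. U i u v) = mult I (F \<inter> safe I) u v)"

lemma reachedD:
  assumes "reached r F" "A \<subseteq> {..<n}" "s \<in> A" "t \<notin> A" "flux n (mult I (F \<inter> safe I)) A < p"
  shows "r \<le> flux n (mult I F) A"
  using assms(1)[unfolded reached_def, rule_format, OF assms(2-4)] assms(5) by linarith

lemma mult_le:
  assumes "F \<subseteq> G" "G \<subseteq> edges I"
  shows "mult I F u v \<le> mult I G u v" "mult I (F \<inter> safe I) u v \<le> mult I (G \<inter> safe I) u v"
  using assms fin[of G] by (auto intro!: mult_mono)

lemma mult_safe_le: "F \<subseteq> edges I \<Longrightarrow> mult I (F \<inter> safe I) u v \<le> mult I F u v"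
  using fin[of F] by (auto intro!: mult_mono)

text \<open>Among the added edges, the safe ones are at most all of them. So no cut gains safe edges
  without gaining as many edges.\<close>

lemma mult_safe_diff:
  assumes "F \<subseteq> G" "G \<subseteq> edges I"
  shows "mult I F u v + mult I (G \<inter> safe I) u v \<le> mult I G u v + mult I (F \<inter> safe I) u v"
proof -
  let ?P = "parallel I u v"
  have fG: "finite G" "finite F" using assms fin finite_subset by blast+
  have split: "card (G \<inter> Y) = card (F \<inter> Y) + card ((G - F) \<inter> Y)" for Y
  proof -
    have "G \<inter> Y = (F \<inter> Y) \<union> ((G - F) \<inter> Y)" using assms(1) by blast
    then show ?thesis using card_Un_disjoint[of "F \<inter> Y" "(G - F) \<inter> Y"] fG by auto
  qed
  have "card (G \<inter> ?P) = card (F \<inter> ?P) + card ((G - F) \<inter> ?P)" by (rule split)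
  moreover have "card (G \<inter> safe I \<inter> ?P) = card (F \<inter> safe I \<inter> ?P) + card ((G - F) \<inter> safe I \<inter> ?P)"
    unfolding Int_assoc by (rule split)
  moreover have "card ((G - F) \<inter> safe I \<inter> ?P) \<le> card ((G - F) \<inter> ?P)"
    using fG by (intro card_mono) auto
  ultimately show ?thesis by (simp add: mult_def)
qed

text \<open>\<open>F\<close> already has at least \<open>r\<close> edges across the cut and
  \<open>G\<close> has exactly \<open>r\<close>, so nothing was bought across it. Violated cuts of a
  stage can only disappear, and those that persist have the same edges as before; statements on
  enumeration and fitting carry over between \<open>F\<close> and \<open>G\<close>.\<close>

lemma violated_antimono:
  assumes F: "reached r F" "F \<subseteq> G" "G \<subseteq> edges I" and A: "violated r G A"
  shows "violated r F A"
    "\<And>u v. u \<in> A \<Longrightarrow> v < n \<Longrightarrow> v \<notin> A \<Longrightarrow>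
      mult I F u v = mult I G u v \<and> mult I (F \<inter> safe I) u v = mult I (G \<inter> safe I) u v"
proof -
  have A': "A \<subseteq> {..<n}" "s \<in> A" "t \<notin> A" "flux n (mult I G) A = r" "flux n (mult I (G \<inter> safe I)) A < p"
    using A by (auto simp: violated_def)
  have "flux n (mult I (F \<inter> safe I)) A \<le> flux n (mult I (G \<inter> safe I)) A"
    using mult_le[OF F(2,3)] by (intro flux_mono) auto
  then have x: "flux n (mult I (F \<inter> safe I)) A < p" using A'(5) by linarith
  then have "r \<le> flux n (mult I F) A" using reachedD[OF F(1) A'(1-3)] by blast
  moreover have "flux n (mult I F) A \<le> flux n (mult I G) A"
    using mult_le[OF F(2,3)] by (intro flux_mono) auto
  ultimately have eq: "flux n (mult I F) A = r" using A'(4) by linarith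
  show "violated r F A" using A' x eq by (simp add: violated_def)
  fix u v assume uv: "u \<in> A" "v < n" "v \<notin> A"
  have "flux n (\<lambda>u v. mult I G u v - mult I F u v) A + flux n (mult I F) A = flux n (mult I G) A"
    unfolding flux_add[symmetric] using mult_le[OF F(2,3)] by (intro flux_cong) auto
  then have "flux n (\<lambda>u v. mult I G u v - mult I F u v) A = 0" using eq A'(4) by linarith
  then have "mult I G u v - mult I F u v = 0" using uv by (subst (asm) flux_zero[OF A'(1)]) auto
  then have "mult I F u v = mult I G u v" using mult_le(1)[OF F(2,3), of u v] by linarith
  then show "mult I F u v = mult I G u v \<and> mult I (F \<inter> safe I) u v = mult I (G \<inter> safe I) u v"
    using mult_safe_diff[OF F(2,3), of u v] mult_le(2)[OF F(2,3), of u v] by linarith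
qed

lemma units_mono: "units U F \<Longrightarrow> F \<subseteq> G \<Longrightarrow> G \<subseteq> edges I \<Longrightarrow> units U G"
proof -
  assume a: "units U F" "F \<subseteq> G" "G \<subseteq> edges I"
  have "capa p q F u v \<le> capa p q G u v" for u v
    unfolding capa_def by (intro add_mono mult_le_mono2 mult_le[OF a(2,3)])
  then show "units U G" using a(1) unfolding units_def by (meson le_trans)
qed

lemma reached_mono: "reached r F \<Longrightarrow> F \<subseteq> G \<Longrightarrow> G \<subseteq> edges I \<Longrightarrow> reached r G"
proof -
  assume a: "reached r F" "F \<subseteq> G" "G \<subseteq> edges I"
  have "flux n (mult I F) A \<le> flux n (mult I G) A"
    "flux n (mult I (F \<inter> safe I)) A \<le> flux n (mult I (G \<inter> safe I)) A" for A
    using mult_le[OF a(2,3)] by (intro flux_mono; simp)+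
  then show "reached r G" using a(1) unfolding reached_def by (meson le_trans)
qed

text \<open>
  Every cut that is closed under the free arcs carries exactly \<open>card Q < p\<close> safe edges of \<open>F\<close>. So
  covering all of them is a problem about minimum cuts, solved by one more augmentation.
\<close>

lemma cover_family:
  assumes sol: "solution h F" and re: "reached r F" and r: "r < p + q"
    and Q: "\<And>i. i \<in> Q \<Longrightarrow> i < p * (p + q)" "finite Q" "card Q < p" and U: "units U F"
    and free: "\<And>u v. u < n \<Longrightarrow> v < n \<Longrightarrow> mat h FREE u v = 0 \<longleftrightarrow>
      (\<Sum>i\<in>Q. U i v u) = 0 \<and> (\<Sum>i\<in>Q. U i u v) = mult I (F \<inter> safe I) u v"
    and flow: "\<And>u v. u < n \<Longrightarrow> v < n \<Longrightarrow> mat h FLOW u v = 0"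
    and X: "X \<subseteq> edges I" "feasible p q I X"
  shows "\<exists>G. solution (sem (saturate (Suc r) 1 0) h) G \<and> F \<subseteq> G \<and>
     total_cost I G \<le> total_cost I F + Suc r * total_cost I X \<and>
     (\<forall>A\<subseteq>{..<n}. s \<in> A \<longrightarrow> t \<notin> A \<longrightarrow> fits U Q F A \<longrightarrow> r < flux n (mult I G) A)"
proof -
  have capa1: "capa 1 0 G = mult I G" for G by (intro ext) (simp add: capa_def)
  have closed: "(\<forall>u\<in>A. \<forall>v<n. v \<notin> A \<longrightarrow> mat h FREE u v = 0) \<longleftrightarrow> fits U Q F A" if "A \<subseteq> {..<n}" for A
    using that free unfolding fits_def by (intro ball_cong) auto
  have "\<exists>G. solution (sem (saturate (Suc r) 1 0) h) G \<and> F \<subseteq> G \<and>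
      valid 1 0 (sem (saturate (Suc r) 1 0) h) G \<and>
     total_cost I G \<le> total_cost I F + Suc r * total_cost I X \<and> amount (sem (saturate (Suc r) 1 0) h) (Suc r)"
  proof (rule saturate_correct[OF sol _ X(1) flow])
    fix G A
    assume FG: "F \<subseteq> G" "G \<subseteq> edges I" and A: "A \<subseteq> {..<n}" "s \<in> A" "t \<notin> A"
      and cl: "\<And>u v. u \<in> A \<Longrightarrow> v < n \<Longrightarrow> v \<notin> A \<Longrightarrow> mat h FREE u v = 0"
      and cap: "flux n (capa 1 0 G) A < Suc r"
    have "fits U Q F A" using closed[OF A(1)] cl by blast
    then have f: "(\<Sum>i\<in>Q. U i v u) = 0" "(\<Sum>i\<in>Q. U i u v) = mult I (F \<inter> safe I) u v"
      if "u \<in> A" "v < n" "v \<notin> A" for u v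
      using that by (auto simp: fits_def)
    \<comment> \<open>Each unit of \<open>Q\<close> leaves \<open>A\<close> exactly once more than
      it enters, and none enters. So \<open>card Q\<close> is the number of safe edges of
      \<open>F\<close> across \<open>A\<close>.\<close>
    have "net n (\<lambda>u v. \<Sum>i\<in>Q. U i u v) A = int (card Q)"
      using U A Q(1) by (simp add: net_sum units_def)
    moreover have "flux n (\<lambda>u v. \<Sum>i\<in>Q. U i v u) A = 0" unfolding flux_zero[OF A(1)] using f by auto
    moreover have "flux n (\<lambda>u v. \<Sum>i\<in>Q. U i u v) A = flux n (mult I (F \<inter> safe I)) A"
      using f by (intro flux_cong) auto
    ultimately have xF: "flux n (mult I (F \<inter> safe I)) A < p" using Q(3) by (simp add: net_eq)
    then have dF: "r \<le> flux n (mult I F) A" using reachedD[OF re A] by blast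
    have dG: "flux n (mult I G) A \<le> r" using cap unfolding capa1 by simp
    show "\<exists>u\<in>A. \<exists>v<n. v \<notin> A \<and> (\<exists>e\<in>X - G. e \<in> parallel I u v) \<and> mult I G u v < p + q"
    proof (rule ccontr)
      assume none: "\<not> ?thesis"
      have "X \<inter> parallel I u v \<subseteq> G" if "u \<in> A" "v < n" "v \<notin> A" for u v
      proof -
        have "mult I G u v < p + q" using flux_member_le[OF A(1) that, of "mult I G"] dG r by linarith
        then show ?thesis using none that by blast
      qed
      then have "mult I X u v \<le> mult I G u v \<and> mult I (X \<inter> safe I) u v \<le> mult I (G \<inter> safe I) u v"
        if "u \<in> A" "v < n" "v \<notin> A" for u v
        unfolding mult_def using that fin[OF FG(2)] by (intro conjI card_mono) blast+
      then have "flux n (mult I X) A \<le> flux n (mult I G) A"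
        "flux n (mult I (X \<inter> safe I)) A \<le> flux n (mult I (G \<inter> safe I)) A"
        by (auto intro!: flux_mono)
      moreover have "p \<le> flux n (mult I (X \<inter> safe I)) A \<or> p + q \<le> flux n (mult I X) A"
        using X A feasible_iff_flux[OF inst num X(1), of p q] by (auto simp: n_def)
      ultimately have "p \<le> flux n (mult I (G \<inter> safe I)) A" using dG r by linarith
      \<comment> \<open>If \<open>X\<close> had nothing to offer, \<open>G\<close> would have
        \<open>p\<close> safe edges across \<open>A\<close>. It would then have gained a safe edge
        over \<open>F\<close>, hence an edge, and would have more than \<open>r\<close>.\<close>
      moreover have "flux n (mult I F) A + flux n (mult I (G \<inter> safe I)) A \<le>
          flux n (mult I G) A + flux n (mult I (F \<inter> safe I)) A"
        unfolding flux_add[symmetric] using mult_safe_diff[OF FG] by (intro flux_mono) auto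
      ultimately show False using xF dF dG by linarith
    qed
  qed simp_all
  then obtain G where G: "solution (sem (saturate (Suc r) 1 0) h) G" "F \<subseteq> G"
      "valid 1 0 (sem (saturate (Suc r) 1 0) h) G"
     "total_cost I G \<le> total_cost I F + Suc r * total_cost I X" "amount (sem (saturate (Suc r) 1 0) h) (Suc r)"
    by blast
  let ?g = "sem (saturate (Suc r) 1 0) h"
  have fr: "mat ?g FREE = mat h FREE"
    using sem_frame_arr[of "saturate (Suc r) 1 0" FREE h] by (simp add: mat_def[abs_def])
  have "r < flux n (mult I G) A" if A: "A \<subseteq> {..<n}" "s \<in> A" "t \<notin> A" "fits U Q F A" for A
  proof -
    have cl: "mat h FREE u v = 0" if "u \<in> A" "v < n" "v \<notin> A" for u v
      using closed[OF A(1)] A(4) that by blast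
    \<comment> \<open>No free arc leaves \<open>A\<close>, so the flow of value \<open>r + 1\<close>
      has to cross it within the capacity given by the edges of \<open>G\<close>.\<close>
    have "int (Suc r) = net n (mat ?g FLOW) A" using G(5) A by (simp add: amount_def)
    also have "\<dots> \<le> flux n (\<lambda>u v. int (mult I G u v)) A"
      unfolding net_def
    proof (rule flux_mono)
      fix u v assume uv: "u \<in> A" "v < n" "v \<notin> A"
      then have "u < n" "u \<noteq> v" using A(1) by auto
      then have "mat ?g FLOW u v \<le> capa 1 0 G u v + mat ?g FLOW v u"
        using G(3)[unfolded valid_def fr, rule_format, of u v] cl[OF uv] uv(2) by simp
      then show "int (mat ?g FLOW u v) - int (mat ?g FLOW v u) \<le> int (mult I G u v)"
        unfolding capa1 by simp
    qed
    finally show ?thesis by (simp add: flux_of_nat)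
  qed
  then show ?thesis using G by blast
qed

lemma enumerates_cong:
  assumes "\<And>u v. u \<in> A \<Longrightarrow> v < n \<Longrightarrow> v \<notin> A \<Longrightarrow> mult I F u v = mult I G u v"
  shows "enumerates w F A = enumerates w G A"
  unfolding enumerates_def using assms by auto

text \<open>The last alternative prepares the charging: a step that changes the solution belongs to
  a set \<open>Q\<close> that fits some violated cut before the step and none after it.\<close>

lemma cover_correct:
  assumes sol: "solution h F" and re: "reached r F" and r: "r < p + q" and pq: "p * q < 2 * (p + q)"
    and U: "units (cube h UNIT) F" and tup: "\<And>i. i < 2 * (p + q) \<Longrightarrow> narr h TUPLE i < n"
    and X: "X \<subseteq> edges I" "feasible p q I X"
  shows "\<exists>G. solution (sem (cover p q r) h) G \<and> F \<subseteq> G \<and>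
     (\<forall>A. violated r G A \<longrightarrow> \<not> enumerates (narr h TUPLE) G A) \<and>
     (G = F \<or> total_cost I G \<le> total_cost I F + Suc r * total_cost I X \<and>
       (\<exists>Q\<subseteq>{..<p * (p + q)}. card Q < p \<and> (\<exists>A. violated r F A \<and> fits (cube h UNIT) Q F A) \<and>
          (\<forall>A. violated r G A \<longrightarrow> \<not> fits (cube h UNIT) Q G A)))"
proof -
  define N where "N = p * (p + q)"
  define h1 where "h1 = sem (side (p + q)) h"
  define h2 where "h2 = sem measure_cut h1"
  define S where "S = on_side h1"
  define w where "w = narr h TUPLE"
  define U' where "U' = cube h UNIT"
  have sm: "same (side (p + q)) h h1" "same measure_cut h1 h2" unfolding h1_def h2_def by (rule same_sem)+
  have sol1: "solution h1 F" by (subst solution_same[OF sm(1)]) (use sol in auto)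
  have sol2: "solution h2 F" by (subst solution_same[OF sm(2)]) (use sol1 in auto)
  have FE: "F \<subseteq> edges I" using sol by (simp add: solution_def)
  have S2: "on_side h2 = S" using on_side_cong[OF sameD(4)[OF sm(2), of SIDE]] by (simp add: S_def)
  have U2: "cube h2 UNIT = U'"
    using sameD(4)[OF sm(1), of UNIT] sameD(1)[OF sm(1)] sameD(4)[OF sm(2), of UNIT] sameD(1)[OF sm(2)]
    by (simp add: U'_def cube_def[abs_def])
  have SS: "s \<in> S" "A \<subseteq> {..<n} \<Longrightarrow> s \<in> A \<Longrightarrow> enumerates w F A \<Longrightarrow>
      S \<subseteq> A \<and> (\<forall>u<n. \<forall>v<n. 0 < mult I F u v \<longrightarrow> (u \<in> S \<and> v \<notin> S \<longleftrightarrow> u \<in> A \<and> v \<notin> A))" for A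
    unfolding S_def h1_def w_def using side_correct[OF sol tup] by blast+
  have Sn: "S \<subseteq> {..<n}" by (simp add: S_def on_side_sub)
  let ?b = "Cnj (Neg (Lss (Lit 0) (Arr SIDE (Inp 3))))
         (Cnj (Cnj (Neg (Lss (cell SUMD) (Lit r))) (Neg (Lss (Lit r) (cell SUMD)))) (Lss (cell SUMX) (Lit p)))"
  have "narr h2 SUMD 0 = flux n (mult I F) S" "narr h2 SUMX 0 = flux n (mult I (F \<inter> safe I)) S"
    unfolding S_def h2_def by (rule measure_cut_correct[OF sol1])+
  moreover have "nin h2 3 = t" using sol2 tables_nin by (simp add: solution_def)
  moreover have "narr h2 SIDE t \<noteq> 0 \<longleftrightarrow> t \<in> S" using t S2 by (auto simp: on_side_def)
  ultimately have test: "beval ?b h2 \<longleftrightarrow> violated r F S"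
    using Sn SS(1) by (auto simp: violated_def)
  have same_cut: "flux n (mult I F) S = flux n (mult I F) A \<and>
      flux n (mult I (F \<inter> safe I)) S = flux n (mult I (F \<inter> safe I)) A"
    if A: "A \<subseteq> {..<n}" "s \<in> A" "enumerates w F A" for A
  proof -
    \<comment> \<open>Any weight dominated by the multiplicities lives on pairs joined by an edge of
      \<open>F\<close>, and of these the same ones leave \<open>S\<close> and
      \<open>A\<close>.\<close>
    have *: "flux n f S = flux n f A" if f: "\<And>u v. f u v \<le> mult I F u v" for f :: "nat \<Rightarrow> nat \<Rightarrow> nat"
    proof -
      have eq: "u \<in> S \<and> v \<notin> S \<longleftrightarrow> u \<in> A \<and> v \<notin> A" if "f u v \<noteq> 0" "u < n" "v < n" for u v
        using SS(2)[OF A] that f[of u v] by auto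
      let ?P = "{(u, v). u < n \<and> v < n \<and> f u v \<noteq> 0}"
      have fP: "finite ?P" by (rule finite_subset[of _ "{..<n} \<times> {..<n}"]) auto
      have "flux n f B = (\<Sum>(u, v)\<in>?P \<inter> B \<times> ({..<n} - B). f u v)" if "B \<subseteq> {..<n}" for B
        unfolding flux_def using that by (intro sum.mono_neutral_right) auto
      moreover have "?P \<inter> S \<times> ({..<n} - S) = ?P \<inter> A \<times> ({..<n} - A)" using eq by blast
      ultimately show ?thesis using Sn A(1) by simp
    qed
    show ?thesis using *[of "mult I F"] *[of "mult I (F \<inter> safe I)"] mult_safe_le[OF FE] by simp
  qed
  have S_vio: "violated r F S" if "violated r F A" "enumerates w F A" for A
  proof -
    have A: "A \<subseteq> {..<n}" "s \<in> A" "t \<notin> A" using that by (auto simp: violated_def)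
    then have "t \<notin> S" using SS(2)[OF A(1,2) that(2)] by blast
    then show ?thesis using that same_cut[OF A(1,2) that(2)] Sn SS(1) by (simp add: violated_def)
  qed
  have run: "sem (cover p q r) h = (if violated r F S
      then sem (saturate (Suc r) 1 0) (sem set_free (sem (greedy N) h2)) else h2)"
    unfolding cover_def N_def using test by (simp add: h1_def h2_def)
  show ?thesis
  proof (cases "violated r F S")
    case False
    then have "\<forall>A. violated r F A \<longrightarrow> \<not> enumerates w F A" using S_vio by blast
    then show ?thesis using run False sol2 by (intro exI[of _ F]) (auto simp: w_def)
  next
    case True
    define h3 where "h3 = sem (greedy N) h2"
    define h4 where "h4 = sem set_free h3"
    have sm': "same (greedy N) h2 h3" "same set_free h3 h4" unfolding h3_def h4_def by (rule same_sem)+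
    have sol3: "solution h3 F" by (subst solution_same[OF sm'(1)]) (use sol2 in auto)
    have sol4: "solution h4 F" by (subst solution_same[OF sm'(2)]) (use sol3 in auto)
    obtain Q where Q: "Q \<subseteq> {..<N}" "\<forall>u<n. \<forall>v<n. mat h3 SUB u v = (\<Sum>i\<in>Q. U' i u v)"
      "\<forall>i\<in>Q. \<forall>u\<in>S. \<forall>v<n. v \<notin> S \<longrightarrow> U' i v u = 0"
      "\<forall>u\<in>S. \<forall>v<n. v \<notin> S \<longrightarrow> (\<Sum>i\<in>Q. U' i u v) \<le> mult I (F \<inter> safe I) u v"
      "\<forall>i<N. i \<notin> Q \<longrightarrow> (\<exists>u\<in>S. \<exists>v<n. v \<notin> S \<and> (U' i v u \<noteq> 0 \<or>
          mult I (F \<inter> safe I) u v < (\<Sum>i\<in>Q. U' i u v) + U' i u v))"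
      using greedy_correct[OF sol2, of N] unfolding S2 U2 h3_def N_def by auto
    have fQ: "finite Q" using Q(1) finite_subset by blast
    note un = U[folded U'_def]
    have S: "S \<subseteq> {..<n}" "s \<in> S" "t \<notin> S" "flux n (mult I F) S = r" "flux n (mult I (F \<inter> safe I)) S < p"
      using True by (auto simp: violated_def)
    have unit: "net n (U' i) A = 1" if "i < N" "A \<subseteq> {..<n}" "s \<in> A" "t \<notin> A" for i A
      using un that by (simp add: units_def N_def)
    \<comment> \<open>The unit flows are set to 0 outside the vertex range, where
      \<open>units\<close> says nothing about their entries but \<open>greedy_saturates\<close> asks
      for values of at most 1.\<close>
    define V where "V i u v = (if u < n \<and> v < n then U' i u v else 0)" for i u v
    have VU: "V i u v = U' i u v" if "u < n" "v < n" for i u v using that by (simp add: V_def)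
    have sat: "(\<Sum>i\<in>Q. U' i u v) = mult I (F \<inter> safe I) u v" if uv: "u \<in> S" "v < n" "v \<notin> S" for u v
    proof -
      have "(\<Sum>i\<in>Q. V i u v) = mult I (F \<inter> safe I) u v"
      proof (rule greedy_saturates[where p = p and q = q and n = n and N = N and A = S and Q = Q and U = V
            and d = "mult I F" and x = "mult I (F \<inter> safe I)" and g = "\<lambda>u v. \<Sum>i\<in>Q. V i u v"])
        show "0 < p + q" using r by linarith
        show "net n (V i) S = 1" if "i < N" for i
          using unit[OF that S(1-3)] net_cong[of "V i" "U' i" S] VU S(1) by simp
        show "V i u v \<le> 1" if "i < N" for i u v using un that by (auto simp: V_def units_def N_def)
        show "(\<Sum>i<N. V i u v + V i v u) \<le> p * mult I F u v + q * mult I (F \<inter> safe I) u v"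
          if "u \<in> S" "v < n" "v \<notin> S" for u v
        proof -
          have "u < n" "u \<noteq> v" using that S(1) by auto
          then have "(\<Sum>i<N. U' i u v + U' i v u) \<le> capa p q F u v"
            using un that by (simp add: units_def N_def)
          then show ?thesis using VU \<open>u < n\<close> \<open>v < n\<close> by (simp add: capa_def)
        qed
        \<comment> \<open>Here the hypothesis \<open>p * q < 2 * (p + q)\<close> enters. With
          \<open>r < p + q\<close> edges and fewer than \<open>p\<close> safe ones, the capacity is
          at most \<open>N - (p + q) + p * q\<close>.\<close>
        show "flux n (\<lambda>u v. p * mult I F u v + q * mult I (F \<inter> safe I) u v) S < N + (p + q)"
        proof -
          have "flux n (\<lambda>u v. p * mult I F u v + q * mult I (F \<inter> safe I) u v) S =
              p * r + q * flux n (mult I (F \<inter> safe I)) S"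
            unfolding flux_add flux_mult using S(4) by simp
          moreover obtain r' where r': "p + q = Suc (r + r')" using r less_iff_Suc_add by auto
          have "p * r + p \<le> p * (p + q)" unfolding r' by (simp add: algebra_simps)
          moreover have "q * flux n (mult I (F \<inter> safe I)) S + q \<le> p * q"
            using mult_le_mono2[of "Suc (flux n (mult I (F \<inter> safe I)) S)" p q] S(5)
            by (simp add: algebra_simps)
          ultimately show ?thesis using pq by (simp add: N_def)
        qed
        show "mult I (F \<inter> safe I) u v \<le> mult I F u v" for u v by (rule mult_safe_le[OF FE])
        show "(\<Sum>i\<in>Q. V i u v) \<le> mult I (F \<inter> safe I) u v" if "u \<in> S" "v < n" "v \<notin> S" for u v
        proof -
          have "u < n" using that S(1) by auto
          then show ?thesis using Q(4) that by (simp add: VU)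
        qed
        show "\<exists>u\<in>S. \<exists>v<n. v \<notin> S \<and> (V i v u \<noteq> 0 \<or> mult I (F \<inter> safe I) u v < (\<Sum>i\<in>Q. V i u v) + V i u v)"
          if "i < N" "i \<notin> Q" for i
        proof -
          obtain u v where uv: "u \<in> S" "v < n" "v \<notin> S" "U' i v u \<noteq> 0 \<or>
              mult I (F \<inter> safe I) u v < (\<Sum>i\<in>Q. U' i u v) + U' i u v"
            using Q(5) \<open>i < N\<close> \<open>i \<notin> Q\<close> by blast
          then have "u < n" using S(1) by auto
          then show ?thesis using uv by (intro bexI[of _ u] exI[of _ v]) (simp_all add: VU)
        qed
      qed (use S(1) Q(1) that in auto)
      moreover have "u < n" using uv S(1) by auto
      ultimately show ?thesis using uv by (simp add: VU)
    qed
    have zero: "(\<Sum>i\<in>Q. U' i v u) = 0" if uv: "u \<in> S" "v < n" "v \<notin> S" for u v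
      using Q(3) that by simp
    have fitS: "fits U' Q F S" using sat zero by (simp add: fits_def)
    have "int (card Q) = net n (\<lambda>u v. \<Sum>i\<in>Q. U' i u v) S"
      using unit[OF _ S(1-3)] Q(1) by (auto simp: net_sum subset_iff)
    also have "\<dots> = int (flux n (mult I (F \<inter> safe I)) S)"
    proof -
      have "flux n (\<lambda>u v. \<Sum>i\<in>Q. U' i v u) S = 0" unfolding flux_zero[OF S(1)] using zero by auto
      moreover have "flux n (\<lambda>u v. \<Sum>i\<in>Q. U' i u v) S = flux n (mult I (F \<inter> safe I)) S"
        using sat by (intro flux_cong) auto
      ultimately show ?thesis by (simp add: net_eq)
    qed
    finally have cQ: "card Q < p" using S(5) by simp
    have "\<exists>G. solution (sem (saturate (Suc r) 1 0) h4) G \<and> F \<subseteq> G \<and>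
     total_cost I G \<le> total_cost I F + Suc r * total_cost I X \<and>
     (\<forall>A\<subseteq>{..<n}. s \<in> A \<longrightarrow> t \<notin> A \<longrightarrow> fits U' Q F A \<longrightarrow> r < flux n (mult I G) A)"
    proof (rule cover_family[OF sol4 re r _ fQ cQ un _ _ X])
      show "mat h4 FREE u v = 0 \<longleftrightarrow> (\<Sum>i\<in>Q. U' i v u) = 0 \<and> (\<Sum>i\<in>Q. U' i u v) = mult I (F \<inter> safe I) u v"
        "mat h4 FLOW u v = 0" if "u < n" "v < n" for u v
        using set_free_correct[OF sol3 that] Q(2) that by (simp_all add: h4_def)
    qed (use Q(1) in \<open>auto simp: N_def\<close>)
    then obtain G where G: "solution (sem (saturate (Suc r) 1 0) h4) G" "F \<subseteq> G"
     "total_cost I G \<le> total_cost I F + Suc r * total_cost I X"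
     "\<And>A. A \<subseteq> {..<n} \<Longrightarrow> s \<in> A \<Longrightarrow> t \<notin> A \<Longrightarrow> fits U' Q F A \<Longrightarrow> r < flux n (mult I G) A"
      by blast
    have GE: "G \<subseteq> edges I" using G(1) by (simp add: solution_def)
    note anti = violated_antimono[OF re G(2) GE]
    have no: "\<not> fits U' Q F A" if "violated r G A" for A
      using G(4)[of A] that by (auto simp: violated_def)
    have nofit: "\<not> fits U' Q G A" if "violated r G A" for A
      using no[OF that] anti(2)[OF that] by (auto simp: fits_def)
    \<comment> \<open>An enumerated set \<open>A\<close> is left by the same edges as
      \<open>S\<close>. Pairs without an edge have capacity 0 and carry no unit flow. So
      \<open>A\<close> fits \<open>Q\<close> as well and has been covered along with
      \<open>S\<close>.\<close>
    have noenum: "\<not> enumerates w G A" if vio: "violated r G A" for A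
    proof
      assume "enumerates w G A"
      then have en: "enumerates w F A" using enumerates_cong[of A F G w] anti(2)[OF vio] by blast
      have A: "A \<subseteq> {..<n}" "s \<in> A" using vio by (auto simp: violated_def)
      note E = SS(2)[OF A en]
      have "fits U' Q F A"
        unfolding fits_def
      proof (intro ballI allI impI)
        fix u v assume uv: "u \<in> A" "v < n" "v \<notin> A"
        then have u: "u < n" "u \<noteq> v" using A(1) by auto
        show "(\<Sum>i\<in>Q. U' i v u) = 0 \<and> (\<Sum>i\<in>Q. U' i u v) = mult I (F \<inter> safe I) u v"
        proof (cases "0 < mult I F u v")
          case True
          then have "u \<in> S" "v \<notin> S" using E uv u(1) by blast+
          then show ?thesis using sat zero uv(2) by simp
        next
          case False
          then have "mult I F u v = 0" "mult I (F \<inter> safe I) u v = 0" using mult_safe_le[OF FE, of u v] by auto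
          then have "(\<Sum>i<N. U' i u v + U' i v u) = 0"
            using un u uv(2) unfolding units_def N_def[symmetric] capa_def by fastforce
          then have "U' i u v = 0" "U' i v u = 0" if "i < N" for i using that by simp_all
          then show ?thesis using Q(1) \<open>mult I (F \<inter> safe I) u v = 0\<close> by (auto intro!: sum.neutral)
        qed
      qed
      then show False using no[OF vio] by simp
    qed
    have "sem (cover p q r) h = sem (saturate (Suc r) 1 0) h4" using run True by (simp add: h3_def h4_def)
    moreover have "\<exists>Q\<subseteq>{..<N}. card Q < p \<and> (\<exists>A. violated r F A \<and> fits U' Q F A) \<and>
        (\<forall>A. violated r G A \<longrightarrow> \<not> fits U' Q G A)"
      using Q(1) cQ True fitS nofit by blast
    ultimately show ?thesis
      using G(1-3) noenum unfolding w_def[symmetric] U'_def[symmetric] N_def[symmetric]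
      by (intro exI[of _ G]) simp
  qed
qed

section \<open>One stage and its cost\<close>

lemma solution_unique: "solution h F \<Longrightarrow> solution h G \<Longrightarrow> F = G"
  unfolding solution_def edges by (auto simp: subset_iff)

text \<open>Crossing pairs are enumerated rather than crossing edges. There are at most as many of
  them, and the number of tuples then depends on the vertices alone.\<close>

lemma exists_enumeration:
  assumes "A \<subseteq> {..<n}" "s \<in> A" "flux n (mult I F) A \<le> p + q"
  shows "\<exists>w. (\<forall>i<2 * (p + q). w i < n) \<and> (\<forall>i\<ge>2 * (p + q). w i = f i) \<and> enumerates w F A"
proof -
  define C where "C = {(u, v). u \<in> A \<and> v < n \<and> v \<notin> A \<and> 0 < mult I F u v}"
  have fin: "finite C" using assms(1) by (intro finite_subset[of C "{..<n} \<times> {..<n}"]) (auto simp: C_def)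
  have "card C = (\<Sum>(u, v)\<in>C. 1)" by simp
  also have "\<dots> \<le> (\<Sum>(u, v)\<in>C. mult I F u v)" by (rule sum_mono) (auto simp: C_def)
  also have "\<dots> \<le> flux n (mult I F) A"
    unfolding flux_def using assms(1) by (intro sum_mono2) (auto simp: C_def)
  finally have card: "card C \<le> p + q" using assms(3) by simp
  obtain xs where xs: "set xs = C" "distinct xs" using finite_distinct_list[OF fin] by blast
  then have len: "length xs \<le> p + q" using card distinct_card by metis
  define w where "w i = (if 2 * (p + q) \<le> i then f i else if i < p + q
      then if i < length xs then fst (xs ! i) else s
      else if i - (p + q) < length xs then snd (xs ! (i - (p + q))) else s)" for i
  have w: "w i = (if i < length xs then fst (xs ! i) else s)"
    "w (p + q + i) = (if i < length xs then snd (xs ! i) else s)" if "i < p + q" for i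
    using that by (simp_all add: w_def)
  have nth: "fst (xs ! i) \<in> A" "fst (xs ! i) < n" "snd (xs ! i) < n" "snd (xs ! i) \<notin> A" if "i < length xs" for i
    using nth_mem[OF that] assms(1) unfolding xs(1) C_def by auto
  have "w i < n" if "i < 2 * (p + q)" for i
    using nth s that by (auto simp: w_def)
  moreover have "enumerates w F A"
    unfolding enumerates_def
  proof (intro conjI allI impI ballI)
    fix i assume i: "i < p + q"
    show "w i \<in> A \<and> w (p + q + i) < n \<and> w (p + q + i) \<notin> A \<or> w i = s \<and> w (p + q + i) = s"
      using w[OF i] nth[of i] by auto
  next
    fix u v assume "u \<in> A" "v < n" "v \<notin> A" "0 < mult I F u v"
    then have "(u, v) \<in> set xs" by (simp add: xs C_def)
    then obtain i where i: "i < length xs" "xs ! i = (u, v)" by (auto simp: in_set_conv_nth)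
    then show "\<exists>i<p + q. u = w i \<and> v = w (p + q + i)"
      using len w[of i] by (intro exI[of _ i]) simp
  qed
  ultimately show ?thesis by (intro exI[of _ w]) (simp add: w_def)
qed

text \<open>Each set \<open>Q\<close> of unit flows triggers at most one covering step per stage.\<close>

definition patterns :: "nat set set" where
  "patterns = {Q. Q \<subseteq> {..<p * (p + q)} \<and> card Q < p}"

lemma finite_patterns: "finite patterns"
  by (rule finite_subset[of _ "Pow {..<p * (p + q)}"]) (auto simp: patterns_def)

lemma total_cost_nonneg: "X \<subseteq> edges I \<Longrightarrow> 0 \<le> total_cost I X"
  using total_cost_mono[of "{}" X] by (simp add: total_cost_def)

text \<open>All tuples are tried. A cut still violated at the end would be enumerated by one of
  them, but the corresponding step rules out such cuts, and by \<open>violated_antimono\<close>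
  later purchases cannot create any.\<close>

lemma stage_correct:
  assumes sol: "solution h F" and re: "reached r F" and r: "r < p + q" and pq: "p * q < 2 * (p + q)"
    and U: "units (cube h UNIT) F" and X: "X \<subseteq> edges I" "feasible p q I X"
  defines "g \<equiv> sem (nest (2 * (p + q)) (cover p q r)) h"
  shows "\<exists>G. solution g G \<and> reached (Suc r) G \<and> units (cube g UNIT) G \<and>
     total_cost I G \<le> total_cost I F + card patterns * (p + q) * total_cost I X"
proof -
  define V where "V = cube h UNIT"
  \<comment> \<open>\<open>M\<close> collects the sets of unit flows already charged. No violated
    cut fits a member of \<open>M\<close>, while each new charge comes from a \<open>Q\<close> that
    fits one; so no set is charged twice.\<close>
  define K where "K f G M \<longleftrightarrow> solution f G \<and> F \<subseteq> G \<and> cube f UNIT = V \<and> M \<subseteq> patterns \<and>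
     (\<forall>Q\<in>M. \<forall>A. violated r G A \<longrightarrow> \<not> fits V Q G A) \<and>
     total_cost I G \<le> total_cost I F + card M * Suc r * total_cost I X" for f G M
  define J where "J f \<longleftrightarrow> (\<exists>G M. K f G M)" for f
  define P where "P w f \<longleftrightarrow> (\<forall>G. solution f G \<longrightarrow> (\<forall>A. violated r G A \<longrightarrow> \<not> enumerates w G A))" for w f
  have solt: "solution (setn TUPLE i x f) G = solution f G" for i x f G by (intro solution_cong) auto
  have "J g \<and> (\<forall>w. (\<forall>i<2 * (p + q). w i < n) \<and> (\<forall>i\<ge>2 * (p + q). w i = narr h TUPLE i) \<longrightarrow> P w g) \<and>
      (\<forall>w. P w h \<longrightarrow> P w g)"
    unfolding g_def
  proof (rule nest_rule[where I = J and P = P and e = "2 * (p + q)"])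
    show "\<not> writes (cover p q r) TUPLE i" for i by simp
    show "J (setn TUPLE i x f)" if "J f" for i x f
      using that by (simp add: J_def K_def solt) (simp add: cube_def[abs_def])
    show "P w (setn TUPLE i x f)" if "P w f" for w i x f
      using that by (simp add: P_def solt)
    have "K h F {}" using sol by (simp add: K_def V_def)
    then show "J h" unfolding J_def by blast
    show "nin h 0 = n" using sol tables_nin by (simp add: solution_def)
  next
    fix f assume "J f" and tup: "\<And>i. i < 2 * (p + q) \<Longrightarrow> narr f TUPLE i < n"
    then obtain G M where G: "solution f G" "F \<subseteq> G" "cube f UNIT = V" "M \<subseteq> patterns"
      "\<And>Q A. Q \<in> M \<Longrightarrow> violated r G A \<Longrightarrow> \<not> fits V Q G A"
      "total_cost I G \<le> total_cost I F + card M * Suc r * total_cost I X"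
      by (auto simp: J_def K_def)
    let ?f = "sem (cover p q r) f"
    have GE: "G \<subseteq> edges I" using G(1) by (simp add: solution_def)
    have reG: "reached r G" by (rule reached_mono[OF re G(2) GE])
    have uG: "units (cube f UNIT) G" using units_mono[OF U G(2) GE] G(3) by (simp add: V_def)
    have uf: "cube ?f UNIT = V"
      using sem_frame_arr[of "cover p q r" UNIT f] G(3) by (simp add: cube_def[abs_def])
    obtain H where H: "solution ?f H" "G \<subseteq> H"
      "\<And>A. violated r H A \<Longrightarrow> \<not> enumerates (narr f TUPLE) H A"
      and alt: "H = G \<or> total_cost I H \<le> total_cost I G + Suc r * total_cost I X \<and>
       (\<exists>Q\<subseteq>{..<p * (p + q)}. card Q < p \<and> (\<exists>A. violated r G A \<and> fits V Q G A) \<and>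
          (\<forall>A. violated r H A \<longrightarrow> \<not> fits V Q H A))"
      using cover_correct[OF G(1) reG r pq uG tup X] unfolding G(3) by blast
    have HE: "H \<subseteq> edges I" using H(1) by (simp add: solution_def)
    note anti = violated_antimono[OF reG H(2) HE]
    have keep: "\<not> fits V Q H A" if "Q \<in> M" "violated r H A" for Q A
      using G(5)[OF that(1) anti(1)[OF that(2)]] anti(2)[OF that(2)] by (auto simp: fits_def)
    have "J ?f"
      using alt
    proof
      assume "H = G"
      then show ?thesis
        unfolding J_def K_def using G H(1) uf by (intro exI[of _ G] exI[of _ M]) simp
    next
      assume "total_cost I H \<le> total_cost I G + Suc r * total_cost I X \<and>
       (\<exists>Q\<subseteq>{..<p * (p + q)}. card Q < p \<and> (\<exists>A. violated r G A \<and> fits V Q G A) \<and>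
          (\<forall>A. violated r H A \<longrightarrow> \<not> fits V Q H A))"
      then obtain Q where Q: "Q \<in> patterns" "\<exists>A. violated r G A \<and> fits V Q G A"
        "\<And>A. violated r H A \<Longrightarrow> \<not> fits V Q H A"
        and c: "total_cost I H \<le> total_cost I G + Suc r * total_cost I X"
        by (auto simp: patterns_def)
      have "Q \<notin> M" using Q(2) G(5) by blast
      moreover have "finite M" using G(4) finite_patterns finite_subset by blast
      ultimately have "card (insert Q M) = Suc (card M)" by simp
      then have "total_cost I H \<le> total_cost I F + card (insert Q M) * Suc r * total_cost I X"
        using c G(6) by (simp add: algebra_simps)
      then show ?thesis
        unfolding J_def K_def using H(1,2) G(2,4) Q(1,3) keep uf
        by (intro exI[of _ H] exI[of _ "insert Q M"]) auto
    qed
    moreover have "P (narr f TUPLE) ?f"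
      unfolding P_def using H(1,3) solution_unique[OF H(1)] by blast
    moreover have "P w ?f" if "P w f" for w
      unfolding P_def
    proof (intro allI impI)
      fix G' A assume "solution ?f G'" and vio: "violated r G' A"
      then have G': "G' = H" using solution_unique H(1) by blast
      have "\<not> enumerates w G A" using that anti(1) vio G(1) by (auto simp: P_def G')
      then show "\<not> enumerates w G' A"
        using enumerates_cong[of A G H w] anti(2) vio unfolding G' by blast
    qed
    ultimately show "J ?f \<and> P (narr f TUPLE) ?f \<and> (\<forall>w. P w f \<longrightarrow> P w ?f)" by blast
  qed simp
  then obtain G M where G: "solution g G" "F \<subseteq> G" "cube g UNIT = V" "M \<subseteq> patterns"
      "total_cost I G \<le> total_cost I F + card M * Suc r * total_cost I X"
    and P: "\<And>w. (\<forall>i<2 * (p + q). w i < n) \<Longrightarrow> (\<forall>i\<ge>2 * (p + q). w i = narr h TUPLE i) \<Longrightarrow> P w g"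
    by (auto simp: J_def K_def)
  have GE: "G \<subseteq> edges I" using G(1) by (simp add: solution_def)
  have reG: "reached r G" by (rule reached_mono[OF re G(2) GE])
  have "reached (Suc r) G"
    unfolding reached_def
  proof (intro allI impI)
    fix A assume A: "A \<subseteq> {..<n}" "s \<in> A" "t \<notin> A"
    show "p \<le> flux n (mult I (G \<inter> safe I)) A \<or> Suc r \<le> flux n (mult I G) A"
    proof (rule ccontr)
      assume no: "\<not> ?thesis"
      then have "r \<le> flux n (mult I G) A" using reachedD[OF reG A] by simp
      then have vio: "violated r G A" using no A by (simp add: violated_def)
      then have "flux n (mult I G) A \<le> p + q" using r by (simp add: violated_def)
      from exists_enumeration[OF A(1,2) this, of "narr h TUPLE"] obtain w where
        "\<forall>i<2 * (p + q). w i < n" "\<forall>i\<ge>2 * (p + q). w i = narr h TUPLE i" "enumerates w G A" by blast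
      then show False using P G(1) vio unfolding P_def by blast
    qed
  qed
  moreover have "units (cube g UNIT) G" using units_mono[OF U G(2) GE] G(3) by (simp add: V_def)
  moreover have "total_cost I G \<le> total_cost I F + card patterns * (p + q) * total_cost I X"
  proof -
    have "card M * Suc r \<le> card patterns * (p + q)"
      using card_mono[OF finite_patterns G(4)] r by (intro mult_le_mono) auto
    then have "real (card M * Suc r) * total_cost I X \<le> real (card patterns * (p + q)) * total_cost I X"
      using total_cost_nonneg[OF X(1)] by (intro mult_right_mono) (simp_all only: of_nat_le_iff)
    then show ?thesis using G(5) by linarith
  qed
  ultimately show ?thesis using G(1) by blast
qed

lemma stages_correct:
  assumes sol: "solution h F" and re: "reached p F" and pq: "p * q < 2 * (p + q)"
    and U: "units (cube h UNIT) F" and X: "X \<subseteq> edges I" "feasible p q I X" and k: "k \<le> q"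
  shows "\<exists>G. solution (sem (stages p q k) h) G \<and> reached (p + k) G \<and> units (cube (sem (stages p q k) h) UNIT) G \<and>
     total_cost I G \<le> total_cost I F + k * (card patterns * (p + q)) * total_cost I X"
  using k
proof (induction k)
  case 0
  then show ?case using assms by (intro exI[of _ F]) simp
next
  case (Suc k)
  then obtain G where G: "solution (sem (stages p q k) h) G" "reached (p + k) G"
    "units (cube (sem (stages p q k) h) UNIT) G"
    "total_cost I G \<le> total_cost I F + k * (card patterns * (p + q)) * total_cost I X"
    by auto
  obtain H where "solution (sem (stages p q (Suc k)) h) H" "reached (Suc (p + k)) H"
    "units (cube (sem (stages p q (Suc k)) h) UNIT) H"
    "total_cost I H \<le> total_cost I G + card patterns * (p + q) * total_cost I X"
    using stage_correct[OF G(1,2) _ pq G(3) X] Suc.prems by auto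
  then show ?case using G(4) by (intro exI[of _ H]) (simp add: algebra_simps)
qed

text \<open>The case \<open>p = 0\<close> is separate because unsafe edges then have capacity 0, and
  buying one would not allow a unit to be pushed.\<close>

lemma first_stage:
  assumes sol: "solution h {}" and zero: "\<And>u v. u < n \<Longrightarrow> v < n \<Longrightarrow> mat h FLOW u v = 0 \<and> mat h FREE u v = 0"
    and unit: "\<And>i u v. u < n \<Longrightarrow> v < n \<Longrightarrow> cube h UNIT i u v = 0"
    and pq: "0 < p + q" and X: "X \<subseteq> edges I" "feasible p q I X"
  defines "g \<equiv> sem (saturate (p * (p + q)) p q ;; decompose (p * (p + q))) h"
  shows "\<exists>F. solution g F \<and> reached p F \<and> units (cube g UNIT) F \<and>
    total_cost I F \<le> p * (p + q) * total_cost I X"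
proof (cases "p = 0")
  case True
  then have "g = setn RND 0 0 (setn RND 0 0 h)" by (simp add: g_def saturate_def decompose_def)
  then have "solution g {}" using sol solution_cong[of g h "{}"] by simp
  moreover have "reached p {}" unfolding reached_def using True by simp
  moreover have "units (cube g UNIT) {}" unfolding units_def using True by simp
  moreover have "total_cost I {} \<le> p * (p + q) * total_cost I X" using True by (simp add: total_cost_def)
  ultimately show ?thesis by blast
next
  case False
  define N where "N = p * (p + q)"
  define h1 where "h1 = sem (saturate N p q) h"
  have flux_capa: "flux n (capa p q F) A = p * flux n (mult I F) A + q * flux n (mult I (F \<inter> safe I)) A" for F A
    unfolding capa_def flux_add flux_mult ..
  have "\<exists>G. solution h1 G \<and> {} \<subseteq> G \<and> valid p q h1 G \<and>
     total_cost I G \<le> total_cost I {} + N * total_cost I X \<and> amount h1 N"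
    unfolding h1_def
  proof (rule saturate_correct[OF sol _ X(1)])
    fix G A
    assume G: "G \<subseteq> edges I" and A: "A \<subseteq> {..<n}" "s \<in> A" "t \<notin> A" and cap: "flux n (capa p q G) A < N"
    show "\<exists>u\<in>A. \<exists>v<n. v \<notin> A \<and> (\<exists>e\<in>X - G. e \<in> parallel I u v) \<and> mult I G u v < p + q"
    proof (rule ccontr)
      assume none: "\<not> ?thesis"
      have "X \<inter> parallel I u v \<subseteq> G" if "u \<in> A" "v < n" "v \<notin> A" for u v
      proof -
        \<comment> \<open>A pair with \<open>p + q\<close> edges has capacity at least
          \<open>N\<close> by itself, which is too much for a deficient cut. So the sentinel hides
          no edge of \<open>X\<close>.\<close>
        have "p * mult I G u v \<le> capa p q G u v" by (simp add: capa_def)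
        also have "\<dots> \<le> flux n (capa p q G) A" using flux_member_le[OF A(1) that] .
        finally have "mult I G u v < p + q"
          using cap by (simp add: N_def) (metis le_less_trans mult_less_cancel1)
        then show ?thesis using none that by blast
      qed
      then have "mult I X u v \<le> mult I G u v \<and> mult I (X \<inter> safe I) u v \<le> mult I (G \<inter> safe I) u v"
        if "u \<in> A" "v < n" "v \<notin> A" for u v
        unfolding mult_def using that fin[OF G] by (intro conjI card_mono) blast+
      then have le: "flux n (mult I X) A \<le> flux n (mult I G) A"
        "flux n (mult I (X \<inter> safe I)) A \<le> flux n (mult I (G \<inter> safe I)) A"
        by (auto intro!: flux_mono)
      have "flux n (mult I (X \<inter> safe I)) A \<le> flux n (mult I X) A"
        using mult_safe_le[OF X(1)] by (intro flux_mono) auto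
      moreover have "p \<le> flux n (mult I (X \<inter> safe I)) A \<or> p + q \<le> flux n (mult I X) A"
        using X A feasible_iff_flux[OF inst num X(1), of p q] by (auto simp: n_def)
      ultimately consider "p \<le> flux n (mult I G) A" "p \<le> flux n (mult I (G \<inter> safe I)) A" | "p + q \<le> flux n (mult I G) A"
        using le by linarith
      then have "N \<le> flux n (capa p q G) A"
      proof cases
        case 1
        have "N = p * p + q * p" by (simp add: N_def algebra_simps)
        also have "\<dots> \<le> flux n (capa p q G) A" unfolding flux_capa by (intro add_mono mult_le_mono2 1)
        finally show ?thesis .
      next
        case 2
        then show ?thesis unfolding flux_capa N_def by (intro trans_le_add1 mult_le_mono2)
      qed
      then show False using cap by simp
    qed
  qed (use False zero in auto)
  then obtain F where F: "solution h1 F" "valid p q h1 F" "total_cost I F \<le> N * total_cost I X" "amount h1 N"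
    by (auto simp: total_cost_def)
  have FE: "F \<subseteq> edges I" and tb: "tables h1" using F(1) by (auto simp: solution_def)
  have nn: "nin h1 = nin h" by (simp add: h1_def)
  have eq: "mat h1 FREE = mat h FREE" "cube h1 UNIT = cube h UNIT"
    using sem_frame_arr[of "saturate N p q" FREE h] sem_frame_arr[of "saturate N p q" UNIT h]
    by (simp_all add: h1_def mat_def[abs_def] cube_def[abs_def])
  have g: "g = sem (decompose N) h1" by (simp add: g_def h1_def N_def)
  have "same (decompose N) h1 g" unfolding g by (rule same_sem)
  then have sol_g: "solution g F" by (subst solution_same) (use F(1) in auto)
  have units: "units (cube g UNIT) F"
    unfolding g N_def using F(4) zero unit
    by (intro decompose_correct[OF tb _ F(2)]) (simp_all add: eq N_def)
  have "reached p F"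
    unfolding reached_def
  proof (intro allI impI)
    fix A assume A: "A \<subseteq> {..<n}" "s \<in> A" "t \<notin> A"
    have "int N = net n (mat h1 FLOW) A" using F(4) A by (simp add: amount_def)
    also have "\<dots> \<le> flux n (\<lambda>u v. int (capa p q F u v)) A"
      unfolding net_def
    proof (rule flux_mono)
      fix u v assume uv: "u \<in> A" "v < n" "v \<notin> A"
      then have "u < n" "u \<noteq> v" using A(1) by auto
      then have "mat h1 FLOW u v \<le> capa p q F u v + mat h1 FLOW v u"
        using F(2)[unfolded valid_def, rule_format, of u v] zero uv(2) by (simp add: eq)
      then show "int (mat h1 FLOW u v) - int (mat h1 FLOW v u) \<le> int (capa p q F u v)" by simp
    qed
    finally have N: "N \<le> p * flux n (mult I F) A + q * flux n (mult I (F \<inter> safe I)) A"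
      by (simp only: flux_of_nat of_nat_le_iff flux_capa)
    have le: "flux n (mult I (F \<inter> safe I)) A \<le> flux n (mult I F) A"
      using mult_safe_le[OF FE] by (intro flux_mono) auto
    show "p \<le> flux n (mult I (F \<inter> safe I)) A \<or> p \<le> flux n (mult I F) A"
    proof (rule ccontr)
      assume "\<not> ?thesis"
      then have less: "flux n (mult I F) A < p" by simp
      \<comment> \<open>Fewer than \<open>p\<close> edges have capacity below
        \<open>(p + q) * p\<close> even if all of them are safe.\<close>
      have "p * flux n (mult I F) A + q * flux n (mult I (F \<inter> safe I)) A \<le>
          p * flux n (mult I F) A + q * flux n (mult I F) A"
        using le by simp
      also have "\<dots> = (p + q) * flux n (mult I F) A" by (simp add: algebra_simps)
      also have "\<dots> < (p + q) * p" using less pq by simp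
      finally show False using N by (simp add: N_def mult.commute)
    qed
  qed
  then show ?thesis using sol_g units F(3) by (auto simp: N_def)
qed

end

section \<open>Reading the instance\<close>

abbreviation (input) "ONCE \<equiv> 32::nat"

definition index_tables :: "nat \<Rightarrow> prog" where
  "index_tables N =
     Put ROW (Lit 0) (Lit 0) ;;
     Loop LAY 0 Verts (Put ROW (Pls (cell LAY) (Lit 1)) (Pls (Arr ROW (cell LAY)) (Inp 0))) ;;
     Put PLANE (Lit 0) (Lit 0) ;;
     Loop LAY 0 (Times N)
       (Put PLANE (Pls (cell LAY) (Lit 1)) (Pls (Arr PLANE (cell LAY)) (Arr ROW (Inp 0))))"

definition load :: prog where
  "load =
     Loop EDGE 0 Edges (Load TAIL 0 (cell EDGE) ;; Load HEAD 1 (cell EDGE) ;; Load SAFE 2 (cell EDGE) ;;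
       RLoad COST (cell EDGE)) ;;
     RPut BIG (Lit 0) (RLit 1) ;;
     Loop EDGE 0 Edges (RPut BIG (Lit 0) (RPls (rcell BIG) (RArr COST (cell EDGE))))"

definition slot_at :: "nx \<Rightarrow> nx \<Rightarrow> nx" where
  "slot_at u v = at3 (cell RND) u v"

definition scan :: prog where
  "scan = Loop EDGE 0 Edges
     (Put TA (Lit 0) (Arr TAIL (cell EDGE)) ;; Put TB (Lit 0) (Arr HEAD (cell EDGE)) ;;
      Ifte (Cnj (Neg (Lss (Lit 0) (Arr USED (cell EDGE))))
          (Neg (Cnj (Lss (Lit 0) (Arr SLOT (slot_at (cell TA) (cell TB))))
            (Neg (RLss (RArr COST (cell EDGE))
              (RArr COST (Mns (Arr SLOT (slot_at (cell TA) (cell TB))) (Lit 1))))))))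
        (Put SLOT (slot_at (cell TA) (cell TB)) (Pls (cell EDGE) (Lit 1)) ;;
         Put SLOT (slot_at (cell TB) (cell TA)) (Pls (cell EDGE) (Lit 1))) Nop)"

definition mark :: prog where
  "mark = pairs (Ifte (Lss (Lit 0) (Arr SLOT (slot_at (cell VU) (cell VV))))
     (Put USED (Mns (Arr SLOT (slot_at (cell VU) (cell VV))) (Lit 1)) (Lit 1)) Nop)"

text \<open>Selection of the cheapest remaining edge, in \<open>p + q\<close> passes over the edges
  that each serve all pairs at once. A pass per pair would multiply the number of edges by
  \<open>n ^ 2\<close> and break the time bound.\<close>

definition sort_slots :: "nat \<Rightarrow> prog" where
  "sort_slots d = Loop RND 0 (Times d) (scan ;; mark)"

definition prepare :: "nat \<Rightarrow> nat \<Rightarrow> prog" where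
  "prepare p q = index_tables (p * (p + q) + (p + q)) ;; load ;; sort_slots (p + q)"

definition gather :: prog where
  "gather = Loop EDGE 0 Edges
     (Ifte (Lss (Lit 0) (Arr SOL (cell EDGE))) (Put OUT (cell LEN) (cell EDGE) ;; incr LEN (Lit 0)) Nop)"

text \<open>With a single vertex \<open>s = t\<close> and nothing has to be bought. The time allowed
  is then a constant plus a multiple of \<open>(p + q) * m\<close>, too little to set up tables
  whose sizes depend on \<open>p\<close> and \<open>q\<close>; so the main part runs only for two or
  more vertices.\<close>

definition solver :: "nat \<Rightarrow> nat \<Rightarrow> prog" where
  "solver p q =
     Loop ONCE 0 Once (prepare p q ;; (saturate (p * (p + q)) p q ;; decompose (p * (p + q))) ;; stages p q q) ;;
     Put CNTR (Lit 0) (Inp 1) ;; gather"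

lemma index_tables_simps [simp]:
  "writes (index_tables N) k i \<longleftrightarrow> k \<in> {ROW, PLANE} \<or> k = LAY \<and> i = 0"
  "\<not> rwrites (index_tables N) k" "legal (index_tables N)"
  by (auto simp: index_tables_def)

lemma load_simps [simp]:
  "writes load k i \<longleftrightarrow> k \<in> {TAIL, HEAD, SAFE} \<or> k = EDGE \<and> i = 0"
  "rwrites load k \<longleftrightarrow> k \<in> {COST, BIG}" "legal load"
  by (auto simp: load_def)

lemma scan_simps [simp]:
  "writes scan k i \<longleftrightarrow> k \<in> {TA, TB, SLOT} \<or> k = EDGE \<and> i = 0"
  "\<not> rwrites scan k" "legal scan"
  by (auto simp: scan_def slot_at_def)

lemma mark_simps [simp]:
  "writes mark k i \<longleftrightarrow> k = USED \<or> k \<in> {VU, VV} \<and> i = 0"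
  "\<not> rwrites mark k" "legal mark"
  by (auto simp: mark_def slot_at_def)

lemma sort_slots_simps [simp]:
  "writes (sort_slots d) k i \<longleftrightarrow> k \<in> {TA, TB, SLOT, USED} \<or> k \<in> {EDGE, VU, VV, RND} \<and> i = 0"
  "\<not> rwrites (sort_slots d) k" "legal (sort_slots d)"
  by (auto simp: sort_slots_def)

lemma prepare_simps [simp]:
  "writes (prepare p q) k i \<longleftrightarrow> k \<in> {ROW, PLANE, TAIL, HEAD, SAFE, TA, TB, SLOT, USED} \<or>
     k \<in> {LAY, EDGE, VU, VV, RND} \<and> i = 0" "legal (prepare p q)"
  by (auto simp: prepare_def)

lemma stages_simps [simp]: "legal (stages p q k)" "\<not> writes (stages p q k) ONCE i"
  by (induction k) (auto simp: nest_writes intro!: nest_legal)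

lemma solver_legal: "legal (solver p q)"
  by (auto simp: solver_def gather_def)

section \<open>Correctness of the preprocessing\<close>

lemma index_tables_correct:
  assumes h: "narr h ROW = (\<lambda>_. 0)" "narr h PLANE = (\<lambda>_. 0)"
  shows "tabs N (sem (index_tables N) h)"
proof -
  define n where "n = nin h 0"
  let ?b1 = "Put ROW (Pls (cell LAY) (Lit 1)) (Pls (Arr ROW (cell LAY)) (Inp 0))"
  let ?b2 = "Put PLANE (Pls (cell LAY) (Lit 1)) (Pls (Arr PLANE (cell LAY)) (Arr ROW (Inp 0)))"
  define h1 where "h1 = sem (Loop LAY 0 Verts ?b1) (setn ROW 0 0 h)"
  have s1: "same (Loop LAY 0 Verts ?b1) (setn ROW 0 0 h) h1" unfolding h1_def by (rule same_sem)
  have n1: "nin h1 0 = n" using sameD(1)[OF s1] by (simp add: n_def)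
  have row: "\<forall>i\<le>n. narr h1 ROW i = i * n"
    unfolding h1_def
  proof (rule Loop_rule[where I = "\<lambda>k g. \<forall>i\<le>k. narr g ROW i = i * n"], goal_cases)
    case (2 k g)
    have "nin g 0 = n" using sameD(1)[OF 2(3)] by (simp add: n_def)
    then show ?case using 2(2) by (auto simp: le_Suc_eq)
  qed (simp_all add: n_def)
  let ?h2 = "setn PLANE 0 0 h1"
  define h3 where "h3 = sem (Loop LAY 0 (Times N) ?b2) ?h2"
  have s3: "same (Loop LAY 0 (Times N) ?b2) ?h2 h3" unfolding h3_def by (rule same_sem)
  have r3: "narr h3 ROW = narr h1 ROW" "nin h3 0 = n"
    using sameD(4)[OF s3, of ROW] sameD(1)[OF s3] n1 by simp_all
  have "\<forall>i\<le>N. narr h3 PLANE i = i * (n * n)"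
    unfolding h3_def
  proof (rule Loop_rule[where I = "\<lambda>k g. \<forall>i\<le>k. narr g PLANE i = i * (n * n)"], goal_cases)
    case (2 k g)
    have "nin g 0 = n" "narr g ROW = narr h1 ROW"
      using sameD(1)[OF 2(3)] sameD(4)[OF 2(3), of ROW] n1 by simp_all
    then show ?case using 2(2) row by (auto simp: le_Suc_eq)
  qed (simp_all)
  moreover have "sem (index_tables N) h = h3"
    by (simp only: index_tables_def sem.simps h3_def h1_def neval.simps)
  ultimately show ?thesis using row r3 by (simp add: tabs_def)
qed

context flex_problem
begin

lemma load_correct:
  assumes h: "nin h = nin (initial I)" "rin h = rin (initial I)"
  defines "g \<equiv> sem load h"
  shows "\<And>e. e < m \<Longrightarrow> narr g TAIL e = fst (ends I e) \<and> narr g HEAD e = snd (ends I e) \<and>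
      narr g SAFE e = (if e \<in> safe I then 1 else 0) \<and> rarr g COST e = cost I e"
    "rarr g BIG 0 = big"
proof -
  let ?b1 = "Load TAIL 0 (cell EDGE) ;; Load HEAD 1 (cell EDGE) ;; Load SAFE 2 (cell EDGE) ;; RLoad COST (cell EDGE)"
  let ?b3 = "RPut BIG (Lit 0) (RPls (rcell BIG) (RArr COST (cell EDGE)))"
  define h1 where "h1 = sem (Loop EDGE 0 Edges ?b1) h"
  have nm: "nin h (Suc 0) = m" using h initial_in(2)[of I] by (simp add: m_def)
  have s1: "same (Loop EDGE 0 Edges ?b1) h h1" unfolding h1_def by (rule same_sem)
  have one: "\<forall>e<m. narr h1 TAIL e = fst (ends I e) \<and> narr h1 HEAD e = snd (ends I e) \<and>
      narr h1 SAFE e = (if e \<in> safe I then 1 else 0) \<and> rarr h1 COST e = cost I e"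
    unfolding h1_def
  proof (rule Loop_rule[where I = "\<lambda>k g. \<forall>e<k. narr g TAIL e = fst (ends I e) \<and> narr g HEAD e = snd (ends I e) \<and>
      narr g SAFE e = (if e \<in> safe I then 1 else 0) \<and> rarr g COST e = cost I e"], goal_cases)
    case (2 k g)
    have k: "k < m" using 2(1) nm by simp
    have ng: "nin g = nin (initial I)" "rin g = rin (initial I)"
      using sameD(1,2)[OF 2(3)] h by simp_all
    have "k < nin g (Suc 0)" using k ng initial_in(2)[of I] by (simp add: m_def)
    then show ?case
      using 2(2) initial_edge[of k I, folded m_def, OF k]
      by (auto simp: ng less_Suc_eq ac_simps)
  qed (simp_all add: nm)
  let ?h2 = "setr BIG 0 1 h1"
  have n1: "nin ?h2 (Suc 0) = m" using sameD(1)[OF s1] nm by simp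
  define h3 where "h3 = sem (Loop EDGE 0 Edges ?b3) ?h2"
  have s3: "same (Loop EDGE 0 Edges ?b3) ?h2 h3" unfolding h3_def by (rule same_sem)
  have "rarr h3 BIG 0 = 1 + (\<Sum>e<m. cost I e)"
    unfolding h3_def
  proof (rule Loop_rule[where I = "\<lambda>k g. k \<le> m \<and> rarr g BIG 0 = 1 + (\<Sum>e<k. cost I e)"], goal_cases)
    case (2 k g)
    have k: "k < m" using 2(1) n1 by simp
    have "rarr g COST = rarr h1 COST" using sameD(5)[OF 2(3), of COST] by simp
    then show ?case using 2(2) one k by simp
  next
    case (3 g)
    then show ?case using n1 by simp
  qed (simp)
  moreover have g: "g = h3" by (simp only: g_def load_def sem.simps h3_def h1_def neval.simps reval.simps of_nat_1)
  ultimately show "rarr g BIG 0 = big" by (simp add: big_def total_cost_def edges)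
  show "narr g TAIL e = fst (ends I e) \<and> narr g HEAD e = snd (ends I e) \<and>
      narr g SAFE e = (if e \<in> safe I then 1 else 0) \<and> rarr g COST e = cost I e" if "e < m" for e
    using one that sameD(4)[OF s3, of TAIL] sameD(4)[OF s3, of HEAD] sameD(4)[OF s3, of SAFE]
      sameD(5)[OF s3, of COST] by (simp add: g)
qed

definition loaded :: "store \<Rightarrow> bool" where
  "loaded h \<longleftrightarrow> tabs bound h \<and> nin h = nin (initial I) \<and>
     (\<forall>e<m. narr h TAIL e = fst (ends I e) \<and> narr h HEAD e = snd (ends I e) \<and> rarr h COST e = cost I e)"

lemma loaded_same:
  assumes "same c h g" "\<And>k i. writes c k i \<Longrightarrow> k \<notin> {ROW, PLANE, TAIL, HEAD}"
    "\<And>k. rwrites c k \<Longrightarrow> k \<noteq> COST"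
  shows "loaded g = loaded h"
proof -
  have "narr g k = narr h k" if "k \<in> {ROW, PLANE, TAIL, HEAD}" for k
    using assms(2) that by (intro sameD(4)[OF assms(1)]) blast
  moreover have "rarr g COST = rarr h COST" using assms(3) by (intro sameD(5)[OF assms(1)]) blast
  ultimately show ?thesis using sameD(1)[OF assms(1)] by (simp add: loaded_def tabs_def)
qed

text \<open>Relative to the edges below \<open>i\<close>, which are those already scanned. With
  \<open>i = m\<close>, and with \<open>Us\<close> marking the edges in earlier slots, it is what
  \<open>sorted_slots\<close> demands of one slot.\<close>

definition cheapest :: "(nat \<Rightarrow> bool) \<Rightarrow> nat \<Rightarrow> nat \<Rightarrow> nat \<Rightarrow> nat \<Rightarrow> bool" where
  "cheapest Us i u v x \<longleftrightarrow> (\<forall>e. x = Suc e \<longrightarrow> e < i \<and> e \<in> parallel I u v \<and> \<not> Us e \<and>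
       (\<forall>e'<i. e' \<in> parallel I u v \<longrightarrow> \<not> Us e' \<longrightarrow> cost I e \<le> cost I e')) \<and>
     (x = 0 \<longrightarrow> (\<forall>e<i. e \<in> parallel I u v \<longrightarrow> Us e))"

lemma cheapest_skip:
  "cheapest Us i u v x \<Longrightarrow> i \<notin> parallel I u v \<or> Us i \<Longrightarrow> cheapest Us (Suc i) u v x"
  by (auto simp: cheapest_def less_Suc_eq)

lemma cheapest_keep:
  "cheapest Us i u v (Suc e) \<Longrightarrow> cost I e \<le> cost I i \<Longrightarrow> cheapest Us (Suc i) u v (Suc e)"
  by (auto simp: cheapest_def less_Suc_eq)

lemma cheapest_new:
  assumes "cheapest Us i u v x" "i \<in> parallel I u v" "\<not> Us i" "\<And>e. x = Suc e \<Longrightarrow> cost I i \<le> cost I e"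
  shows "cheapest Us (Suc i) u v (Suc i)"
proof -
  have "cost I i \<le> cost I e'" if e': "e' < i" "e' \<in> parallel I u v" "\<not> Us e'" for e'
  proof (cases x)
    case 0
    then show ?thesis using assms(1) e' by (auto simp: cheapest_def)
  next
    case (Suc e)
    then have "cost I e \<le> cost I e'" using assms(1) e' by (auto simp: cheapest_def)
    then show ?thesis using assms(4)[OF Suc] by linarith
  qed
  then show ?thesis using assms(2,3) by (auto simp: cheapest_def less_Suc_eq)
qed

lemma scan_correct:
  assumes ld: "loaded h" and l: "narr h RND 0 = l" "l \<le> bound"
    and zero: "\<And>u v. u < n \<Longrightarrow> v < n \<Longrightarrow> cube h SLOT l u v = 0"
  defines "g \<equiv> sem scan h" and "Us \<equiv> \<lambda>e. narr h USED e \<noteq> 0"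
  shows "\<forall>u<n. \<forall>v<n. cheapest Us m u v (cube g SLOT l u v) \<and> cube g SLOT l u v = cube g SLOT l v u \<and>
     (\<forall>l'. l' \<noteq> l \<longrightarrow> cube g SLOT l' u v = cube h SLOT l' u v)"
proof -
  let ?c = "Ifte (Cnj (Neg (Lss (Lit 0) (Arr USED (cell EDGE))))
          (Neg (Cnj (Lss (Lit 0) (Arr SLOT (slot_at (cell TA) (cell TB))))
            (Neg (RLss (RArr COST (cell EDGE))
              (RArr COST (Mns (Arr SLOT (slot_at (cell TA) (cell TB))) (Lit 1))))))))
        (Put SLOT (slot_at (cell TA) (cell TB)) (Pls (cell EDGE) (Lit 1)) ;;
         Put SLOT (slot_at (cell TB) (cell TA)) (Pls (cell EDGE) (Lit 1))) Nop"
  let ?body = "Put TA (Lit 0) (Arr TAIL (cell EDGE)) ;; Put TB (Lit 0) (Arr HEAD (cell EDGE)) ;; ?c"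
  define J where "J i f \<longleftrightarrow> i \<le> m \<and> (\<forall>u<n. \<forall>v<n. cheapest Us i u v (cube f SLOT l u v) \<and>
     cube f SLOT l u v = cube f SLOT l v u \<and>
     (\<forall>l'. l' \<noteq> l \<longrightarrow> cube f SLOT l' u v = cube h SLOT l' u v))" for i f
  have nm: "nin h 0 = n" "nin h (Suc 0) = m" using ld initial_in[of I] by (simp_all add: loaded_def m_def n_def)
  have "J m g"
    unfolding g_def scan_def
  proof (rule Loop_rule[where I = J], goal_cases)
    case 1
    show ?case using zero by (simp add: J_def cheapest_def)
  next
    case (2 i f)
    have i: "i < m" using 2(1) nm by simp
    have lf: "loaded f" by (subst loaded_same[OF 2(3)]) (use ld in \<open>auto simp: slot_at_def\<close>)
    have ff: "narr f RND 0 = l" "narr f USED = narr h USED" "nin f 0 = n" "nin f = nin h"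
      using sameD(4)[OF 2(3), of RND] sameD(4)[OF 2(3), of USED] sameD(1)[OF 2(3)] l nm
      by (simp_all add: slot_at_def)
    obtain a b where ab: "ends I i = (a, b)" by fastforce
    have ip: "i \<in> parallel I a b" using i ab by (simp add: parallel_def edges)
    then have abn: "a < n" "b < n" using in_parallel by auto
    have ld': "narr f TAIL i = a" "narr f HEAD i = b" "rarr f COST i = cost I i"
      using lf i ab by (simp_all add: loaded_def)
    have Jf: "cheapest Us i u v (cube f SLOT l u v)" "cube f SLOT l u v = cube f SLOT l v u"
      "l' \<noteq> l \<Longrightarrow> cube f SLOT l' u v = cube h SLOT l' u v" if "u < n" "v < n" for u v l'
      using 2(2) that by (simp_all add: J_def)
    define f1 where "f1 = setn TB 0 b (setn TA 0 a (setn EDGE 0 i f))"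
    define x where "x = cube f SLOT l a b"
    have e1: "sem ?body (setn EDGE 0 i f) = sem ?c f1" using ld' by (simp add: f1_def)
    have f1: "tabs bound f1" "narr f1 RND 0 = l" "narr f1 TA 0 = a" "narr f1 TB 0 = b" "nin f1 0 = n"
      using lf ff by (simp_all add: f1_def loaded_def)
    have slot: "neval (slot_at (cell TA) (cell TB)) f1 = idx3 n l a b"
      "neval (slot_at (cell TB) (cell TA)) f1 = idx3 n l b a"
      "narr f1 SLOT (idx3 n l a b) = x" "nin f1 0 = n" "tabs bound f1"
      using f1 abn l(2) by (simp_all add: slot_at_def) (simp add: f1_def x_def cube_def ff)
    have cx: "rarr f COST e = cost I e" if "x = Suc e" for e
      using Jf(1)[OF abn] that lf i by (auto simp: cheapest_def x_def loaded_def)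
    let ?new = "\<not> Us i \<and> (\<forall>e. x = Suc e \<longrightarrow> cost I i < cost I e)"
    have c: "sem ?c f1 = (if ?new then setn SLOT (idx3 n l b a) (Suc i) (setn SLOT (idx3 n l a b) (Suc i) f1) else f1)"
    proof (cases x)
      case 0
      then show ?thesis using slot ff ld' abn l by (simp add: Us_def) (simp add: f1_def slot_at_def)
    next
      case (Suc e)
      then show ?thesis using slot ff ld' cx[OF Suc] abn l by (simp add: Us_def) (simp add: f1_def slot_at_def)
    qed
    have cube_f1: "cube f1 SLOT = cube f SLOT" by (simp add: f1_def cube_def[abs_def])
    have pr: "i \<in> parallel I u v \<longleftrightarrow> {u, v} = {a, b}" for u v
      using ab i by (auto simp: parallel_def edges doubleton_eq_iff)
    show ?case
      unfolding e1 c J_def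
    proof (intro conjI allI impI)
      show "Suc i \<le> m" using i by simp
    next
      fix u v assume uv: "u < n" "v < n"
      let ?g = "if ?new then setn SLOT (idx3 n l b a) (Suc i) (setn SLOT (idx3 n l a b) (Suc i) f1) else f1"
      have val: "cube ?g SLOT l' x y = (if ?new \<and> l' = l \<and> {x, y} = {a, b} then Suc i else cube f SLOT l' x y)"
        if "x < n" "y < n" for l' x y
      proof -
        have "idx3 n l' x y = idx3 n l a b \<longleftrightarrow> l' = l \<and> x = a \<and> y = b"
          "idx3 n l' x y = idx3 n l b a \<longleftrightarrow> l' = l \<and> x = b \<and> y = a"
          using that abn by auto
        moreover have "{x, y} = {a, b} \<longleftrightarrow> x = a \<and> y = b \<or> x = b \<and> y = a" by (rule doubleton_eq_iff)
        moreover have "cube f1 SLOT l' x y = cube f SLOT l' x y" by (simp add: cube_f1)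
        moreover have "cube (setn SLOT (idx3 n l b a) (Suc i) (setn SLOT (idx3 n l a b) (Suc i) f1)) SLOT l' x y =
          (if idx3 n l' x y = idx3 n l b a then Suc i else if idx3 n l' x y = idx3 n l a b then Suc i
           else cube f1 SLOT l' x y)"
          using slot(4) by (simp add: cube_def)
        ultimately show ?thesis by (cases ?new) (simp_all only: if_True if_False simp_thms, presburger)
      qed
      show "cube ?g SLOT l u v = cube ?g SLOT l v u"
        unfolding val[OF uv] val[OF uv(2,1)] insert_commute[of v u] by (simp only: Jf(2)[OF uv])
      show "cube ?g SLOT l' u v = cube h SLOT l' u v" if "l' \<noteq> l" for l'
        unfolding val[OF uv] using that Jf(3)[OF uv] by simp
      show "cheapest Us (Suc i) u v (cube ?g SLOT l u v)"
      proof (cases "{u, v} = {a, b}")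
        case False
        then have "cheapest Us (Suc i) u v (cube f SLOT l u v)"
          using cheapest_skip[OF Jf(1)[OF uv]] pr by blast
        then show ?thesis unfolding val[OF uv] using False by simp
      next
        case True
        have xx: "cube f SLOT l u v = x"
          using True Jf(2)[OF abn] unfolding x_def by (auto simp: doubleton_eq_iff)
        show ?thesis
        proof (cases ?new)
          case new: True
          have "cheapest Us (Suc i) u v (Suc i)"
            using Jf(1)[OF uv] unfolding xx
            by (rule cheapest_new) (use new True pr in \<open>auto intro: less_imp_le\<close>)
          then show ?thesis unfolding val[OF uv] using new True by simp
        next
          case old: False
          have "cheapest Us (Suc i) u v x"
          proof (cases "Us i")
            case True
            then show ?thesis using cheapest_skip[OF Jf(1)[OF uv]] xx by simp
          next
            case False
            then obtain e where "x = Suc e" "cost I e \<le> cost I i" using old by (auto simp: not_less)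
            then show ?thesis using cheapest_keep Jf(1)[OF uv] xx by simp
          qed
          then show ?thesis unfolding val[OF uv] using old xx by (simp only: simp_thms if_False)
        qed
      qed
    qed
  next
    case (3 f)
    then show ?case using nm by (simp add: J_def cube_def)
  qed
  then show ?thesis by (simp add: J_def)
qed

lemma mark_correct:
  assumes ld: "loaded h" and l: "narr h RND 0 = l" "l \<le> bound"
  shows "narr (sem mark h) USED e \<noteq> 0 \<longleftrightarrow>
    narr h USED e \<noteq> 0 \<or> (\<exists>u<n. \<exists>v<n. cube h SLOT l u v = Suc e)"
proof -
  let ?c = "Ifte (Lss (Lit 0) (Arr SLOT (slot_at (cell VU) (cell VV))))
     (Put USED (Mns (Arr SLOT (slot_at (cell VU) (cell VV))) (Lit 1)) (Lit 1)) Nop"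
  have nm: "nin h 0 = n" using ld initial_in[of I] by (simp add: loaded_def n_def)
  let ?I = "\<lambda>T f. \<forall>e. narr f USED e \<noteq> 0 \<longleftrightarrow> narr h USED e \<noteq> 0 \<or> (\<exists>(u, v)\<in>T. cube h SLOT l u v = Suc e)"
  have "?I ({..<nin h 0} \<times> {..<nin h 0}) (sem (pairs ?c) h)"
  proof (rule pairs_rule[where I = ?I], goal_cases)
    case (6 T f u v)
    have lf: "loaded f" by (subst loaded_same[OF 6(5)]) (use ld in \<open>auto simp: slot_at_def\<close>)
    have f: "narr f RND 0 = l" "cube f SLOT = cube h SLOT" "nin f 0 = n"
      using sameD(4)[OF 6(5), of RND] sameD(4)[OF 6(5), of SLOT] sameD(1)[OF 6(5)] l nm
      by (simp_all add: slot_at_def cube_def[abs_def])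
    have "tabs bound f" using lf by (simp add: loaded_def)
    then have "neval (slot_at (cell VU) (cell VV)) f = idx3 n l u v"
      using f l 6(1,2,6,7) nm by (simp add: slot_at_def)
    moreover have "narr f SLOT (idx3 n l u v) = cube h SLOT l u v"
      using f(2,3) by (metis cube_def)
    ultimately have c: "sem ?c f = (case cube h SLOT l u v of 0 \<Rightarrow> f | Suc e \<Rightarrow> setn USED e 1 f)"
      by (simp split: nat.split)
    show ?case
      unfolding c using 6(4) by (auto split: nat.split)
  qed (auto simp: slot_at_def)
  then show ?thesis unfolding mark_def nm by auto
qed

lemma sort_slots_correct:
  assumes ld: "loaded h" and zero: "narr h SLOT = (\<lambda>_. 0)" "narr h USED = (\<lambda>_. 0)"
  shows "sorted_slots (cube (sem (sort_slots (p + q)) h) SLOT)"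
proof -
  define J where "J l f \<longleftrightarrow> l \<le> p + q \<and> loaded f \<and>
     (\<forall>e. narr f USED e \<noteq> 0 \<longleftrightarrow> (\<exists>u<n. \<exists>v<n. \<exists>l'<l. cube f SLOT l' u v = Suc e)) \<and>
     (\<forall>u<n. \<forall>v<n. (\<forall>l'. cube f SLOT l' u v = cube f SLOT l' v u) \<and>
        (\<forall>l'\<ge>l. cube f SLOT l' u v = 0) \<and>
        (\<forall>l'<l. cheapest (\<lambda>e. \<exists>l''<l'. cube f SLOT l'' u v = Suc e) m u v (cube f SLOT l' u v)))" for l f
  have J_setn: "J l (setn RND 0 x f) = J l f" for l x f
    by (simp add: J_def loaded_def) (simp add: cube_def[abs_def])
  have "J (p + q) (sem (sort_slots (p + q)) h)"
    unfolding sort_slots_def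
  proof (rule Loop_rule[where I = J], goal_cases)
    case 1
    show ?case using ld zero by (simp add: J_def cube_def)
  next
    case (2 l f)
    have l: "l < p + q" using 2(1) by simp
    let ?f = "setn RND 0 l f"
    define f1 where "f1 = sem scan ?f"
    define f2 where "f2 = sem mark f1"
    have Jf: "J l ?f" using 2(2) J_setn by simp
    have ld0: "loaded ?f" using Jf by (simp add: J_def)
    have sm: "same scan ?f f1" "same mark f1 f2" unfolding f1_def f2_def by (rule same_sem)+
    have ld1: "loaded f1" by (subst loaded_same[OF sm(1)]) (use ld0 in auto)
    have ld2: "loaded f2" by (subst loaded_same[OF sm(2)]) (use ld1 in auto)
    have bd: "l \<le> bound" using l by simp
    have used: "narr ?f USED e \<noteq> 0 \<longleftrightarrow> (\<exists>u<n. \<exists>v<n. \<exists>l'<l. cube ?f SLOT l' u v = Suc e)" for e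
      using Jf unfolding J_def by blast
    have sym: "cube ?f SLOT l' u v = cube ?f SLOT l' v u" and top: "l \<le> l' \<Longrightarrow> cube ?f SLOT l' u v = 0"
      and ch: "l' < l \<Longrightarrow> cheapest (\<lambda>e. \<exists>l''<l'. cube ?f SLOT l'' u v = Suc e) m u v (cube ?f SLOT l' u v)"
      if "u < n" "v < n" for l' u v
      using Jf that unfolding J_def by blast+
    have rnd: "narr ?f RND 0 = l" "narr f1 RND 0 = l" using sameD(4)[OF sm(1), of RND] by simp_all
    define Us where "Us = (\<lambda>e. narr ?f USED e \<noteq> 0)"
    have sc: "cheapest Us m u v (cube f1 SLOT l u v)" "cube f1 SLOT l u v = cube f1 SLOT l v u"
      "l' \<noteq> l \<Longrightarrow> cube f1 SLOT l' u v = cube ?f SLOT l' u v" if "u < n" "v < n" for u v l'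
      using scan_correct[OF ld0 rnd(1) bd] top that unfolding f1_def Us_def by blast+
    have c2: "cube f2 SLOT = cube f1 SLOT" "narr f1 USED = narr ?f USED"
      using sameD(4)[OF sm(2), of SLOT] sameD(1)[OF sm(2)] sameD(4)[OF sm(1), of USED]
      by (simp_all add: cube_def[abs_def])
    have used2: "narr f2 USED e \<noteq> 0 \<longleftrightarrow> Us e \<or> (\<exists>u<n. \<exists>v<n. cube f1 SLOT l u v = Suc e)" for e
      using mark_correct[OF ld1 rnd(2) bd, of e] unfolding f2_def[symmetric] c2 Us_def .
    have mem: "e \<in> parallel I u v" if "u < n" "v < n" "l' < l" "cube ?f SLOT l' u v = Suc e" for u v l' e
      using ch[OF that(1,2,3)] that(4) by (auto simp: cheapest_def)
    \<comment> \<open>\<open>USED\<close> is kept for all pairs together. It agrees with the earlier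
      slots of a single pair because an edge is parallel to one unordered pair only.\<close>
    have Us: "Us e \<longleftrightarrow> (\<exists>l'<l. cube ?f SLOT l' u v = Suc e)" if "e \<in> parallel I u v" for e u v
    proof
      assume "Us e"
      then obtain a b l' where *: "a < n" "b < n" "l' < l" "cube ?f SLOT l' a b = Suc e"
        using used unfolding Us_def by blast
      then have "{a, b} = {u, v}" using mem[OF *] that parallel_disjoint by blast
      then have "cube ?f SLOT l' u v = Suc e" using * sym[OF *(1,2)] by (auto simp: doubleton_eq_iff)
      then show "\<exists>l'<l. cube ?f SLOT l' u v = Suc e" using * by blast
    next
      assume "\<exists>l'<l. cube ?f SLOT l' u v = Suc e"
      then show "Us e" using used in_parallel[OF that] unfolding Us_def by blast
    qed
    have "J (Suc l) f2"
      unfolding J_def c2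
    proof (intro conjI allI impI)
      fix e show "(narr f2 USED e \<noteq> 0) = (\<exists>u<n. \<exists>v<n. \<exists>l'<Suc l. cube f1 SLOT l' u v = Suc e)"
      proof -
        have "Us e \<longleftrightarrow> (\<exists>u<n. \<exists>v<n. \<exists>l'<l. cube f1 SLOT l' u v = Suc e)"
          using used[of e] sc(3) unfolding Us_def by (metis less_irrefl)
        then show ?thesis unfolding used2 less_Suc_eq by blast
      qed
    next
      fix u v assume uv: "u < n" "v < n"
      show "cube f1 SLOT l' u v = cube f1 SLOT l' v u" for l'
        using sc(2)[OF uv] sc(3)[OF uv, of l'] sc(3)[OF uv(2,1), of l'] sym[OF uv, of l'] by (cases "l' = l") auto
      show "cube f1 SLOT l' u v = 0" if "Suc l \<le> l'" for l'
        using sc(3)[OF uv, of l'] top[OF uv, of l'] that by simp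
      show "cheapest (\<lambda>e. \<exists>l''<l'. cube f1 SLOT l'' u v = Suc e) m u v (cube f1 SLOT l' u v)" if "l' < Suc l" for l'
      proof -
        have eq: "(\<exists>l''<l'. cube f1 SLOT l'' u v = Suc e) \<longleftrightarrow> (\<exists>l''<l'. cube ?f SLOT l'' u v = Suc e)" for e
          using sc(3)[OF uv] that by (metis less_Suc_eq less_trans not_less_eq)
        show ?thesis
        proof (cases "l' = l")
          case True
          have "cheapest Us m u v x \<longleftrightarrow> cheapest (\<lambda>e. \<exists>l''<l. cube ?f SLOT l'' u v = Suc e) m u v x" for x
            unfolding cheapest_def using Us by blast
          then show ?thesis unfolding eq using sc(1)[OF uv] True by simp
        next
          case False
          then show ?thesis unfolding eq using sc(3)[OF uv, of l'] ch[OF uv, of l'] that by simp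
        qed
      qed
    qed (use l ld2 in auto)
    then show ?case by (simp add: f1_def f2_def)
  next
    case (3 f)
    then show ?case using J_setn by simp
  qed
  then have K: "(\<forall>l'. sl l' u v = sl l' v u) \<and> (\<forall>l'\<ge>p + q. sl l' u v = 0) \<and>
      (\<forall>l'<p + q. cheapest (\<lambda>e. \<exists>l''<l'. sl l'' u v = Suc e) m u v (sl l' u v))"
    if "u < n" "v < n" "sl = cube (sem (sort_slots (p + q)) h) SLOT" for u v sl
    using that unfolding J_def by (elim conjE) simp
  show ?thesis
    unfolding sorted_slots_def
  proof (intro allI impI conjI ballI)
    fix u v assume uv: "u < n" "v < n"
    let ?sl = "cube (sem (sort_slots (p + q)) h) SLOT"
    show "?sl l u v = ?sl l v u" for l using K[OF uv refl] by blast
    show "?sl (p + q) u v = 0" using K[OF uv refl] by blast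
    fix l assume "l < p + q"
    then have C: "cheapest (\<lambda>e. \<exists>l''<l. ?sl l'' u v = Suc e) m u v (?sl l u v)" using K[OF uv refl] by blast
    show "e \<in> parallel I u v" if "?sl l u v = Suc e" for e
      using C that unfolding cheapest_def by blast
    show "?sl l' u v \<noteq> Suc e" if "?sl l u v = Suc e" "l' < l" for e l'
      using C that unfolding cheapest_def by blast
    show "cost I e \<le> cost I e'" if "?sl l u v = Suc e" "e' \<in> parallel I u v" "\<forall>l'<l. ?sl l' u v \<noteq> Suc e'" for e e'
      using C that in_parallel edges unfolding cheapest_def by blast
    show "\<exists>l'<l. ?sl l' u v = Suc e" if "?sl l u v = 0" "e \<in> parallel I u v" for e
      using C that in_parallel edges unfolding cheapest_def by blast
  qed
qed

lemma prepare_correct: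
  defines "g \<equiv> sem (prepare p q) (setn ONCE 0 0 (initial I))"
  shows "solution g {}" "\<And>u v. mat g FLOW u v = 0 \<and> mat g FREE u v = 0" "\<And>i u v. cube g UNIT i u v = 0"
proof -
  define h where "h = setn ONCE 0 0 (initial I)"
  define h1 where "h1 = sem (index_tables bound) h"
  define h2 where "h2 = sem load h1"
  have g: "g = sem (sort_slots (p + q)) h2" by (simp add: g_def prepare_def h_def h1_def h2_def)
  have narr0: "narr h k = (\<lambda>_. 0)" for k by (simp add: h_def initial_def fun_eq_iff)
  have sm: "same (index_tables bound) h h1" "same load h1 h2" "same (sort_slots (p + q)) h2 g"
    unfolding h1_def h2_def g by (rule same_sem)+
  have keep: "narr g k = (\<lambda>_. 0)" if "k \<in> {SOL, DEG, SDEG, FLOW, FREE, UNIT}" for k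
    using sameD(4)[OF sm(1), of k] sameD(4)[OF sm(2), of k] sameD(4)[OF sm(3), of k] that narr0[of k] by auto
  have nn: "nin h1 = nin (initial I)" "rin h1 = rin (initial I)"
    using sameD(1,2)[OF sm(1)] by (simp_all add: h_def)
  note L = load_correct[OF nn, folded h2_def]
  have "tabs bound h1" unfolding h1_def using narr0 by (intro index_tables_correct) simp_all
  then have t2: "tabs bound h2" using tabs_same[OF sm(2), of bound] by simp
  have n2: "nin h2 = nin (initial I)" using sameD(1)[OF sm(2)] nn by simp
  have ld: "loaded h2" using t2 n2 L(1) by (simp add: loaded_def)
  have z2: "narr h2 SLOT = (\<lambda>_. 0)" "narr h2 USED = (\<lambda>_. 0)"
    using sameD(4)[OF sm(1), of SLOT] sameD(4)[OF sm(2), of SLOT] sameD(4)[OF sm(1), of USED]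
      sameD(4)[OF sm(2), of USED] narr0 by simp_all
  have tg: "tabs bound g" using tabs_same[OF sm(3), of bound] t2 by simp
  have ng: "nin g = nin (initial I)" using sameD(1)[OF sm(3)] n2 by simp
  have "sorted_slots (cube g SLOT)" unfolding g by (rule sort_slots_correct[OF ld z2])
  then have tables: "tables g"
    using tg ng L sameD(4)[OF sm(3), of SAFE] sameD(5)[OF sm(3), of COST] sameD(5)[OF sm(3), of BIG]
    by (simp add: tables_def)
  then show "solution g {}"
    using keep[of SOL] keep[of DEG] keep[of SDEG] by (simp add: solution_def mat_def mult_def)
  show "mat g FLOW u v = 0 \<and> mat g FREE u v = 0" for u v
    using keep[of FLOW] keep[of FREE] by (simp add: mat_def)
  show "cube g UNIT i u v = 0" for i u v
    using keep[of UNIT] by (simp add: cube_def)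
qed

lemma gather_correct:
  assumes nm: "nin h (Suc 0) = m" and len: "narr h LEN 0 = 0"
  defines "g \<equiv> sem gather h"
  shows "narr g LEN 0 \<le> m" "narr g OUT ` {..<narr g LEN 0} = {e. e < m \<and> narr h SOL e \<noteq> 0}"
proof -
  have "narr g LEN 0 \<le> m \<and> narr g OUT ` {..<narr g LEN 0} = {e. e < m \<and> narr h SOL e \<noteq> 0}"
    unfolding g_def gather_def
  proof (rule Loop_rule[where I = "\<lambda>i f. narr f LEN 0 \<le> i \<and>
      narr f OUT ` {..<narr f LEN 0} = {e. e < i \<and> narr h SOL e \<noteq> 0}"], goal_cases)
    case (2 i f)
    have sol: "narr f SOL = narr h SOL" using sameD(4)[OF 2(3), of SOL] by simp
    have set: "{e. e < Suc i \<and> narr h SOL e \<noteq> 0} =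
        (if narr h SOL i \<noteq> 0 then insert i else id) {e. e < i \<and> narr h SOL e \<noteq> 0}"
      by (auto simp: less_Suc_eq)
    show ?case
    proof (cases "narr h SOL i = 0")
      case True
      then show ?thesis unfolding set using 2(2) sol by simp
    next
      case False
      have "(narr f OUT)(narr f LEN 0 := i) ` {..<Suc (narr f LEN 0)} =
          insert i (narr f OUT ` {..<narr f LEN 0})"
        by (auto simp: lessThan_Suc)
      then show ?thesis unfolding set using 2(2) sol False by simp
    qed
  qed (use nm len in simp_all)
  then show "narr g LEN 0 \<le> m" "narr g OUT ` {..<narr g LEN 0} = {e. e < m \<and> narr h SOL e \<noteq> 0}" by simp_all
qed

end

section \<open>The algorithm\<close>

lemma stages_writes_LEN: "\<not> writes (stages p q k) LEN i"
  by (induction k) (auto simp: nest_writes)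

section \<open>Approximation ratio and correctness\<close>

lemma sem_Once:
  "sem (Loop k l Once c) h = (if nin h 0 < 2 then setn k l 0 h else setn k l 1 (sem c (setn k l 0 h)))"
proof -
  have "bval_of Once h = (if nin h 0 < 2 then 0 else 1)" by auto
  then show ?thesis by auto
qed

text \<open>A nonempty set arises from a smaller one by adding one of \<open>N\<close> elements; the
  extra value \<open>N\<close> stands for adding nothing.\<close>

lemma card_small_subsets:
  "card {Q. Q \<subseteq> {..<N} \<and> card Q \<le> k} \<le> (N + 1) ^ k" for N k :: nat
proof (induction k)
  case 0
  have "{Q. Q \<subseteq> {..<N} \<and> card Q \<le> 0} = {{}}" using finite_subset by (auto simp: card_eq_0_iff)
  then show ?case by simp
next
  case (Suc k)
  let ?S = "\<lambda>k. {Q. Q \<subseteq> {..<N} \<and> card Q \<le> k}"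
  let ?f = "\<lambda>(x, Q). if x = N then Q else insert x Q"
  have fin: "finite (?S k)" by (rule finite_subset[of _ "Pow {..<N}"]) auto
  have "?S (Suc k) \<subseteq> ?f ` ({..N} \<times> ?S k)"
  proof
    fix Q assume Q: "Q \<in> ?S (Suc k)"
    then have fQ: "finite Q" using finite_subset by auto
    show "Q \<in> ?f ` ({..N} \<times> ?S k)"
    proof (cases "Q = {}")
      case True
      then show ?thesis by (intro image_eqI[of _ _ "(N, {})"]) auto
    next
      case False
      then obtain x where x: "x \<in> Q" by blast
      then have "card (Q - {x}) \<le> k" using Q fQ by auto
      moreover have "x < N" using x Q by auto
      ultimately show ?thesis using x Q by (intro image_eqI[of _ _ "(x, Q - {x})"]) auto
    qed
  qed
  then have "card (?S (Suc k)) \<le> card ({..N} \<times> ?S k)"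
    using fin by (intro surj_card_le) auto
  also have "\<dots> = (N + 1) * card (?S k)" by (simp add: card_cartesian_product)
  also have "\<dots> \<le> (N + 1) * (N + 1) ^ k" by (rule mult_le_mono2[OF Suc])
  finally show ?case by simp
qed

context flex_problem
begin

text \<open>Let \<open>d = p + q\<close>. For positive \<open>q\<close>,
  \<open>p * d + 1 <= d ^ 2\<close> bounds the number of patterns by \<open>d ^ (2 * p)\<close>. The
  factors \<open>q\<close> and \<open>d\<close> add 2 to the exponent, and
  \<open>2 * p + 2 <= 4 * p\<close> for positive \<open>p\<close>. For \<open>p = 0\<close> there
  are no patterns and the left-hand side is 0.\<close>

lemma ratio_bound:
  assumes "0 < p + q"
  shows "p * (p + q) + q * (card patterns * (p + q)) \<le> 2 * (p + q) ^ (4 * p)"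
proof (cases "p = 0")
  case True
  then have "patterns = {}" unfolding patterns_def by simp
  then have "card patterns = 0" by simp
  then show ?thesis using True by simp
next
  case False
  define d where "d = p + q"
  have d: "1 \<le> d" "p \<le> d" "q \<le> d" using assms unfolding d_def by linarith+
  have two: "d ^ 2 \<le> d ^ (4 * p)" using d False by (intro power_increasing) auto
  have "p * d \<le> d ^ 2" using d by (simp add: power2_eq_square)
  moreover have "q * (card patterns * d) \<le> d ^ (4 * p)"
  proof (cases "q = 0")
    case False
    have "patterns \<subseteq> {Q. Q \<subseteq> {..<p * d} \<and> card Q \<le> p}" by (auto simp: patterns_def d_def)
    then have "card patterns \<le> card {Q. Q \<subseteq> {..<p * d} \<and> card Q \<le> p}"
      by (rule card_mono[rotated]) (rule finite_subset[OF _ finite_Pow_iff[THEN iffD2, OF finite_lessThan[of "p * d"]]], blast)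
    also have "\<dots> \<le> (p * d + 1) ^ p" by (rule card_small_subsets)
    also have "\<dots> \<le> (d ^ 2) ^ p"
    proof (rule power_mono)
      have "Suc p * d \<le> d * d" using False by (intro mult_le_mono1) (simp add: d_def)
      then show "p * d + 1 \<le> d ^ 2" using d by (simp add: power2_eq_square)
    qed simp
    finally have "q * (card patterns * d) \<le> d * ((d ^ 2) ^ p * d)" using d by (intro mult_le_mono) auto
    also have "\<dots> = d ^ (2 * p + 2)" by (simp add: power_add power_mult power2_eq_square)
    also have "\<dots> \<le> d ^ (4 * p)" using d \<open>p \<noteq> 0\<close> by (intro power_increasing) auto
    finally show ?thesis .
  qed simp
  ultimately show ?thesis using two unfolding d_def[symmetric] by linarith
qed

lemma solver_correct:
  assumes pq: "0 < p + q" "p * q < 2 * (p + q)" and X: "X \<subseteq> edges I" "feasible p q I X"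
  defines "g \<equiv> sem (solver p q) (initial I)"
  defines "F \<equiv> narr g OUT ` {..<narr g LEN 0}"
  shows "narr g LEN 0 \<le> m" "feasible p q I F"
    "total_cost I F \<le> 2 * real (p + q) ^ (4 * p) * total_cost I X"
proof -
  define c where "c = (prepare p q ;; (saturate (p * (p + q)) p q ;; decompose (p * (p + q))) ;; stages p q q)"
  define h1 where "h1 = sem (Loop ONCE 0 Once c) (initial I)"
  define h2 where "h2 = setn CNTR 0 m h1"
  have nn: "nin h1 0 = n" "nin h1 (Suc 0) = m" by (simp_all add: h1_def initial_in n_def m_def del: sem.simps)
  have g: "g = sem gather h2"
    using nn by (simp add: g_def solver_def h1_def c_def h2_def del: sem.simps(6))
  have "\<not> writes (Loop ONCE 0 Once c) LEN 0" by (simp add: c_def stages_writes_LEN)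
  then have "narr h1 LEN 0 = narr (initial I) LEN 0" unfolding h1_def by (rule sem_frame)
  then have len: "narr h2 LEN 0 = 0" by (simp add: h2_def initial_def)
  have n2: "nin h2 (Suc 0) = m" using nn by (simp add: h2_def)
  note O = gather_correct[OF n2 len, folded g]
  show "narr g LEN 0 \<le> m" by (rule O)
  have F: "F = {e. e < m \<and> narr h1 SOL e \<noteq> 0}" using O(2) by (simp add: F_def h2_def)
  have "\<exists>G. F = G \<and> G \<subseteq> edges I \<and> feasible p q I G \<and>
      total_cost I G \<le> 2 * real (p + q) ^ (4 * p) * total_cost I X"
  proof (cases "n < 2")
    case True
    have "h1 = setn ONCE 0 0 (initial I)"
      unfolding h1_def sem_Once using True by (simp add: initial_in n_def)
    then have "F = {}" by (simp add: F initial_def)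
    moreover have "feasible p q I {}"
    proof -
      have "s = t" using True s t by linarith
      then show ?thesis using feasible_iff_flux[OF inst num, of "{}" p q] by (simp add: n_def)
    qed
    ultimately show ?thesis using total_cost_nonneg[OF X(1)] by (auto simp: total_cost_def)
  next
    case False
    define h0 where "h0 = sem (prepare p q) (setn ONCE 0 0 (initial I))"
    define h3 where "h3 = sem (saturate (p * (p + q)) p q ;; decompose (p * (p + q))) h0"
    define h4 where "h4 = sem (stages p q q) h3"
    have h1: "h1 = setn ONCE 0 1 h4"
      unfolding h1_def sem_Once using False
      by (simp add: initial_in n_def c_def h4_def h3_def h0_def)
    obtain G where G: "solution h3 G" "reached p G" "units (cube h3 UNIT) G"
      "total_cost I G \<le> p * (p + q) * total_cost I X"
      using first_stage[OF prepare_correct(1) prepare_correct(2) prepare_correct(3) pq(1) X]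
      unfolding h3_def h0_def by blast
    obtain H where H: "solution h4 H" "reached (p + q) H"
      "total_cost I H \<le> total_cost I G + q * (card patterns * (p + q)) * total_cost I X"
      using stages_correct[OF G(1,2) pq(2) G(3) X order_refl] unfolding h4_def by blast
    have HE: "H \<subseteq> edges I" using H(1) by (simp add: solution_def)
    have "F = H" using H(1) unfolding F h1 by (auto simp: solution_def edges)
    moreover have "feasible p q I H"
      using H(2) feasible_iff_flux[OF inst num HE, of p q] unfolding reached_def n_def by blast
    moreover have "total_cost I H \<le> 2 * real (p + q) ^ (4 * p) * total_cost I X"
    proof -
      have "total_cost I H \<le> real (p * (p + q) + q * (card patterns * (p + q))) * total_cost I X"
        using H(3) G(4) by (simp add: algebra_simps)
      also have "\<dots> \<le> real (2 * (p + q) ^ (4 * p)) * total_cost I X"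
        using ratio_bound[OF pq(1)] total_cost_nonneg[OF X(1)]
        by (intro mult_right_mono) (simp_all only: of_nat_le_iff)
      finally show ?thesis by simp
    qed
    ultimately show ?thesis using HE by blast
  qed
  then show "feasible p q I F" "total_cost I F \<le> 2 * real (p + q) ^ (4 * p) * total_cost I X"
    by blast+
qed

end

section \<open>Running time\<close>

definition polyb :: "(nat \<Rightarrow> nat \<Rightarrow> nat \<Rightarrow> nat \<Rightarrow> nat) \<Rightarrow> bool" where
  "polyb f \<longleftrightarrow> (\<exists>C d. \<forall>p q n m. 2 \<le> n \<longrightarrow> 0 < p + q \<longrightarrow> f p q n m \<le> C * (n ^ (p + q)) ^ d)"

lemma polybI:
  "(\<And>p q n m. 2 \<le> n \<Longrightarrow> 0 < p + q \<Longrightarrow> f p q n m \<le> C * (n ^ (p + q)) ^ d) \<Longrightarrow> polyb f"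
  unfolding polyb_def by blast

lemma polyb_mono: "polyb g \<Longrightarrow> (\<And>p q n m. 2 \<le> n \<Longrightarrow> 0 < p + q \<Longrightarrow> f p q n m \<le> g p q n m) \<Longrightarrow> polyb f"
  unfolding polyb_def by (meson le_trans)

lemma polyb_const: "polyb (\<lambda>p q n m. c)"
  by (rule polybI[where C = c and d = 0]) simp

lemma polyb_n: "polyb (\<lambda>p q n m. n)"
  by (rule polybI[where C = 1 and d = 1]) (simp add: self_le_power)

text \<open>The constants in \<open>polyb\<close> are absolute, so \<open>p\<close> and
  \<open>q\<close> have to be absorbed by \<open>n ^ (p + q)\<close>, which works because
  \<open>2 <= n\<close>. This makes the bounds closed under every operation that occurs in
  \<open>tbd\<close>. As \<open>m\<close> is absent from the bound, a program that scans the edges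
  does not qualify.\<close>

lemma polyb_dim: "polyb (\<lambda>p q n m. p + q)"
proof (rule polybI[where C = 1 and d = 1])
  fix p q n :: nat assume "2 \<le> n"
  have "p + q < 2 ^ (p + q)" by (rule less_exp)
  also have "\<dots> \<le> n ^ (p + q)" using \<open>2 \<le> n\<close> by (rule power_mono) simp
  finally show "p + q \<le> 1 * (n ^ (p + q)) ^ 1" by simp
qed

lemma polyb_p: "polyb (\<lambda>p q n m. p)" and polyb_q: "polyb (\<lambda>p q n m. q)"
  by (rule polyb_mono[OF polyb_dim], simp)+

lemma polyb_add:
  assumes "polyb f" "polyb g"
  shows "polyb (\<lambda>p q n m. f p q n m + g p q n m)"
proof -
  obtain C d where f: "\<And>p q n m. 2 \<le> n \<Longrightarrow> 0 < p + q \<Longrightarrow> f p q n m \<le> C * (n ^ (p + q)) ^ d"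
    using assms(1) unfolding polyb_def by blast
  obtain C' d' where g: "\<And>p q n m. 2 \<le> n \<Longrightarrow> 0 < p + q \<Longrightarrow> g p q n m \<le> C' * (n ^ (p + q)) ^ d'"
    using assms(2) unfolding polyb_def by blast
  show ?thesis
  proof (rule polybI[where C = "C + C'" and d = "d + d'"])
    fix p q n m :: nat assume a: "2 \<le> n" "0 < p + q"
    have Z: "1 \<le> n ^ (p + q)" using a by simp
    have "C * (n ^ (p + q)) ^ d \<le> C * (n ^ (p + q)) ^ (d + d')"
      "C' * (n ^ (p + q)) ^ d' \<le> C' * (n ^ (p + q)) ^ (d + d')"
      using Z by (intro mult_le_mono2 power_increasing; simp)+
    then show "f p q n m + g p q n m \<le> (C + C') * (n ^ (p + q)) ^ (d + d')"
      using f[OF a, of m] g[OF a, of m] unfolding add_mult_distrib by linarith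
  qed
qed

lemma polyb_mult:
  assumes "polyb f" "polyb g"
  shows "polyb (\<lambda>p q n m. f p q n m * g p q n m)"
proof -
  obtain C d where f: "\<And>p q n m. 2 \<le> n \<Longrightarrow> 0 < p + q \<Longrightarrow> f p q n m \<le> C * (n ^ (p + q)) ^ d"
    using assms(1) unfolding polyb_def by blast
  obtain C' d' where g: "\<And>p q n m. 2 \<le> n \<Longrightarrow> 0 < p + q \<Longrightarrow> g p q n m \<le> C' * (n ^ (p + q)) ^ d'"
    using assms(2) unfolding polyb_def by blast
  show ?thesis
  proof (rule polybI[where C = "C * C'" and d = "d + d'"])
    fix p q n m :: nat assume a: "2 \<le> n" "0 < p + q"
    have "f p q n m * g p q n m \<le> (C * (n ^ (p + q)) ^ d) * (C' * (n ^ (p + q)) ^ d')"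
      using f[OF a] g[OF a] by (rule mult_le_mono)
    then show "f p q n m * g p q n m \<le> C * C' * (n ^ (p + q)) ^ (d + d')"
      by (simp add: power_add ac_simps)
  qed
qed

lemma polyb_Suc: "polyb f \<Longrightarrow> polyb (\<lambda>p q n m. Suc (f p q n m))"
  using polyb_add[OF _ polyb_const[of 1]] by simp

lemmas polyb_intros = polyb_const polyb_n polyb_p polyb_q polyb_add polyb_mult polyb_Suc

lemma nbd_rep [simp]: "nbd (rep k a) = k * (nbd a + 1) + 1"
  by (induction k) (simp_all add: algebra_simps)

lemmas bound_simps = tbd.simps bbd.simps rbd.simps nbd.simps nbd_rep times.simps at2_def at3_def

lemma polyb_walk: "polyb (\<lambda>p q n m. tbd walk n m)"
  unfolding walk_def relax_def bound_simps by (rule polyb_intros)+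

lemma polyb_saturate:
  assumes "polyb (\<lambda>p q n m. k p q)" "polyb (\<lambda>p q n m. a p q)" "polyb (\<lambda>p q n m. b p q)"
  shows "polyb (\<lambda>p q n m. tbd (saturate (k p q) (a p q) (b p q)) n m)"
  unfolding saturate_def augment_def weights_def push_def buy_def incr_def pairs_def residual_def
    next_edge_def bound_simps
  by (rule polyb_intros polyb_walk assms)+

lemma polyb_decompose: "polyb (\<lambda>p q n m. tbd (decompose (p * (p + q))) n m)"
  unfolding decompose_def peel_def incr_def pairs_def bound_simps
  by (rule polyb_intros polyb_walk)+

lemma polyb_cover: "polyb (\<lambda>p q n m. tbd (cover p q (p + q)) n m)"
  unfolding cover_def side_def measure_cut_def greedy_def set_free_def leaves_def pairs_def tbd.simps(4,5)
  unfolding bound_simps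
  by (rule polyb_intros polyb_walk polyb_saturate)+

lemma tbd_cover_mono: "r \<le> r' \<Longrightarrow> tbd (cover p q r) n m \<le> tbd (cover p q r') n m"
  by (simp add: cover_def saturate_def)

text \<open>The offset 2000 absorbs the overhead of a loop at the price of a factor 2 per level,
  which is harmless since \<open>2 * n <= n ^ 2\<close> for \<open>2 <= n\<close>.\<close>

lemma tbd_nest: "1 \<le> n \<Longrightarrow> tbd (nest d c) n m + 2000 \<le> (2 * n) ^ d * (tbd c n m + 2000)"
proof (induction d)
  case (Suc d)
  have "tbd (nest (Suc d) c) n m + 2000 = n * (tbd (nest d c) n m + 1000) + 3000" by simp
  also have "\<dots> \<le> n * (2 * (tbd (nest d c) n m + 2000))"
  proof -
    have "3000 \<le> n * 3000" using Suc.prems by simp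
    then show ?thesis by (simp add: algebra_simps)
  qed
  also have "\<dots> \<le> n * (2 * ((2 * n) ^ d * (tbd c n m + 2000)))" using Suc by (intro mult_le_mono2) simp
  finally show ?case by (simp add: ac_simps)
qed simp

text \<open>The \<open>2 * (p + q)\<close> nested loops over the vertices are the source of the
  exponent \<open>p + q\<close> in the running time. Stage \<open>r\<close> is bounded by the time
  of \<open>cover\<close> at \<open>r = p + q\<close>.\<close>

lemma polyb_stages: "polyb (\<lambda>p q n m. tbd (stages p q q) n m)"
proof -
  have one: "tbd (stages p q k) n m \<le> 1 + k * ((2 * n) ^ (2 * (p + q)) * (tbd (cover p q (p + q)) n m + 2000))"
    if "1 \<le> n" "k \<le> q" for p q k n m
    using that(2)
  proof (induction k)
    case (Suc k)
    have "tbd (nest (2 * (p + q)) (cover p q (p + k))) n m \<le>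
        (2 * n) ^ (2 * (p + q)) * (tbd (cover p q (p + k)) n m + 2000)"
      using tbd_nest[OF that(1), of "2 * (p + q)" "cover p q (p + k)" m] by linarith
    also have "\<dots> \<le> (2 * n) ^ (2 * (p + q)) * (tbd (cover p q (p + q)) n m + 2000)"
      using tbd_cover_mono[of "p + k" "p + q" p q n m] Suc.prems by (intro mult_le_mono2) simp
    finally show ?case using Suc by simp
  qed simp
  have "polyb (\<lambda>p q n m. (2 * n) ^ (2 * (p + q)))"
  proof (rule polybI[where C = 1 and d = 4])
    fix p q n :: nat assume "2 \<le> n"
    then have "(2 * n) ^ (2 * (p + q)) \<le> (n * n) ^ (2 * (p + q))" by (intro power_mono mult_le_mono1) auto
    also have "\<dots> = 1 * (n ^ (p + q)) ^ 4"
      by (simp add: power_mult[symmetric] power2_eq_square[symmetric] algebra_simps)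
    finally show "(2 * n) ^ (2 * (p + q)) \<le> 1 * (n ^ (p + q)) ^ 4" .
  qed
  note power = this
  have "polyb (\<lambda>p q n m. 1 + q * ((2 * n) ^ (2 * (p + q)) * (tbd (cover p q (p + q)) n m + 2000)))"
    by (rule polyb_intros polyb_cover power)+
  then show ?thesis by (rule polyb_mono) (use one in auto)
qed

text \<open>Loading and sorting form the only part of the main program whose time depends on
  \<open>m\<close>; it is split off here with its linear dependence explicit.\<close>

lemma prepare_time:
  "\<exists>K g. polyb g \<and> (\<forall>p q n m. 0 < p + q \<longrightarrow> tbd (prepare p q) n m \<le> K * (p + q) * m + g p q n m)"
proof -
  obtain cl cl' where load: "\<And>n m. tbd load n m = m * cl + cl'"
  proof
    \<comment> \<open>The time is affine in \<open>m\<close> and independent of \<open>n\<close>;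
      its coefficients are read off at \<open>m = 0\<close> and \<open>m = 1\<close>.\<close>
    show "tbd load n m = m * (tbd load 0 1 - tbd load 0 0) + tbd load 0 0" for n m
      by (simp add: load_def)
  qed
  obtain cs cs' where scan: "\<And>n m. tbd scan n m = m * cs + cs'"
  proof
    show "tbd scan n m = m * (tbd scan 0 1 - tbd scan 0 0) + tbd scan 0 0" for n m
      by (simp add: scan_def)
  qed
  define g where "g p q n m = tbd (index_tables (p * (p + q) + (p + q))) n m + cl' +
      ((p + q) * (cs' + tbd mark n m + 1000) + 1000)" for p q n m
  have "polyb g"
    unfolding g_def[abs_def] index_tables_def mark_def slot_at_def pairs_def bound_simps
    by (rule polyb_intros)+
  moreover have "tbd (prepare p q) n m \<le> (cl + cs) * (p + q) * m + g p q n m" if "0 < p + q" for p q n m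
  proof -
    have "1 \<le> p + q" using that by linarith
    from mult_le_mono1[OF this, of "cl * m"] have "m * cl \<le> cl * (p + q) * m"
      by (simp only: mult_1_left ac_simps)
    moreover have "(p + q) * (m * cs) = cs * (p + q) * m" by simp
    ultimately show ?thesis
      by (simp only: prepare_def sort_slots_def tbd.simps times.simps load scan g_def
          add_mult_distrib add_mult_distrib2)
  qed
  ultimately show ?thesis by blast
qed

lemma solver_time:
  "\<exists>K k. \<forall>p q n m. 0 < p + q \<longrightarrow> 1 \<le> n \<longrightarrow>
     tbd (solver p q) n m + 20000 * m + 2000 \<le> K * (p + q) * m + K * n ^ (k * (p + q))"
proof -
  obtain K g where g: "polyb g"
    "\<And>p q n m. 0 < p + q \<Longrightarrow> tbd (prepare p q) n m \<le> K * (p + q) * m + g p q n m"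
    using prepare_time by blast
  obtain cg cg' where gather: "\<And>n m. tbd gather n m = m * cg + cg'"
  proof
    show "tbd gather n m = m * (tbd gather 0 1 - tbd gather 0 0) + tbd gather 0 0" for n m
      by (simp add: gather_def incr_def)
  qed
  define main where "main p q = (prepare p q ;;
    (saturate (p * (p + q)) p q ;; decompose (p * (p + q))) ;; stages p q q)" for p q
  define f where "f p q n m = g p q n m + ((tbd (saturate (p * (p + q)) p q) n m +
      tbd (decompose (p * (p + q))) n m) + tbd (stages p q q) n m)" for p q n m
  have "polyb f"
    unfolding f_def[abs_def]
    by (rule polyb_add g(1) polyb_saturate polyb_decompose polyb_stages polyb_intros)+
  then obtain C d where f: "\<And>p q n m. 2 \<le> n \<Longrightarrow> 0 < p + q \<Longrightarrow> f p q n m \<le> C * (n ^ (p + q)) ^ d"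
    unfolding polyb_def by blast
  define c where "c = tbd (Put CNTR (Lit 0) (Inp 1)) 0 0 + cg' + 4000"
  have solver: "tbd (solver p q) n m + 20000 * m + 2000 \<le>
      times Once n m * tbd (main p q) n m + (cg + 20000) * m + c" for p q n m
  proof -
    have "times Once n m * (tbd (main p q) n m + 1000) \<le> times Once n m * tbd (main p q) n m + 1000"
      by (simp add: add_mult_distrib2)
    then show ?thesis
      unfolding solver_def main_def[symmetric] tbd.simps(4,6) gather c_def by (simp add: algebra_simps)
  qed
  let ?K = "K + C + cg + 20000 + c"
  have "tbd (solver p q) n m + 20000 * m + 2000 \<le> ?K * (p + q) * m + ?K * n ^ (d * (p + q))"
    if pq: "0 < p + q" and n: "1 \<le> n" for p q n m
  proof -
    have one: "1 \<le> n ^ (d * (p + q))" using n by simp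
    \<comment> \<open>For \<open>n = 1\<close> the factor \<open>times Once n m\<close> is 0. It has
      to be, as \<open>n ^ (d * (p + q))\<close> is then 1 and cannot absorb \<open>p\<close> and
      \<open>q\<close>.\<close>
    have lin: "times Once n m * tbd (main p q) n m \<le> K * (p + q) * m + C * n ^ (d * (p + q))"
    proof (cases "2 \<le> n")
      case True
      have "tbd (main p q) n m \<le> K * (p + q) * m + f p q n m"
        using g(2)[OF pq, of n m] by (simp add: main_def f_def)
      moreover have "(n ^ (p + q)) ^ d = n ^ (d * (p + q))" by (simp add: power_mult[symmetric] mult.commute)
      ultimately have "tbd (main p q) n m \<le> K * (p + q) * m + C * n ^ (d * (p + q))"
        using f[OF True pq, of m] by simp
      moreover have "times Once n m * tbd (main p q) n m \<le> tbd (main p q) n m" by simp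
      ultimately show ?thesis by linarith
    next
      case False
      then show ?thesis using n by simp
    qed
    have "1 \<le> p + q" using pq by linarith
    from mult_le_mono1[OF this, of m] have "(cg + 20000) * m \<le> (cg + 20000) * ((p + q) * m)"
      by (intro mult_le_mono2) (simp only: mult_1_left)
    moreover have "c \<le> c * n ^ (d * (p + q))" using one by simp
    moreover have "?K * (p + q) * m = K * (p + q) * m + (cg + 20000) * ((p + q) * m) + (C + c) * ((p + q) * m)"
      by (simp add: algebra_simps)
    moreover have "?K * n ^ (d * (p + q)) = C * n ^ (d * (p + q)) + c * n ^ (d * (p + q)) +
        (K + cg + 20000) * n ^ (d * (p + q))"
      by (simp add: algebra_simps)
    ultimately show ?thesis using solver[of p q n m] lin by linarith
  qed
  then show ?thesis by blast
qed

lemma approx_algorithm_mono: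
  "approx_algorithm p q \<alpha> T c \<Longrightarrow> (\<And>n m. T n m \<le> T' n m) \<Longrightarrow> approx_algorithm p q \<alpha> T' c"
  unfolding approx_algorithm_def by (meson le_trans)

lemma solver_approx:
  "\<exists>K k. \<forall>p q. 0 < p + q \<longrightarrow> p * q < 2 * (p + q) \<longrightarrow>
     approx_algorithm p q (2 * real (p + q) ^ (4 * p))
       (\<lambda>n m. K * (p + q) * m + K * n ^ (k * (p + q))) (Seq (compile (solver p q)) (emit OUT LEN CNTR))"
proof -
  obtain K k where time: "\<And>p q n m. 0 < p + q \<Longrightarrow> 1 \<le> n \<Longrightarrow>
     tbd (solver p q) n m + 20000 * m + 2000 \<le> K * (p + q) * m + K * n ^ (k * (p + q))"
    using solver_time by blast
  have "approx_algorithm p q (2 * real (p + q) ^ (4 * p))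
       (\<lambda>n m. K * (p + q) * m + K * n ^ (k * (p + q))) (Seq (compile (solver p q)) (emit OUT LEN CNTR))"
    if pq: "0 < p + q" "p * q < 2 * (p + q)" for p q
    unfolding approx_algorithm_def
  proof (intro allI impI)
    fix I :: "(nat, nat) flex_st" assume I: "flex_st_instance I \<and> numbered I"
    then interpret flex_problem I p q by unfold_locales auto
    let ?g = "sem (solver p q) (initial I)"
    have "narr ?g CNTR 0 = card (edges I)"
    proof -
      have "\<not> writes gather CNTR 0" by (simp add: gather_def)
      then show ?thesis
        by (simp add: solver_def sem_frame initial_in del: sem.simps(6))
    qed
    then obtain u \<tau> where run: "exec (Seq (compile (solver p q)) (emit OUT LEN CNTR)) (input_state I) u \<tau>"
      "u \<le> tbd (solver p q) (card (verts I)) (card (edges I)) + 20000 * card (edges I) + 2000"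
      "narr ?g LEN 0 \<le> card (edges I) \<longrightarrow> output_edges \<tau> = narr ?g OUT ` {..<narr ?g LEN 0}"
      using run_program[OF solver_legal, of OUT CNTR LEN p q I] by auto
    have "1 \<le> card (verts I)" using s by (simp add: n_def)
    then have "u \<le> K * (p + q) * card (edges I) + K * card (verts I) ^ (k * (p + q))"
      using run(2) time[OF pq(1), of "card (verts I)" "card (edges I)"] by linarith
    moreover have "feasible p q I (output_edges \<tau>) \<and>
        total_cost I (output_edges \<tau>) \<le> 2 * real (p + q) ^ (4 * p) * opt p q I"
      if feas: "\<exists>F. feasible p q I F"
    proof -
      let ?S = "{F. feasible p q I F}"
      have "?S \<subseteq> Pow (edges I)" by (auto simp: feasible_def)
      then have "finite ?S" using fin[of "edges I"] finite_subset by blast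
      then have "opt p q I \<in> total_cost I ` ?S"
        unfolding opt_def using feas by (intro Min_in) auto
      then obtain X where X: "feasible p q I X" "opt p q I = total_cost I X" by blast
      then have XE: "X \<subseteq> edges I" by (simp add: feasible_def)
      note S = solver_correct[OF pq XE X(1)]
      have "output_edges \<tau> = narr ?g OUT ` {..<narr ?g LEN 0}" using run(3) S(1) by (simp add: m_def)
      then show ?thesis using S(2,3) X(2) by simp
    qed
    ultimately show "\<exists>u \<tau>. exec (Seq (compile (solver p q)) (emit OUT LEN CNTR)) (input_state I) u \<tau> \<and>
        u \<le> K * (p + q) * card (edges I) + K * card (verts I) ^ (k * (p + q)) \<and>
        ((\<exists>F. feasible p q I F) \<longrightarrow> feasible p q I (output_edges \<tau>) \<and>
          total_cost I (output_edges \<tau>) \<le> 2 * real (p + q) ^ (4 * p) * opt p q I)"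
      using run(1) by blast
  qed
  then show ?thesis by blast
qed

theorem theorem1p2:
  shows "(\<exists>(a::real) (b::nat) (K::nat) (k::nat). \<forall>p q :: nat.
            real (p + q) > real (p * q) / 2 \<longrightarrow>
            (\<exists>c. approx_algorithm p q (a * real (p + q) ^ (b * p))
                   (\<lambda>n m. K * (p + q) * m + K * n ^ (k * (p + q))) c))
       \<and> (\<forall>p::nat. \<exists>(\<alpha>::real) (K::nat) (k::nat) c.
            approx_algorithm p 2 \<alpha> (\<lambda>n m. K * m + K * n ^ k) c)
       \<and> (\<forall>q::nat. \<exists>(\<alpha>::real) (K::nat) (k::nat) c.
            approx_algorithm 2 q \<alpha> (\<lambda>n m. K * m + K * n ^ k) c)"
proof -
  obtain K k where main: "\<And>p q. 0 < p + q \<Longrightarrow> p * q < 2 * (p + q) \<Longrightarrow>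
     approx_algorithm p q (2 * real (p + q) ^ (4 * p))
       (\<lambda>n m. K * (p + q) * m + K * n ^ (k * (p + q))) (Seq (compile (solver p q)) (emit OUT LEN CNTR))"
    using solver_approx by blast
  have general: "\<exists>c. approx_algorithm p q (2 * real (p + q) ^ (4 * p))
      (\<lambda>n m. K * (p + q) * m + K * n ^ (k * (p + q))) c" if "real (p + q) > real (p * q) / 2" for p q
  proof -
    have "real (p * q) < real (2 * (p + q))" using that by simp
    then have "p * q < 2 * (p + q)" by (simp only: of_nat_less_iff)
    moreover from this have "0 < p + q" by (cases "p + q") auto
    ultimately show ?thesis by (intro exI) (rule main)
  qed
  \<comment> \<open>With one parameter equal to 2 and the other \<open>x\<close>, the condition
    reads \<open>2 * x < 2 * (x + 2)\<close> and always holds. For fixed \<open>p\<close> and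
    \<open>q\<close> the factor \<open>p + q\<close> and the exponents become constants.\<close>
  have fixed: "\<exists>(\<alpha>::real) (K::nat) (k::nat) c. approx_algorithm p q \<alpha> (\<lambda>n m. K * m + K * n ^ k) c"
    if "0 < p + q" "p * q < 2 * (p + q)" for p q
  proof (intro exI)
    have "1 \<le> p + q" using that(1) by linarith
    from mult_le_mono2[OF this, of K] have K: "K \<le> K * (p + q)" by (simp only: mult_1_right)
    show "approx_algorithm p q (2 * real (p + q) ^ (4 * p))
        (\<lambda>n m. (K * (p + q)) * m + (K * (p + q)) * n ^ (k * (p + q)))
        (Seq (compile (solver p q)) (emit OUT LEN CNTR))"
      using main[OF that] by (rule approx_algorithm_mono) (intro add_le_mono mult_le_mono1 order_refl K)
  qed
  show ?thesis
  proof (intro conjI)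
    show "\<exists>(a::real) (b::nat) (K::nat) (k::nat). \<forall>p q :: nat.
            real (p + q) > real (p * q) / 2 \<longrightarrow>
            (\<exists>c. approx_algorithm p q (a * real (p + q) ^ (b * p))
                   (\<lambda>n m. K * (p + q) * m + K * n ^ (k * (p + q))) c)"
      \<comment> \<open>The constants 2 and 4 are those of \<open>ratio_bound\<close>.\<close>
      by (rule exI[of _ 2], rule exI[of _ 4], rule exI[of _ K], rule exI[of _ k]) (intro allI impI general)
    show "\<forall>p::nat. \<exists>(\<alpha>::real) (K::nat) (k::nat) c.
            approx_algorithm p 2 \<alpha> (\<lambda>n m. K * m + K * n ^ k) c"
      by (intro allI fixed) simp_all
    show "\<forall>q::nat. \<exists>(\<alpha>::real) (K::nat) (k::nat) c.
            approx_algorithm 2 q \<alpha> (\<lambda>n m. K * m + K * n ^ k) c"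
      by (intro allI fixed) simp_all
  qed
qed

end
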